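(* Let $K \subset S^3$ be a knot with complement $X$ and infinite cyclic covering $X_\infty \to X$. Then $K$ has shrinkage type I if and only if $\alpha^{(2)}_2(X_\infty) = \infty^+$. If $K$ has shrinkage type II or III, then $\alpha^{(2)}_2(X_\infty) = \underline{\mu}(K)^{-1}$.
   Context: Shrinkage rates. Let $K \subset S^3$ be a knot and $X = S^3 \setminus \nu K$ the complement of an open tubular neighborhood of $K$. Since $\pi_1(X)$ has infinite cyclic abelianization, for each positive integer $n$ there is a unique $n$-sheeted cyclic covering $X_n \to X$, and there is a unique infinite cyclic covering $X_\infty \to X$. Fix a (finite) CW structure on $X$ and give $X_n$ and $X_\infty$ the lifted CW structures. The cellular chain modules $C_p(X_n;\mathbb{C})$ carry the inner product for which the cells form an orthonormal basis. Let $\sigma_n$ be the smallest positive singular value of the differential $d_2^n \colon C_2(X_n;\mathbb{C}) \to C_1(X_n;\mathbb{C})$, i.e. the smallest positive eigenvalue of $\sqrt{(d_2^n)^* d_2^n}$. The lower and upper shrinkage rates of $K$ are $$\underline{\mu}(K) = \liminf_{n\to\infty} \frac{-\log \sigma_n}{\log n}, \qquad \overline{\mu}(K) = \limsup_{n\to\infty} \frac{-\log \sigma_n}{\log n}.$$ They do not depend on the chosen CW structure. If they agree, the common value is denoted $\mu(K)$. Shrinkage types. $K$ has shrinkage type I if $\underline{\mu}(K) = \overline{\mu}(K) = 0$; type II if $\underline{\mu}(K) = \overline{\mu}(K) > 0$; type III if $\underline{\mu}(K) < \overline{\mu}(K)$. Novikov--Shubin number. The $\ell^2$-chain complex $C^{(2)}_*(X_\infty)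 = \ell^2\mathbb{Z} \otimes_{\mathbb{Z}[\mathbb{Z}]} C_*(X_\infty)$ is obtained from the cellular chain complex of $X_\infty$, where $\mathbb{Z}$ acts by deck transformations; its differentials $d^{(2)}_p$ are bounded $\mathbb{Z}$-equivariant operators between Hilbert spaces of the form $(\ell^2\mathbb{Z})^N$. For such an operator $f$ let $F(\lambda) = \mathrm{tr}_{\mathcal{N}(\mathbb{Z})}\big(E^{f^*f}_{\lambda^2}\big)$, $\lambda \ge 0$, be its spectral density function, where $E^{f^*f}_{\lambda^2}$ is the spectral projection of $f^*f$ for the interval $[0,\lambda^2]$ and $\mathrm{tr}_{\mathcal{N}(\mathbb{Z})}$ is the von Neumann trace of the group von Neumann algebra $\mathcal{N}(\mathbb{Z})$. The Novikov--Shubin number of $f$ is $$\alpha^{(2)}(f) = \liminf_{\lambda \to 0^+} \frac{\log(F(\lambda) - F(0))}{\log \lambda} \in [0,\infty]$$ if $F(\lambda) > F(0)$ for all $\lambda > 0$, and $\alpha^{(2)}(f) = \infty^+$ (a formal symbol, indicating a spectral gap at zero) otherwise. The second Novikov--Shubin number of $X_\infty$ is $\alpha^{(2)}_2(X_\infty) = \alpha^{(2)}(d^{(2)}_2)$ for the second differential $d^{(2)}_2 \colon C^{(2)}_2(X_\infty) \to C^{(2)}_1(X_\infty)$. *)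

theory Defs
  imports "HOL-Analysis.Analysis" "HOL-Homology.Homology"
begin

section \<open>Knots and tubular neighbourhoods\<close>

abbreviation S3 :: "(real^4) set" where
  "S3 \<equiv> sphere 0 1"

text \<open>Knots are taken in the topological locally flat (tame) category, which contains all smooth
  and all polygonal knots.\<close>

definition knot :: "(real^4) set \<Rightarrow> bool" where
  "knot K \<longleftrightarrow> K \<subseteq> S3 \<and> K homeomorphic sphere (0::complex) 1 \<and>
     (\<forall>x\<in>K. \<exists>U h k. openin (top_of_set S3) U \<and> x \<in> U \<and>
        homeomorphism U (UNIV :: (real \<times> complex) set) h k \<and>
        h ` (U \<inter> K) = UNIV \<times> {0})"

text \<open>The trivialisation is required to live on all of \<open>S\<^sup>1 \<times> \<complex>\<close>, although only the open unit
  disc bundle is removed: this makes the frontier torus collared, so that the complement is a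
  compact 3-manifold with boundary.\<close>

definition open_tubular_neighbourhood :: "(real^4) set \<Rightarrow> (real^4) set \<Rightarrow> bool" where
  "open_tubular_neighbourhood K N \<longleftrightarrow>
     (\<exists>h k T. openin (top_of_set S3) T \<and>
        homeomorphism (sphere (0::complex) 1 \<times> (UNIV::complex set)) T h k \<and>
        h ` (sphere 0 1 \<times> {0}) = K \<and> h ` (sphere 0 1 \<times> ball 0 1) = N)"


section \<open>CW structures and cellular chains\<close>

text \<open>The closed \<open>p\<close>-cell is modelled by the standard \<open>p\<close>-simplex, with the interior of the simplex
  as open cell.  A characteristic map is thus a singular \<open>p\<close>-simplex, and a cell is identified with
  its characteristic map: \<open>\<Phi> p\<close> is the set of \<open>p\<close>-cells.\<close>

type_synonym 'a cell = "(nat \<Rightarrow> real) \<Rightarrow> 'a"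
type_synonym 'a cell_structure = "nat \<Rightarrow> 'a cell set"

definition open_simplex :: "nat \<Rightarrow> (nat \<Rightarrow> real) set" where
  "open_simplex p = {x \<in> standard_simplex p. \<forall>i\<le>p. 0 < x i}"

text \<open>For finitely many cells in a Hausdorff space, closure finiteness, the weak topology, and the
  fact that characteristic maps are embeddings on the open cells are automatic.\<close>

definition finite_CW_structure :: "'a::t2_space set \<Rightarrow> 'a cell_structure \<Rightarrow> bool" where
  "finite_CW_structure X \<Phi> \<longleftrightarrow>
     finite (SIGMA p:UNIV. \<Phi> p) \<and>
     (\<forall>p. \<forall>f\<in>\<Phi> p. singular_simplex p (top_of_set X) f \<and> inj_on f (open_simplex p)) \<and>
     (\<forall>p q. \<forall>f\<in>\<Phi> p. \<forall>g\<in>\<Phi> q. (p, f) \<noteq> (q, g) \<longrightarrow>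
        f ` open_simplex p \<inter> g ` open_simplex q = {}) \<and>
     (\<Union>p. \<Union>f\<in>\<Phi> p. f ` open_simplex p) = X \<and>
     (\<forall>p. \<forall>f\<in>\<Phi> p. f ` (standard_simplex p - open_simplex p)
        \<subseteq> (\<Union>q<p. \<Union>g\<in>\<Phi> q. g ` open_simplex q))"

definition lifted_cells ::
    "'e::topological_space set \<Rightarrow> ('e \<Rightarrow> 'a) \<Rightarrow> 'a cell_structure \<Rightarrow> 'e cell_structure" where
  "lifted_cells E \<pi> \<Phi> p = {g. singular_simplex p (top_of_set E) g \<and> simplex_map p \<pi> g \<in> \<Phi> p}"

definition skeleton :: "'a cell_structure \<Rightarrow> int \<Rightarrow> 'a set" where
  "skeleton \<Phi> m = (\<Union>p\<in>{p. int p \<le> m}. \<Union>f\<in>\<Phi> p. f ` standard_simplex p)"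

definition cellular_chain_group ::
    "'a::topological_space cell_structure \<Rightarrow> nat \<Rightarrow> 'a chain set monoid" where
  "cellular_chain_group \<Phi> p =
     relative_homology_group (int p) (top_of_set (skeleton \<Phi> (int p))) (skeleton \<Phi> (int p - 1))"

definition cell_class :: "'a::topological_space cell_structure \<Rightarrow> nat \<Rightarrow> 'a cell \<Rightarrow> 'a chain set" where
  "cell_class \<Phi> p f =
     homologous_rel_set p (top_of_set (skeleton \<Phi> (int p))) (skeleton \<Phi> (int p - 1)) (frag_of f)"

definition cellular_boundary ::
    "'a::topological_space cell_structure \<Rightarrow> nat \<Rightarrow> 'a chain set \<Rightarrow> 'a chain set" where
  "cellular_boundary \<Phi> p =
     hom_relboundary (int p) (top_of_set (skeleton \<Phi> (int p)))
       (skeleton \<Phi> (int p - 1)) (skeleton \<Phi> (int p - 2))"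

text \<open>The coordinates of the boundary of the \<open>Suc p\<close>-cell \<open>g\<close> in the basis of \<open>p\<close>-cells of the
  (multiplicatively written) free abelian group of cellular \<open>p\<close>-chains.\<close>

definition incidence :: "'a::topological_space cell_structure \<Rightarrow> nat \<Rightarrow> 'a cell \<Rightarrow> 'a cell \<Rightarrow> int" where
  "incidence \<Phi> p g =
     (THE c. finite {f. c f \<noteq> 0} \<and> {f. c f \<noteq> 0} \<subseteq> \<Phi> p \<and>
        cellular_boundary \<Phi> (Suc p) (cell_class \<Phi> (Suc p) g) =
        finprod (cellular_chain_group \<Phi> p)
          (\<lambda>f. cell_class \<Phi> p f [^]\<^bsub>cellular_chain_group \<Phi> p\<^esub> c f) {f. c f \<noteq> 0})"


section \<open>Cyclic coverings\<close>

definition deck_group :: "'e::topological_space set \<Rightarrow> ('e \<Rightarrow> 'a) \<Rightarrow> ('e \<Rightarrow> 'e) monoid" where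
  "deck_group E \<pi> =
     \<lparr>carrier = {h \<in> extensional E. (\<exists>k. homeomorphism E E h k) \<and> (\<forall>x\<in>E. \<pi> (h x) = \<pi> x)},
      monoid.mult = (\<lambda>g h. compose E g h), one = restrict id E\<rparr>"

definition regular_connected_covering ::
    "'e::topological_space set \<Rightarrow> ('e \<Rightarrow> 'a) \<Rightarrow> 'a::topological_space set \<Rightarrow> bool" where
  "regular_connected_covering E \<pi> X \<longleftrightarrow>
     covering_space E \<pi> X \<and> connected E \<and>
     (\<forall>x\<in>E. \<forall>y\<in>E. \<pi> x = \<pi> y \<longrightarrow> (\<exists>h\<in>carrier (deck_group E \<pi>). h x = y))"

text \<open>Deck groups of connected regular coverings act simply transitively on the fibres, so that
  these coverings have exactly \<open>n\<close> sheets.\<close>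

definition cyclic_covering ::
    "nat \<Rightarrow> 'e::topological_space set \<Rightarrow> ('e \<Rightarrow> 'a) \<Rightarrow> 'a::topological_space set \<Rightarrow> bool" where
  "cyclic_covering n E \<pi> X \<longleftrightarrow>
     0 < n \<and> regular_connected_covering E \<pi> X \<and> deck_group E \<pi> \<cong> integer_mod_group n"

definition infinite_cyclic_covering ::
    "'e::topological_space set \<Rightarrow> ('e \<Rightarrow> 'a) \<Rightarrow> 'a::topological_space set \<Rightarrow> bool" where
  "infinite_cyclic_covering E \<pi> X \<longleftrightarrow>
     regular_connected_covering E \<pi> X \<and> deck_group E \<pi> \<cong> integer_group"


section \<open>Square-summable functions\<close>

definition ell2 :: "'c set \<Rightarrow> ('c \<Rightarrow> complex) set" where
  "ell2 B = {u. (\<forall>x. x \<notin> B \<longrightarrow> u x = 0) \<and> (\<lambda>x. (cmod (u x))\<^sup>2) summable_on UNIV}"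

definition ell2_inner :: "('c \<Rightarrow> complex) \<Rightarrow> ('c \<Rightarrow> complex) \<Rightarrow> complex" where
  "ell2_inner u v = (\<Sum>\<^sub>\<infinity>x. u x * cnj (v x))"

definition ell2_norm :: "('c \<Rightarrow> complex) \<Rightarrow> real" where
  "ell2_norm u = sqrt (Re (ell2_inner u u))"

definition basis_vector :: "'c \<Rightarrow> 'c \<Rightarrow> complex" where
  "basis_vector b = (\<lambda>x. if x = b then 1 else 0)"

text \<open>The adjoint of a bounded operator \<open>A\<close> defined on \<open>ell2 B\<close>: the \<open>x\<close>-coordinate of \<open>A\<^sup>* v\<close> is
  \<open>\<langle>A\<^sup>* v, e\<^sub>x\<rangle> = \<langle>v, A e\<^sub>x\<rangle>\<close>.\<close>

definition ell2_adjoint ::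
    "'c set \<Rightarrow> (('c \<Rightarrow> complex) \<Rightarrow> 'd \<Rightarrow> complex) \<Rightarrow> ('d \<Rightarrow> complex) \<Rightarrow> 'c \<Rightarrow> complex" where
  "ell2_adjoint B A v = (\<lambda>x. if x \<in> B then ell2_inner v (A (basis_vector x)) else 0)"

text \<open>For a covering of finite degree, \<open>ell2 (\<Phi> p)\<close> is the space of complex cellular \<open>p\<close>-chains
  with the cells as orthonormal basis.  For a lifted structure on an infinite cyclic covering,
  it is \<open>\<ell>\<^sup>2\<int> \<otimes> C\<^sub>p\<close>: the choice of a lift of every \<open>p\<close>-cell gives a \<open>\<int>[\<int>]\<close>-basis of \<open>C\<^sub>p\<close>, hence a
  bijection between \<open>\<Phi> p\<close> and \<open>N\<close> copies of \<open>\<int>\<close>.  In both cases the following is the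
  differential from \<open>(Suc p)\<close>-chains to \<open>p\<close>-chains; the sums have finitely many nonzero terms.\<close>

definition ell2_differential ::
    "'a::topological_space cell_structure \<Rightarrow> nat \<Rightarrow> ('a cell \<Rightarrow> complex) \<Rightarrow> 'a cell \<Rightarrow> complex" where
  "ell2_differential \<Phi> p u =
     (\<lambda>f. if f \<in> \<Phi> p then (\<Sum>\<^sub>\<infinity>g\<in>\<Phi> (Suc p). of_int (incidence \<Phi> p g f) * u g) else 0)"


section \<open>Shrinkage rates\<close>

definition singular_values :: "'c set \<Rightarrow> (('c \<Rightarrow> complex) \<Rightarrow> 'd \<Rightarrow> complex) \<Rightarrow> real set" where
  "singular_values B A =
     {s. 0 \<le> s \<and> (\<exists>u\<in>ell2 B. u \<noteq> (\<lambda>x. 0) \<and>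
            ell2_adjoint B A (A u) = (\<lambda>x. of_real (s\<^sup>2) * u x))}"

definition smallest_positive_singular_value ::
    "'c set \<Rightarrow> (('c \<Rightarrow> complex) \<Rightarrow> 'd \<Rightarrow> complex) \<Rightarrow> real" where
  "smallest_positive_singular_value B A = Min {s \<in> singular_values B A. 0 < s}"

definition shrinkage_sigma ::
    "(nat \<Rightarrow> 'e::topological_space set) \<Rightarrow> (nat \<Rightarrow> 'e \<Rightarrow> 'a) \<Rightarrow> 'a cell_structure \<Rightarrow> nat \<Rightarrow> real" where
  "shrinkage_sigma E \<pi> \<Phi> n =
     (let \<Psi> = lifted_cells (E n) (\<pi> n) \<Phi>
      in smallest_positive_singular_value (\<Psi> 2) (ell2_differential \<Psi> 1))"

definition lower_shrinkage_rate ::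
    "(nat \<Rightarrow> 'e::topological_space set) \<Rightarrow> (nat \<Rightarrow> 'e \<Rightarrow> 'a) \<Rightarrow> 'a cell_structure \<Rightarrow> ereal" where
  "lower_shrinkage_rate E \<pi> \<Phi> =
     liminf (\<lambda>n. ereal (- ln (shrinkage_sigma E \<pi> \<Phi> n) / ln (real n)))"

definition upper_shrinkage_rate ::
    "(nat \<Rightarrow> 'e::topological_space set) \<Rightarrow> (nat \<Rightarrow> 'e \<Rightarrow> 'a) \<Rightarrow> 'a cell_structure \<Rightarrow> ereal" where
  "upper_shrinkage_rate E \<pi> \<Phi> =
     limsup (\<lambda>n. ereal (- ln (shrinkage_sigma E \<pi> \<Phi> n) / ln (real n)))"

definition shrinkage_type_I ::
    "(nat \<Rightarrow> 'e::topological_space set) \<Rightarrow> (nat \<Rightarrow> 'e \<Rightarrow> 'a) \<Rightarrow> 'a cell_structure \<Rightarrow> bool" where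
  "shrinkage_type_I E \<pi> \<Phi> \<longleftrightarrow>
     lower_shrinkage_rate E \<pi> \<Phi> = upper_shrinkage_rate E \<pi> \<Phi> \<and> upper_shrinkage_rate E \<pi> \<Phi> = 0"

definition shrinkage_type_II ::
    "(nat \<Rightarrow> 'e::topological_space set) \<Rightarrow> (nat \<Rightarrow> 'e \<Rightarrow> 'a) \<Rightarrow> 'a cell_structure \<Rightarrow> bool" where
  "shrinkage_type_II E \<pi> \<Phi> \<longleftrightarrow>
     lower_shrinkage_rate E \<pi> \<Phi> = upper_shrinkage_rate E \<pi> \<Phi> \<and> upper_shrinkage_rate E \<pi> \<Phi> > 0"

definition shrinkage_type_III ::
    "(nat \<Rightarrow> 'e::topological_space set) \<Rightarrow> (nat \<Rightarrow> 'e \<Rightarrow> 'a) \<Rightarrow> 'a cell_structure \<Rightarrow> bool" where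
  "shrinkage_type_III E \<pi> \<Phi> \<longleftrightarrow> lower_shrinkage_rate E \<pi> \<Phi> < upper_shrinkage_rate E \<pi> \<Phi>"


section \<open>Novikov--Shubin numbers\<close>

text \<open>Orthogonal projections of \<open>ell2 B\<close>; linearity and boundedness follow from symmetry.\<close>

definition ell2_projection :: "'c set \<Rightarrow> (('c \<Rightarrow> complex) \<Rightarrow> 'c \<Rightarrow> complex) \<Rightarrow> bool" where
  "ell2_projection B P \<longleftrightarrow>
     (\<forall>u\<in>ell2 B. P u \<in> ell2 B \<and> P (P u) = P u) \<and>
     (\<forall>u\<in>ell2 B. \<forall>v\<in>ell2 B. ell2_inner (P u) v = ell2_inner u (P v))"

text \<open>\<open>E\<close> is the spectral family of the bounded self-adjoint operator \<open>T\<close>: a right-continuous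
  increasing family of projections of bounded support with \<open>T = \<integral> s dE\<^sub>s\<close>.  By the spectral theorem
  it exists and is unique on \<open>ell2 B\<close>, and \<open>E\<^sub>s\<close> is the spectral projection for \<open>(-\<infinity>, s]\<close>.\<close>

definition spectral_family ::
    "'c set \<Rightarrow> (('c \<Rightarrow> complex) \<Rightarrow> 'c \<Rightarrow> complex) \<Rightarrow>
     (real \<Rightarrow> ('c \<Rightarrow> complex) \<Rightarrow> 'c \<Rightarrow> complex) \<Rightarrow> bool" where
  "spectral_family B T E \<longleftrightarrow>
     (\<forall>s. ell2_projection B (E s)) \<and>
     (\<forall>s t. s \<le> t \<longrightarrow> (\<forall>u\<in>ell2 B. E s (E t u) = E s u)) \<and>
     (\<forall>s. \<forall>u\<in>ell2 B. ((\<lambda>t. ell2_norm (\<lambda>x. E t u x - E s u x)) \<longlongrightarrow> 0) (at_right s)) \<and>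
     (\<exists>M. \<forall>u\<in>ell2 B. (\<forall>s. s < - M \<longrightarrow> E s u = (\<lambda>x. 0)) \<and> (\<forall>s. s \<ge> M \<longrightarrow> E s u = u)) \<and>
     (\<forall>u\<in>ell2 B. ell2_inner (T u) u =
        of_real (\<integral>s. s \<partial>interval_measure (\<lambda>s. Re (ell2_inner (E s u) u))))"

definition spectral_projection ::
    "'c set \<Rightarrow> (('c \<Rightarrow> complex) \<Rightarrow> 'c \<Rightarrow> complex) \<Rightarrow> real \<Rightarrow> ('c \<Rightarrow> complex) \<Rightarrow> 'c \<Rightarrow> complex" where
  "spectral_projection B T = (SOME E. spectral_family B T E)"

definition deck_orbits ::
    "'e::topological_space set \<Rightarrow> ('e \<Rightarrow> 'a) \<Rightarrow> 'a cell_structure \<Rightarrow> nat \<Rightarrow> 'e cell set set" where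
  "deck_orbits E \<pi> \<Phi> p =
     (\<lambda>g. (\<lambda>h. simplex_map p h g) ` carrier (deck_group E \<pi>)) ` lifted_cells E \<pi> \<Phi> p"

text \<open>Under an identification of \<open>ell2 (\<Union>\<O>)\<close> with \<open>(\<ell>\<^sup>2\<int>)\<^sup>N\<close> given by representatives of
  the orbits, this is the sum over the \<open>N\<close> diagonal entries of \<open>\<langle>A\<^sub>i\<^sub>i e, e\<rangle>\<close>, where \<open>e\<close> is the
  basis vector at the neutral element.  For equivariant \<open>A\<close> the choice is irrelevant.\<close>

definition von_Neumann_trace ::
    "'c set set \<Rightarrow> (('c \<Rightarrow> complex) \<Rightarrow> 'c \<Rightarrow> complex) \<Rightarrow> complex" where
  "von_Neumann_trace \<O> A =
     (\<Sum>orb\<in>\<O>. let b = (SOME b. b \<in> orb) in ell2_inner (A (basis_vector b)) (basis_vector b))"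

definition spectral_density ::
    "'c set set \<Rightarrow> 'c set \<Rightarrow> (('c \<Rightarrow> complex) \<Rightarrow> 'd \<Rightarrow> complex) \<Rightarrow> real \<Rightarrow> real" where
  "spectral_density \<O> B A l =
     Re (von_Neumann_trace \<O> (spectral_projection B (ell2_adjoint B A \<circ> A) (l\<^sup>2)))"

text \<open>\<open>NS_val a\<close> with \<open>a\<close> in \<open>[0, \<infinity>]\<close> (where \<open>a\<close> may be \<open>\<infinity>\<close>), or the formal symbol \<open>\<infinity>\<^sup>+\<close>.\<close>

datatype novikov_shubin_number = NS_val ereal | Infinity_plus

definition novikov_shubin :: "(real \<Rightarrow> real) \<Rightarrow> novikov_shubin_number" where
  "novikov_shubin F =
     (if \<forall>l>0. F l > F 0
      then NS_val (Liminf (at_right 0) (\<lambda>l. ereal (ln (F l - F 0) / ln l)))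
      else Infinity_plus)"

definition second_novikov_shubin ::
    "'e::topological_space set \<Rightarrow> ('e \<Rightarrow> 'a) \<Rightarrow> 'a cell_structure \<Rightarrow> novikov_shubin_number" where
  "second_novikov_shubin E \<pi> \<Phi> =
     (let \<Psi> = lifted_cells E \<pi> \<Phi>
      in novikov_shubin
           (spectral_density (deck_orbits E \<pi> \<Phi> 2) (\<Psi> 2) (ell2_differential \<Psi> 1)))"

end

theory Submission
 imports Defs "HOL-Computational_Algebra.Computational_Algebra" "HOL-Real_Asymp.Real_Asymp"
  "Jordan_Normal_Form.Schur_Decomposition"
begin

text \<open>
 The covers of \<open>X\<close> are handled through \<open>H\<^sub>1(X)\<close> alone, which is cyclic by excision: \<open>X\<^sub>n\<close> is the
 quotient of \<open>X\<^sub>\<infinity>\<close> by \<open>n\<int>\<close>, so that all differentials come from one matrix \<open>D\<close> of Laurent polynomials.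
 The squares of the singular values of \<open>d\<^sub>2\<^sup>n\<close> are the eigenvalues of \<open>H(z) = D(z)\<^sup>* D(z)\<close>, \<open>z\<^sup>n = 1\<close>.
 Let \<open>P\<close> and \<open>Q\<close> be the two lowest generically nonvanishing coefficients of the characteristic polynomial of
 \<open>H\<close>. Where \<open>P(z) \<noteq> 0\<close>, the smallest positive eigenvalue is comparable to \<open>q(z) = |P(z)| / |Q(z)|\<close>. Let \<open>\<kappa>\<close> be
 the largest vanishing order of \<open>q\<close> on the unit circle. Some root of unity has distance at most \<open>const / n\<close> from a
 worst zero, so \<open>- log \<sigma>\<^sub>n / log n\<close> is asymptotically at least \<open>\<kappa> / 2\<close>. By simultaneous approximation,
 infinitely often all \<open>n\<close>-th roots of unity have distance at least \<open>const / n\<close> from all zeros, so the lower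
 limit is \<open>\<kappa> / 2\<close>. The set of \<open>z\<close> with \<open>q(z) \<le> \<lambda>\<^sup>2\<close> has measure of order \<open>\<lambda>\<close> to the power \<open>2 / \<kappa>\<close>; this measure
 is computed by counting \<open>n\<close>-th roots of unity for large \<open>n\<close>.
\<close>

text \<open>The two sides of the theorem see H on different sets: sigma_n only at n-th roots of
  unity, the Novikov-Shubin number on the circle up to null sets. They are matched by moments. An
  operator of finite propagation cannot distinguish Z from Z/n in m steps once n is large, so the
  trace of the m-th power of the Gram operator of the infinite cover equals, exactly, the average of
  tr H(z)^m over n-th roots of unity. Polynomial approximation extends this to ramp functions, whose
  limits are spectral projections. Spectral projections are given only by a choice among spectral
  families, so existence and uniqueness of such a family must be proved; this is done over the
  reals. The covers are arbitrary spaces with an abstract deck group, and incidence numbers are a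
  unique description in relative homology. The map from the infinite to a finite cover is built from
  holonomies and controlled only on singular simplices, which is enough for chains. If no
  coefficient below the leading one survives, H is 0 on the circle. Then every n uses the same value
  \<open>Min {}\<close> and all rates are 0.\<close>

hide_const (open) up_ring.coeff up_ring.monom module.smult Coset.order VectorSpace.subspace Module.submodule

hide_fact (open) VectorSpace.subspace_def

no_notation Matrix.scalar_prod (infix \<open>\<bullet>\<close> 70)
 and Finite_Cartesian_Product.vec.vec_nth (infixl \<open>$\<close> 90)
 and fps_nth (infixl \<open>$\<close> 75)

section \<open>Real polynomials in a symmetric operator\<close>

definition poly_op :: "('a => 'a) => real poly => 'a => 'a::real_vector" where
 "poly_op T p u = (\<Sum>i\<le>degree p. coeff p i *\<^sub>R (T ^^ i) u)"

lemma poly_op_eq_sum: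
 assumes "degree p <= n"
 shows "poly_op T p u = (\<Sum>i\<le>n. coeff p i *\<^sub>R (T ^^ i) u)"
 unfolding poly_op_def
 by (rule sum.mono_neutral_left) (use assms in \<open>auto simp: coeff_eq_0\<close>)

lemma poly_op_0 [simp]: "poly_op T 0 u = 0"
 by (simp add: poly_op_def)

lemma poly_op_pCons:
 assumes "linear T"
 shows "poly_op T (pCons a p) u = a *\<^sub>R u + T (poly_op T p u)"
proof -
 interpret linear T by fact
 have "poly_op T (pCons a p) u = (\<Sum>i\<le>Suc (degree p). coeff (pCons a p) i *\<^sub>R (T ^^ i) u)"
  by (rule poly_op_eq_sum) (rule degree_pCons_le)
 thus ?thesis
  by (simp add: sum.atMost_Suc_shift poly_op_def sum scale del: sum.atMost_Suc)
qed

lemma poly_op_add: "poly_op T (p + q) u = poly_op T p u + poly_op T q u"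
proof -
 let ?n = "max (degree p) (degree q)"
 have "degree (p + q) <= ?n" by (rule degree_add_le_max)
 thus ?thesis
  by (simp add: poly_op_eq_sum[of _ ?n] scaleR_add_left sum.distrib)
qed

lemma poly_op_smult: "poly_op T (smult c p) u = c *\<^sub>R poly_op T p u"
 using poly_op_eq_sum[of "smult c p" "degree p" T u]
 by (simp add: degree_smult_le poly_op_def scaleR_sum_right)

lemma poly_op_diff: "poly_op T (p - q) u = poly_op T p u - poly_op T q u"
 using poly_op_add[of T p "smult (-1) q" u] poly_op_smult[of T "-1" q u] by simp

lemma poly_op_linear:
 assumes "linear T"
 shows "linear (poly_op T p)"
proof -
 interpret linear T by fact
 have pow: "(T ^^ i) (x + y) = (T ^^ i) x + (T ^^ i) y" "(T ^^ i) (c *\<^sub>R x) = c *\<^sub>R (T ^^ i) x" for i x y c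
  by (induction i) (auto simp: add scale)
 show ?thesis
  by (intro linearI)
    (auto simp: poly_op_def pow scaleR_add_right sum.distrib scaleR_sum_right mult.commute)
qed

lemma poly_op_mult:
 assumes "linear T"
 shows "poly_op T (p * q) u = poly_op T p (poly_op T q u)"
 by (induction p) (simp_all add: poly_op_pCons[OF assms] poly_op_add poly_op_smult)

lemma poly_op_1 [simp]: "poly_op T 1 u = u"
 by (simp add: poly_op_def)

lemma poly_op_const [simp]: "poly_op T [:c:] u = c *\<^sub>R u"
 by (simp add: poly_op_def)

lemma poly_op_in_subspace:
 assumes "subspace W" "!!u. u : W ==> T u : W" "u : W"
 shows "poly_op T p u : W"
proof -
 have "(T ^^ i) u : W" for i
  by (induction i) (use assms in auto)
 thus ?thesis
  unfolding poly_op_def by (intro subspace_sum subspace_scale assms)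
qed

lemma poly_op_commute:
 assumes "linear T" "linear J" "!!u. J (T u) = T (J u)"
 shows "J (poly_op T p u) = poly_op T p (J u)"
 by (induction p) (simp_all add: poly_op_pCons assms linear_add linear_scale linear_0)

lemma le_if_le_add_epsilon_mult:
 fixes x y c :: real
 assumes "!!e. e > 0 ==> x <= y + e * c"
 shows "x <= y"
proof -
 have "((%e. y + e * c) \<longlongrightarrow> y + 0 * c) (at_right 0)"
  by (intro tendsto_intros)
 thus ?thesis
  by (intro tendsto_lowerbound[of "%e. y + e * c" y "at_right 0"])
    (auto simp: assms eventually_at_right_less intro: eventually_at_rightI[of 0 1])
qed

text \<open>The scalars are real even where the space is complex: self-adjoint operators need only
  real polynomials, and complex linearity is recovered later from commutation with multiplication by
  i (\<open>times_i\<close>).\<close>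

locale symmetric_operator =
 fixes T :: "'a::real_inner => 'a"
 assumes bounded_linear: "bounded_linear T" and sym: "T x \<bullet> y = x \<bullet> T y"
begin

lemma linear: "linear T"
 using bounded_linear by (simp add: bounded_linear.linear)

lemma poly_op_sym: "poly_op T p x \<bullet> y = x \<bullet> poly_op T p y"
proof (induction p arbitrary: x y)
 case (pCons a p)
 have "T (poly_op T p y) = poly_op T p (T y)"
  by (rule poly_op_commute) (auto intro: linear)
 thus ?case
  by (simp add: poly_op_pCons[OF linear] inner_add_left inner_add_right sym pCons.IH)
qed simp

definition pos_on :: "'a set => real poly => bool" where
 "pos_on W p \<longleftrightarrow> (\<forall>u\<in>W. 0 <= poly_op T p u \<bullet> u)"

text \<open>Positivity on \<open>[a, b]\<close> is propagated through the linear and quadratic factors of a polynomial.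
 This needs an invariant that is stable under multiplication by \<open>x - a\<close>, by \<open>b - x\<close> and by squares.\<close>

definition pos_between :: "real => real => 'a set => real poly => bool" where
 "pos_between a b W p \<longleftrightarrow> pos_on W p & pos_on W ([:-a, 1:] * p) & pos_on W ([:b, -1:] * p) & pos_on W ([:-a, 1:] * [:b, -1:] * p)"

lemma pos_on_add: "pos_on W p ==> pos_on W q ==> pos_on W (p + q)"
 by (simp add: pos_on_def poly_op_add inner_add_left)

lemma pos_on_smult: "0 <= c ==> pos_on W p ==> pos_on W (smult c p)"
 by (simp add: pos_on_def poly_op_smult)

lemma pos_between_add: "pos_between a b W p ==> pos_between a b W q ==> pos_between a b W (p + q)"
 unfolding pos_between_def distrib_left by (intro conjI pos_on_add) auto

lemma pos_between_smult: "0 <= c ==> pos_between a b W p ==> pos_between a b W (smult c p)"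
 unfolding pos_between_def mult_smult_right by (intro conjI pos_on_smult) auto

context
 fixes W assumes W: "subspace W" "!!u. u : W ==> T u : W"
begin

text \<open>By symmetry one factor \<open>s\<close> moves to the other side, so the form of
  \<open>s * s * p\<close> at \<open>u\<close> is that of \<open>p\<close> at
  \<open>poly_op T s u\<close>, which stays in the invariant subspace \<open>W\<close>.\<close>

lemma pos_on_square: "pos_on W p ==> pos_on W (s * s * p)"
proof -
 have eq: "poly_op T (s * s * p) u = poly_op T s (poly_op T p (poly_op T s u))" for u
  by (simp only: poly_op_mult[OF linear, symmetric] mult_ac)
 show "pos_on W p ==> ?thesis"
  unfolding pos_on_def eq poly_op_sym[of s] using poly_op_in_subspace[of W T, OF W] by blast
qed

lemma pos_between_square: "pos_between a b W p ==> pos_between a b W (s * s * p)"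
 using pos_on_square[of "[:-a, 1:] * p" s] pos_on_square[of "[:b, -1:] * p" s] pos_on_square[of "[:-a, 1:] * [:b, -1:] * p" s]
 pos_on_square[of p s] unfolding pos_between_def by (simp only: mult_ac)

text \<open>Each of the four conditions for the new polynomial is one of the old four, up to the
  square of an end factor. This is why \<open>pos_between\<close> carries all four products.\<close>

lemma pos_between_ends:
 assumes "pos_between a b W p"
 shows "pos_between a b W ([:-a, 1:] * p)" "pos_between a b W ([:b, -1:] * p)"
 using assms pos_on_square[of p "[:-a, 1:]"] pos_on_square[of p "[:b, -1:]"] pos_on_square[of "[:b, -1:] * p" "[:-a, 1:]"]
  pos_on_square[of "[:-a, 1:] * p" "[:b, -1:]"]
 unfolding pos_between_def by (simp_all only: mult_ac)

lemma pos_between_1: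
 assumes bounds: "!!u. u : W ==> a * (u \<bullet> u) <= T u \<bullet> u" "!!u. u : W ==> T u \<bullet> u <= b * (u \<bullet> u)" and ab: "a < b"
 shows "pos_between a b W 1"
proof -
 have lin: "pos_on W 1" "pos_on W [:-a, 1:]" "pos_on W [:b, -1:]"
  using bounds linear by (auto simp: pos_on_def poly_op_pCons[OF linear] inner_diff_left linear_neg)
 \<comment> \<open>Since (x - a) + (b - x) = b - a, the product of the end factors is a positive
   combination of two terms, each a square times one end factor. This is how a product of commuting
   positive operators is seen to be positive.\<close>
 have "[:-a, 1:] * [:b, -1:] = smult (1 / (b - a)) ([:-a, 1:] * [:-a, 1:] * [:b, -1:] + [:b, -1:] * [:b, -1:] * [:-a, 1:])"
  using ab by (simp add: field_simps)
 hence "pos_on W ([:-a, 1:] * [:b, -1:])"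
  using ab lin by (metis (no_types) pos_on_smult pos_on_add pos_on_square less_eq_real_def diff_gt_0_iff_gt zero_less_divide_1_iff)
 thus ?thesis using lin unfolding pos_between_def by simp
qed

lemma pos_between_nonneg_poly:
 assumes one: "pos_between a b W 1" and ab: "a < b" and p: "!!x. a <= x ==> x <= b ==> 0 <= poly p x"
 shows "pos_between a b W p"
 using p
proof (induction "degree p" arbitrary: p rule: less_induct)
 case less
 show ?case
 proof (cases "degree p = 0")
  case True
  then obtain c where c: "p = [:c:]" by (rule degree_eq_zeroE)
  hence "0 <= c" using less.prems[of a] ab by simp
  thus ?thesis using pos_between_smult[OF _ one, of c] c by simp
 next
  case False
  hence p0: "p ~= 0" by auto
  \<comment> \<open>The cofactor has the sign of \<open>p\<close> wherever \<open>f\<close> is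
    positive; the possible zero \<open>r\<close> of \<open>f\<close> is covered by continuity,
    because [a, b] has no isolated points.\<close>
  have factor: "pos_between a b W q" if q: "p = f * q" "0 < degree f" and f: "!!x. a <= x ==> x <= b ==> x ~= r ==> 0 < poly f x" for f q r
  proof (rule less.hyps)
   have "f ~= 0" "q ~= 0" using p0 q by auto
   thus "degree q < degree p" using q by (simp add: degree_mult_eq)
   fix x assume x: "a <= x" "x <= b"
   show "0 <= poly q x"
   proof (rule ccontr)
    assume "\<not> 0 <= poly q x"
    moreover have "(poly q \<longlongrightarrow> poly q x) (at x within {a..b})" by (intro tendsto_intros)
    ultimately have "\<forall>\<^sub>F y in at x within {a..b}. poly q y < 0" by (auto intro: order_tendstoD)
    moreover have "\<forall>\<^sub>F y in at x within {a..b}. y ~= r" "\<forall>\<^sub>F y in at x within {a..b}. y : {a..b}"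
     by (rule eventually_neq_at_within) (simp add: eventually_at_filter)
    ultimately have "\<forall>\<^sub>F y in at x within {a..b}. False"
    proof eventually_elim
     case (elim y)
     hence "poly p y < 0" using f[of y] by (auto simp: q mult_pos_neg)
     thus False using less.prems[of y] elim by auto
    qed
    thus False using x ab by (simp add: trivial_limit_within islimpt_Icc)
   qed
  qed
  have "\<not> constant (poly (map_poly complex_of_real p))" using False by (simp add: constant_degree)
  then obtain z where z: "poly (map_poly complex_of_real p) z = 0" using fundamental_theorem_of_algebra by blast
  have square: "poly ([:-c, 1:] * [:-c, 1:]) x = (x - c)\<^sup>2" for c x :: real
   by (simp add: power2_eq_square algebra_simps)
  show ?thesis
  proof (cases "Im z = 0")
   case True
   define r where "r = Re z"
   have "z = of_real r" using True by (simp add: r_def complex_eq_iff)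
   hence r: "poly p r = 0" using z by simp
   then obtain q where q: "p = [:-r, 1:] * q" by (metis dvdE poly_eq_0_iff_dvd)
   consider "r <= a" | "b <= r" | "a < r" "r < b" by linarith
   thus ?thesis
   proof cases
    case 1
    hence "pos_between a b W q" by (intro factor[OF q, of r]) auto
    moreover have "p = [:-a, 1:] * q + smult (a - r) q" unfolding q by (simp add: smult_diff_left)
    ultimately show ?thesis using 1 by (metis pos_between_add pos_between_ends(1) pos_between_smult diff_ge_0_iff_ge)
   next
    case 2
    have q': "p = [:r, -1:] * (- q)" unfolding q by simp
    hence "pos_between a b W (- q)" using 2 by (intro factor[OF q', of r]) auto
    moreover have "p = [:b, -1:] * (- q) + smult (r - b) (- q)" unfolding q by (simp add: smult_diff_left)
    ultimately show ?thesis using 2 by (metis pos_between_add pos_between_ends(2) pos_between_smult diff_ge_0_iff_ge)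
   next
    case 3
    \<comment> \<open>A zero inside the interval is a local minimum of a nonnegative function, hence
      a double zero, and a square splits off.\<close>
    have "poly (pderiv p) r = 0"
    proof (rule DERIV_local_min[OF poly_DERIV])
     show "0 < min (r - a) (b - r)" using 3 by simp
     show "\<forall>y. \<bar>r - y\<bar> < min (r - a) (b - r) --> poly p r <= poly p y" using less.prems r by (auto simp: abs_if split: if_splits)
    qed
    hence "poly q r = 0" unfolding q pderiv_mult by (simp add: pderiv_pCons)
    then obtain s where s: "q = [:-r, 1:] * s" by (metis dvdE poly_eq_0_iff_dvd)
    have q': "p = ([:-r, 1:] * [:-r, 1:]) * s" unfolding q s by (simp only: mult_ac)
    have "pos_between a b W s" by (rule factor[OF q', of r]) (simp_all only: square, simp_all)
    thus ?thesis unfolding q' by (rule pos_between_square)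
   qed
  next
   case False
   define m where "m = [:-Re z, 1:] * [:-Re z, 1:] + [:(Im z)\<^sup>2:]"
   have m: "degree m = 2" "poly (map_poly complex_of_real m) z = 0"
    by (auto simp: m_def complex_eq_iff power2_eq_square algebra_simps)
   \<comment> \<open>\<open>m\<close> is the real polynomial with roots \<open>z\<close> and its
     conjugate. The remainder is real of degree at most 1 and vanishes at the nonreal point
     \<open>z\<close>, so it is 0.\<close>
   have "degree (p mod m) < 2" using degree_mod_less[of m p] m(1) by (cases "m = 0") auto
   hence "p mod m = [:coeff (p mod m) 0, coeff (p mod m) 1:]"
    by (intro poly_eqI) (auto simp: coeff_pCons coeff_eq_0 split: nat.split)
   then obtain e f where ef: "p mod m = [:e, f:]" by blast
   interpret map: map_poly_comm_ring_hom "of_real :: real => complex" ..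
   have "map_poly complex_of_real p = map_poly of_real m * map_poly of_real (p div m) + map_poly of_real [:e, f:]"
    unfolding ef[symmetric] map.hom_mult[symmetric] map.hom_add[symmetric] by simp
   hence "complex_of_real e + z * of_real f = 0" using z m(2) by (simp add: of_real_hom.map_poly_pCons_hom)
   hence "f = 0" "e = 0" using False by (auto simp: complex_eq_iff)
   hence q: "p = m * (p div m)" using ef by (metis mult.commute div_mult_mod_eq add.right_neutral pCons_0_0)
   have "pos_between a b W (p div m)"
    using False m(1) by (intro factor[OF q, of 0]) (simp_all add: add_nonneg_pos m_def square del: mult_pCons_left mult_pCons_right)
   hence "pos_between a b W ([:-Re z, 1:] * [:-Re z, 1:] * (p div m) + smult ((Im z)\<^sup>2) (p div m))"
    by (intro pos_between_add pos_between_square pos_between_smult) auto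
   thus ?thesis by (subst q) (simp add: m_def distrib_right smult_add_left algebra_simps)
  qed
 qed
qed

lemma poly_op_nonneg:
 assumes bounds: "!!u. u : W ==> a * (u \<bullet> u) <= T u \<bullet> u" "!!u. u : W ==> T u \<bullet> u <= b * (u \<bullet> u)"
  and u: "u : W" and ab: "a < b" and p: "!!x. a <= x ==> x <= b ==> 0 <= poly p x"
 shows "0 <= poly_op T p u \<bullet> u"
 using pos_between_nonneg_poly[OF pos_between_1[OF bounds ab] ab p] u by (auto simp: pos_between_def pos_on_def)

end

text \<open>Positivity of c^2 - p^2 is the norm bound. The form relative to an invariant subspace,
  with the bounds of \<open>T\<close> on that subspace, is what later localises functions of
  \<open>T\<close> to spectral subspaces.\<close>

lemma poly_op_norm_le:
 assumes W: "subspace W" "!!u. u : W ==> T u : W"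
  and bounds: "!!u. u : W ==> a * (u \<bullet> u) <= T u \<bullet> u" "!!u. u : W ==> T u \<bullet> u <= b * (u \<bullet> u)"
  and u: "u : W" and ab: "a < b" and p: "!!x. a <= x ==> x <= b ==> \<bar>poly p x\<bar> <= c"
 shows "norm (poly_op T p u) <= c * norm u"
proof -
 have c: "0 <= c" using p[of a] ab by linarith
 have "0 <= poly_op T ([:c^2:] - p * p) u \<bullet> u"
 proof (rule poly_op_nonneg[OF W bounds u ab])
  fix x assume "a <= x" "x <= b"
  hence "\<bar>poly p x\<bar>^2 <= c^2" using p by (intro power_mono) auto
  thus "0 <= poly ([:c^2:] - p * p) x" by (simp add: power2_eq_square)
 qed
 hence "(norm (poly_op T p u))^2 <= (c * norm u)^2"
  by (simp add: poly_op_diff poly_op_mult[OF linear] inner_diff_left poly_op_sym power_mult_distrib power2_norm_eq_inner)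
 thus ?thesis using c by (simp add: power2_le_iff_abs_le)
qed

end

section \<open>Continuous functional calculus\<close>

lemma uniform_limit_polynomials_exist:
 fixes f :: "real => real"
 assumes "continuous_on {a..b} f"
 shows "\<exists>q :: nat => real poly. uniform_limit {a..b} (%n. poly (q n)) f sequentially"
proof -
 have "\<exists>q. \<forall>x\<in>{a..b}. \<bar>f x - poly q x\<bar> < e" if e: "e > 0" for e
 proof -
  obtain g where g: "real_polynomial_function g" "\<forall>x\<in>{a..b}. \<bar>f x - g x\<bar> < e"
   by (rule Stone_Weierstrass_real_polynomial_function[OF compact_Icc assms e]) blast
  obtain A n where "g = (%x. \<Sum>i\<le>n. A i * x ^ i)"
   using g(1) real_polynomial_function_iff_sum by blast
  hence "g x = poly (\<Sum>i\<le>n. monom (A i) i) x" for x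
   by (simp add: poly_sum poly_monom)
  thus ?thesis using g(2) by (intro exI[of _ "\<Sum>i\<le>n. monom (A i) i"]) simp
 qed
 hence "\<exists>q. \<forall>x\<in>{a..b}. \<bar>f x - poly q x\<bar> < 1 / real (Suc n)" for n by simp
 then obtain q where q: "!!n x. x : {a..b} ==> \<bar>f x - poly (q n) x\<bar> < 1 / real (Suc n)"
  by metis
 have "uniform_limit {a..b} (%n. poly (q n)) f sequentially"
 proof (rule uniform_limitI)
  fix e :: real assume "e > 0"
  hence "eventually (%n. 1 / real (Suc n) < e) sequentially"
   by (intro order_tendstoD(2)[OF LIMSEQ_Suc[OF lim_1_over_n]])
  thus "\<forall>\<^sub>F n in sequentially. \<forall>x\<in>{a..b}. dist (poly (q n) x) (f x) < e"
   by (rule eventually_mono) (use q in \<open>force simp: dist_real_def abs_minus_commute intro: less_trans\<close>)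
 qed
 thus ?thesis by blast
qed

locale bounded_spectrum = symmetric_operator T
 for T :: "'a::{real_inner,complete_space} => 'a" +
 fixes a b :: real
 assumes ab: "a < b"
  and lower: "a * (u \<bullet> u) <= T u \<bullet> u" and upper: "T u \<bullet> u <= b * (u \<bullet> u)"
begin

lemma poly_op_norm_le_UNIV:
 assumes "!!x. a <= x ==> x <= b ==> \<bar>poly p x\<bar> <= c"
 shows "norm (poly_op T p u) <= c * norm u"
 by (rule poly_op_norm_le[of UNIV a b]) (use assms ab lower upper in auto)

lemma poly_op_Cauchy:
 assumes "uniform_limit {a..b} (%n. poly (q n)) f sequentially"
 shows "Cauchy (%n. poly_op T (q n) u)"
proof (rule CauchyI)
 fix e :: real assume e: "e > 0"
 define d where "d = e / (2 * (norm u + 1))"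
 have d: "d > 0" using e by (simp add: d_def add_nonneg_pos)
 have "\<forall>\<^sub>F n in sequentially. \<forall>x\<in>{a..b}. dist (poly (q n) x) (f x) < d / 2"
  using uniform_limitD[OF assms, of "d/2"] d by simp
 then obtain N where N: "\<forall>n\<ge>N. \<forall>x\<in>{a..b}. dist (poly (q n) x) (f x) < d/2"
  unfolding eventually_sequentially by blast
 have "norm (poly_op T (q m) u - poly_op T (q n) u) < e" if "m >= N" "n >= N" for m n
 proof -
  have "norm (poly_op T (q m - q n) u) <= d * norm u"
  proof (rule poly_op_norm_le_UNIV)
   fix x assume "a <= x" "x <= b"
   hence "dist (poly (q m) x) (f x) < d/2" "dist (poly (q n) x) (f x) < d/2"
    using N that by (meson atLeastAtMost_iff)+
   thus "\<bar>poly (q m - q n) x\<bar> <= d"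
    unfolding dist_real_def abs_less_iff abs_le_iff poly_diff by linarith
  qed
  also have "... <= d * (norm u + 1)" using d by simp
  also have "... = e / 2"
  proof -
   have "norm u + 1 ~= 0" using norm_ge_zero[of u] by linarith
   thus ?thesis unfolding d_def by (simp add: divide_simps)
  qed
  also have "... < e" using e by simp
  finally show ?thesis by (simp add: poly_op_diff)
 qed
 thus "\<exists>M. \<forall>m\<ge>M. \<forall>n\<ge>M. norm (poly_op T (q m) u - poly_op T (q n) u) < e" by blast
qed

definition fc :: "(real => real) => 'a => 'a" where
 "fc f u = lim (%n. poly_op T ((SOME q. uniform_limit {a..b} (%n. poly (q n)) f sequentially) n) u)"

text \<open>The value of \<open>fc\<close> comes from one chosen approximating sequence.
  Interleaving it with any other gives a third approximating sequence, whose single limit is shared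
  by both.\<close>

lemma fc_limit:
 assumes q: "uniform_limit {a..b} (%n. poly (q n)) f sequentially"
 shows "(%n. poly_op T (q n) u) \<longlonglongrightarrow> fc f u"
proof -
 define r where "r = (SOME q. uniform_limit {a..b} (%n. poly (q n :: real poly)) f sequentially)"
 have r: "uniform_limit {a..b} (%n. poly (r n)) f sequentially"
  unfolding r_def by (rule someI[of _ q]) (rule q)
 have lr: "(%n. poly_op T (r n) u) \<longlonglongrightarrow> fc f u"
  unfolding fc_def r_def[symmetric]
  using Cauchy_convergent[OF poly_op_Cauchy[OF r]] unfolding convergent_LIMSEQ_iff .
 define s where "s n = (if even n then q (n div 2) else r (n div 2))" for n
 have half: "filterlim (%n::nat. n div 2) sequentially sequentially"
  unfolding filterlim_at_top eventually_sequentially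
 proof
  fix Z :: nat
  show "\<exists>N. \<forall>n\<ge>N. Z <= n div 2" by (rule exI[of _ "2 * Z"]) auto
 qed
 have s: "uniform_limit {a..b} (%n. poly (s n)) f sequentially"
 proof (rule uniform_limitI)
  fix e :: real assume "e > 0"
  from eventually_compose_filterlim[OF uniform_limitD[OF q this] half]
   eventually_compose_filterlim[OF uniform_limitD[OF r this] half]
  have "\<forall>\<^sub>F n in sequentially. (\<forall>x\<in>{a..b}. dist (poly (q (n div 2)) x) (f x) < e) & (\<forall>x\<in>{a..b}. dist (poly (r (n div 2)) x) (f x) < e)"
   by (rule eventually_conj)
  thus "\<forall>\<^sub>F n in sequentially. \<forall>x\<in>{a..b}. dist (poly (s n) x) (f x) < e"
   by (rule eventually_mono) (auto simp: s_def)
 qed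
 obtain L where L: "(%n. poly_op T (s n) u) \<longlonglongrightarrow> L"
  using poly_op_Cauchy[OF s] Cauchy_convergent convergent_def by blast
 have "(%n. poly_op T (s (2 * n)) u) \<longlonglongrightarrow> L"
  using LIMSEQ_subseq_LIMSEQ[OF L, of "%n. 2 * n"] by (simp add: strict_mono_def o_def)
 hence Lq: "(%n. poly_op T (q n) u) \<longlonglongrightarrow> L" by (simp add: s_def)
 have "(%n. poly_op T (s (2 * n + 1)) u) \<longlonglongrightarrow> L"
  using LIMSEQ_subseq_LIMSEQ[OF L, of "%n. 2 * n + 1"] by (simp add: strict_mono_def o_def)
 hence "(%n. poly_op T (r n) u) \<longlonglongrightarrow> L" by (simp add: s_def)
 hence "L = fc f u" using lr LIMSEQ_unique by blast
 with Lq show ?thesis by simp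
qed

lemma fc_poly [simp]: "fc (poly p) u = poly_op T p u"
proof -
 have "uniform_limit {a..b} (%n. poly p) (poly p) sequentially"
  by (rule uniform_limitI) simp
 from fc_limit[OF this] show ?thesis by (simp add: LIMSEQ_const_iff)
qed

lemma fc_cong:
 assumes "!!x. x : {a..b} ==> f x = g x"
 shows "fc f u = fc g u"
proof -
 have "uniform_limit {a..b} F f sequentially = uniform_limit {a..b} F g sequentially" for F :: "nat => real => real"
  using assms by (intro uniform_limit_cong') auto
 thus ?thesis unfolding fc_def by simp
qed

lemma fc_diff:
 assumes f: "continuous_on {a..b} f" and g: "continuous_on {a..b} g"
 shows "fc (%x. f x - g x) u = fc f u - fc g u"
proof -
 obtain q r where q: "uniform_limit {a..b} (%n. poly (q n)) f sequentially"
  and r: "uniform_limit {a..b} (%n. poly (r n)) g sequentially"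
  using f g uniform_limit_polynomials_exist by meson
 have "uniform_limit {a..b} (%n. poly (q n - r n)) (%x. f x - g x) sequentially"
  unfolding poly_diff by (rule uniform_limit_minus[OF q r])
 from fc_limit[OF this] have "(%n. poly_op T (q n - r n) u) \<longlonglongrightarrow> fc (%x. f x - g x) u" .
 moreover have "(%n. poly_op T (q n - r n) u) \<longlonglongrightarrow> fc f u - fc g u"
  unfolding poly_op_diff by (intro tendsto_diff fc_limit q r)
 ultimately show ?thesis by (rule LIMSEQ_unique)
qed

context
 fixes f :: "real => real"
 assumes f: "continuous_on {a..b} f"
begin

lemma fc_linear: "linear (fc f)"
proof -
 obtain q where q: "uniform_limit {a..b} (%n. poly (q n)) f sequentially"
  using f uniform_limit_polynomials_exist by meson
 note l = fc_limit[OF q] and pl = poly_op_linear[OF linear]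
 show ?thesis
 proof
  fix x y :: 'a and c :: real
  have "(%n. poly_op T (q n) (x + y)) \<longlonglongrightarrow> fc f x + fc f y"
   unfolding linear_add[OF pl] by (intro tendsto_add l)
  thus "fc f (x + y) = fc f x + fc f y" using l LIMSEQ_unique by blast
  have "(%n. poly_op T (q n) (c *\<^sub>R x)) \<longlonglongrightarrow> c *\<^sub>R fc f x"
   unfolding linear_scale[OF pl] by (intro tendsto_scaleR tendsto_const l)
  thus "fc f (c *\<^sub>R x) = c *\<^sub>R fc f x" using l LIMSEQ_unique by blast
 qed
qed

lemma fc_sym: "fc f u \<bullet> v = u \<bullet> fc f v"
proof -
 obtain q where q: "uniform_limit {a..b} (%n. poly (q n)) f sequentially"
  using f uniform_limit_polynomials_exist by meson
 have "(%n. poly_op T (q n) u \<bullet> v) \<longlonglongrightarrow> fc f u \<bullet> v"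
  by (intro tendsto_inner fc_limit q tendsto_const)
 moreover have "(%n. poly_op T (q n) u \<bullet> v) \<longlonglongrightarrow> u \<bullet> fc f v"
  unfolding poly_op_sym by (intro tendsto_inner fc_limit q tendsto_const)
 ultimately show ?thesis by (rule LIMSEQ_unique)
qed

lemma fc_commute:
 assumes "bounded_linear J" "!!u. J (T u) = T (J u)"
 shows "J (fc f u) = fc f (J u)"
proof -
 obtain q where q: "uniform_limit {a..b} (%n. poly (q n)) f sequentially"
  using f uniform_limit_polynomials_exist by meson
 have "(%n. J (poly_op T (q n) u)) \<longlonglongrightarrow> J (fc f u)"
  by (rule bounded_linear.tendsto[OF assms(1) fc_limit[OF q]])
 moreover have "J (poly_op T (q n) u) = poly_op T (q n) (J u)" for n
  by (rule poly_op_commute) (use assms linear in \<open>auto simp: bounded_linear.linear\<close>)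
 ultimately show ?thesis using fc_limit[OF q, of "J u"] by (simp add: LIMSEQ_unique)
qed

lemma fc_in_closed_subspace:
 assumes "subspace W" "closed W" "!!u. u : W ==> T u : W" "u : W"
 shows "fc f u : W"
proof -
 obtain q where q: "uniform_limit {a..b} (%n. poly (q n)) f sequentially"
  using f uniform_limit_polynomials_exist by meson
 show ?thesis
  by (rule closed_sequentially[OF assms(2) _ fc_limit[OF q]])
    (use poly_op_in_subspace assms in blast)
qed

text \<open>Where \<open>T\<close> is confined to [c, d], only the values of \<open>f\<close> on
  [c, d] count. Uniqueness of spectral families rests on this: on suitable subspaces
  \<open>T\<close> is confined to an interval where a ramp is constantly 1 or 0.\<close>

lemma fc_norm_le:
 assumes V: "subspace V" "!!u. u : V ==> T u : V"
  and bounds: "!!u. u : V ==> c * (u \<bullet> u) <= T u \<bullet> u" "!!u. u : V ==> T u \<bullet> u <= d * (u \<bullet> u)"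
  and u: "u : V" and cd: "a <= c" "c < d" "d <= b"
  and fB: "!!x. c <= x ==> x <= d ==> \<bar>f x\<bar> <= B"
 shows "norm (fc f u) <= B * norm u"
proof -
 obtain q where q: "uniform_limit {a..b} (%n. poly (q n)) f sequentially"
  using f uniform_limit_polynomials_exist by meson
 have "norm (fc f u) <= (B + e) * norm u" if e: "e > 0" for e
 proof (rule tendsto_upperbound[OF tendsto_norm[OF fc_limit[OF q]]])
  show "\<forall>\<^sub>F n in sequentially. norm (poly_op T (q n) u) <= (B + e) * norm u"
   using uniform_limitD[OF q e]
  proof (rule eventually_mono)
   fix n assume n: "\<forall>x\<in>{a..b}. dist (poly (q n) x) (f x) < e"
   show "norm (poly_op T (q n) u) <= (B + e) * norm u"
   proof (rule poly_op_norm_le[OF V bounds u cd(2)])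
    fix x assume x: "c <= x" "x <= d"
    hence "dist (poly (q n) x) (f x) < e" using n cd by auto
    thus "\<bar>poly (q n) x\<bar> <= B + e"
     using fB[OF x] unfolding dist_real_def by linarith
   qed
  qed
 qed auto
 thus ?thesis
  using le_if_le_add_epsilon_mult[of "norm (fc f u)" "B * norm u" "norm u"]
  by (simp only: distrib_right)
qed

lemma fc_norm_le_UNIV:
 assumes "!!x. a <= x ==> x <= b ==> \<bar>f x\<bar> <= B"
 shows "norm (fc f u) <= B * norm u"
 by (rule fc_norm_le[of UNIV a b]) (use assms ab lower upper in auto)

lemma fc_nonneg:
 assumes "!!x. a <= x ==> x <= b ==> 0 <= f x"
 shows "0 <= fc f u \<bullet> u"
proof -
 obtain q where q: "uniform_limit {a..b} (%n. poly (q n)) f sequentially"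
  using f uniform_limit_polynomials_exist by meson
 have "- (e * (u \<bullet> u)) <= fc f u \<bullet> u" if e: "e > 0" for e
 proof (rule tendsto_lowerbound[OF tendsto_inner[OF fc_limit[OF q] tendsto_const]])
  show "\<forall>\<^sub>F n in sequentially. - (e * (u \<bullet> u)) <= poly_op T (q n) u \<bullet> u"
   using uniform_limitD[OF q e]
  proof (rule eventually_mono)
   fix n assume n: "\<forall>x\<in>{a..b}. dist (poly (q n) x) (f x) < e"
   have "0 <= poly_op T (q n + [:e:]) u \<bullet> u"
   proof (rule poly_op_nonneg[of UNIV a b])
    fix x assume x: "a <= x" "x <= b"
    hence "dist (poly (q n) x) (f x) < e" using n by auto
    thus "0 <= poly (q n + [:e:]) x"
     using assms[OF x] unfolding dist_real_def poly_add by simp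
   qed (use ab lower upper in auto)
   thus "- (e * (u \<bullet> u)) <= poly_op T (q n) u \<bullet> u" by (simp add: poly_op_add inner_add_left)
  qed
 qed auto
 note * = this
 have "0 <= fc f u \<bullet> u + e * (u \<bullet> u)" if "e > 0" for e
  using *[OF that] by linarith
 thus ?thesis by (rule le_if_le_add_epsilon_mult)
qed

end

lemma fc_mult:
 assumes f: "continuous_on {a..b} f" and g: "continuous_on {a..b} g"
 shows "fc (%x. f x * g x) u = fc f (fc g u)"
proof -
 obtain q r where q: "uniform_limit {a..b} (%n. poly (q n)) f sequentially"
  and r: "uniform_limit {a..b} (%n. poly (r n)) g sequentially"
  using f g uniform_limit_polynomials_exist by meson
 have bnd: "bounded (f ` {a..b})" "bounded (g ` {a..b})"
  using f g by (auto intro!: compact_imp_bounded compact_continuous_image)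
 obtain B where B: "\<forall>x\<in>{a..b}. \<bar>f x\<bar> <= B"
  using bnd(1) unfolding bounded_iff by force
 have "uniform_limit {a..b} (%n. poly (q n * r n)) (%x. f x * g x) sequentially"
  unfolding poly_mult by (rule uniform_lim_mult[OF q r bnd])
 from fc_limit[OF this] have 1: "(%n. poly_op T (q n) (poly_op T (r n) u)) \<longlonglongrightarrow> fc (%x. f x * g x) u"
  by (simp add: poly_op_mult[OF linear])
 \<comment> \<open>Operator and argument both vary with \<open>n\<close>; the uniform norm bound
   \<open>B + 1\<close> separates the two limits.\<close>
 have "(%n. poly_op T (q n) (poly_op T (r n) u - fc g u)) \<longlonglongrightarrow> 0"
 proof (rule Lim_null_comparison)
  show "\<forall>\<^sub>F n in sequentially. norm (poly_op T (q n) (poly_op T (r n) u - fc g u)) <= (B + 1) * norm (poly_op T (r n) u - fc g u)"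
   using uniform_limitD[OF q zero_less_one_class.zero_less_one]
  proof (rule eventually_mono)
   fix n assume n: "\<forall>x\<in>{a..b}. dist (poly (q n) x) (f x) < 1"
   show "norm (poly_op T (q n) (poly_op T (r n) u - fc g u)) <= (B + 1) * norm (poly_op T (r n) u - fc g u)"
   proof (rule poly_op_norm_le_UNIV)
    fix x assume "a <= x" "x <= b"
    hence "dist (poly (q n) x) (f x) < 1" "\<bar>f x\<bar> <= B" using n B by auto
    thus "\<bar>poly (q n) x\<bar> <= B + 1" unfolding dist_real_def by linarith
   qed
  qed
  show "(%n. (B + 1) * norm (poly_op T (r n) u - fc g u)) \<longlonglongrightarrow> 0"
   using tendsto_mult_right_zero[OF tendsto_norm_zero[OF LIM_zero[OF fc_limit[OF r]]]] .
 qed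
 hence "(%n. poly_op T (q n) (poly_op T (r n) u - fc g u) + poly_op T (q n) (fc g u)) \<longlonglongrightarrow> 0 + fc f (fc g u)"
  by (intro tendsto_add fc_limit q)
 hence 2: "(%n. poly_op T (q n) (poly_op T (r n) u)) \<longlonglongrightarrow> fc f (fc g u)"
  by (simp add: linear_diff[OF poly_op_linear[OF linear]])
 show ?thesis using LIMSEQ_unique[OF 1 2] .
qed

end

section \<open>Stieltjes integrals of bounded distribution functions\<close>

locale bounded_distribution =
 fixes G :: "real => real" and lo hi :: real
 assumes mono: "!!s t. s <= t ==> G s <= G t"
  and rcont: "!!s. continuous (at_right s) G"
  and lohi: "lo < hi"
  and below: "!!s. s <= lo ==> G s = 0"
  and above: "!!s. hi <= s ==> G s = G hi"
begin

lemma emeasure_Ioc: "s <= t ==> emeasure (interval_measure G) {s<..t} = ennreal (G t - G s)"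
 by (rule emeasure_interval_measure_Ioc) (use mono rcont in auto)

lemma AE_in_support: "AE s in interval_measure G. s : {lo<..hi}"
proof -
 have "(\<Union>n::nat. {lo - real n<..lo}) : null_sets (interval_measure G)" "(\<Union>n::nat. {hi<..hi + real n}) : null_sets (interval_measure G)"
  using above[of "hi + real _"] by (rule_tac [!] null_sets_UN) (simp_all add: null_sets_def emeasure_Ioc below)
 moreover have "{s : space (interval_measure G). s ~: {lo<..hi}} \<subseteq> (\<Union>n::nat. {lo - real n<..lo}) \<union> (\<Union>n::nat. {hi<..hi + real n})"
 proof
  fix s assume "s : {s : space (interval_measure G). s ~: {lo<..hi}}"
  then consider "s <= lo" | "hi < s" by fastforce
  thus "s : (\<Union>n::nat. {lo - real n<..lo}) \<union> (\<Union>n::nat. {hi<..hi + real n})"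
  proof cases
   case 1
   obtain n :: nat where "lo - s < real n" using reals_Archimedean2 by blast
   thus ?thesis using 1 by (intro UnI1 UN_I[of n]) auto
  next
   case 2
   obtain n :: nat where "s - hi < real n" using reals_Archimedean2 by blast
   thus ?thesis using 2 by (intro UnI2 UN_I[of n]) auto
  qed
 qed
 ultimately show ?thesis by (intro AE_I'[OF null_sets.Un])
qed

lemma integrable_Ioc:
 assumes "s <= t"
 shows "integrable (interval_measure G) (%x. c * indicator {s<..t} x :: real)"
  "integrable (interval_measure G) (%x. x * indicator {s<..t} x :: real)"
proof -
 show 1: "integrable (interval_measure G) (%x. c * indicator {s<..t} x :: real)" for c
  using assms by (intro integrable_mult_right integrable_real_indicator) (auto simp: emeasure_Ioc)
 show "integrable (interval_measure G) (%x. x * indicator {s<..t} x :: real)"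
  by (rule Bochner_Integration.integrable_bound[OF 1[of "\<bar>s\<bar> + \<bar>t\<bar>"]]) (auto simp: indicator_def)
qed

lemma integral_Ioc_bounds:
 assumes "s <= t"
 shows "s * (G t - G s) <= (\<integral>x. x * indicator {s<..t} x \<partial>interval_measure G)"
  "(\<integral>x. x * indicator {s<..t} x \<partial>interval_measure G) <= t * (G t - G s)"
proof -
 have m: "measure (interval_measure G) {s<..t} = G t - G s"
  using mono[OF assms] by (simp add: measure_def emeasure_Ioc[OF assms])
 have "(\<integral>x. s * indicator {s<..t} x \<partial>interval_measure G) <= (\<integral>x. x * indicator {s<..t} x \<partial>interval_measure G)"
  "(\<integral>x. x * indicator {s<..t} x \<partial>interval_measure G) <= (\<integral>x. t * indicator {s<..t} x \<partial>interval_measure G)"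
  by (intro integral_mono integrable_Ioc assms; simp add: indicator_def)+
 thus "s * (G t - G s) <= (\<integral>x. x * indicator {s<..t} x \<partial>interval_measure G)"
  "(\<integral>x. x * indicator {s<..t} x \<partial>interval_measure G) <= t * (G t - G s)" by (simp_all add: m)
qed

lemma integral_support: "(\<integral>s. s \<partial>interval_measure G) = (\<integral>s. s * indicator {lo<..hi} s \<partial>interval_measure G)"
 using AE_in_support by (intro integral_cong_AE) (auto simp: indicator_def)

lemma integral_bounds: "lo * G hi <= (\<integral>s. s \<partial>interval_measure G)" "(\<integral>s. s \<partial>interval_measure G) <= hi * G hi"
 using integral_Ioc_bounds[of lo hi] lohi by (simp_all add: integral_support below)

text \<open>Both \<open>J\<close> and the integral over \<open>(lo, t]\<close> change by an amount between \<open>s (G t - G s)\<close> and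
 \<open>t (G t - G s)\<close> on \<open>(s, t]\<close>; summing over a fine partition, their difference is constant.\<close>

lemma integral_eq_increment:
 assumes J: "!!s t. s <= t ==> s * (G t - G s) <= J t - J s" "!!s t. s <= t ==> J t - J s <= t * (G t - G s)"
 shows "(\<integral>s. s \<partial>interval_measure G) = J hi - J lo"
proof -
 let ?I = "%s t. \<integral>x. x * indicator {s<..t} x \<partial>interval_measure G"
 define D where "D t = J t - ?I lo t" for t
 have D: "\<bar>D t - D s\<bar> <= (t - s) * (G t - G s)" if st: "lo <= s" "s <= t" for s t
 proof -
  have "?I lo t = (\<integral>x. x * indicator {lo<..s} x + x * indicator {s<..t} x \<partial>interval_measure G)"
   using st by (intro Bochner_Integration.integral_cong) (auto simp: indicator_def)
  also have "... = ?I lo s + ?I s t" using st by (intro Bochner_Integration.integral_add integrable_Ioc)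
  finally show ?thesis using J[OF st(2)] integral_Ioc_bounds[OF st(2)] by (simp add: D_def left_diff_distrib)
 qed
 have "\<bar>D hi - D lo\<bar> <= (hi - lo) * G hi * (1 / real N)" if N: "N > 0" for N
 proof -
  define g where "g i = lo + real i * ((hi - lo) / real N)" for i
  have g: "g 0 = lo" "g N = hi" "lo <= g i" "g (Suc i) - g i = (hi - lo) / real N" "g i <= g (Suc i)" for i
   using N lohi unfolding g_def of_nat_Suc distrib_right by auto
  have "\<bar>D hi - D lo\<bar> = \<bar>\<Sum>i<N. D (g (Suc i)) - D (g i)\<bar>" by (simp add: sum_lessThan_telescope[of "%i. D (g i)"] g)
  also have "... <= (\<Sum>i<N. (g (Suc i) - g i) * (G (g (Suc i)) - G (g i)))"
   by (rule order_trans[OF sum_abs sum_mono]) (intro D g)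
  also have "... = (hi - lo) / real N * G hi"
   by (simp only: g sum_distrib_left[symmetric] sum_lessThan_telescope[of "%i. G (g i)"]) (simp add: below)
  finally show ?thesis by simp
 qed
 hence "\<bar>D hi - D lo\<bar> <= 0"
  by (intro tendsto_lowerbound[OF tendsto_mult_right_zero[OF lim_1_over_n]] eventually_mono[OF eventually_gt_at_top[of 0]]) auto
 thus ?thesis by (simp add: D_def integral_support)
qed

end

text \<open>Continuous functions decreasing to the indicator function of \<open>(-\<infinity>, s]\<close>, chosen such that
 every member equals 1 on the support of the later ones.\<close>

definition ramp :: "real => nat => real => real" where
 "ramp s k x = max 0 (min 1 (2 - 2 ^ Suc k * (x - s)))"

lemma ramp_continuous [intro]: "continuous_on A (ramp s k)"
 unfolding ramp_def by (intro continuous_intros)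

lemma ramp_nonneg: "0 <= ramp s k x" and ramp_le_1: "ramp s k x <= 1"
 by (auto simp: ramp_def)

lemma ramp_eq_1: "x <= s + 1 / 2 ^ Suc k ==> ramp s k x = 1"
proof -
 assume "x <= s + 1 / 2 ^ Suc k"
 hence "2 ^ Suc k * (x - s) <= 2 ^ Suc k * (1 / 2 ^ Suc k)"
  by (intro mult_left_mono) auto
 thus ?thesis by (simp add: ramp_def)
qed

lemma ramp_eq_0: "s + 1 / 2 ^ k <= x ==> ramp s k x = 0"
proof -
 assume "s + 1 / 2 ^ k <= x"
 hence "2 ^ Suc k * (1 / 2 ^ k) <= 2 ^ Suc k * (x - s)"
  by (intro mult_left_mono) auto
 thus ?thesis by (simp add: ramp_def)
qed

lemma ramp_mono:
 assumes "l <= k" "s <= t"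
 shows "ramp s k x <= ramp t l x"
proof (cases "x <= t")
 case True
 hence "2 ^ Suc l * (x - t) <= 0" by (intro mult_nonneg_nonpos) auto
 hence "2 - 2 ^ Suc l * (x - t) >= 2" by simp
 hence "ramp t l x = 1" unfolding ramp_def by linarith
 thus ?thesis by (simp add: ramp_le_1)
next
 case False
 hence "2 ^ Suc l * (x - t) <= 2 ^ Suc k * (x - s)"
  using assms by (intro mult_mono) (auto intro: power_increasing)
 thus ?thesis unfolding ramp_def by linarith
qed

lemma ramp_absorb:
 assumes "l < k" "s <= t"
 shows "ramp s k x * ramp t l x = ramp s k x"
proof (cases "x <= s + 1 / 2 ^ k")
 case True
 have "(1::real) / 2 ^ k <= 1 / 2 ^ Suc l"
  using assms by (intro divide_left_mono power_increasing) auto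
 thus ?thesis using True assms ramp_eq_1[of x t l] by simp
qed (simp add: ramp_eq_0)

section \<open>Existence of the spectral family\<close>

context bounded_spectrum
begin

lemma fc_1 [simp]: "fc (%_. 1) u = u"
proof -
 have "poly [:1:] = (%_. 1::real)" by (simp add: fun_eq_iff)
 thus ?thesis using fc_poly[of "[:1:]" u] by simp
qed

lemma fc_0 [simp]: "fc (%_. 0) u = 0"
proof -
 have "poly 0 = (%_. 0::real)" by (simp add: fun_eq_iff)
 thus ?thesis using fc_poly[of 0 u] by simp
qed

lemma fc_mono:
 assumes "continuous_on {a..b} f" "continuous_on {a..b} g" "!!x. a <= x ==> x <= b ==> f x <= g x"
 shows "fc f u \<bullet> u <= fc g u \<bullet> u"
proof -
 have "0 <= fc (%x. g x - f x) u \<bullet> u"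
  by (rule fc_nonneg) (use assms in \<open>auto intro!: continuous_intros\<close>)
 thus ?thesis by (simp add: fc_diff assms inner_diff_left)
qed

lemma norm_fc_squared:
 assumes "continuous_on {a..b} f"
 shows "(norm (fc f u))\<^sup>2 = fc (%x. f x * f x) u \<bullet> u"
 by (simp add: power2_norm_eq_inner fc_mult[OF assms assms] fc_sym[OF assms])

text \<open>Monotone convergence of operators: the quadratic forms decrease and are bounded below,
  and since differences of ramps take values in [0, 1], the squared distance of two of the vectors
  is at most the difference of their forms.\<close>

lemma convergent_fc_ramp: "convergent (%k. fc (ramp s k) u)"
proof -
 define c where "c k = fc (ramp s k) u \<bullet> u" for k
 have dec: "c k <= c l" if "l <= k" for k l
  unfolding c_def by (intro fc_mono ramp_continuous ramp_mono that order_refl)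
 have "0 <= c k" for k
  unfolding c_def by (intro fc_nonneg ramp_continuous ramp_nonneg)
 then obtain L where "c \<longlonglongrightarrow> L"
  using decseq_convergent[of c 0] dec unfolding monotone_on_def by metis
 hence "Cauchy c" by (simp add: LIMSEQ_imp_Cauchy)
 have key: "(norm (fc (ramp s k) u - fc (ramp s l) u))\<^sup>2 <= c l - c k" if "l <= k" for k l
 proof -
  have "(norm (fc (ramp s k) u - fc (ramp s l) u))\<^sup>2 = (norm (fc (%x. ramp s l x - ramp s k x) u))\<^sup>2"
   by (simp add: fc_diff ramp_continuous norm_minus_commute)
  also have "... = fc (%x. (ramp s l x - ramp s k x) * (ramp s l x - ramp s k x)) u \<bullet> u"
   by (intro norm_fc_squared continuous_intros ramp_continuous)
  also have "... <= fc (%x. ramp s l x - ramp s k x) u \<bullet> u"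
  proof (intro fc_mono continuous_intros ramp_continuous)
   fix x
   have "0 <= ramp s l x - ramp s k x" "ramp s l x - ramp s k x <= 1"
    using ramp_mono[OF that, of s s x] ramp_nonneg[of s k x] ramp_le_1[of s l x] by auto
   thus "(ramp s l x - ramp s k x) * (ramp s l x - ramp s k x) <= ramp s l x - ramp s k x"
    by (simp add: mult_left_le)
  qed
  also have "... = c l - c k"
   by (simp add: fc_diff ramp_continuous c_def inner_diff_left)
  finally show ?thesis .
 qed
 have "Cauchy (%k. fc (ramp s k) u)"
 proof (rule CauchyI)
  fix e :: real assume e: "e > 0"
  then obtain M where M: "\<forall>m\<ge>M. \<forall>n\<ge>M. norm (c m - c n) < e\<^sup>2"
   using CauchyD[OF \<open>Cauchy c\<close>, of "e\<^sup>2"] by auto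
  have "norm (fc (ramp s m) u - fc (ramp s n) u) < e" if "m >= M" "n >= M" "n <= m" for m n
  proof -
   have "\<bar>c n - c m\<bar> < e\<^sup>2" using M that by simp
   hence "(norm (fc (ramp s m) u - fc (ramp s n) u))\<^sup>2 < e\<^sup>2"
    using key[OF that(3)] by linarith
   thus ?thesis using e by (simp add: power_less_imp_less_base)
  qed
  hence "norm (fc (ramp s m) u - fc (ramp s n) u) < e" if "m >= M" "n >= M" for m n
   using that by (metis norm_minus_commute nle_le)
  thus "\<exists>M. \<forall>m\<ge>M. \<forall>n\<ge>M. norm (fc (ramp s m) u - fc (ramp s n) u) < e" by blast
 qed
 thus ?thesis by (rule Cauchy_convergent)
qed

definition specproj :: "real => 'a => 'a" where
 "specproj s u = lim (%k. fc (ramp s k) u)"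

lemma specproj_limit: "(%k. fc (ramp s k) u) \<longlonglongrightarrow> specproj s u"
 unfolding specproj_def using convergent_fc_ramp by (simp add: convergent_LIMSEQ_iff)

lemma specproj_linear: "linear (specproj s)"
proof
 note l = fc_linear[OF ramp_continuous]
 fix x y :: 'a and c :: real
 have "(%k. fc (ramp s k) (x + y)) \<longlonglongrightarrow> specproj s x + specproj s y"
  unfolding linear_add[OF l] by (intro tendsto_add specproj_limit)
 thus "specproj s (x + y) = specproj s x + specproj s y"
  using specproj_limit LIMSEQ_unique by blast
 have "(%k. fc (ramp s k) (c *\<^sub>R x)) \<longlonglongrightarrow> c *\<^sub>R specproj s x"
  unfolding linear_scale[OF l] by (intro tendsto_scaleR tendsto_const specproj_limit)
 thus "specproj s (c *\<^sub>R x) = c *\<^sub>R specproj s x"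
  using specproj_limit LIMSEQ_unique by blast
qed

lemma specproj_sym: "specproj s u \<bullet> v = u \<bullet> specproj s v"
proof -
 have "(%k. fc (ramp s k) u \<bullet> v) \<longlonglongrightarrow> specproj s u \<bullet> v"
  by (intro tendsto_inner specproj_limit tendsto_const)
 moreover have "(%k. fc (ramp s k) u \<bullet> v) \<longlonglongrightarrow> u \<bullet> specproj s v"
  unfolding fc_sym[OF ramp_continuous, of _ _ u v] by (intro tendsto_inner specproj_limit tendsto_const)
 ultimately show ?thesis by (rule LIMSEQ_unique)
qed

lemma specproj_norm_le: "norm (specproj s u) <= norm u"
proof (rule tendsto_upperbound[OF tendsto_norm[OF specproj_limit]])
 have "norm (fc (ramp s k) u) <= 1 * norm u" for k
  by (intro fc_norm_le_UNIV ramp_continuous) (use ramp_nonneg ramp_le_1 in auto)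
 thus "\<forall>\<^sub>F k in sequentially. norm (fc (ramp s k) u) <= norm u" by simp
qed auto

lemma specproj_bounded_linear: "bounded_linear (specproj s)"
 using specproj_linear specproj_norm_le
 by (intro bounded_linear_intro[where K=1]) (auto simp: linear_add linear_scale)

text \<open>By \<open>ramp_absorb\<close>, a fixed ramp at \<open>t\<close> acts as the identity on
  all later ramps at \<open>s\<close>; the two limits are then taken one after the other.\<close>

lemma specproj_mult:
 assumes "s <= t"
 shows "specproj s (specproj t u) = specproj s u"
proof -
 have "specproj s (fc (ramp t l) u) = specproj s u" for l
 proof -
  have "fc (ramp s k) (fc (ramp t l) u) = fc (ramp s k) u" if "l < k" for k
   using fc_mult[OF ramp_continuous ramp_continuous, of s k t l u] ramp_absorb[OF that assms] by simp
  hence "\<forall>\<^sub>F k in sequentially. fc (ramp s k) (fc (ramp t l) u) = fc (ramp s k) u"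
   by (rule eventually_mono[OF eventually_gt_at_top[of l]])
  hence "(%k. fc (ramp s k) u) \<longlonglongrightarrow> specproj s (fc (ramp t l) u)"
   using specproj_limit tendsto_cong by fast
  thus ?thesis using specproj_limit LIMSEQ_unique by blast
 qed
 moreover have "(%l. specproj s (fc (ramp t l) u)) \<longlonglongrightarrow> specproj s (specproj t u)"
  by (intro bounded_linear.tendsto[OF specproj_bounded_linear] specproj_limit)
 ultimately show ?thesis by (simp add: LIMSEQ_const_iff)
qed

lemma specproj_mult':
 assumes "s <= t"
 shows "specproj t (specproj s u) = specproj s u"
proof -
 have "specproj t (specproj s u) \<bullet> v = specproj s u \<bullet> v" for v
  by (simp add: specproj_sym specproj_mult[OF assms])
 thus ?thesis using vector_eq_rdot by blast
qed

lemma specproj_below: "s < a ==> specproj s u = 0"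
proof -
 assume "s < a"
 have "eventually (%k. (1/2::real) ^ k < a - s) sequentially"
  using \<open>s < a\<close> by (intro order_tendstoD(2)[OF LIMSEQ_realpow_zero]) auto
 hence "\<forall>\<^sub>F k in sequentially. fc (ramp s k) u = 0"
 proof eventually_elim
  case (elim k)
  have "fc (ramp s k) u = fc (%_. 0) u"
   using elim by (intro fc_cong ramp_eq_0) (auto simp: power_one_over)
  thus ?case by simp
 qed
 hence "(%k. fc (ramp s k) u) \<longlonglongrightarrow> 0" by (simp add: tendsto_eventually)
 thus ?thesis using specproj_limit LIMSEQ_unique by blast
qed

lemma specproj_above: "b <= s ==> specproj s u = u"
proof -
 assume s: "b <= s"
 have "fc (ramp s k) u = u" for k
 proof -
  have "fc (ramp s k) u = fc (%_. 1) u"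
  proof (intro fc_cong ramp_eq_1)
   fix x assume "x : {a..b}"
   hence "x <= s" using s by simp
   thus "x <= s + 1 / 2 ^ Suc k" by (simp add: add_increasing2)
  qed
  thus ?thesis by simp
 qed
 thus ?thesis using specproj_limit[of s u] by (simp add: LIMSEQ_const_iff)
qed

lemma specproj_commute:
 assumes "bounded_linear J" "!!u. J (T u) = T (J u)"
 shows "J (specproj s u) = specproj s (J u)"
proof -
 have "(%k. J (fc (ramp s k) u)) \<longlonglongrightarrow> J (specproj s u)"
  by (rule bounded_linear.tendsto[OF assms(1) specproj_limit])
 hence "(%k. fc (ramp s k) (J u)) \<longlonglongrightarrow> J (specproj s u)"
  by (simp add: fc_commute[OF ramp_continuous assms])
 thus ?thesis using specproj_limit LIMSEQ_unique by blast
qed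

lemma specproj_in_closed_subspace:
 assumes "subspace W" "closed W" "!!u. u : W ==> T u : W" "u : W"
 shows "specproj s u : W"
 by (rule closed_sequentially[OF assms(2) _ specproj_limit])
   (intro fc_in_closed_subspace ramp_continuous assms)

text \<open>The hypothesis says that a ramp at \<open>s\<close> has died out before the ramp at
  \<open>t\<close> leaves the value 1. It serves right continuity, with \<open>s\<close> slightly
  above \<open>t\<close>.\<close>

lemma specproj_le_ramp:
 assumes "s + 1 / 2 ^ m <= t + 1 / 2 ^ Suc k"
 shows "specproj s u \<bullet> u <= fc (ramp t k) u \<bullet> u"
proof (rule tendsto_upperbound)
 show "(%l. fc (ramp s l) u \<bullet> u) \<longlonglongrightarrow> specproj s u \<bullet> u"
  by (intro tendsto_inner specproj_limit tendsto_const)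
 have "fc (ramp s m) u \<bullet> u <= fc (ramp t k) u \<bullet> u"
 proof (intro fc_mono ramp_continuous)
  fix x
  show "ramp s m x <= ramp t k x"
  proof (cases "x <= t + 1 / 2 ^ Suc k")
   case True
   thus ?thesis using ramp_le_1[of s m x] by (simp only: ramp_eq_1)
  next
   case False
   thus ?thesis using ramp_nonneg[of t k x] assms by (subst ramp_eq_0) auto
  qed
 qed
 moreover have "fc (ramp s l) u \<bullet> u <= fc (ramp s m) u \<bullet> u" if "m <= l" for l
  by (intro fc_mono ramp_continuous ramp_mono that order_refl)
 ultimately show "\<forall>\<^sub>F l in sequentially. fc (ramp s l) u \<bullet> u <= fc (ramp t k) u \<bullet> u"
  by (auto simp: eventually_sequentially intro: order_trans)
qed auto

lemma norm_specproj_diff: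
 assumes "s <= t"
 shows "(norm (specproj t u - specproj s u))\<^sup>2 = specproj t u \<bullet> u - specproj s u \<bullet> u"
proof -
 have "specproj p u \<bullet> specproj q u = specproj (min p q) u \<bullet> u" for p q
  unfolding specproj_sym[of p u] using specproj_mult[of p q u] specproj_mult'[of q p u]
  by (cases "p <= q") (auto simp: min_def inner_commute)
 thus ?thesis
  using assms by (simp add: power2_norm_eq_inner inner_diff_left inner_diff_right min_def)
qed

lemma specproj_right_continuous: "((%t. norm (specproj t u - specproj s u)) \<longlongrightarrow> 0) (at_right s)"
proof (rule tendstoI)
 fix e :: real assume e: "e > 0"
 have "(%k. fc (ramp s k) u \<bullet> u) \<longlonglongrightarrow> specproj s u \<bullet> u"
  by (intro tendsto_inner specproj_limit tendsto_const)
 hence "\<forall>\<^sub>F k in sequentially. fc (ramp s k) u \<bullet> u < specproj s u \<bullet> u + e\<^sup>2"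
  using e by (intro order_tendstoD(2)) auto
 then obtain k where k: "fc (ramp s k) u \<bullet> u < specproj s u \<bullet> u + e\<^sup>2"
  by (auto simp: eventually_sequentially)
 show "\<forall>\<^sub>F t in at_right s. dist (norm (specproj t u - specproj s u)) 0 < e"
 proof (rule eventually_at_rightI[of s "s + 1 / 2 ^ Suc (Suc k)"])
  \<comment> \<open>Half of 1 / 2^(k+1) goes to the distance of \<open>t\<close> from
    \<open>s\<close>, the other half to the width of a ramp at \<open>t\<close>.\<close>
  fix t assume t: "t : {s<..<s + 1 / 2 ^ Suc (Suc k)}"
  moreover have "(1::real) / 2 ^ Suc k = 1 / 2 ^ Suc (Suc k) + 1 / 2 ^ Suc (Suc k)" by simp
  ultimately have "t + 1 / 2 ^ Suc (Suc k) <= s + 1 / 2 ^ Suc k" unfolding greaterThanLessThan_iff by linarith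
  hence "specproj t u \<bullet> u <= fc (ramp s k) u \<bullet> u" by (rule specproj_le_ramp)
  hence "(norm (specproj t u - specproj s u))\<^sup>2 < e\<^sup>2"
   using t k by (subst norm_specproj_diff) auto
  thus "dist (norm (specproj t u - specproj s u)) 0 < e"
   using e by (simp add: power_less_imp_less_base)
 qed simp
qed

lemma specproj_quadratic_mono: "s <= t ==> specproj s u \<bullet> u <= specproj t u \<bullet> u"
 using norm_specproj_diff[of s t u] zero_le_power2[of "norm (specproj t u - specproj s u)"] by simp

lemma T_commute_specproj: "T (specproj s u) = specproj s (T u)"
 by (rule specproj_commute) (auto intro: bounded_linear)

lemma fc_affine: "fc (%x. c - x) u = c *\<^sub>R u - T u"
proof -
 have "poly [:c, -1:] = (%x. c - x)" by (simp add: fun_eq_iff)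
 thus ?thesis using fc_poly[of "[:c, -1:]" u] linear
  by (simp add: poly_op_pCons[OF linear] linear_neg)
qed

text \<open>The function (t + 1/2^k - x) times the ramp is nonnegative, because the ramp vanishes
  beyond t + 1/2^k. In the limit this says that t - T is nonnegative on the range of the
  projection.\<close>

lemma T_le_on_specproj: "T (specproj t u) \<bullet> specproj t u <= t * (specproj t u \<bullet> specproj t u)"
proof -
 let ?w = "specproj t u"
 have "0 <= (t + 1 / 2 ^ k) * (?w \<bullet> fc (ramp t k) ?w) - T ?w \<bullet> fc (ramp t k) ?w" for k
 proof -
  have "0 <= fc (%x. (t + 1 / 2 ^ k - x) * ramp t k x) ?w \<bullet> ?w"
  proof (intro fc_nonneg continuous_intros ramp_continuous)
   fix x
   show "0 <= (t + 1 / 2 ^ k - x) * ramp t k x"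
    by (cases "x <= t + 1 / 2 ^ k") (auto simp: ramp_eq_0 ramp_nonneg)
  qed
  moreover have "fc (%x. (t + 1 / 2 ^ k - x) * ramp t k x) ?w = fc (%x. t + 1 / 2 ^ k - x) (fc (ramp t k) ?w)"
   by (intro fc_mult continuous_intros ramp_continuous)
  moreover have "T (fc (ramp t k) ?w) \<bullet> ?w = T ?w \<bullet> fc (ramp t k) ?w"
   by (simp add: sym inner_commute)
  ultimately show ?thesis
   by (simp add: fc_affine inner_diff_left inner_commute[of ?w "fc (ramp t k) ?w"])
 qed
 moreover have "(%k. (t + 1 / 2 ^ k) * (?w \<bullet> fc (ramp t k) ?w) - T ?w \<bullet> fc (ramp t k) ?w)
   \<longlonglongrightarrow> (t + 0) * (?w \<bullet> specproj t ?w) - T ?w \<bullet> specproj t ?w"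
  by (intro tendsto_intros specproj_limit) (simp add: LIMSEQ_realpow_zero flip: power_one_over)
 ultimately have "0 <= (t + 0) * (?w \<bullet> specproj t ?w) - T ?w \<bullet> specproj t ?w"
  by (intro tendsto_lowerbound[of _ _ sequentially]) auto
 thus ?thesis by (simp add: specproj_mult)
qed

text \<open>Up to \<open>s\<close> the ramp equals 1 and beyond it is at most 1, so (s - x)(ramp -
  1) is nonnegative; in the limit the ramp term disappears on vectors killed by the
  projection.\<close>

lemma T_ge_on_complement: "s * ((u - specproj s u) \<bullet> (u - specproj s u)) <= T (u - specproj s u) \<bullet> (u - specproj s u)"
proof -
 define w where "w = u - specproj s u"
 have w: "specproj s w = 0" by (simp add: w_def linear_diff[OF specproj_linear] specproj_mult)
 have "(s * (w \<bullet> w) - T w \<bullet> w) - (s * (w \<bullet> fc (ramp s k) w) - T w \<bullet> fc (ramp s k) w) <= 0" for k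
 proof -
  have "0 <= fc (%x. (s - x) * ramp s k x - (s - x)) w \<bullet> w"
  proof (intro fc_nonneg continuous_intros ramp_continuous)
   fix x
   show "0 <= (s - x) * ramp s k x - (s - x)"
   proof (cases "x <= s")
    case True
    hence "ramp s k x = 1" by (intro ramp_eq_1) (simp add: add_increasing2)
    thus ?thesis by simp
   next
    case False
    thus ?thesis using mult_right_mono_neg[of "ramp s k x" 1 "s - x"] ramp_le_1[of s k x]
     by (simp add: mult.commute)
   qed
  qed
  moreover have "fc (%x. (s - x) * ramp s k x - (s - x)) w = fc (%x. (s - x) * ramp s k x) w - fc (%x. s - x) w"
   by (intro fc_diff continuous_intros ramp_continuous)
  moreover have "fc (%x. (s - x) * ramp s k x) w = fc (%x. s - x) (fc (ramp s k) w)"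
   by (intro fc_mult continuous_intros ramp_continuous)
  moreover have "T (fc (ramp s k) w) \<bullet> w = T w \<bullet> fc (ramp s k) w"
   by (simp add: sym inner_commute)
  ultimately show ?thesis
   by (simp add: fc_affine inner_diff_left inner_commute[of w "fc (ramp s k) w"])
 qed
 moreover have "(%k. (s * (w \<bullet> w) - T w \<bullet> w) - (s * (w \<bullet> fc (ramp s k) w) - T w \<bullet> fc (ramp s k) w))
   \<longlonglongrightarrow> (s * (w \<bullet> w) - T w \<bullet> w) - (s * (w \<bullet> specproj s w) - T w \<bullet> specproj s w)"
  by (intro tendsto_intros specproj_limit)
 ultimately have "(s * (w \<bullet> w) - T w \<bullet> w) - (s * (w \<bullet> specproj s w) - T w \<bullet> specproj s w) <= 0"
  by (intro tendsto_upperbound[of _ _ sequentially]) auto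
 thus ?thesis unfolding w_def[symmetric] by (simp add: w)
qed

lemma specproj_integral: "(\<integral>s. s \<partial>interval_measure (%s. specproj s u \<bullet> u)) = T u \<bullet> u"
proof -
 \<comment> \<open>The lower end lies strictly below \<open>a\<close> because the family may jump at
   \<open>a\<close> itself.\<close>
 interpret G: bounded_distribution "%s. specproj s u \<bullet> u" "a - 1" b
 proof
  show "continuous (at_right s) (%s. specproj s u \<bullet> u)" for s
  proof -
   have "((%t. specproj t u) \<longlongrightarrow> specproj s u) (at_right s)"
    using specproj_right_continuous[of u s] by (simp add: LIM_zero_iff tendsto_norm_zero_iff)
   thus ?thesis unfolding continuous_within by (intro tendsto_inner tendsto_const)
  qed
 qed (use ab in \<open>auto simp: specproj_quadratic_mono specproj_below specproj_above\<close>)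
 have J: "s * (specproj t u \<bullet> u - specproj s u \<bullet> u) <= T (specproj t u) \<bullet> u - T (specproj s u) \<bullet> u &
   T (specproj t u) \<bullet> u - T (specproj s u) \<bullet> u <= t * (specproj t u \<bullet> u - specproj s u \<bullet> u)" if "s <= t" for s t
 proof -
  \<comment> \<open>\<open>v\<close> lies in the range of the projection at \<open>t\<close> and in
    the kernel of the one at \<open>s\<close>, where the form of \<open>T\<close> is between
    \<open>s\<close> and \<open>t\<close>. This squeezes the increments as
    \<open>integral_eq_increment\<close> requires.\<close>
  define v where "v = specproj t u - specproj s u"
  have v1: "specproj t v = v"
   using that by (simp add: v_def linear_diff[OF specproj_linear] specproj_mult specproj_mult')
  have v2: "v - specproj s v = v"
   using that by (simp add: v_def linear_diff[OF specproj_linear] specproj_mult specproj_mult')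
  have vv: "v \<bullet> v = specproj t u \<bullet> u - specproj s u \<bullet> u"
   using norm_specproj_diff[OF that, of u] by (simp add: v_def power2_norm_eq_inner)
  have v3: "specproj t v - specproj s v = v" using v1 v2 by simp
  have "T v \<bullet> v = T v \<bullet> (specproj t u - specproj s u)" by (simp add: v_def)
  also have "... = (specproj t (T v) - specproj s (T v)) \<bullet> u"
   by (simp add: inner_diff_left inner_diff_right specproj_sym)
  also have "... = T (specproj t v - specproj s v) \<bullet> u"
   by (simp add: T_commute_specproj linear_diff[OF linear])
  also have "... = T (specproj t u) \<bullet> u - T (specproj s u) \<bullet> u"
   unfolding v3 by (simp add: v_def linear_diff[OF linear] inner_diff_left)
  finally have Tv: "T v \<bullet> v = T (specproj t u) \<bullet> u - T (specproj s u) \<bullet> u" .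
  show ?thesis
   using T_le_on_specproj[of t v] T_ge_on_complement[of s v] unfolding v1 v2 vv Tv by simp
 qed
 have "(\<integral>s. s \<partial>interval_measure (%s. specproj s u \<bullet> u)) = T (specproj b u) \<bullet> u - T (specproj (a - 1) u) \<bullet> u"
  by (rule G.integral_eq_increment) (use J in auto)
 thus ?thesis by (simp add: specproj_below specproj_above linear_0[OF linear])
qed

end

section \<open>Uniqueness of the spectral family\<close>

text \<open>The assumptions on \<open>E\<close> are those that \<open>spectral_family\<close>
  provides; linearity of \<open>E s\<close> and its commutation with \<open>T\<close> have to be
  derived from them. \<open>W\<close> stands for the functions supported on the index set, inside
  the Hilbert space over the whole type.\<close>

locale spectral_family_on = bounded_spectrum T a b
 for T :: "'a::{real_inner,complete_space} => 'a" and a b :: real +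
 fixes W :: "'a set" and E :: "real => 'a => 'a" and M :: real
 assumes W: "subspace W" and TW: "u : W ==> T u : W"
  and EW: "u : W ==> E s u : W"
  and E_idem: "u : W ==> E s (E s u) = E s u"
  and E_sym: "u : W ==> v : W ==> E s u \<bullet> v = u \<bullet> E s v"
  and E_mult: "s <= t ==> u : W ==> E s (E t u) = E s u"
  and E_rcont: "u : W ==> ((%t. norm (E t u - E s u)) \<longlongrightarrow> 0) (at_right s)"
  and E_below: "u : W ==> s < - M ==> E s u = 0"
  and E_above: "u : W ==> M <= s ==> E s u = u"
  and E_integral: "u : W ==> (\<integral>s. s \<partial>interval_measure (%s. E s u \<bullet> u)) = T u \<bullet> u"
begin

lemma eq_if_inner_eq:
 assumes "x : W" "y : W" "!!w. w : W ==> x \<bullet> w = y \<bullet> w"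
 shows "x = y"
proof -
 have "(x - y) \<bullet> (x - y) = 0"
  using assms(3)[of "x - y"] subspace_diff[OF W assms(1,2)] by (simp add: inner_diff_left)
 thus ?thesis by simp
qed

lemma E_add: "u : W ==> v : W ==> E s (u + v) = E s u + E s v"
 by (rule eq_if_inner_eq)
   (auto simp: EW E_sym inner_add_left inner_add_right subspace_add[OF W])

lemma E_scale: "u : W ==> E s (c *\<^sub>R u) = c *\<^sub>R E s u"
 by (rule eq_if_inner_eq)
   (auto simp: EW E_sym subspace_scale[OF W])

lemma E_diff: "u : W ==> v : W ==> E s (u - v) = E s u - E s v"
 using E_add[of u "(-1) *\<^sub>R v" s] E_scale[of v s "-1"] subspace_scale[OF W, of v "-1"] by simp

lemma E_0 [simp]: "E s 0 = 0"
 using E_scale[of 0 s 0] subspace_0[OF W] by simp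

lemma E_mult': "s <= t ==> u : W ==> E t (E s u) = E s u"
 by (rule eq_if_inner_eq) (auto simp: EW E_sym E_mult)

lemma E_quadratic: "u : W ==> E s u \<bullet> u = (norm (E s u))\<^sup>2"
 by (simp add: power2_norm_eq_inner EW E_idem E_sym[of u "E s u"])
   (simp add: E_sym EW E_idem)

lemma E_norm_le: "u : W ==> norm (E s u) <= norm u"
proof -
 assume u: "u : W"
 have "(norm (E s u))\<^sup>2 <= norm (E s u) * norm u"
  using E_quadratic[OF u, of s] norm_cauchy_schwarz[of "E s u" u] by simp
 thus ?thesis by (cases "E s u = 0") (simp_all add: power2_eq_square)
qed

lemma distribution:
 assumes u: "u : W" and cd: "c < d" "E c u = 0" "E d u = u"
 shows "bounded_distribution (%s. E s u \<bullet> u) c d"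
proof
 show "E s u \<bullet> u <= E t u \<bullet> u" if "s <= t" for s t
  using E_norm_le[OF EW[OF u], of s t] E_mult[OF that u] unfolding E_quadratic[OF u]
  by (simp add: power_mono)
 show "continuous (at_right s) (%s. E s u \<bullet> u)" for s
 proof -
  have "((%t. E t u) \<longlongrightarrow> E s u) (at_right s)"
   using E_rcont[OF u, of s] by (simp add: LIM_zero_iff tendsto_norm_zero_iff)
  thus ?thesis unfolding continuous_within by (intro tendsto_inner tendsto_const)
 qed
 show "E s u \<bullet> u = 0" if "s <= c" for s
  using E_mult[OF that u] cd by simp
 show "E s u \<bullet> u = E d u \<bullet> u" if "d <= s" for s
  using E_mult'[OF that u] cd by simp
qed (rule cd)

lemma E_lo: "u : W ==> E (- \<bar>M\<bar> - 1) u = 0" and E_hi: "u : W ==> E (\<bar>M\<bar> + 1) u = u"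
 by (auto intro: E_below E_above)

lemma quadratic_bounds:
 assumes u: "u : W" and cd: "c < d" "E c u = 0" "E d u = u"
 shows "c * (u \<bullet> u) <= T u \<bullet> u" "T u \<bullet> u <= d * (u \<bullet> u)"
proof -
 interpret bounded_distribution "%s. E s u \<bullet> u" c d
  by (rule distribution[OF assms])
 show "c * (u \<bullet> u) <= T u \<bullet> u" "T u \<bullet> u <= d * (u \<bullet> u)"
  using integral_bounds cd E_integral[OF u] by simp_all
qed

text \<open>Only quadratic forms are known as integrals. For \<open>x\<close> in the range and
  \<open>w\<close> in the kernel of \<open>E c\<close> the mixed terms of all \<open>E s\<close>
  vanish, so x + w and x - w have the same distribution function and hence the same form of
  \<open>T\<close>; polarisation gives the claim. This is how \<open>E c\<close> and
  \<open>T\<close> are seen to commute.\<close>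

lemma cross_term:
 assumes x: "x : W" "E c x = x" and w: "w : W" "E c w = 0"
 shows "T x \<bullet> w = 0"
proof -
 have xw: "x + w : W" "x - w : W" using subspace_add[OF W] subspace_diff[OF W] x(1) w(1) by auto
 have "E s x \<bullet> w = 0 & E s w \<bullet> x = 0" for s
 proof (cases "s <= c")
  case True
  hence "E s w = 0" using E_mult[OF True w(1)] w(2) by simp
  thus ?thesis by (simp add: E_sym x w)
 next
  case False
  hence "E s x = x" using E_mult'[of c s x] x by simp
  moreover have "x \<bullet> w = 0" using E_sym[OF x(1) w(1), of c] x w by simp
  ultimately show ?thesis using E_sym[OF w(1) x(1), of s] by (simp add: inner_commute)
 qed
 hence "(%s. E s (x + w) \<bullet> (x + w)) = (%s. E s (x - w) \<bullet> (x - w))"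
  by (simp add: fun_eq_iff E_add E_diff x w inner_add_left inner_add_right inner_diff_left inner_diff_right)
 hence "T (x + w) \<bullet> (x + w) = T (x - w) \<bullet> (x - w)"
  using E_integral[OF xw(1)] E_integral[OF xw(2)] by simp
 moreover have "T w \<bullet> x = T x \<bullet> w" using sym[of w x] by (simp add: inner_commute)
 ultimately show ?thesis
  by (simp add: linear_add[OF linear] linear_diff[OF linear] inner_add_left inner_add_right inner_diff_left inner_diff_right)
qed

lemma T_range_invariant:
 assumes "x : W" "E c x = x"
 shows "E c (T x) = T x"
proof (rule eq_if_inner_eq)
 fix v assume v: "v : W"
 have "T x \<bullet> (v - E c v) = 0"
  by (rule cross_term[OF assms]) (simp_all add: E_diff EW E_idem v subspace_diff[OF W])
 thus "E c (T x) \<bullet> v = T x \<bullet> v"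
  using v assms by (simp add: E_sym TW inner_diff_right)
qed (use assms TW EW in auto)

lemma T_kernel_invariant:
 assumes "w : W" "E c w = 0"
 shows "E c (T w) = 0"
proof (rule eq_if_inner_eq)
 fix v assume v: "v : W"
 have "T (E c v) \<bullet> w = 0"
  by (rule cross_term[OF _ _ assms]) (simp_all add: EW E_idem v)
 thus "E c (T w) \<bullet> v = 0 \<bullet> v"
  using v assms by (simp add: E_sym TW) (simp add: sym inner_commute)
qed (use assms TW EW subspace_0[OF W] in auto)

text \<open>On the range of \<open>E s\<close> the distribution functions live below
  \<open>s\<close>, so \<open>T\<close> is at most \<open>s\<close> there and every ramp at
  \<open>s\<close> acts as the identity.\<close>

lemma specproj_eq_on_range:
 assumes u: "u : W" "E s u = u"
 shows "specproj s u = u"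
proof -
 define V where "V = {v : W. E s v = v}"
 have V: "subspace V"
  unfolding V_def using W
  by (auto simp: subspace_def E_add E_scale)
 have TV: "T v : V" if "v : V" for v
  using that by (auto simp: V_def TW T_range_invariant)
 have upV: "T v \<bullet> v <= s * (v \<bullet> v)" if "v : V" for v
 proof (rule quadratic_bounds(2))
  have "v : W" "E s v = v" using that by (auto simp: V_def)
  show "v : W" by fact
  show "E s v = v" by fact
  show "min (- \<bar>M\<bar> - 1) (s - 1) < s" by linarith
  have "E (min (- \<bar>M\<bar> - 1) (s - 1)) (E (- \<bar>M\<bar> - 1) v) = E (min (- \<bar>M\<bar> - 1) (s - 1)) v"
   using \<open>v : W\<close> by (intro E_mult) auto
  thus "E (min (- \<bar>M\<bar> - 1) (s - 1)) v = 0"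
   using E_lo[OF \<open>v : W\<close>] by simp
 qed
 show ?thesis
 proof (cases "s < a")
  case True
  have "a * (u \<bullet> u) <= s * (u \<bullet> u)"
   using upV[of u] lower[of u] u by (simp add: V_def)
  hence "u = 0" using True by (auto simp: mult_le_cancel_right)
  thus ?thesis by (simp add: linear_0[OF specproj_linear])
 next
  case False
  have "fc (ramp s k) u = u" for k
  proof -
   define d where "d = min b (s + 1 / 2 ^ Suc k)"
   have up: "T v \<bullet> v <= d * (v \<bullet> v)" if "v : V" for v
   proof -
    have "s * (v \<bullet> v) <= (s + 1 / 2 ^ Suc k) * (v \<bullet> v)" by (intro mult_right_mono) auto
    hence "T v \<bullet> v <= (s + 1 / 2 ^ Suc k) * (v \<bullet> v)" using upV[OF that] by linarith
    thus ?thesis using upper[of v] by (auto simp: d_def min_def)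
   qed
   have "s < s + 1 / 2 ^ Suc k" by simp
   hence "a < d" using ab False unfolding d_def by linarith
   have "norm (fc (%x. ramp s k x - 1) u) <= 0 * norm u"
   proof (rule fc_norm_le[OF _ V TV lower up])
    show "\<bar>ramp s k x - 1\<bar> <= 0" if "a <= x" "x <= d" for x
     using that ramp_eq_1[of x s k] by (simp add: d_def)
   qed (use \<open>a < d\<close> u in \<open>auto simp: V_def d_def intro!: continuous_intros\<close>)
   thus ?thesis by (simp add: fc_diff ramp_continuous)
  qed
  thus ?thesis using specproj_limit[of s u] by (simp add: LIMSEQ_const_iff)
 qed
qed

text \<open>On the kernel of \<open>E t\<close> the operator is at least \<open>t\<close>, and ramps
  at \<open>s\<close> eventually vanish from \<open>t\<close> on. Ramps at \<open>t\<close> itself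
  never do, hence the strict inequality.\<close>

lemma specproj_eq_0_on_kernel:
 assumes u: "u : W" "E t u = 0" and st: "s < t"
 shows "specproj s u = 0"
proof -
 define V where "V = {v : W. E t v = 0}"
 have V: "subspace V"
  unfolding V_def using W
  by (auto simp: subspace_def E_add E_scale)
 have TV: "T v : V" if "v : V" for v
  using that by (auto simp: V_def TW T_kernel_invariant)
 have loV: "t * (v \<bullet> v) <= T v \<bullet> v" if "v : V" for v
 proof (rule quadratic_bounds(1))
  have "v : W" "E t v = 0" using that by (auto simp: V_def)
  show "v : W" by fact
  show "E t v = 0" by fact
  show "t < max (\<bar>M\<bar> + 1) (t + 1)" by linarith
  have "E (max (\<bar>M\<bar> + 1) (t + 1)) (E (\<bar>M\<bar> + 1) v) = E (\<bar>M\<bar> + 1) v"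
   using \<open>v : W\<close> by (intro E_mult') auto
  thus "E (max (\<bar>M\<bar> + 1) (t + 1)) v = v"
   using E_hi[OF \<open>v : W\<close>] by simp
 qed
 show ?thesis
 proof (cases "t > b")
  case True
  have "t * (u \<bullet> u) <= b * (u \<bullet> u)"
   using loV[of u] upper[of u] u by (simp add: V_def)
  hence "u = 0" using True by (auto simp: mult_le_cancel_right)
  thus ?thesis by (simp add: linear_0[OF specproj_linear])
 next
  case False
  have "eventually (%k. (1/2::real) ^ k < t - s) sequentially"
   using st by (intro order_tendstoD(2)[OF LIMSEQ_realpow_zero]) auto
  hence "\<forall>\<^sub>F k in sequentially. fc (ramp s k) u = 0"
  proof eventually_elim
   case (elim k)
   define c where "c = max a (s + 1 / 2 ^ k)"
   have s: "s + 1 / 2 ^ k < t" using elim by (simp add: power_one_over)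
   have lo: "c * (v \<bullet> v) <= T v \<bullet> v" if "v : V" for v
   proof -
    have "(s + 1 / 2 ^ k) * (v \<bullet> v) <= t * (v \<bullet> v)" using s by (intro mult_right_mono) auto
    hence "(s + 1 / 2 ^ k) * (v \<bullet> v) <= T v \<bullet> v" using loV[OF that] by linarith
    thus ?thesis using lower[of v] by (auto simp: c_def max_def)
   qed
   have "norm (fc (ramp s k) u) <= 0 * norm u"
   proof (rule fc_norm_le[OF ramp_continuous V TV lo upper])
    show "\<bar>ramp s k x\<bar> <= 0" if "c <= x" "x <= b" for x
     using that ramp_eq_0[of s k x] by (simp add: c_def)
    show "c < b" using s False ab by (simp add: c_def)
   qed (use u in \<open>auto simp: V_def c_def\<close>)
   thus ?case by simp
  qed
  hence "(%k. fc (ramp s k) u) \<longlonglongrightarrow> 0" by (simp add: tendsto_eventually)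
  thus ?thesis using specproj_limit LIMSEQ_unique by blast
 qed
qed

text \<open>For t > s the splitting of \<open>u\<close> by \<open>E t\<close> shows that
  \<open>specproj s\<close> ignores the part outside the range of \<open>E t\<close>. As
  \<open>t\<close> decreases to \<open>s\<close>, right continuity puts \<open>E s u\<close> in the
  place of \<open>E t u\<close>, and on this vector the projection is the identity.\<close>

theorem E_eq_specproj:
 assumes u: "u : W"
 shows "E s u = specproj s u"
proof -
 have "specproj s (E t u) = specproj s u" if "s < t" for t
 proof -
  have "specproj s (u - E t u) = 0"
   by (rule specproj_eq_0_on_kernel[OF _ _ that]) (simp_all add: u EW E_diff E_idem subspace_diff[OF W])
  thus ?thesis by (simp add: linear_diff[OF specproj_linear])
 qed
 hence "\<forall>\<^sub>F t in at_right s. specproj s (E t u) = specproj s u"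
  by (intro eventually_at_rightI[of s "s + 1"]) auto
 moreover have "((%t. specproj s (E t u)) \<longlongrightarrow> specproj s (E s u)) (at_right s)"
 proof (rule bounded_linear.tendsto[OF specproj_bounded_linear])
  show "((%t. E t u) \<longlongrightarrow> E s u) (at_right s)"
   using E_rcont[OF u, of s] by (simp add: LIM_zero_iff tendsto_norm_zero_iff)
 qed
 ultimately have "((%t. specproj s u) \<longlongrightarrow> specproj s (E s u)) (at_right s)"
  by (rule Lim_transform_eventually[rotated])
 hence "specproj s u = specproj s (E s u)"
  using tendsto_unique[OF trivial_limit_at_right_real] tendsto_const by blast
 also have "... = E s u"
  by (rule specproj_eq_on_range) (simp_all add: u EW E_idem)
 finally show ?thesis by simp
qed

end

section \<open>Square-summable functions and bounded matrices acting on them\<close>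

lemma ell2_UNIV_iff: "u : ell2 UNIV \<longleftrightarrow> (%x. (cmod (u x))\<^sup>2) summable_on UNIV"
 by (simp add: ell2_def)

lemma ell2_imp_UNIV: "u : ell2 B ==> u : ell2 UNIV"
 by (simp add: ell2_def)

lemma ell2_add:
 assumes "u : ell2 UNIV" "v : ell2 UNIV"
 shows "(%x. u x + v x) : ell2 UNIV"
 unfolding ell2_UNIV_iff
proof (rule summable_on_comparison_test)
 show "(%x. 2 * (cmod (u x))\<^sup>2 + 2 * (cmod (v x))\<^sup>2) summable_on UNIV"
  using assms by (intro summable_on_add summable_on_cmult_right) (auto simp: ell2_UNIV_iff)
 fix x
 have "(cmod (u x + v x))\<^sup>2 <= (cmod (u x) + cmod (v x))\<^sup>2"
  by (intro power_mono norm_triangle_ineq) auto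
 also have "... <= 2 * (cmod (u x))\<^sup>2 + 2 * (cmod (v x))\<^sup>2"
  using sum_squares_bound[of "cmod (u x)" "cmod (v x)"] by (simp add: power2_sum)
 finally show "(cmod (u x + v x))\<^sup>2 <= 2 * (cmod (u x))\<^sup>2 + 2 * (cmod (v x))\<^sup>2" .
qed auto

lemma ell2_cmult:
 assumes "u : ell2 B"
 shows "(%x. c * u x) : ell2 B"
 using assms summable_on_cmult_right[of "%x. (cmod (u x))\<^sup>2" UNIV "(cmod c)\<^sup>2"]
 by (auto simp: ell2_def norm_mult power_mult_distrib)

lemma ell2_inner_summable:
 assumes "u : ell2 UNIV" "v : ell2 UNIV"
 shows "(%x. u x * cnj (v x)) summable_on UNIV"
proof -
 have "(%x. norm (u x * cnj (v x))) summable_on UNIV"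
 proof (rule summable_on_comparison_test)
  show "(%x. (cmod (u x))\<^sup>2 + (cmod (v x))\<^sup>2) summable_on UNIV"
   using assms by (intro summable_on_add) (auto simp: ell2_UNIV_iff)
  fix x
  show "norm (u x * cnj (v x)) <= (cmod (u x))\<^sup>2 + (cmod (v x))\<^sup>2"
   using sum_squares_bound[of "cmod (u x)" "cmod (v x)"] mult_nonneg_nonneg[OF norm_ge_zero[of "u x"] norm_ge_zero[of "v x"]]
   unfolding norm_mult complex_mod_cnj mult.assoc by linarith
 qed auto
 thus ?thesis by (rule abs_summable_summable)
qed

lemma ell2_inner_add_left:
 assumes "u : ell2 UNIV" "v : ell2 UNIV" "w : ell2 UNIV"
 shows "ell2_inner (%x. u x + v x) w = ell2_inner u w + ell2_inner v w"
 using assms unfolding ell2_inner_def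
 by (subst infsum_add[symmetric]) (auto intro: ell2_inner_summable simp: distrib_right)

lemma ell2_inner_cmult_left: "ell2_inner (%x. c * u x) v = c * ell2_inner u v"
 unfolding ell2_inner_def by (simp add: mult.assoc infsum_cmult_right')

lemma ell2_inner_commute: "ell2_inner u v = cnj (ell2_inner v u)"
 unfolding ell2_inner_def by (simp add: mult.commute flip: infsum_cnj)

lemma ell2_inner_cmult_right: "ell2_inner u (%x. c * v x) = cnj c * ell2_inner u v"
 by (subst (1 2) ell2_inner_commute) (simp add: ell2_inner_cmult_left)

lemma ell2_inner_self: "ell2_inner u u = of_real (\<Sum>\<^sub>\<infinity>x. (cmod (u x))\<^sup>2)"
proof -
 have "ell2_inner u u = (\<Sum>\<^sub>\<infinity>x. of_real ((cmod (u x))\<^sup>2))"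
  unfolding ell2_inner_def by (intro infsum_cong) (simp only: complex_norm_square)
 also have "... = of_real (\<Sum>\<^sub>\<infinity>x. (cmod (u x))\<^sup>2)"
 proof (rule infsum_bounded_linear_strong[OF _ bounded_linear_of_real])
  show "(%x. complex_of_real ((cmod (u x))\<^sup>2)) summable_on UNIV \<longleftrightarrow> (%x. (cmod (u x))\<^sup>2) summable_on UNIV"
   using summable_on_Re[of "%x. complex_of_real ((cmod (u x))\<^sup>2)"]
    summable_on_bounded_linear[OF bounded_linear_of_real, of "%x. (cmod (u x))\<^sup>2" UNIV] by auto
 qed
 finally show ?thesis .
qed

text \<open>A type makes the functional calculus for complete real inner product spaces applicable.
  Its inner product will be the real part of \<open>ell2_inner\<close>.\<close>

typedef 'c l2 = "ell2 (UNIV :: 'c set)" morphisms l2_fun Abs_l2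
 by (rule exI[of _ "%_. 0"]) (simp add: ell2_def)

setup_lifting type_definition_l2

lemma l2_fun_ell2 [simp]: "l2_fun u : ell2 UNIV"
 by (rule l2_fun)

instantiation l2 :: (type) real_vector
begin
lift_definition zero_l2 :: "'a l2" is "%_. 0" by (simp add: ell2_def)
lift_definition plus_l2 :: "'a l2 => 'a l2 => 'a l2" is "%u v x. u x + v x" by (rule ell2_add)
lift_definition uminus_l2 :: "'a l2 => 'a l2" is "%u x. - u x" by (simp add: ell2_def)
lift_definition minus_l2 :: "'a l2 => 'a l2 => 'a l2" is "%u v x. u x - v x"
 using ell2_add[of _ "%x. - _ x"] by (simp add: ell2_def)
lift_definition scaleR_l2 :: "real => 'a l2 => 'a l2" is "%r u x. of_real r * u x" by (rule ell2_cmult)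
instance
 by standard (transfer; simp add: algebra_simps fun_eq_iff)+
end

instantiation l2 :: (type) real_inner
begin
lift_definition inner_l2 :: "'a l2 => 'a l2 => real" is "%u v. Re (ell2_inner u v)" .
definition norm_l2 :: "'a l2 => real" where "norm_l2 u = sqrt (inner u u)"
definition sgn_l2 :: "'a l2 => 'a l2" where "sgn_l2 u = u /\<^sub>R norm u"
definition dist_l2 :: "'a l2 => 'a l2 => real" where "dist_l2 u v = norm (u - v)"
definition uniformity_l2 :: "('a l2 \<times> 'a l2) filter" where
 "uniformity_l2 = (INF e\<in>{0<..}. principal {(x, y). dist x y < e})"
definition open_l2 :: "'a l2 set => bool" where
 "open_l2 U = (\<forall>x\<in>U. eventually (%(x', y). x' = x --> y : U) uniformity)"
instance
proof
 fix u v w :: "'a l2" and r :: real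
 show "inner u v = inner v u"
  by transfer (subst ell2_inner_commute, simp)
 show "inner (u + v) w = inner u w + inner v w"
  by transfer (simp add: ell2_inner_add_left)
 show "inner (r *\<^sub>R u) v = r * inner u v"
  by transfer (simp add: ell2_inner_cmult_left)
 show "0 <= inner u u"
  by transfer (simp add: ell2_inner_self infsum_nonneg)
 show "inner u u = 0 \<longleftrightarrow> u = 0"
 proof
  assume "inner u u = 0"
  thus "u = 0"
  proof transfer
   fix u :: "'a => complex"
   assume u: "u : ell2 UNIV" "Re (ell2_inner u u) = 0"
   hence "(\<Sum>\<^sub>\<infinity>x. (cmod (u x))\<^sup>2) <= 0" by (simp add: ell2_inner_self)
   hence "(cmod (u x))\<^sup>2 = 0" for x
    using u by (intro nonneg_infsum_le_0D[of "%x. (cmod (u x))\<^sup>2" UNIV]) (auto simp: ell2_UNIV_iff)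
   thus "u = (%_. 0)" by auto
  qed
 qed (transfer, simp add: ell2_inner_def)
qed (simp_all add: norm_l2_def sgn_l2_def dist_l2_def uniformity_l2_def open_l2_def)
end

lemma norm_l2_squared: "(norm u)\<^sup>2 = (\<Sum>\<^sub>\<infinity>x. (cmod (l2_fun u x))\<^sup>2)"
 by (simp add: power2_norm_eq_inner inner_l2.rep_eq ell2_inner_self)

lemma l2_summable: "(%x. (cmod (l2_fun u x))\<^sup>2) summable_on UNIV"
 using l2_fun_ell2[of u] by (simp add: ell2_UNIV_iff)

lemma sum_le_norm_l2: "finite F ==> (\<Sum>x\<in>F. (cmod (l2_fun u x))\<^sup>2) <= (norm u)\<^sup>2"
 unfolding norm_l2_squared by (intro finite_sum_le_infsum l2_summable) auto

lemma norm_l2_fun_le: "cmod (l2_fun u x) <= norm u"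
 using sum_le_norm_l2[of "{x}" u] by (simp add: power2_le_iff_abs_le)

instance l2 :: (type) complete_space
proof
 fix X :: "nat => 'a l2"
 assume X: "Cauchy X"
 have "Cauchy (%n. l2_fun (X n) x)" for x
 proof (rule CauchyI)
  fix e :: real assume "e > 0"
  then obtain M where "\<forall>m\<ge>M. \<forall>n\<ge>M. norm (X m - X n) < e"
   using CauchyD[OF X] by blast
  moreover have "norm (l2_fun (X m) x - l2_fun (X n) x) <= norm (X m - X n)" for m n
   using norm_l2_fun_le[of "X m - X n" x] by (simp add: minus_l2.rep_eq)
  ultimately show "\<exists>M. \<forall>m\<ge>M. \<forall>n\<ge>M. norm (l2_fun (X m) x - l2_fun (X n) x) < e"
   by (meson le_less_trans)
 qed
 hence "\<exists>l. (%n. l2_fun (X n) x) \<longlonglongrightarrow> l" for x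
  using Cauchy_convergent convergent_def by blast
 then obtain f where f: "!!x. (%n. l2_fun (X n) x) \<longlonglongrightarrow> f x" by metis
 have bound: "(\<Sum>x\<in>F. (cmod (f x - l2_fun (X n) x))\<^sup>2) <= e\<^sup>2"
  if M: "\<forall>m\<ge>M. \<forall>n\<ge>M. norm (X m - X n) < e" and F: "finite F" and n: "n >= M" and e: "e > 0" for F n e M
 proof (rule tendsto_upperbound)
  show "(%m. \<Sum>x\<in>F. (cmod (l2_fun (X m) x - l2_fun (X n) x))\<^sup>2) \<longlonglongrightarrow> (\<Sum>x\<in>F. (cmod (f x - l2_fun (X n) x))\<^sup>2)"
   by (intro tendsto_intros f)
  have "(\<Sum>x\<in>F. (cmod (l2_fun (X m) x - l2_fun (X n) x))\<^sup>2) <= e\<^sup>2" if "m >= M" for m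
  proof -
   have "(\<Sum>x\<in>F. (cmod (l2_fun (X m - X n) x))\<^sup>2) <= (norm (X m - X n))\<^sup>2"
    by (rule sum_le_norm_l2[OF F])
   also have "... <= e\<^sup>2" using M n that by (intro power_mono) (auto intro: less_imp_le)
   finally show ?thesis by (simp add: minus_l2.rep_eq)
  qed
  thus "\<forall>\<^sub>F m in sequentially. (\<Sum>x\<in>F. (cmod (l2_fun (X m) x - l2_fun (X n) x))\<^sup>2) <= e\<^sup>2"
   by (auto simp: eventually_sequentially)
 qed auto
 have diff: "(%x. f x - l2_fun (X n) x) : ell2 UNIV"
  if M: "\<forall>m\<ge>M. \<forall>n\<ge>M. norm (X m - X n) < e" and n: "n >= M" and e: "e > 0" for n e M
  unfolding ell2_UNIV_iff
  by (rule nonneg_bdd_above_summable_on)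
    (use bound[OF M _ n e] in \<open>auto intro!: bdd_aboveI[of _ "e\<^sup>2"]\<close>)
 obtain M1 where M1: "\<forall>m\<ge>M1. \<forall>n\<ge>M1. norm (X m - X n) < 1"
  using CauchyD[OF X, of 1] by auto
 have f_ell2: "f : ell2 UNIV"
  using ell2_add[OF diff[OF M1 order_refl] l2_fun_ell2[of "X M1"]] by simp
 define L where "L = Abs_l2 f"
 have L: "l2_fun L = f" using f_ell2 by (simp add: L_def Abs_l2_inverse)
 have "X \<longlonglongrightarrow> L"
 proof (rule LIMSEQ_I)
  fix e :: real assume e: "e > 0"
  then obtain M where M: "\<forall>m\<ge>M. \<forall>n\<ge>M. norm (X m - X n) < e / 2"
   using CauchyD[OF X, of "e/2"] by auto
  have "norm (X n - L) < e" if n: "n >= M" for n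
  proof -
   have "(norm (L - X n))\<^sup>2 <= (e/2)\<^sup>2"
    unfolding norm_l2_squared minus_l2.rep_eq L
    by (rule infsum_le_finite_sums)
      (use bound[OF M _ n] diff[OF M n] e in \<open>auto simp: ell2_UNIV_iff\<close>)
   hence "norm (L - X n) <= e/2" using e by (simp add: power2_le_iff_abs_le)
   thus ?thesis using e by (simp add: norm_minus_commute)
  qed
  thus "\<exists>no. \<forall>n\<ge>no. norm (X n - L) < e" by blast
 qed
 thus "convergent X" by (auto simp: convergent_def)
qed

lemma ell2_norm_eq: "ell2_norm (l2_fun u) = norm u"
 by (simp add: ell2_norm_def norm_l2_def inner_l2.rep_eq)

text \<open>It carries the complex structure that the real inner product forgets: the imaginary part
  of \<open>ell2_inner\<close> is an inner product with a vector multiplied by i.\<close>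

lift_definition times_i :: "'c l2 => 'c l2" is "%u x. \<i> * u x" by (rule ell2_cmult)

lemma norm_times_i: "norm (times_i u) = norm u"
 unfolding norm_l2_def
 by (simp add: inner_l2.rep_eq times_i.rep_eq ell2_inner_cmult_left ell2_inner_cmult_right)

lemma bounded_linear_times_i: "bounded_linear times_i"
proof (rule bounded_linear_intro[where K=1])
 show "times_i (u + v) = times_i u + times_i v" for u v :: "'c l2"
  by transfer (simp add: fun_eq_iff distrib_left)
 show "times_i (r *\<^sub>R u) = r *\<^sub>R times_i u" for r and u :: "'c l2"
  by transfer (simp add: fun_eq_iff)
qed (simp add: norm_times_i)

lemma Im_ell2_inner: "Im (ell2_inner (l2_fun u) (l2_fun v)) = u \<bullet> times_i v"
 by (simp add: inner_l2.rep_eq times_i.rep_eq ell2_inner_cmult_right)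

lemma ell2_inner_l2_fun: "ell2_inner (l2_fun u) (l2_fun v) = Complex (u \<bullet> v) (u \<bullet> times_i v)"
 by (simp add: complex_eq_iff inner_l2.rep_eq Im_ell2_inner)

lift_definition restrict_l2 :: "'c set => 'c l2 => 'c l2" is "%F u x. if x : F then u x else 0"
proof -
 fix F :: "'c set" and u :: "'c => complex"
 assume u: "u : ell2 UNIV"
 show "(%x. if x : F then u x else 0) : ell2 UNIV"
  unfolding ell2_UNIV_iff
  by (rule summable_on_comparison_test[of "%x. (cmod (u x))\<^sup>2"]) (use u in \<open>auto simp: ell2_UNIV_iff\<close>)
qed

lemma restrict_l2_approx:
 assumes "e > 0"
 obtains F where "finite F" "norm (u - restrict_l2 F u) < e"
proof -
 let ?f = "%x. (cmod (l2_fun u x))\<^sup>2"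
 obtain F where F: "finite F" "dist (\<Sum>x\<in>F. ?f x) (\<Sum>\<^sub>\<infinity>x. ?f x) <= e\<^sup>2 / 2"
  using infsum_finite_approximation[OF l2_summable[of u], of "e\<^sup>2/2"] assms by auto
 have "(norm (u - restrict_l2 F u))\<^sup>2 = (\<Sum>\<^sub>\<infinity>x. if x : F then 0 else ?f x)"
  unfolding norm_l2_squared minus_l2.rep_eq restrict_l2.rep_eq by (intro infsum_cong) auto
 also have "... = (\<Sum>\<^sub>\<infinity>x\<in>-F. ?f x)"
  by (rule infsum_cong_neutral) auto
 also have "... = (\<Sum>\<^sub>\<infinity>x. ?f x) - (\<Sum>x\<in>F. ?f x)"
  using infsum_Un_disjoint[of ?f F "-F"] F(1) summable_on_subset_banach[OF l2_summable[of u], of "-F"]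
  by simp
 also have "... <= e\<^sup>2 / 2" using F(2) unfolding dist_real_def by linarith
 also have "... < e\<^sup>2" using assms by simp
 finally show ?thesis using assms F(1) that by (simp add: power_less_imp_less_base)
qed

lemma basis_vector_ell2 [simp]: "basis_vector x : ell2 UNIV"
proof -
 have "(%y. (cmod (basis_vector x y))\<^sup>2) summable_on UNIV \<longleftrightarrow> (%y. 1::real) summable_on {x}"
  by (rule summable_on_cong_neutral) (auto simp: basis_vector_def)
 thus ?thesis by (simp add: ell2_UNIV_iff)
qed

lift_definition basis_l2 :: "'c => complex => 'c l2" is "%x c y. c * basis_vector x y"
 by (rule ell2_cmult) simp

lemma restrict_l2_eq_sum:
 "finite F ==> restrict_l2 F u = (\<Sum>x\<in>F. basis_l2 x (l2_fun u x))"
proof (induction F rule: finite_induct)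
 case empty
 thus ?case by (intro l2_fun_inject[THEN iffD1]) (simp add: restrict_l2.rep_eq zero_l2.rep_eq)
next
 case (insert x F)
 have "restrict_l2 (insert x F) u = basis_l2 x (l2_fun u x) + restrict_l2 F u"
  using insert.hyps
  by (intro l2_fun_inject[THEN iffD1])
    (auto simp: restrict_l2.rep_eq plus_l2.rep_eq basis_l2.rep_eq basis_vector_def fun_eq_iff)
 thus ?case using insert by simp
qed

text \<open>Finitely supported vectors are dense. The maps are only real linear, so all complex
  multiples of the basis vectors have to be tested.\<close>

lemma bounded_linear_l2_eqI:
 assumes f: "bounded_linear f" and g: "bounded_linear g"
  and eq: "!!x c. f (basis_l2 x c) = g (basis_l2 x c)"
 shows "f u = g u"
proof -
 interpret f: bounded_linear f by fact
 interpret g: bounded_linear g by fact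
 obtain K where K: "!!u. norm (f u - g u) <= norm u * K" "K > 0"
  using bounded_linear.pos_bounded[OF bounded_linear_sub[OF f g]] by blast
 have "norm (f u - g u) <= e" if "e > 0" for e
 proof -
  obtain F where F: "finite F" "norm (u - restrict_l2 F u) < e / K"
   using restrict_l2_approx[of "e / K" u] \<open>e > 0\<close> K by auto
  have "f (restrict_l2 F u) = g (restrict_l2 F u)"
   by (simp add: restrict_l2_eq_sum[OF F(1)] f.sum g.sum eq)
  hence "f u - g u = f (u - restrict_l2 F u) - g (u - restrict_l2 F u)"
   by (simp add: f.diff g.diff)
  hence "norm (f u - g u) <= norm (u - restrict_l2 F u) * K"
   using K(1) by simp
  also have "... <= (e / K) * K" using F K by (intro mult_right_mono) auto
  also have "... = e" using K by simp
  finally show ?thesis .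
 qed
 hence "norm (f u - g u) <= 0" by (rule field_le_epsilon[of _ 0, simplified])
 thus ?thesis by simp
qed

lemma l2_fun_basis_l2: "l2_fun (basis_l2 x c) = (%y. if y = x then c else 0)"
 by (auto simp: basis_l2.rep_eq basis_vector_def)

lemma ell2_inner_delta_right: "ell2_inner u (%y. if y = x then c else 0) = u x * cnj c"
proof -
 have "ell2_inner u (%y. if y = x then c else 0) = (\<Sum>\<^sub>\<infinity>y\<in>{x}. u y * cnj c)"
  unfolding ell2_inner_def by (rule infsum_cong_neutral) auto
 thus ?thesis by simp
qed

lemma ell2_inner_delta_left: "ell2_inner (%y. if y = x then c else 0) u = c * cnj (u x)"
 by (subst ell2_inner_commute) (simp add: ell2_inner_delta_right mult.commute)

lemma inner_basis_l2: "u \<bullet> basis_l2 x 1 = Re (l2_fun u x)"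
 by (simp add: inner_l2.rep_eq l2_fun_basis_l2 ell2_inner_delta_right)

text \<open>An operator whose matrix has uniformly bounded entries and uniformly boundedly many nonzero
 entries in every row and column.\<close>

locale bounded_matrix =
 fixes B :: "'c set" and C :: "'d set" and m :: "'c => 'd => int" and K :: nat
 assumes row_finite: "x : B ==> finite {f\<in>C. m x f ~= 0}"
  and row_card: "x : B ==> card {f\<in>C. m x f ~= 0} <= K"
  and col_finite: "f : C ==> finite {x\<in>B. m x f ~= 0}"
  and col_card: "f : C ==> card {x\<in>B. m x f ~= 0} <= K"
  and entry_bound: "x : B ==> f : C ==> \<bar>m x f\<bar> <= int K"
begin

definition matrix_op :: "('c => complex) => 'd => complex" where
 "matrix_op u = (%f. if f : C then \<Sum>x | x : B & m x f ~= 0. of_int (m x f) * u x else 0)"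

lemma matrix_op_eq_infsum:
 "matrix_op u = (%f. if f : C then \<Sum>\<^sub>\<infinity>x\<in>B. of_int (m x f) * u x else 0)"
proof
 fix f
 show "matrix_op u f = (if f : C then \<Sum>\<^sub>\<infinity>x\<in>B. of_int (m x f) * u x else 0)"
 proof (cases "f : C")
  case True
  have "(\<Sum>\<^sub>\<infinity>x\<in>B. of_int (m x f) * u x) = (\<Sum>\<^sub>\<infinity>x\<in>{x\<in>B. m x f ~= 0}. of_int (m x f) * u x)"
   by (rule infsum_cong_neutral) auto
  thus ?thesis using True col_finite by (simp add: matrix_op_def)
 qed (simp add: matrix_op_def)
qed

text \<open>A Schur test. Of the factors in \<open>K ^ 4\<close>, two come from the entries, one
  from the Cauchy-Schwarz inequality over at most \<open>K\<close> terms, and one from the fact that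
  each coordinate of \<open>u\<close> enters at most \<open>K\<close> coordinates of the
  result.\<close>

lemma matrix_op_bound:
 assumes u: "u : ell2 UNIV" and F: "finite F"
 shows "(\<Sum>f\<in>F. (cmod (matrix_op u f))\<^sup>2) <= real K ^ 4 * (\<Sum>\<^sub>\<infinity>x. (cmod (u x))\<^sup>2)"
proof -
 let ?n = "%x. (cmod (u x))\<^sup>2"
 have pt: "(cmod (matrix_op u f))\<^sup>2 <= real K ^ 3 * (\<Sum>x | x : B & m x f ~= 0. ?n x)" if f: "f : C" for f
 proof -
  let ?S = "{x. x : B & m x f ~= 0}"
  have fin: "finite ?S" using col_finite[OF f] by simp
  have cS: "real (card ?S) <= real K" using col_card[OF f] by simp
  have "cmod (matrix_op u f) <= (\<Sum>x\<in>?S. cmod (of_int (m x f) * u x))"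
   using f by (simp add: matrix_op_def norm_sum)
  also have "... <= (\<Sum>x\<in>?S. real K * cmod (u x))"
  proof (rule sum_mono)
   fix x assume "x : ?S"
   hence "\<bar>m x f\<bar> <= int K" using entry_bound f by auto
   hence "\<bar>real_of_int (m x f)\<bar> <= real K" by (metis of_int_abs of_int_le_iff of_int_of_nat_eq)
   thus "cmod (of_int (m x f) * u x) <= real K * cmod (u x)"
    by (simp add: norm_mult mult_right_mono)
  qed
  finally have "(cmod (matrix_op u f))\<^sup>2 <= (\<Sum>x\<in>?S. real K * cmod (u x))\<^sup>2"
   by (intro power_mono) auto
  also have "... = real K ^ 2 * (\<Sum>x\<in>?S. cmod (u x))\<^sup>2"
   by (simp add: sum_distrib_left[symmetric] power_mult_distrib)
  also have "(\<Sum>x\<in>?S. cmod (u x))\<^sup>2 <= real (card ?S) * (\<Sum>x\<in>?S. ?n x)"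
   using sum_squared_le_sum_of_squares[of "%x. cmod (u x)" ?S] fin
   by (simp add: mult.commute)
  also have "real (card ?S) * (\<Sum>x\<in>?S. ?n x) <= real K * (\<Sum>x\<in>?S. ?n x)"
   using cS by (intro mult_right_mono sum_nonneg) auto
  finally show ?thesis by (simp add: power2_eq_square power3_eq_cube mult.assoc mult_left_mono)
 qed
 define G where "G = (\<Union>f\<in>F \<inter> C. {x. x : B & m x f ~= 0})"
 have G: "finite G" using F col_finite by (auto simp: G_def)
 have "(\<Sum>f\<in>F. (cmod (matrix_op u f))\<^sup>2) = (\<Sum>f\<in>F \<inter> C. (cmod (matrix_op u f))\<^sup>2)"
  using F by (intro sum.mono_neutral_right) (auto simp: matrix_op_def)
 also have "... <= (\<Sum>f\<in>F \<inter> C. real K ^ 3 * (\<Sum>x | x : B & m x f ~= 0. ?n x))"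
  by (intro sum_mono pt) auto
 also have "... = real K ^ 3 * (\<Sum>f\<in>F \<inter> C. \<Sum>x\<in>G. if x : B & m x f ~= 0 then ?n x else 0)"
  unfolding sum_distrib_left[symmetric]
  by (intro arg_cong[where f="(*) _"] sum.cong refl sum.mono_neutral_cong_left G) (auto simp: G_def)
 also have "(\<Sum>f\<in>F \<inter> C. \<Sum>x\<in>G. if x : B & m x f ~= 0 then ?n x else 0)
   = (\<Sum>x\<in>G. \<Sum>f\<in>F \<inter> C. if m x f ~= 0 then ?n x else 0)"
  by (subst sum.swap) (auto simp: G_def intro!: sum.cong)
 also have "... <= (\<Sum>x\<in>G. real K * ?n x)"
 proof (rule sum_mono)
  fix x assume "x : G"
  hence x: "x : B" by (auto simp: G_def)
  have "(\<Sum>f\<in>F \<inter> C. if m x f ~= 0 then ?n x else 0) = real (card {f\<in>F \<inter> C. m x f ~= 0}) * ?n x"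
   using F by (simp add: sum.If_cases Int_def)
  also have "... <= real K * ?n x"
  proof (intro mult_right_mono)
   have "card {f\<in>F \<inter> C. m x f ~= 0} <= card {f\<in>C. m x f ~= 0}"
    by (intro card_mono row_finite[OF x]) auto
   thus "real (card {f\<in>F \<inter> C. m x f ~= 0}) <= real K" using row_card[OF x] by simp
  qed simp
  finally show "(\<Sum>f\<in>F \<inter> C. if m x f ~= 0 then ?n x else 0) <= real K * ?n x" .
 qed
 also have "... <= real K * (\<Sum>\<^sub>\<infinity>x. ?n x)"
  unfolding sum_distrib_left[symmetric]
  using u G by (intro mult_left_mono finite_sum_le_infsum) (auto simp: ell2_UNIV_iff)
 finally show ?thesis by (simp add: mult_left_mono power_eq_if mult.assoc)
qed

lemma matrix_op_ell2: "u : ell2 UNIV ==> matrix_op u : ell2 C"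
proof -
 assume "u : ell2 UNIV"
 have "(%x. (cmod (matrix_op u x))\<^sup>2) summable_on UNIV"
  by (rule nonneg_bdd_above_summable_on)
    (use matrix_op_bound[OF \<open>u : ell2 UNIV\<close>] in \<open>auto intro!: bdd_aboveI\<close>)
 thus ?thesis by (auto simp: matrix_op_def ell2_def)
qed

definition matrix_l2 :: "'c l2 => 'd l2" where
 "matrix_l2 u = Abs_l2 (matrix_op (l2_fun u))"

lemma l2_fun_matrix_l2: "l2_fun (matrix_l2 u) = matrix_op (l2_fun u)"
 unfolding matrix_l2_def by (rule Abs_l2_inverse) (use matrix_op_ell2 ell2_imp_UNIV l2_fun_ell2 in blast)

lemma matrix_l2_norm: "norm (matrix_l2 u) <= real K ^ 2 * norm u"
proof -
 have "(norm (matrix_l2 u))\<^sup>2 <= real K ^ 4 * (norm u)\<^sup>2"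
  unfolding norm_l2_squared l2_fun_matrix_l2
  by (rule infsum_le_finite_sums)
    (use matrix_op_bound[OF l2_fun_ell2] matrix_op_ell2[OF l2_fun_ell2] in \<open>auto simp: ell2_def\<close>)
 also have "... = (real K ^ 2 * norm u)\<^sup>2" by (simp add: power_mult_distrib)
 finally show ?thesis by (rule power2_le_imp_le) simp
qed

lemma matrix_l2_bounded_linear: "bounded_linear matrix_l2"
proof (rule bounded_linear_intro)
 show "matrix_l2 (u + v) = matrix_l2 u + matrix_l2 v" for u v
  by (intro l2_fun_inject[THEN iffD1])
    (auto simp: l2_fun_matrix_l2 plus_l2.rep_eq matrix_op_def fun_eq_iff distrib_left sum.distrib)
 show "matrix_l2 (r *\<^sub>R u) = r *\<^sub>R matrix_l2 u" for r u
  by (intro l2_fun_inject[THEN iffD1])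
    (auto simp: l2_fun_matrix_l2 scaleR_l2.rep_eq matrix_op_def fun_eq_iff sum_distrib_left mult_ac)
 show "norm (matrix_l2 u) <= norm u * real K ^ 2" for u
  using matrix_l2_norm[of u] by (simp add: mult.commute)
qed

end

context bounded_matrix
begin

interpretation tr: bounded_matrix C B "%f x. m x f" K
 by standard (auto simp: row_finite row_card col_finite col_card entry_bound)

lemma matrix_op_delta:
 "x : B ==> matrix_op (%y. if y = x then c else 0) = (%f. if f : C then of_int (m x f) * c else 0)"
proof
 fix f assume x: "x : B"
 show "matrix_op (%y. if y = x then c else 0) f = (if f : C then of_int (m x f) * c else 0)"
 proof (cases "f : C")
  case True
  have "(\<Sum>y | y : B & m y f ~= 0. of_int (m y f) * (if y = x then c else 0))
    = (\<Sum>y | y : B & m y f ~= 0. if y = x then of_int (m x f) * c else 0)"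
   by (intro sum.cong) auto
  also have "... = of_int (m x f) * c"
   using x col_finite[OF True] by (simp add: sum.delta)
  finally show ?thesis using True by (simp add: matrix_op_def)
 qed (simp add: matrix_op_def)
qed

lemma matrix_op_delta_outside:
 "x ~: B ==> matrix_op (%y. if y = x then c else 0) = (%f. 0)"
 by (auto simp: matrix_op_def fun_eq_iff intro!: sum.neutral)

lemma ell2_inner_matrix_op_delta:
 assumes "x : B"
 shows "ell2_inner v (matrix_op (%y. if y = x then c else 0)) = cnj c * tr.matrix_op v x"
proof -
 have "ell2_inner v (matrix_op (%y. if y = x then c else 0))
   = (\<Sum>\<^sub>\<infinity>f\<in>{f\<in>C. m x f ~= 0}. of_int (m x f) * v f * cnj c)"
  unfolding ell2_inner_def matrix_op_delta[OF assms]
  by (rule infsum_cong_neutral) (auto split: if_splits)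
 also have "... = cnj c * tr.matrix_op v x"
  using row_finite[OF assms] assms by (simp add: tr.matrix_op_def sum_distrib_left mult_ac)
 finally show ?thesis .
qed

lemma matrix_l2_adjoint: "matrix_l2 u \<bullet> w = u \<bullet> tr.matrix_l2 w"
proof (rule bounded_linear_l2_eqI[where f = "%u. matrix_l2 u \<bullet> w" and g = "%u. u \<bullet> tr.matrix_l2 w"])
 show "bounded_linear (%u. matrix_l2 u \<bullet> w)"
  by (rule bounded_linear_compose[OF bounded_linear_inner_left matrix_l2_bounded_linear])
 show "bounded_linear (%u. u \<bullet> tr.matrix_l2 w)"
  by (rule bounded_linear_inner_left)
 fix x c
 show "matrix_l2 (basis_l2 x c) \<bullet> w = basis_l2 x c \<bullet> tr.matrix_l2 w"
 proof (cases "x : B")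
  case True
  have "Re (ell2_inner (matrix_op (%y. if y = x then c else 0)) (l2_fun w))
    = Re (ell2_inner (l2_fun w) (matrix_op (%y. if y = x then c else 0)))"
   by (subst ell2_inner_commute) simp
  also have "... = Re (c * cnj (tr.matrix_op (l2_fun w) x))"
   by (simp add: ell2_inner_matrix_op_delta[OF True])
  finally show ?thesis
   by (simp add: inner_l2.rep_eq l2_fun_matrix_l2 tr.l2_fun_matrix_l2 l2_fun_basis_l2 ell2_inner_delta_left)
 next
  case False
  thus ?thesis
   by (simp add: inner_l2.rep_eq l2_fun_matrix_l2 tr.l2_fun_matrix_l2 l2_fun_basis_l2
     ell2_inner_delta_left matrix_op_delta_outside tr.matrix_op_def ell2_inner_def)
 qed
qed

lemma ell2_adjoint_matrix_op: "ell2_adjoint B matrix_op v = tr.matrix_op v"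
proof
 fix x :: 'c
 have b: "basis_vector x = (%y. if y = x then 1 else 0)" by (auto simp: basis_vector_def)
 show "ell2_adjoint B matrix_op v x = tr.matrix_op v x"
  by (cases "x : B") (simp_all add: ell2_adjoint_def b ell2_inner_matrix_op_delta tr.matrix_op_def)
qed

definition gram :: "('c => complex) => 'c => complex" where
 "gram = ell2_adjoint B matrix_op \<circ> matrix_op"

definition gram_l2 :: "'c l2 => 'c l2" where
 "gram_l2 u = tr.matrix_l2 (matrix_l2 u)"

lemma l2_fun_gram_l2: "l2_fun (gram_l2 u) = gram (l2_fun u)"
 by (simp add: gram_l2_def gram_def tr.l2_fun_matrix_l2 l2_fun_matrix_l2 ell2_adjoint_matrix_op)

lemma gram_eq:
 assumes "x : B"
 shows "gram u x = (\<Sum>f | f : C & m x f ~= 0. \<Sum>y | y : B & m y f ~= 0. of_int (m x f * m y f) * u y)"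
 using assms by (simp add: gram_def ell2_adjoint_matrix_op tr.matrix_op_def matrix_op_def
   sum_distrib_left mult.assoc)

lemma gram_outside: "x ~: B ==> gram u x = 0"
 by (simp add: gram_def ell2_adjoint_def)

lemma gram_ell2: "u : ell2 UNIV ==> gram u : ell2 B"
 using tr.matrix_op_ell2[OF ell2_imp_UNIV[OF matrix_op_ell2]]
 by (simp add: gram_def ell2_adjoint_matrix_op)

lemma gram_l2_bounded_linear: "bounded_linear gram_l2"
 unfolding gram_l2_def[abs_def]
 by (rule bounded_linear_compose[OF tr.matrix_l2_bounded_linear matrix_l2_bounded_linear])

lemma inner_gram_l2: "gram_l2 u \<bullet> v = matrix_l2 u \<bullet> matrix_l2 v"
 unfolding gram_l2_def by (subst (1 2) inner_commute) (simp add: matrix_l2_adjoint)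

text \<open>The summand 1 keeps the interval [0, gram_bound] nondegenerate when
  \<open>K = 0\<close>, and it makes the bound at least \<open>K ^ 2\<close>, which will bound the
  eigenvalues of the symbols.\<close>

definition gram_bound :: real where
 "gram_bound = real K ^ 4 + 1"

sublocale gram: bounded_spectrum gram_l2 0 gram_bound
proof
 show "gram_l2 (x + y) = gram_l2 x + gram_l2 y" "gram_l2 (r *\<^sub>R x) = r *\<^sub>R gram_l2 x" for x y r
  using gram_l2_bounded_linear by (simp_all add: linear_simps)
 show "\<exists>K. \<forall>x. norm (gram_l2 x) <= norm x * K"
  using bounded_linear.bounded[OF gram_l2_bounded_linear] .
 show "gram_l2 x \<bullet> y = x \<bullet> gram_l2 y" for x y
  using inner_gram_l2[of x y] inner_gram_l2[of y x] by (simp add: inner_commute)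
 show "0 < gram_bound" by (simp add: gram_bound_def add_nonneg_pos)
 show "0 * (u \<bullet> u) <= gram_l2 u \<bullet> u" for u by (simp add: inner_gram_l2)
 show "gram_l2 u \<bullet> u <= gram_bound * (u \<bullet> u)" for u
 proof -
  have "(norm (matrix_l2 u))\<^sup>2 <= (real K ^ 2 * norm u)\<^sup>2"
   by (intro power_mono matrix_l2_norm) auto
  hence "gram_l2 u \<bullet> u <= real K ^ 4 * (u \<bullet> u)"
   by (simp add: inner_gram_l2 power2_norm_eq_inner[symmetric] power_mult_distrib)
  also have "... <= gram_bound * (u \<bullet> u)"
   by (intro mult_right_mono) (auto simp: gram_bound_def)
  finally show ?thesis .
 qed
qed

lemma gram_l2_times_i: "times_i (gram_l2 u) = gram_l2 (times_i u)"
proof -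
 have "matrix_op (%x. \<i> * u x) = (%f. \<i> * matrix_op u f)"
  "tr.matrix_op (%x. \<i> * v x) = (%f. \<i> * tr.matrix_op v f)" for u v
  by (auto simp: matrix_op_def tr.matrix_op_def fun_eq_iff sum_distrib_left mult_ac)
 thus ?thesis
  by (intro l2_fun_inject[THEN iffD1])
    (simp add: times_i.rep_eq l2_fun_gram_l2 gram_def ell2_adjoint_matrix_op)
qed

definition supported :: "'c l2 set" where
 "supported = {u. l2_fun u : ell2 B}"

lemma supported_iff: "u : supported \<longleftrightarrow> (\<forall>x. x ~: B --> l2_fun u x = 0)"
 using l2_fun_ell2[of u] by (auto simp: supported_def ell2_def)

lemma subspace_supported: "subspace supported"
 by (auto simp: subspace_def supported_iff zero_l2.rep_eq plus_l2.rep_eq scaleR_l2.rep_eq)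

lemma closed_supported: "closed supported"
 unfolding closed_sequential_limits
proof (intro allI impI, elim conjE)
 fix X :: "nat => 'c l2" and l
 assume X: "\<forall>n. X n : supported" "X \<longlonglongrightarrow> l"
 have "l2_fun l x = 0" if x: "x ~: B" for x
 proof -
  have "(%n. l2_fun (X n) x - l2_fun l x) \<longlonglongrightarrow> 0"
  proof (rule Lim_null_comparison)
   show "\<forall>\<^sub>F n in sequentially. norm (l2_fun (X n) x - l2_fun l x) <= norm (X n - l)"
    using norm_l2_fun_le[of "X _ - l" x] by (simp add: minus_l2.rep_eq)
   show "(%n. norm (X n - l)) \<longlonglongrightarrow> 0"
    using X(2) by (simp add: LIM_zero tendsto_norm_zero)
  qed
  thus ?thesis using X(1) x by (simp add: supported_iff LIMSEQ_const_iff)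
 qed
 thus "l : supported" by (simp add: supported_iff)
qed

lemma gram_l2_supported: "gram_l2 u : supported"
 unfolding supported_def by (simp add: l2_fun_gram_l2 gram_ell2)

lemma l2_fun_Abs_l2: "u : ell2 B ==> l2_fun (Abs_l2 u) = u"
 by (rule Abs_l2_inverse) (rule ell2_imp_UNIV)

lemma Abs_l2_supported: "u : ell2 B ==> Abs_l2 u : supported"
 by (simp add: supported_def l2_fun_Abs_l2)

definition gram_proj :: "real => ('c => complex) => 'c => complex" where
 "gram_proj s u = l2_fun (gram.specproj s (Abs_l2 u))"

lemma gram_proj_in: "u : ell2 B ==> gram_proj s u : ell2 B"
 unfolding gram_proj_def
 using gram.specproj_in_closed_subspace[OF subspace_supported closed_supported gram_l2_supported Abs_l2_supported]
 by (simp add: supported_def)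

text \<open>Real symmetry gives equality of the real parts; commutation with \<open>times_i\<close>
  gives that of the imaginary parts.\<close>

lemma ell2_inner_gram_proj:
 assumes "u : ell2 B" "v : ell2 B"
 shows "ell2_inner (gram_proj s u) v = ell2_inner u (gram_proj s v)"
proof -
 let ?u = "Abs_l2 u" and ?v = "Abs_l2 v"
 have "ell2_inner (l2_fun (gram.specproj s ?u)) (l2_fun ?v) = ell2_inner (l2_fun ?u) (l2_fun (gram.specproj s ?v))"
  unfolding ell2_inner_l2_fun
  using gram.specproj_commute[OF bounded_linear_times_i gram_l2_times_i, of s ?v]
  by (simp add: gram.specproj_sym)
 thus ?thesis using assms by (simp add: gram_proj_def l2_fun_Abs_l2)
qed

lemma spectral_family_gram_proj: "spectral_family B gram gram_proj"
 unfolding spectral_family_def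
proof (intro conjI allI ballI impI)
 fix s :: real
 show "ell2_projection B (gram_proj s)"
  unfolding ell2_projection_def
  by (auto simp: gram_proj_in ell2_inner_gram_proj)
    (simp add: gram_proj_def l2_fun_inverse gram.specproj_mult)
next
 fix s t :: real and u assume "s <= t" "u : ell2 B"
 thus "gram_proj s (gram_proj t u) = gram_proj s u"
  by (simp add: gram_proj_def l2_fun_inverse gram.specproj_mult)
next
 fix s :: real and u
 have "ell2_norm (%x. gram_proj t u x - gram_proj s u x) = norm (gram.specproj t (Abs_l2 u) - gram.specproj s (Abs_l2 u))" for t
  by (simp add: gram_proj_def ell2_norm_eq[symmetric] minus_l2.rep_eq)
 thus "((%t. ell2_norm (%x. gram_proj t u x - gram_proj s u x)) \<longlongrightarrow> 0) (at_right s)"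
  by (simp add: gram.specproj_right_continuous)
next
 show "\<exists>M. \<forall>u\<in>ell2 B. (\<forall>s. s < - M --> gram_proj s u = (%x. 0)) & (\<forall>s. M <= s --> gram_proj s u = u)"
 proof (intro exI[of _ gram_bound] ballI conjI allI impI)
  fix u and s :: real assume u: "u : ell2 B"
  have "0 < gram_bound" by (rule gram.ab)
  show "gram_proj s u = (%x. 0)" if "s < - gram_bound"
   using that \<open>0 < gram_bound\<close> by (simp add: gram_proj_def gram.specproj_below zero_l2.rep_eq)
  show "gram_proj s u = u" if "gram_bound <= s"
   using that u by (simp add: gram_proj_def gram.specproj_above l2_fun_Abs_l2)
 qed
next
 fix u assume u: "u : ell2 B"
 let ?u = "Abs_l2 u"
 \<comment> \<open>The form of a self-adjoint operator is real; only then does the real integral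
   give the complex number demanded by \<open>spectral_family\<close>.\<close>
 have "gram_l2 ?u \<bullet> times_i ?u = 0"
 proof -
  have "gram_l2 ?u \<bullet> times_i ?u = ?u \<bullet> times_i (gram_l2 ?u)"
   by (simp add: gram.sym gram_l2_times_i)
  also have "... = Im (ell2_inner (l2_fun ?u) (l2_fun (gram_l2 ?u)))"
   by (rule Im_ell2_inner[symmetric])
  also have "... = - Im (ell2_inner (l2_fun (gram_l2 ?u)) (l2_fun ?u))"
   by (subst ell2_inner_commute) simp
  finally show ?thesis by (simp add: Im_ell2_inner)
 qed
 hence "ell2_inner (gram u) u = of_real (gram_l2 ?u \<bullet> ?u)"
  using ell2_inner_l2_fun[of "gram_l2 ?u" ?u] u
  by (simp add: l2_fun_gram_l2 l2_fun_Abs_l2 complex_eq_iff)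
 also have "gram_l2 ?u \<bullet> ?u = (\<integral>s. s \<partial>interval_measure (%s. gram.specproj s ?u \<bullet> ?u))"
  by (rule gram.specproj_integral[symmetric])
 also have "(%s. gram.specproj s ?u \<bullet> ?u) = (%s. Re (ell2_inner (gram_proj s u) u))"
  using u by (simp add: fun_eq_iff inner_l2.rep_eq gram_proj_def l2_fun_Abs_l2)
 finally show "ell2_inner (gram u) u = of_real (\<integral>s. s \<partial>interval_measure (%s. Re (ell2_inner (gram_proj s u) u)))" .
qed

lemma spectral_family_unique:
 assumes E: "spectral_family B gram E" and u: "u : ell2 B"
 shows "E s u = gram_proj s u"
proof -
 define F where "F s v = Abs_l2 (E s (l2_fun v))" for s v
 note E' = E[unfolded spectral_family_def ell2_projection_def]
 have in_B: "E s w : ell2 B" if "w : ell2 B" for s w using E' that by blast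
 have lF: "l2_fun (F s v) = E s (l2_fun v)" if "v : supported" for s v
  using that in_B unfolding F_def supported_def by (simp add: l2_fun_Abs_l2)
 obtain M where M: "!!u s. u : ell2 B ==> s < - M ==> E s u = (%x. 0)" "!!u s. u : ell2 B ==> s >= M ==> E s u = u"
  using E' by meson
 interpret F: spectral_family_on gram_l2 0 gram_bound supported F M
 proof
  fix v and s :: real assume v: "v : supported"
  hence vB: "l2_fun v : ell2 B" by (simp add: supported_def)
  show FW: "F s v : supported" using in_B[OF vB] lF[OF v] by (simp add: supported_def)
  show "F s (F s v) = F s v"
   using E' vB by (intro l2_fun_inject[THEN iffD1]) (simp add: lF FW v)
  show "F s v = 0" if "s < - M"
   using M(1)[OF vB that] by (intro l2_fun_inject[THEN iffD1]) (simp add: lF v zero_l2.rep_eq)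
  show "F s v = v" if "M <= s"
   using M(2)[OF vB that] by (intro l2_fun_inject[THEN iffD1]) (simp add: lF v)
  show "F s v \<bullet> w = v \<bullet> F s w" if "w : supported" for w
   using E' vB that by (simp add: inner_l2.rep_eq lF v) (simp add: supported_def)
  have "norm (F t v - F s v) = ell2_norm (%x. E t (l2_fun v) x - E s (l2_fun v) x)" for t
   using v by (simp add: ell2_norm_eq[symmetric] minus_l2.rep_eq lF)
  thus "((%t. norm (F t v - F s v)) \<longlongrightarrow> 0) (at_right s)"
   using E' vB by simp
  have "complex_of_real (\<integral>s. s \<partial>interval_measure (%s. Re (ell2_inner (E s (l2_fun v)) (l2_fun v)))) = ell2_inner (gram (l2_fun v)) (l2_fun v)"
   using E' vB by simp
  thus "(\<integral>s. s \<partial>interval_measure (%s. F s v \<bullet> v)) = gram_l2 v \<bullet> v"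
   by (simp add: inner_l2.rep_eq lF v l2_fun_gram_l2) (metis Re_complex_of_real)
 next
  fix s t :: real and v assume "s <= t" and v: "v : supported"
  hence vB: "l2_fun v : ell2 B" by (simp add: supported_def)
  have "F t v : supported" using in_B[OF vB] lF[OF v] by (simp add: supported_def)
  thus "F s (F t v) = F s v"
   using E' vB \<open>s <= t\<close> by (intro l2_fun_inject[THEN iffD1]) (simp add: lF v)
 qed (auto simp: subspace_supported gram_l2_supported)
 have "F s (Abs_l2 u) = gram.specproj s (Abs_l2 u)"
  by (rule F.E_eq_specproj[OF Abs_l2_supported[OF u]])
 thus ?thesis
  using lF[OF Abs_l2_supported[OF u], of s] u by (simp add: gram_proj_def l2_fun_Abs_l2)
qed

text \<open>The choice in \<open>spectral_projection\<close> is made among families that are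
  determined on \<open>ell2 B\<close> only, whence the hypothesis on \<open>u\<close>.\<close>

lemma spectral_projection_gram:
 assumes "u : ell2 B"
 shows "spectral_projection B gram s u = gram_proj s u"
 unfolding spectral_projection_def
 by (rule spectral_family_unique[OF someI[of "spectral_family B gram", OF spectral_family_gram_proj] assms])

lemma spectral_projection_diagonal:
 assumes "x : B"
 shows "Re (ell2_inner (spectral_projection B gram s (basis_vector x)) (basis_vector x))
    = gram.specproj s (basis_l2 x 1) \<bullet> basis_l2 x 1"
proof -
 have b: "basis_vector x : ell2 B" using assms basis_vector_ell2[of x] by (auto simp: ell2_def basis_vector_def)
 have "l2_fun (basis_l2 x 1) = basis_vector x" by (simp add: basis_l2.rep_eq)
 hence "Abs_l2 (basis_vector x) = basis_l2 x 1" by (metis l2_fun_inverse)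
 thus ?thesis
  using \<open>l2_fun (basis_l2 x 1) = basis_vector x\<close>
  by (simp add: spectral_projection_gram[OF b] gram_proj_def inner_l2.rep_eq)
qed

end

section \<open>Eigenvalues and characteristic polynomials of complex matrices\<close>

definition mat_trace :: "'a::comm_monoid_add mat => 'a" where
 "mat_trace A = (\<Sum>i<dim_row A. A $$ (i, i))"

lemma mat_trace_mult_commute:
 assumes "A : carrier_mat n n" "B : carrier_mat n (n::nat)"
 shows "mat_trace (A * B) = mat_trace (B * A :: 'a::comm_semiring_0 mat)"
proof -
 have "mat_trace (A * B) = (\<Sum>i<n. \<Sum>j<n. A $$ (i, j) * B $$ (j, i))"
  using assms by (simp add: mat_trace_def scalar_prod_def atLeast0LessThan)
 also have "... = (\<Sum>j<n. \<Sum>i<n. B $$ (j, i) * A $$ (i, j))"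
  by (subst sum.swap) (simp add: mult.commute)
 also have "... = mat_trace (B * A)"
  using assms by (simp add: mat_trace_def scalar_prod_def atLeast0LessThan)
 finally show ?thesis .
qed

lemma upper_triangular_mult:
 fixes A B :: "'a::semiring_0 mat"
 assumes A: "A : carrier_mat n n" "upper_triangular A" and B: "B : carrier_mat n n" "upper_triangular B"
 shows "upper_triangular (A * B)" "!!i. i < n ==> (A * B) $$ (i, i) = A $$ (i, i) * B $$ (i, i)"
proof -
 have e: "(A * B) $$ (i, j) = (\<Sum>l<n. A $$ (i, l) * B $$ (l, j))" if "i < n" "j < n" for i j
  using A B that by (simp add: scalar_prod_def atLeast0LessThan)
 have zA: "A $$ (i, j) = 0" and zB: "B $$ (i, j) = 0" if "j < i" "i < n" for i j
  using A B that by (auto simp: upper_triangular_def)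
 show "upper_triangular (A * B)"
  unfolding upper_triangular_def
 proof (intro allI impI)
  fix i j assume i: "i < dim_row (A * B)" and j: "j < i"
  hence "i < n" using A by simp
  have "A $$ (i, l) * B $$ (l, j) = 0" if "l < n" for l
   using zA[of l i] zB[of j l] \<open>i < n\<close> j that by (cases "l < i") auto
  thus "(A * B) $$ (i, j) = 0"
   using \<open>i < n\<close> j by (subst e) (auto intro!: sum.neutral)
 qed
 fix i assume i: "i < n"
 have "A $$ (i, l) * B $$ (l, i) = 0" if "l < n" "l ~= i" for l
  using zA[of l i] zB[of i l] i that by (cases "l < i") auto
 hence "(\<Sum>l<n. A $$ (i, l) * B $$ (l, i)) = (\<Sum>l\<in>{i}. A $$ (i, l) * B $$ (l, i))"
  using i by (intro sum.mono_neutral_right) auto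
 thus "(A * B) $$ (i, i) = A $$ (i, i) * B $$ (i, i)"
  using e[OF i i] by simp
qed

lemma upper_triangular_pow:
 fixes A :: "'a::semiring_1 mat"
 assumes A: "A : carrier_mat n n" "upper_triangular A"
 shows "upper_triangular (A ^\<^sub>m k) & (\<forall>i<n. (A ^\<^sub>m k) $$ (i, i) = A $$ (i, i) ^ k)"
proof (induction k)
 case 0
 thus ?case using A by (auto simp: upper_triangular_def)
next
 case (Suc k)
 thus ?case
  using upper_triangular_mult[OF pow_carrier_mat[OF A(1), of k] _ A]
  by (auto simp: power_commutes)
qed

text \<open>Schur triangularisation: powers and multiples of a triangular matrix act on its
  diagonal. One list has to serve traces, all multiples of \<open>A\<close> and the eigenvalues,
  because later \<open>A\<close> is rescaled by a power of z that turns Laurent polynomials into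
  polynomials.\<close>

theorem eigenvalue_list_exists:
 fixes A :: "complex mat"
 assumes A: "A : carrier_mat n n"
 obtains es where "length es = n" "!!k. mat_trace (A ^\<^sub>m k) = (\<Sum>a\<leftarrow>es. a ^ k)"
  "!!c. char_poly (c \<cdot>\<^sub>m A) = (\<Prod>a\<leftarrow>es. [:- (c * a), 1:])" "!!x. eigenvalue A x \<longleftrightarrow> x : set es"
proof -
 obtain as where as: "char_poly A = (\<Prod> a \<leftarrow> as. [:- a, 1:])"
  using char_poly_factorized[OF A] by auto
 obtain B where B: "B : carrier_mat n n" "upper_triangular B" "similar_mat A B"
  using schur_decomposition_exists[OF A as] by auto
 obtain P Q where PQ: "similar_mat_wit A B P Q"
  using B(3) by (auto simp: similar_mat_def)
 note D = similar_mat_witD2[OF A PQ]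
 have len: "length (diag_mat B) = n" using B by (simp add: diag_mat_def)
 have trace: "mat_trace (A ^\<^sub>m k) = (\<Sum>a\<leftarrow>diag_mat B. a ^ k)" for k
 proof -
  have Bk: "B ^\<^sub>m k : carrier_mat n n" using B by simp
  have "mat_trace (A ^\<^sub>m k) = mat_trace (P * (B ^\<^sub>m k * Q))"
   using similar_mat_wit_pow_id[OF PQ, of k] assoc_mult_mat[OF D(6) Bk D(7)] by simp
  also have "... = mat_trace (B ^\<^sub>m k * Q * P)"
   by (rule mat_trace_mult_commute[OF D(6) mult_carrier_mat[OF Bk D(7)]])
  also have "B ^\<^sub>m k * Q * P = B ^\<^sub>m k"
   using assoc_mult_mat[OF Bk D(7) D(6)] D(2) right_mult_one_mat[OF Bk] by simp
  also have "mat_trace (B ^\<^sub>m k) = (\<Sum>i<n. B $$ (i, i) ^ k)"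
   using upper_triangular_pow[OF B(1,2), of k] carrier_matD(1)[OF Bk] by (simp only: mat_trace_def) simp
  also have "... = (\<Sum>a\<leftarrow>diag_mat B. a ^ k)"
   using B by (simp add: diag_mat_def sum_list_sum_nth atLeast0LessThan)
  finally show ?thesis .
 qed
 have cp: "char_poly (c \<cdot>\<^sub>m A) = (\<Prod>a\<leftarrow>diag_mat B. [:- (c * a), 1:])" for c
 proof -
  have "similar_mat_wit (c \<cdot>\<^sub>m A) (c \<cdot>\<^sub>m B) P Q"
  proof (rule similar_mat_witI[OF D(1,2) _ _ _ D(6,7)])
   show "c \<cdot>\<^sub>m A = P * (c \<cdot>\<^sub>m B) * Q"
    using D B by (simp add: mult_smult_distrib[OF D(6) B(1)] mult_smult_assoc_mat[OF mult_carrier_mat[OF D(6) B(1)] D(7)])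
  qed (use A B in auto)
  hence "char_poly (c \<cdot>\<^sub>m A) = char_poly (c \<cdot>\<^sub>m B)"
   by (intro char_poly_similar) (auto simp: similar_mat_def)
  also have "... = (\<Prod>a\<leftarrow>diag_mat (c \<cdot>\<^sub>m B). [:- a, 1:])"
   by (rule char_poly_upper_triangular[of _ n]) (use B in \<open>auto simp: upper_triangular_def\<close>)
  also have "diag_mat (c \<cdot>\<^sub>m B) = map ((*) c) (diag_mat B)"
   using B by (auto simp: diag_mat_def)
  finally show ?thesis by (simp add: o_def)
 qed
 have "eigenvalue A x \<longleftrightarrow> x : set (diag_mat B)" for x
 proof -
  have "1 \<cdot>\<^sub>m A = A" using A by auto
  hence "char_poly A = (\<Prod>a\<leftarrow>diag_mat B. [:- a, 1:])" using cp[of 1] by simp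
  hence "poly (char_poly A) x = (\<Prod>a\<leftarrow>diag_mat B. x - a)"
   by (simp add: poly_prod_list o_def)
  thus ?thesis
   unfolding eigenvalue_root_char_poly[OF A] by (auto simp: prod_list_zero_iff)
 qed
 thus ?thesis using that len trace cp by blast
qed

lemma coeff_0_prod_linear: "coeff (\<Prod>a\<leftarrow>es. [:- a, 1:]) 0 = (\<Prod>a\<leftarrow>es. - a :: 'a::field)"
 by (induction es) (simp_all add: mult_pCons_left coeff_mult)

lemma coeff_1_prod_linear:
 assumes "0 ~: set es"
 shows "coeff (\<Prod>a\<leftarrow>es. [:- a, 1:]) (Suc 0) = - (\<Prod>a\<leftarrow>es. - a :: 'a::field) * (\<Sum>a\<leftarrow>es. 1 / a)"
 using assms
proof (induction es)
 case (Cons a es)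
 define Q where "Q = (\<Prod>a\<leftarrow>es. [:- a, 1:])"
 have "coeff (\<Prod>a\<leftarrow>a # es. [:- a, 1:]) (Suc 0) = coeff Q 0 - a * coeff Q (Suc 0)"
  by (simp add: Q_def[symmetric] mult_pCons_left)
 also have "coeff Q 0 = (\<Prod>a\<leftarrow>es. - a)" by (simp add: Q_def coeff_0_prod_linear)
 also have "coeff Q (Suc 0) = - (\<Prod>a\<leftarrow>es. - a) * (\<Sum>a\<leftarrow>es. 1 / a)"
  unfolding Q_def by (rule Cons.IH) (use Cons.prems in auto)
 finally show ?case using Cons.prems by (simp add: distrib_left)
qed simp

text \<open>The smallest positive element of \<open>es\<close> is comparable to the ratio of the two lowest nonvanishing
 coefficients of \<open>\<Prod>(x - a)\<close>, which is the reciprocal of the sum of the reciprocals.\<close>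

lemma smallest_root_vs_coefficients:
 fixes es :: "real list" and c :: complex
 assumes nonneg: "!!a. a : set es ==> 0 <= a" and c: "cmod c = 1"
  and p: "p = (\<Prod>a\<leftarrow>es. [:- (c * of_real a), 1:])"
  and low: "!!i. i < j ==> coeff p i = 0" and j: "coeff p j ~= 0" "j < length es"
 defines "q \<equiv> cmod (coeff p j) / cmod (coeff p (Suc j))"
 shows "coeff p (Suc j) ~= 0" "!!a. a : set es ==> a ~= 0 ==> q <= a"
  "\<exists>a\<in>set es. a ~= 0 & a <= real (length es) * q"
proof -
 define fs where "fs = filter (%a. a ~= 0) es"
 define k where "k = length (filter (%a. a = 0) es)"
 define g where "g = (\<Prod>a\<leftarrow>fs. [:- (c * of_real a), 1:])"
 have p_eq: "p = monom 1 k * g"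
  unfolding p g_def fs_def k_def
  by (induction es) (auto simp: monom_Suc mult_ac)
 have g_map: "g = (\<Prod>a\<leftarrow>map (%a. c * of_real a) fs. [:- a, 1:])"
  by (simp add: g_def o_def)
 have c0: "c ~= 0" using c by auto
 have nz: "0 ~: set (map (%a. c * of_real a) fs)"
  using c0 by (auto simp: fs_def)
 have g0: "coeff g 0 ~= 0"
  unfolding g_map coeff_0_prod_linear using nz by (auto simp: prod_list_zero_iff)
 have cp: "coeff p i = (if i < k then 0 else coeff g (i - k))" for i
  unfolding p_eq by (simp add: coeff_monom_mult)
 \<comment> \<open>\<open>k\<close> is the multiplicity of 0, and the remaining factor
   \<open>g\<close> does not vanish at 0, so the lowest nonvanishing coefficient sits exactly at
   \<open>k\<close>.\<close>
 have "j = k"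
 proof (rule ccontr)
  assume "j ~= k"
  then consider "j < k" | "k < j" by linarith
  thus False using j(1) low[of k] g0 by cases (auto simp: cp)
 qed
 hence cj: "coeff p j = coeff g 0" "coeff p (Suc j) = coeff g (Suc 0)" by (simp_all add: cp)
 have len: "length es = length fs + k"
  unfolding fs_def k_def using sum_length_filter_compl[of "%a. a ~= 0" es] by simp
 hence ne: "fs ~= []" using j(2) \<open>j = k\<close> by auto
 have pos: "0 < a" if "a : set fs" for a using that nonneg[of a] by (auto simp: fs_def)
 define S where "S = (\<Sum>a\<leftarrow>fs. 1 / a)"
 have S_ge: "1 / a <= S" if "a : set fs" for a
 proof -
  have "1 / a <= (\<Sum>x\<leftarrow>l. 1 / x)" if "a : set l" "\<forall>x\<in>set l. 0 < x" for l :: "real list"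
   using that
  proof (induction l)
   case (Cons x l)
   have "0 <= (\<Sum>x\<leftarrow>l. 1 / x)"
    by (rule sum_list_nonneg) (use Cons.prems in auto)
   moreover have "0 < 1 / x" using Cons.prems by simp
   moreover have "a = x \<or> 1 / a <= (\<Sum>x\<leftarrow>l. 1 / x)" using Cons by auto
   ultimately show ?case by (auto intro: add_increasing)
  qed simp
  thus ?thesis using that pos by (simp add: S_def)
 qed
 have "0 < 1 / hd fs" using pos[of "hd fs"] ne by simp
 hence S_pos: "S > 0" using S_ge[of "hd fs"] ne by (meson hd_in_set less_le_trans)
 have cS: "(\<Sum>a\<leftarrow>map (%a. c * of_real a) fs. 1 / a) = of_real S / c"
  unfolding S_def by (induction fs) (simp_all add: add_divide_distrib mult.commute)
 have g1: "coeff g (Suc 0) = - coeff g 0 * (of_real S / c)"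
  unfolding g_map coeff_1_prod_linear[OF nz] cS[symmetric] coeff_0_prod_linear ..
 hence "cmod (coeff g (Suc 0)) = cmod (coeff g 0) * S"
  using c S_pos by (simp only: norm_mult norm_divide norm_minus_cancel) simp
 hence q: "q = 1 / S" using g0 by (simp add: q_def cj)
 show "coeff p (Suc j) ~= 0" using g1 g0 S_pos c0 by (simp add: cj)
 show "q <= a" if "a : set es" "a ~= 0" for a
 proof -
  have a: "a : set fs" using that by (simp add: fs_def)
  have "1 <= S * a" using S_ge[OF a] pos[OF a] by (simp add: pos_divide_le_eq)
  thus ?thesis using S_pos by (simp add: q pos_divide_le_eq mult.commute)
 qed
 define M where "M = Min (set fs)"
 have M: "M : set fs" "!!a. a : set fs ==> M <= a" using ne unfolding M_def by (simp_all add: Min_le_iff)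
 have "S <= (\<Sum>a\<leftarrow>fs. 1 / M)"
  unfolding S_def
 proof (rule sum_list_mono)
  fix a assume "a : set fs"
  thus "1 / a <= 1 / M" using M pos by (intro divide_left_mono) auto
 qed
 also have "... = real (length fs) / M" by (simp add: sum_list_triv)
 also have "... <= real (length es) / M" using len pos[OF M(1)] by (simp add: divide_right_mono)
 finally have "S <= real (length es) / M" .
 hence "S * M <= real (length es)" by (rule pos_le_divide_eq[OF pos[OF M(1)], THEN iffD1])
 hence "M * S <= real (length es)" by (simp only: mult.commute)
 hence "M <= real (length es) / S" by (rule pos_le_divide_eq[OF S_pos, THEN iffD2])
 hence "M <= real (length es) * q" unfolding q by simp
 thus "\<exists>a\<in>set es. a ~= 0 & a <= real (length es) * q"
  using M(1) by (intro bexI[of _ M]) (auto simp: fs_def)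
qed

section \<open>Polynomials on the unit circle\<close>

lemma poly_local_order:
 fixes P :: "complex poly"
 assumes "P ~= 0"
 obtains d c C where "d > 0" "c > 0" "C > 0"
  "!!z. dist z w < d ==> c * cmod (z - w) ^ order w P <= cmod (poly P z)"
  "!!z. dist z w < d ==> cmod (poly P z) <= C * cmod (z - w) ^ order w P"
proof -
 obtain R where R: "P = [:- w, 1:] ^ order w P * R" "\<not> [:- w, 1:] dvd R"
  using order_decomp[OF assms] by blast
 define r where "r = cmod (poly R w)"
 have r: "r > 0" using R(2) by (simp add: r_def poly_eq_0_iff_dvd)
 have "isCont (%z. cmod (poly R z)) w" by (intro continuous_intros)
 then obtain d where d: "d > 0" "!!z. dist z w < d ==> \<bar>cmod (poly R z) - r\<bar> < r / 2"
  unfolding continuous_at_eps_delta r_def dist_real_def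
  using r by (metis half_gt_zero r_def)
 have P: "cmod (poly P z) = cmod (z - w) ^ order w P * cmod (poly R z)" for z
  by (subst R(1)) (simp add: norm_mult norm_power)
 show ?thesis
 proof (rule that[of d "r/2" "2*r"])
  fix z assume "dist z w < d"
  hence "\<bar>cmod (poly R z) - r\<bar> < r / 2" by (rule d(2))
  hence b: "r / 2 <= cmod (poly R z)" "cmod (poly R z) <= 2 * r" by linarith+
  show "r / 2 * cmod (z - w) ^ order w P <= cmod (poly P z)"
   unfolding P using b(1) by (subst mult.commute) (intro mult_left_mono, auto)
  show "cmod (poly P z) <= 2 * r * cmod (z - w) ^ order w P"
   unfolding P using b(2) by (subst (2) mult.commute) (intro mult_left_mono, auto)
 qed (use r d in auto)
qed

lemma circle_points_near:
 assumes "cmod w = 1" "e > 0"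
 obtains z where "cmod z = 1" "z ~= w" "dist z w < e"
proof -
 have "w islimpt sphere 0 1"
 proof (rule connected_imp_perfect)
  show "connected (sphere (0::complex) 1)" by (rule connected_sphere) simp
  show "sphere 0 1 ~= {x}" for x :: complex
  proof
   assume "sphere 0 1 = {x}"
   moreover have "1 : sphere (0::complex) 1" "-1 : sphere (0::complex) 1" by auto
   ultimately have "(1::complex) = -1" by (metis singletonD)
   thus False by simp
  qed
 qed (use assms in auto)
 thus ?thesis using that assms(2) unfolding islimpt_approachable by auto
qed

text \<open>\<open>P\<close> and \<open>Q\<close> will be consecutive coefficients of a
  characteristic polynomial, and \<open>b\<close> a bound for the eigenvalues. The conditions
  concern points where \<open>P\<close> does not vanish; at its zeros the kernel is larger and the
  quotient loses its meaning.\<close>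

locale circle_quotient =
 fixes P Q :: "complex poly" and b :: real
 assumes P_nz: "P ~= 0" 
  and Q_nz: "!!z. cmod z = 1 ==> poly P z ~= 0 ==> poly Q z ~= 0"
  and q_bounded: "!!z. cmod z = 1 ==> poly P z ~= 0 ==> cmod (poly P z) / cmod (poly Q z) <= b"
begin

definition q :: "complex => real" where
 "q z = cmod (poly P z) / cmod (poly Q z)"

definition Z :: "complex set" where
 "Z = {z. cmod z = 1 & poly P z = 0}"

lemma finite_Z: "finite Z"
 unfolding Z_def by (rule finite_subset[OF _ poly_roots_finite[OF P_nz]]) auto

lemma near_not_root:
 obtains d where "d > 0" "!!z. dist z w < d ==> z ~= w ==> poly P z ~= 0"
proof -
 obtain d c C where *: "d > 0" "c > 0" "(C::real) > 0" "!!z. dist z w < d ==> c * cmod (z - w) ^ order w P <= cmod (poly P z)"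
   "!!z. dist z w < d ==> cmod (poly P z) <= C * cmod (z - w) ^ order w P"
  using poly_local_order[OF P_nz, of w] by metis
 show ?thesis
 proof (rule that[OF *(1)])
  fix z assume "dist z w < d" "z ~= w"
  hence "0 < c * cmod (z - w) ^ order w P" using *(2) by simp
  thus "poly P z ~= 0" using *(4)[OF \<open>dist z w < d\<close>] by auto
 qed
qed

lemma circle_not_root: "\<exists>z. cmod z = 1 & poly P z ~= 0"
proof -
 obtain d where d: "d > 0" "!!z. dist z 1 < d ==> z ~= 1 ==> poly P z ~= 0"
  using near_not_root[of 1] by metis
 thus ?thesis using circle_points_near[of 1 d] by (metis norm_one)
qed

lemma Q_nonzero: "Q ~= 0"
 using circle_not_root Q_nz by auto

text \<open>The vanishing order of the quotient \<open>q\<close> at \<open>w\<close>. The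
  subtraction of natural numbers is a true difference at points of the circle, by
  \<open>order_Q_le\<close>.\<close>

definition kap :: "complex => nat" where
 "kap w = order w P - order w Q"

text \<open>If \<open>Q\<close> vanished to higher order, \<open>q\<close> would grow at least like
  1 / |z - w| along the circle near \<open>w\<close>, against the bound \<open>b\<close>. The
  quantity c1 / (B C2) in \<open>e\<close> is the distance at which the contradiction
  appears.\<close>

lemma order_Q_le:
 assumes w: "cmod w = 1"
 shows "order w Q <= order w P"
proof (rule ccontr)
 assume "\<not> ?thesis"
 hence lt: "order w P < order w Q" by simp
 obtain d1 c1 C1 where 1: "d1 > 0" "c1 > 0" "!!z. dist z w < d1 ==> c1 * cmod (z - w) ^ order w P <= cmod (poly P z)"
  using poly_local_order[OF P_nz, of w] by metis
 obtain d2 c2 C2 where 2: "d2 > 0" "C2 > 0" "!!z. dist z w < d2 ==> cmod (poly Q z) <= C2 * cmod (z - w) ^ order w Q"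
  using poly_local_order[OF Q_nonzero, of w] by metis
 obtain d3 where d3: "d3 > 0" "!!z. dist z w < d3 ==> z ~= w ==> poly P z ~= 0"
  using near_not_root[of w] by metis
 define B where "B = \<bar>b\<bar> + 1"
 have B: "B > 0" "b < B" by (auto simp: B_def)
 define e where "e = Min {d1, d2, d3, 1, c1 / (B * C2)}"
 have e: "e > 0" using 1 2 d3 B by (simp add: e_def)
 obtain z where z: "cmod z = 1" "z ~= w" "dist z w < e"
  using circle_points_near[OF w e] by auto
 have zd: "dist z w < d1" "dist z w < d2" "dist z w < d3" "dist z w < 1" "dist z w < c1 / (B * C2)"
  using z(3) by (auto simp: e_def)
 define r where "r = cmod (z - w)"
 have r: "0 < r" "r < 1" "r < c1 / (B * C2)" using z(2) zd by (auto simp: r_def dist_norm)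
 have Pz: "poly P z ~= 0" using d3(2)[OF zd(3) z(2)] .
 have Qz: "poly Q z ~= 0" using Q_nz[OF z(1) Pz] .
 have "cmod (poly P z) <= b * cmod (poly Q z)"
  using q_bounded[OF z(1) Pz] Qz by (simp add: pos_divide_le_eq)
 also have "... <= B * cmod (poly Q z)" using B by (intro mult_right_mono) auto
 also have "... <= B * (C2 * r ^ order w Q)" using 2(3)[OF zd(2)] B by (simp add: r_def)
 also have "r ^ order w Q <= r ^ Suc (order w P)" using r lt by (intro power_decreasing) auto
 finally have "cmod (poly P z) <= (B * C2 * r) * r ^ order w P" using B 2(2) by (simp add: mult_ac)
 moreover have "B * C2 * r < c1" using r(3) B 2(2) by (simp add: pos_less_divide_eq mult_ac)
 ultimately have "cmod (poly P z) < c1 * r ^ order w P"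
  using r by (meson le_less_trans mult_strict_right_mono zero_less_power)
 thus False using 1(3)[OF zd(1)] by (simp add: r_def)
qed

lemma q_local:
 assumes w: "cmod w = 1"
 obtains d c C where "d > 0" "c > 0" "C > 0"
  "!!z. dist z w < d ==> cmod z = 1 ==> poly P z ~= 0 ==> c * cmod (z - w) ^ kap w <= q z"
  "!!z. dist z w < d ==> cmod z = 1 ==> poly P z ~= 0 ==> q z <= C * cmod (z - w) ^ kap w"
proof -
 obtain d1 c1 C1 where 1: "d1 > 0" "c1 > 0" "C1 > 0" "!!z. dist z w < d1 ==> c1 * cmod (z - w) ^ order w P <= cmod (poly P z)"
   "!!z. dist z w < d1 ==> cmod (poly P z) <= C1 * cmod (z - w) ^ order w P"
  using poly_local_order[OF P_nz, of w] by metis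
 obtain d2 c2 C2 where 2: "d2 > 0" "c2 > 0" "C2 > 0" "!!z. dist z w < d2 ==> c2 * cmod (z - w) ^ order w Q <= cmod (poly Q z)"
   "!!z. dist z w < d2 ==> cmod (poly Q z) <= C2 * cmod (z - w) ^ order w Q"
  using poly_local_order[OF Q_nonzero, of w] by metis
 have split: "order w P = kap w + order w Q"
  using order_Q_le[OF w] by (simp add: kap_def)
 show ?thesis
 proof (rule that[of "min d1 d2" "c1 / C2" "C1 / c2"])
  fix z assume z: "dist z w < min d1 d2" "cmod z = 1" "poly P z ~= 0"
  hence z': "dist z w < d1" "dist z w < d2" by auto
  have Qz: "cmod (poly Q z) > 0" using Q_nz[OF z(2,3)] by simp
  define r where "r = cmod (z - w)"
  define X where "X = r ^ order w Q"
  have X: "X > 0" using 2(5)[OF z'(2)] Qz 2(3) unfolding X_def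
   by (metis less_le_trans r_def zero_less_mult_pos)
  have rP: "r ^ order w P = r ^ kap w * X" by (simp add: split power_add X_def)
  have 25: "cmod (poly Q z) <= C2 * X" and 24: "c2 * X <= cmod (poly Q z)"
   and 14: "c1 * (r ^ kap w * X) <= cmod (poly P z)" and 15: "cmod (poly P z) <= C1 * (r ^ kap w * X)"
   using 1(4,5)[OF z'(1)] 2(4,5)[OF z'(2)] by (simp_all add: r_def[symmetric] rP X_def)
  have "c1 / C2 * r ^ kap w = c1 * (r ^ kap w * X) / (C2 * X)"
   using X by simp
  also have "... <= cmod (poly P z) / (C2 * X)"
   using 14 2(3) X by (intro divide_right_mono) auto
  also have "... <= cmod (poly P z) / cmod (poly Q z)"
   using 25 Qz 2(3) X by (intro divide_left_mono) auto
  finally show "c1 / C2 * cmod (z - w) ^ kap w <= q z" by (simp add: q_def r_def)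
  have "cmod (poly P z) / cmod (poly Q z) <= cmod (poly P z) / (c2 * X)"
   using 24 Qz 2(2) X by (intro divide_left_mono) auto
  also have "... <= C1 * (r ^ kap w * X) / (c2 * X)"
   using 15 2(2) X by (intro divide_right_mono) auto
  also have "... = C1 / c2 * r ^ kap w"
   using X by simp
  finally show "q z <= C1 / c2 * cmod (z - w) ^ kap w" by (simp add: q_def r_def)
 qed (use 1 2 in auto)
qed

definition kappa :: nat where
 "kappa = Max (insert 0 (kap ` Z))"

lemma kap_le_kappa: "w : Z ==> kap w <= kappa"
 using finite_Z by (simp add: kappa_def)

text \<open>Within distance 1 of a zero \<open>w\<close> the power \<open>kappa\<close> is at most
  the power \<open>kap w\<close>; compactness of the circle reduces the local constants to finitely
  many.\<close>

lemma q_lower_bound: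
 obtains c where "c > 0" "!!z. cmod z = 1 ==> poly P z ~= 0 ==> c <= q z \<or> (\<exists>w\<in>Z. c * cmod (z - w) ^ kappa <= q z)"
proof -
 have "\<exists>d c. d > 0 & c > 0 & (\<forall>z. dist z w < d --> cmod z = 1 --> poly P z ~= 0 -->
     c <= q z \<or> (\<exists>w\<in>Z. c * cmod (z - w) ^ kappa <= q z))" if w: "cmod w = 1" for w
 proof -
  obtain d c C where *: "d > 0" "c > 0" "!!z. dist z w < d ==> cmod z = 1 ==> poly P z ~= 0 ==> c * cmod (z - w) ^ kap w <= q z"
   using q_local[OF w] by metis
  show ?thesis
  proof (cases "w : Z")
   case True
   have "c * cmod (z - w) ^ kappa <= q z" if z: "dist z w < min d 1" "cmod z = 1" "poly P z ~= 0" for z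
   proof -
    have "cmod (z - w) ^ kappa <= cmod (z - w) ^ kap w"
     using z(1) kap_le_kappa[OF True] by (intro power_decreasing) (auto simp: dist_norm)
    hence "c * cmod (z - w) ^ kappa <= c * cmod (z - w) ^ kap w" using *(2) by simp
    thus ?thesis using *(3)[of z] z by simp
   qed
   thus ?thesis using True * by (intro exI[of _ "min d 1"] exI[of _ c]) auto
  next
   case False
   hence "order w P = 0" using w by (simp add: Z_def order_0I)
   hence "kap w = 0" by (simp add: kap_def)
   thus ?thesis using * by (intro exI[of _ d] exI[of _ c]) auto
  qed
 qed
 then obtain d c where dc: "!!w. cmod w = 1 ==> d w > 0" "!!w. cmod w = 1 ==> c w > (0::real)"
  "!!w z. cmod w = 1 ==> dist z w < d w ==> cmod z = 1 ==> poly P z ~= 0 ==>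
     c w <= q z \<or> (\<exists>w'\<in>Z. c w * cmod (z - w') ^ kappa <= q z)"
  by metis
 have "compact (sphere (0::complex) 1)" by simp
 then obtain F where F: "F \<subseteq> sphere 0 1" "finite F" "sphere (0::complex) 1 \<subseteq> (\<Union>w\<in>F. ball w (d w))"
 proof (rule compactE_image[where C = "sphere 0 1" and f = "%w. ball w (d w)"])
  show "sphere 0 1 \<subseteq> (\<Union>w\<in>sphere 0 1. ball w (d w))" using dc(1) by force
 qed auto
 define c0 where "c0 = Min (insert 1 (c ` F))"
 have c0: "c0 > 0" "!!w. w : F ==> c0 <= c w"
  using F dc(2) by (auto simp: c0_def subset_iff)
 show ?thesis
 proof (rule that[OF c0(1)])
  fix z assume z: "cmod z = 1" "poly P z ~= 0"
  then obtain w where w: "w : F" "dist z w < d w" using F(3) by (force simp: dist_commute)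
  hence w1: "cmod w = 1" using F(1) by auto
  from dc(3)[OF w1 w(2) z] show "c0 <= q z \<or> (\<exists>w\<in>Z. c0 * cmod (z - w) ^ kappa <= q z)"
  proof
   assume "c w <= q z"
   thus ?thesis using c0(2)[OF w(1)] by simp
  next
   assume "\<exists>w'\<in>Z. c w * cmod (z - w') ^ kappa <= q z"
   then obtain w' where w': "w' : Z" "c w * cmod (z - w') ^ kappa <= q z" by blast
   have "c0 * cmod (z - w') ^ kappa <= c w * cmod (z - w') ^ kappa"
    using c0(2)[OF w(1)] by (intro mult_right_mono) auto
   thus ?thesis using w' by fastforce
  qed
 qed
qed

lemma q_near_worst_point:
 obtains w d c C where "cmod w = 1" "d > 0" "c > 0" "C > 0"
  "!!z. dist z w < d ==> z ~= w ==> poly P z ~= 0"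
  "!!z. dist z w < d ==> z ~= w ==> cmod z = 1 ==> c * cmod (z - w) ^ kappa <= q z"
  "!!z. dist z w < d ==> z ~= w ==> cmod z = 1 ==> q z <= C * cmod (z - w) ^ kappa"
proof -
 obtain w where w: "cmod w = 1" "kap w = kappa"
 proof (cases "kappa = 0")
  case True
  \<comment> \<open>If no zero has positive order, any point of the circle is a worst point, for
    instance 1.\<close>
  have "kap 1 = 0" using kap_le_kappa[of 1] True order_0I[of P 1] by (cases "1 : Z") (auto simp: Z_def kap_def)
  thus ?thesis using that[of 1] True by simp
 next
  case False
  have "kappa : insert 0 (kap ` Z)" unfolding kappa_def by (rule Max_in) (use finite_Z in auto)
  thus ?thesis using that False by (auto simp: Z_def)
 qed
 then obtain d c C where *: "d > 0" "c > 0" "C > 0"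
  "!!z. dist z w < d ==> cmod z = 1 ==> poly P z ~= 0 ==> c * cmod (z - w) ^ kap w <= q z"
  "!!z. dist z w < d ==> cmod z = 1 ==> poly P z ~= 0 ==> q z <= C * cmod (z - w) ^ kap w"
  using q_local by metis
 obtain d' where d': "d' > 0" "!!z. dist z w < d' ==> z ~= w ==> poly P z ~= 0"
  using near_not_root[of w] by metis
 show ?thesis
  by (rule that[of w "min d d'" c C]) (use w * d' in auto)
qed

end

section \<open>Roots of unity\<close>

lemma norm_power_diff_le:
 fixes x y :: complex
 assumes "cmod x = 1" "cmod y = 1"
 shows "cmod (x ^ n - y ^ n) <= real n * cmod (x - y)"
 using norm_power_diff[of x y n] assms by simp

text \<open>If \<open>z\<close> were closer to 1, then all powers below the n-th would have positive
  real part, whereas their sum is 0.\<close>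

lemma root_of_unity_far_from_1:
 assumes z: "z ^ n = 1" "z ~= 1" "n > 0"
 shows "cmod (z - 1) >= 1 / real n"
proof (rule ccontr)
 assume *: "\<not> ?thesis"
 have z1: "cmod z = 1" using z by (metis norm_one norm_power power_eq_1_iff power_one norm_ge_zero zero_less_norm_iff neq0_conv)
 have "Re (z ^ j) > 0" if "j < n" for j
 proof -
  have "cmod (z ^ j - 1 ^ j) <= real j * cmod (z - 1)"
   by (rule norm_power_diff_le) (use z1 in auto)
  also have "... <= real n * cmod (z - 1)" using that by (intro mult_right_mono) auto
  also have "... < 1" using * z(3) by (simp add: not_le pos_less_divide_eq mult.commute)
  finally have "cmod (z ^ j - 1) < 1" by simp
  hence "\<bar>Re (z ^ j - 1)\<bar> < 1" using abs_Re_le_cmod le_less_trans by blast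
  thus ?thesis by simp
 qed
 hence "(\<Sum>j<n. Re (z ^ j)) > 0" using z(3) by (intro sum_pos) auto
 moreover have "(\<Sum>j<n. z ^ j) = 0"
  using z by (simp add: geometric_sum)
 ultimately show False by (metis Re_sum less_irrefl zero_complex.simps(1))
qed

lemma unit_circle_simultaneous_return:
 assumes Z: "finite Z" "!!w. w : Z ==> cmod w = 1" and e: "e > 0"
 shows "\<exists>N\<ge>N0. \<forall>w\<in>Z. cmod (w ^ N - 1) < e"
proof -
 obtain g where g: "bij_betw g {0..<card Z} Z" using ex_bij_betw_nat_finite[OF Z(1)] by blast
 \<comment> \<open>The angles are scaled by \<open>Suc N0\<close> in advance, so that the exponent
   found by simultaneous Dirichlet approximation is a multiple of \<open>Suc N0\<close> and thus
   large.\<close>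
 define t where "t i = real (Suc N0) * Arg (g i) / (2 * pi)" for i
 obtain M :: nat where M: "2 * pi / e < real M" using reals_Archimedean2 by blast
 moreover have "0 < 2 * pi / e" using e by simp
 ultimately have M0: "M > 0" by (intro gr0I) auto
 obtain k p where k: "0 < k" "!!i. i < card Z ==> \<bar>of_int k * t i - of_int (p i)\<bar> < 1 / real M"
  using Dirichlet_approx_simult[OF M0, of "card Z" t] by metis
 define N where "N = nat k * Suc N0"
 have "cmod (w ^ N - 1) < e" if w: "w : Z" for w
 proof -
  obtain i where i: "i < card Z" "w = g i" using g w unfolding bij_betw_def by (metis atLeastLessThan_iff imageE)
  define x where "x = 2 * pi * (of_int k * t i - of_int (p i))"
  have "w = cis (Arg w)" using cis_Arg[of w] Z(2)[OF w] by (cases "w = 0") (auto simp: sgn_eq)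
  hence "w ^ N = cis (real N * Arg w)" using Complex.DeMoivre by metis
  also have "real N * Arg w = x + 2 * pi * of_int (p i)" using k(1) by (simp add: N_def x_def t_def i(2) field_simps)
  finally have "w ^ N = cis x" by (simp add: cis_mult[symmetric] cis_multiple_2pi)
  hence "cmod (w ^ N - 1) <= \<bar>x\<bar>" using dist_exp_i_1[of x] abs_sin_x_le_abs_x[of "x/2"] by (simp add: cis_conv_exp)
  also have "... = 2 * pi * \<bar>of_int k * t i - of_int (p i)\<bar>" by (simp add: x_def abs_mult)
  also have "... < 2 * pi * (1 / real M)" using k(2)[OF i(1)] by (intro mult_strict_left_mono) auto
  also have "... < e" using M M0 e by (simp add: field_simps)
  finally show ?thesis .
 qed
 moreover have "1 * N0 <= N" unfolding N_def using k(1) by (intro mult_le_mono) auto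
 ultimately show ?thesis by (metis mult_1)
qed

text \<open>Consecutive integers are used: if \<open>w\<^sup>N\<close> is close to 1, then \<open>w\<^sup>N\<^sup>+\<^sup>1\<close> is not.\<close>

lemma roots_of_unity_avoid_finite_set:
 fixes Z :: "complex set"
 assumes Z: "finite Z" "!!w. w : Z ==> cmod w = 1"
 obtains c where "c > 0" "!!N0. \<exists>n\<ge>N0. \<forall>z w. z ^ n = 1 --> w : Z --> z ~= w --> c / real n <= cmod (z - w)"
proof -
 define c where "c = Min (insert 1 ((%w. cmod (w - 1) / 2) ` (Z - {1})))"
 have c: "c > 0" "c <= 1" "!!w. w : Z ==> w ~= 1 ==> 2 * c <= cmod (w - 1)"
 proof -
  show "c > 0" using Z(1) by (auto simp: c_def)
  show "c <= 1" using Z(1) by (auto simp: c_def)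
  fix w assume "w : Z" "w ~= 1"
  hence "c <= cmod (w - 1) / 2" using Z(1) unfolding c_def by (intro Min_le) auto
  thus "2 * c <= cmod (w - 1)" by simp
 qed
 show ?thesis
 proof (rule that[OF c(1)])
  fix N0
  obtain N where N: "N >= N0" "\<forall>w\<in>Z. cmod (w ^ N - 1) < c"
   using unit_circle_simultaneous_return[OF Z c(1)] by blast
  have "c / real (Suc N) <= cmod (z - w)" if z: "z ^ Suc N = 1" and w: "w : Z" and zw: "z ~= w" for z w
  proof (cases "w = 1")
   case True
   hence "1 / real (Suc N) <= cmod (z - w)" using root_of_unity_far_from_1[OF z] zw by simp
   thus ?thesis using c(2) by (meson divide_right_mono of_nat_0_le_iff order_trans)
  next
   case False
   have w1: "cmod w = 1" by (rule Z(2)[OF w])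
   have "cmod z ^ Suc N = 1" using z by (metis norm_one norm_power)
   hence z1: "cmod z = 1" using power_eq_imp_eq_base[of "cmod z" "Suc N" 1] by simp
   \<comment> \<open>The distance of \<open>w\<close> from 1 is at least 2c, and replacing w by
     w^(N+1) costs less than c, so w^(N+1) stays more than c away from 1 = z^(N+1). Powers are at
     most N + 1 times as far apart as the points.\<close>
   have "2 * c <= cmod (w - 1)" using c(3) w False by simp
   also have "cmod (w - 1) <= cmod (w ^ Suc N - 1) + cmod (w ^ Suc N - w)"
    using norm_triangle_ineq4[of "w ^ Suc N - 1" "w ^ Suc N - w"] by simp
   also have "cmod (w ^ Suc N - w) = cmod w * cmod (w ^ N - 1)"
    by (simp add: norm_mult[symmetric] right_diff_distrib)
   also have "... < c" using N(2) w w1 by simp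
   finally have "c < cmod (w ^ Suc N - z ^ Suc N)" using z by simp
   also have "... <= real (Suc N) * cmod (w - z)" by (rule norm_power_diff_le[OF w1 z1])
   finally show ?thesis by (simp add: divide_le_eq norm_minus_commute mult.commute)
  qed
  thus "\<exists>n\<ge>N0. \<forall>z w. z ^ n = 1 --> w : Z --> z ~= w --> c / real n <= cmod (z - w)"
   using N(1) by (intro exI[of _ "Suc N"]) auto
 qed
qed

lemma half_le_sin:
 fixes x :: real
 assumes "0 <= x" "x <= pi / 2"
 shows "x / 2 <= sin x"
proof (cases "x <= pi / 3")
 case True
 show ?thesis
 proof (cases "x = 0")
  case False
  hence "0 < x" using assms by simp
  then obtain t where t: "0 < t" "t < x" "sin x - sin 0 = (x - 0) * cos t"
   using MVT2[of 0 x sin cos] by (auto simp: DERIV_sin)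
  have "cos (pi/3) <= cos t" using t True pi_gt_zero by (intro cos_monotone_0_pi_le) auto
  hence "x * (1/2) <= x * cos t" using assms by (intro mult_left_mono) (auto simp: cos_60)
  thus ?thesis using t by simp
 qed simp
next
 case False
 have "sin (pi/3) <= sin x" using False assms by (intro sin_monotone_2pi_le) auto
 moreover have "17/10 <= sqrt 3" by (rule real_le_rsqrt) (simp add: power2_eq_square)
 moreover have "pi < 33/10" using pi_approx by simp
 ultimately show ?thesis using assms by (simp add: sin_60)
qed

lemma chord_eq: "cmod (cis t - 1) = 2 * \<bar>sin (t / 2)\<bar>"
 using dist_exp_i_1[of t] by (simp add: cis_conv_exp)

lemma chord_le: "cmod (cis t - 1) <= \<bar>t\<bar>"
 unfolding chord_eq using abs_sin_x_le_abs_x[of "t/2"] by simp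

lemma chord_ge: "\<bar>t\<bar> <= pi ==> \<bar>t\<bar> / 2 <= cmod (cis t - 1)"
proof -
 assume t: "\<bar>t\<bar> <= pi"
 have "\<bar>t\<bar> / 2 / 2 <= sin (\<bar>t\<bar> / 2)" using t by (intro half_le_sin) auto
 also have "... <= \<bar>sin (\<bar>t\<bar> / 2)\<bar>" by simp
 also have "... = \<bar>sin (t / 2)\<bar>" by (auto simp: abs_if)
 finally show ?thesis unfolding chord_eq by simp
qed

lemma cmod_cis_diff: "cmod (cis s - cis t) = cmod (cis (s - t) - 1)"
proof -
 have "cis s - cis t = cis t * (cis (s - t) - 1)" by (simp add: right_diff_distrib cis_mult)
 thus ?thesis by (simp add: norm_mult)
qed

lemma card_int_interval:
 fixes a b :: real
 shows "real (card {m::int. a <= m & m <= b}) <= max 0 (b - a + 1)" "b - a - 1 <= real (card {m::int. a <= m & m <= b})"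
  "finite {m::int. a <= m & m <= b}"
proof -
 have e: "{m::int. a <= m & m <= b} = {\<lceil>a\<rceil>..\<lfloor>b\<rfloor>}" by (auto simp: ceiling_le_iff le_floor_iff)
 show "finite {m::int. a <= m & m <= b}" unfolding e by simp
 have "real_of_int \<lfloor>b\<rfloor> <= b" "b - 1 <= real_of_int \<lfloor>b\<rfloor>" "a <= real_of_int \<lceil>a\<rceil>" "real_of_int \<lceil>a\<rceil> <= a + 1"
  by linarith+
 moreover have "real (card {\<lceil>a\<rceil>..\<lfloor>b\<rfloor>}) = max 0 (real_of_int \<lfloor>b\<rfloor> - real_of_int \<lceil>a\<rceil> + 1)"
  by (simp add: max_def)
 ultimately show "real (card {m::int. a <= m & m <= b}) <= max 0 (b - a + 1)" "b - a - 1 <= real (card {m::int. a <= m & m <= b})"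
  unfolding e by linarith+
qed

definition unity_roots :: "nat => complex set" where
 "unity_roots n = {z. z ^ n = 1}"

lemma finite_unity_roots: "n > 0 ==> finite (unity_roots n)"
 unfolding unity_roots_def by (rule finite_roots_unity) simp

lemma unity_roots_norm: "z : unity_roots n ==> n > 0 ==> cmod z = 1"
proof -
 assume "z : unity_roots n" "n > 0"
 hence "cmod z ^ n = 1" by (simp add: unity_roots_def flip: norm_power)
 thus ?thesis using power_eq_imp_eq_base[of "cmod z" n 1] \<open>n > 0\<close> by simp
qed

lemma cis_unity_root: "n > 0 ==> cis (2 * pi * of_int k / real n) : unity_roots n"
 unfolding unity_roots_def by (simp add: Complex.DeMoivre cis_multiple_2pi)

lemma unit_eq_cis: "cmod w = 1 ==> w = cis (Arg w)"
 using cis_Arg[of w] by (cases "w = 0") (auto simp: sgn_eq)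

text \<open>A chord is at least half its angle, so the angles fill an interval of length 4e. The
  spacing is 2 pi / n, and 4 / (2 pi) < 1.\<close>

lemma card_unity_roots_near_le:
 assumes w: "cmod w = 1" and n: "n > 0" and e: "e >= 0"
 shows "real (card {z : unity_roots n. cmod (z - w) <= e}) <= real n * e + 1"
proof -
 define t where "t = Arg w"
 have wt: "w = cis t" unfolding t_def by (rule unit_eq_cis[OF w])
 define S where "S = {z : unity_roots n. cmod (z - w) <= e}"
 define a where "a = real n * (t - 2 * e) / (2 * pi)"
 define b where "b = real n * (t + 2 * e) / (2 * pi)"
 have ex: "\<exists>m::int. a <= m & m <= b & z = cis (2 * pi * of_int m / real n)" if z: "z : S" for z
 proof -
  have z1: "cmod z = 1" and ze: "cmod (z - w) <= e" and zn: "z ^ n = 1"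
   using z unity_roots_norm n by (auto simp: S_def unity_roots_def)
  define p where "p = Arg (z / w)"
  have "z / w = cis p" unfolding p_def by (rule unit_eq_cis) (simp add: norm_divide z1 w)
  hence zp: "z = cis (t + p)" using w by (auto simp: wt cis_mult[symmetric] field_simps)
  have "\<bar>p\<bar> <= pi" using Arg_bounded[of "z / w"] by (auto simp: p_def)
  hence "\<bar>p\<bar> / 2 <= cmod (cis p - 1)" by (rule chord_ge)
  also have "... = cmod (z - w)" by (simp add: zp wt cmod_cis_diff)
  finally have p: "\<bar>p\<bar> <= 2 * e" using ze by simp
  have "cis (real n * (t + p)) = 1" using zn by (simp add: zp Complex.DeMoivre)
  then obtain m :: int where m: "real n * (t + p) = of_int m * (2 * pi)"
   by (metis cis.simps(1) cos_one_2pi_int one_complex.simps(1) mult.assoc)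
  have mm: "of_int m = real n * (t + p) / (2 * pi)" using m by (simp add: field_simps)
  have "a <= m" "m <= b"
   unfolding a_def b_def mm using p by (auto intro!: divide_right_mono mult_left_mono)
  moreover have "z = cis (2 * pi * of_int m / real n)"
   unfolding zp mm using n by simp
  ultimately show ?thesis by blast
 qed
 then obtain m where m: "!!z. z : S ==> a <= of_int (m z) & of_int (m z) <= b & z = cis (2 * pi * of_int (m z :: int) / real n)"
  by metis
 have "inj_on m S" by (rule inj_onI) (metis m)
 hence "card S = card (m ` S)" by (simp add: card_image)
 also have "... <= card {m::int. a <= m & m <= b}"
  using m by (intro card_mono card_int_interval(3)) auto
 finally have "real (card S) <= max 0 (b - a + 1)" using card_int_interval(1)[of a b] by linarith
 moreover have "b - a = real n * e * (4 / (2 * pi))" by (simp add: a_def b_def field_simps)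
 moreover have "real n * e * (4 / (2 * pi)) <= real n * e * 1"
  using e pi_gt3 by (intro mult_left_mono) auto
 moreover have "0 <= real n * e" using e by simp
 ultimately show ?thesis by (simp add: S_def)
qed

text \<open>Angles between e/2 and e give chords between e/4 and e. This interval of length e/2
  contains at least n e / (4 pi) - 1 angles, and the hypothesis absorbs the 1 into half of the main
  term. The inner radius later keeps the eigenvalues away from 0.\<close>

lemma card_unity_roots_annulus_ge:
 assumes w: "cmod w = 1" and e: "0 < e" "e <= 1" and n: "real n * e >= 8 * pi"
 shows "real n * e / (8 * pi) <= real (card {z : unity_roots n. e / 4 <= cmod (z - w) & cmod (z - w) <= e})"
proof -
 define t where "t = Arg w"
 have wt: "w = cis t" unfolding t_def by (rule unit_eq_cis[OF w])
 have n0: "n > 0" using n e pi_gt_zero by (intro gr0I) auto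
 define a where "a = real n * (t + e / 2) / (2 * pi)"
 define b where "b = real n * (t + e) / (2 * pi)"
 define S where "S = {z : unity_roots n. e / 4 <= cmod (z - w) & cmod (z - w) <= e}"
 define f where "f m = cis (2 * pi * of_int m / real n)" for m :: int
 let ?I = "{m::int. a <= m & m <= b}"
 have ang: "e / 2 <= 2 * pi * of_int m / real n - t & 2 * pi * of_int m / real n - t <= e" if "m : ?I" for m
 proof -
  have "real n * (t + e / 2) <= 2 * pi * m" "2 * pi * m <= real n * (t + e)"
   using that by (auto simp: a_def b_def field_simps)
  hence "t + e / 2 <= 2 * pi * m / real n" "2 * pi * m / real n <= t + e"
   using n0 by (simp_all add: pos_le_divide_eq pos_divide_le_eq mult.commute)
  thus ?thesis by simp
 qed
 have fS: "f m : S" if "m : ?I" for m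
 proof -
  define p where "p = 2 * pi * of_int m / real n - t"
  have p: "e / 2 <= p" "p <= e" using ang[OF that] by (auto simp: p_def)
  have c: "cmod (f m - w) = cmod (cis p - 1)" by (simp add: f_def wt cmod_cis_diff p_def)
  have "\<bar>p\<bar> <= pi" using p e pi_gt3 by auto
  thus ?thesis
   using p e chord_le[of p] chord_ge[of p] cis_unity_root[OF n0, of m] unfolding S_def f_def[symmetric]
   by (auto simp: c)
 qed
 have "inj_on f ?I"
 proof (rule inj_onI)
  fix m k assume mk: "m : ?I" "k : ?I" "f m = f k"
  define p where "p = 2 * pi * of_int m / real n - 2 * pi * of_int k / real n"
  have "\<bar>p\<bar> <= e" unfolding p_def abs_le_iff using ang[OF mk(1)] ang[OF mk(2)] e by linarith
  hence "\<bar>p\<bar> <= pi" using e pi_gt3 by linarith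
  hence "\<bar>p\<bar> / 2 <= cmod (f m - f k)"
   unfolding f_def cmod_cis_diff p_def by (rule chord_ge)
  hence "p = 0" using mk(3) by simp
  thus "m = k" using n0 by (simp add: p_def field_simps)
 qed
 hence "card ?I = card (f ` ?I)" by (simp add: card_image)
 also have "... <= card S"
  using finite_unity_roots[OF n0] fS by (intro card_mono) (auto simp: S_def)
 finally have "b - a - 1 <= real (card S)" using card_int_interval(2)[of b a] by linarith
 moreover have "b - a = 2 * (real n * e / (8 * pi))" by (simp add: a_def b_def field_simps)
 moreover have "1 <= real n * e / (8 * pi)" using n by (simp add: pos_le_divide_eq)
 ultimately have "real n * e / (8 * pi) <= real (card S)" by linarith
 thus ?thesis by (simp add: S_def)
qed

definition smallest_positive :: "(complex => real list) => nat => real" where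
 "smallest_positive ev n = Min {a. 0 < a & (\<exists>z\<in>unity_roots n. a : set (ev z))}"

definition root_average :: "(complex => real list) => (real => real) => nat => real" where
 "root_average ev f n = (\<Sum>z\<in>unity_roots n. \<Sum>a\<leftarrow>ev z. f a) / real n"

text \<open>\<open>x\<close> stands for an eigenvalue of H, the square of a singular value.\<close>

definition decay_rate :: "real => nat => real" where
 "decay_rate x n = - ln (sqrt x) / ln (real n)"

locale circle_spectrum = circle_quotient +
 fixes N :: nat and ev :: "complex => real list"
 assumes ev_len: "cmod z = 1 ==> length (ev z) = N"
  and ev_nonneg: "cmod z = 1 ==> a : set (ev z) ==> 0 <= a"
  and ev_ge: "cmod z = 1 ==> poly P z ~= 0 ==> a : set (ev z) ==> a ~= 0 ==> q z <= a"
  and ev_le: "cmod z = 1 ==> poly P z ~= 0 ==> \<exists>a\<in>set (ev z). a ~= 0 & a <= real N * q z"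
begin

abbreviation pos_spec :: "nat => real set" where
 "pos_spec n \<equiv> {a. 0 < a & (\<exists>z\<in>unity_roots n. a : set (ev z))}"

lemma finite_pos_spec: "n > 0 ==> finite (pos_spec n)"
 by (rule finite_subset[of _ "\<Union>z\<in>unity_roots n. set (ev z)"]) (auto simp: finite_unity_roots)

lemma N_pos: "N > 0"
 using circle_not_root ev_le ev_len by fastforce

lemma pos_spec_member:
 assumes "z : unity_roots n" "n > 0" "poly P z ~= 0"
 obtains a where "a : pos_spec n" "a <= real N * q z"
proof -
 have z: "cmod z = 1" using unity_roots_norm assms by auto
 obtain a where a: "a : set (ev z)" "a ~= 0" "a <= real N * q z" using ev_le[OF z assms(3)] by auto
 moreover have "0 <= a" using ev_nonneg[OF z a(1)] .
 ultimately show ?thesis using that[of a] assms by force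
qed

lemma smallest_positive_le: "a : pos_spec n ==> n > 0 ==> smallest_positive ev n <= a"
 unfolding smallest_positive_def by (intro Min_le finite_pos_spec)

text \<open>There are \<open>n\<close> roots of unity, and only \<open>card Z\<close> points of the
  circle are zeros of \<open>P\<close>.\<close>

lemma pos_spec_nonempty: "n > card Z ==> pos_spec n ~= {}"
proof -
 assume n: "n > card Z"
 hence n0: "n > 0" by simp
 have "card (unity_roots n) = n" unfolding unity_roots_def by (rule card_roots_unity_eq[OF n0])
 hence "\<not> unity_roots n \<subseteq> Z" using n card_mono[OF finite_Z, of "unity_roots n"] by auto
 then obtain z where z: "z : unity_roots n" "z ~: Z" by auto
 hence "poly P z ~= 0" using unity_roots_norm[OF z(1) n0] by (simp add: Z_def)
 then obtain a where "a : pos_spec n" "a <= real N * q z"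
  by (rule pos_spec_member[OF z(1) n0])
 thus ?thesis by blast
qed

lemma smallest_positive_in: "n > card Z ==> smallest_positive ev n : pos_spec n"
 unfolding smallest_positive_def by (rule Min_in[OF finite_pos_spec pos_spec_nonempty]) auto

lemma smallest_positive_upper:
 obtains C where "C > 0" "\<forall>\<^sub>F n in sequentially. smallest_positive ev n <= C / real n ^ kappa"
proof -
 obtain w d c C where w: "cmod w = 1" "d > 0" "c > 0" "C > 0"
  "!!z. dist z w < d ==> z ~= w ==> poly P z ~= 0"
  "!!z. dist z w < d ==> z ~= w ==> cmod z = 1 ==> c * cmod (z - w) ^ kappa <= q z"
  "!!z. dist z w < d ==> z ~= w ==> cmod z = 1 ==> q z <= C * cmod (z - w) ^ kappa"
  using q_near_worst_point by metis
 define C' where "C' = real N * (C * (8 * pi) ^ kappa)"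
 have C': "C' > 0" using N_pos w(4) by (simp add: C'_def)
 have "(%n. 8 * pi / real n) \<longlonglongrightarrow> 0" by real_asymp
 hence "\<forall>\<^sub>F n in sequentially. 8 * pi / real n < min d 1" using w(2) by (intro order_tendstoD) auto
 hence "\<forall>\<^sub>F n in sequentially. smallest_positive ev n <= C' / real n ^ kappa"
  using eventually_gt_at_top[of 0]
 proof eventually_elim
  case (elim n)
  \<comment> \<open>The smallest radius for which the annulus count guarantees a root of unity; the
    inner radius makes this root different from \<open>w\<close>.\<close>
  let ?e = "8 * pi / real n" and ?A = "%e. {z : unity_roots n. e / 4 <= cmod (z - w) & cmod (z - w) <= e}"
  have e: "0 < ?e" "?e <= 1" "real n * ?e = 8 * pi" using elim by auto
  have "1 <= real (card (?A ?e))" using card_unity_roots_annulus_ge[OF w(1) e(1,2), of n] unfolding e(3) by simp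
  hence "?A ?e ~= {}" by (metis card.empty not_one_le_zero of_nat_0 of_nat_1 of_nat_le_iff)
  then obtain z where z: "z : unity_roots n" "cmod (z - w) <= ?e" "?e / 4 <= cmod (z - w)" by blast
  have zw: "z ~= w" using z(3) e(1) by auto
  have zd: "dist z w < d" using z(2) elim(1) by (simp add: dist_norm)
  have z1: "cmod z = 1" using unity_roots_norm[OF z(1) elim(2)] .
  obtain a where a: "a : pos_spec n" "a <= real N * q z"
   by (rule pos_spec_member[OF z(1) elim(2) w(5)[OF zd zw]])
  have "q z <= C * cmod (z - w) ^ kappa" by (rule w(7)[OF zd zw z1])
  also have "... <= C * ?e ^ kappa"
   using z(2) w(4) by (intro mult_left_mono power_mono) auto
  finally have "a <= real N * (C * ?e ^ kappa)"
   using a(2) by (meson mult_left_mono of_nat_0_le_iff order_trans)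
  also have "... = C' / real n ^ kappa" by (simp add: C'_def power_divide)
  finally show ?case using smallest_positive_le[OF a(1) elim(2)] by simp
 qed
 thus ?thesis using that C' by blast
qed

text \<open>At the zeros of \<open>P\<close> the quotient \<open>q\<close> says nothing, but these
  are finitely many points with finitely many positive eigenvalues, which get a constant bound.
  Elsewhere \<open>q\<close> bounds the eigenvalues from below, which gives the alternative with
  \<open>z ~: Z\<close>.\<close>

lemma positive_eigenvalue_lower_bound:
 obtains c where "c > 0" "!!z a. cmod z = 1 ==> a : set (ev z) ==> 0 < a ==> c <= a \<or> (z ~: Z & (\<exists>w\<in>Z. c * cmod (z - w) ^ kappa <= a))"
proof -
 obtain c where c: "c > 0" "!!z. cmod z = 1 ==> poly P z ~= 0 ==> c <= q z \<or> (\<exists>w\<in>Z. c * cmod (z - w) ^ kappa <= q z)"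
  using q_lower_bound by metis
 define A where "A = {a : (\<Union>z\<in>Z. set (ev z)). 0 < a}"
 have A: "finite A" using finite_Z by (simp add: A_def)
 define c' where "c' = Min (insert c A)"
 have c': "c' > 0" "c' <= c" "!!a. a : A ==> c' <= a"
 proof -
  show "c' > 0" using A c(1) by (auto simp: c'_def A_def)
  show "c' <= c" using A by (simp add: c'_def)
  show "c' <= a" if "a : A" for a using A that by (simp add: c'_def)
 qed
 show ?thesis
 proof (rule that[OF c'(1)])
  fix z a assume z: "cmod z = 1" and a: "a : set (ev z)" "0 < a"
  show "c' <= a \<or> (z ~: Z & (\<exists>w\<in>Z. c' * cmod (z - w) ^ kappa <= a))"
  proof (cases "z : Z")
   case True
   hence "a : A" using a by (auto simp: A_def)
   thus ?thesis using c'(3) by simp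
  next
   case False
   hence Pz: "poly P z ~= 0" using z by (simp add: Z_def)
   have qa: "q z <= a" using ev_ge[OF z Pz a(1)] a(2) by simp
   from c(2)[OF z Pz] show ?thesis
   proof
    assume "c <= q z" thus ?thesis using qa c'(2) by simp
   next
    assume "\<exists>w\<in>Z. c * cmod (z - w) ^ kappa <= q z"
    then obtain w where w: "w : Z" "c * cmod (z - w) ^ kappa <= q z" by blast
    have "c' * cmod (z - w) ^ kappa <= c * cmod (z - w) ^ kappa" using c'(2) by (intro mult_right_mono) auto
    hence "c' * cmod (z - w) ^ kappa <= a" using w(2) qa by simp
    thus ?thesis using w(1) False by blast
   qed
  qed
 qed
qed

definition gap :: real where
 "gap = (SOME c. c > 0 & (\<forall>z a. cmod z = 1 --> a : set (ev z) --> 0 < a -->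
   c <= a \<or> (z ~: Z & (\<exists>w\<in>Z. c * cmod (z - w) ^ kappa <= a))))"

lemma gap: "gap > 0"
 "cmod z = 1 ==> a : set (ev z) ==> 0 < a ==> gap <= a \<or> (z ~: Z & (\<exists>w\<in>Z. gap * cmod (z - w) ^ kappa <= a))"
proof -
 have "gap > 0 & (\<forall>z a. cmod z = 1 --> a : set (ev z) --> 0 < a -->
   gap <= a \<or> (z ~: Z & (\<exists>w\<in>Z. gap * cmod (z - w) ^ kappa <= a)))"
  unfolding gap_def by (rule someI_ex) (use positive_eigenvalue_lower_bound in metis)
 thus "gap > 0" "cmod z = 1 ==> a : set (ev z) ==> 0 < a ==> gap <= a \<or> (z ~: Z & (\<exists>w\<in>Z. gap * cmod (z - w) ^ kappa <= a))"
  by blast+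
qed

text \<open>Roots of unity that are themselves zeros of \<open>P\<close> are harmless by the
  constant \<open>gap\<close>; all others differ from every zero, for suitable \<open>n\<close> by
  at least d / n.\<close>

lemma smallest_positive_lower_frequently:
 obtains c where "c > 0" "!!N0. \<exists>n\<ge>N0. n > card Z & c / real n ^ kappa <= smallest_positive ev n"
proof -
 have Z1: "!!w. w : Z ==> cmod w = 1" by (simp add: Z_def)
 obtain d where d: "d > 0" "!!N0. \<exists>n\<ge>N0. \<forall>z w. z ^ n = 1 --> w : Z --> z ~= w --> d / real n <= cmod (z - w)"
  using roots_of_unity_avoid_finite_set[OF finite_Z Z1] by metis
 define e where "e = min gap (gap * d ^ kappa)"
 have e: "e > 0" using gap(1) d(1) by (simp add: e_def)
 show ?thesis
 proof (rule that[OF e])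
  fix N0
  obtain n where n: "n >= max N0 (Suc (card Z))" "\<forall>z w. z ^ n = 1 --> w : Z --> z ~= w --> d / real n <= cmod (z - w)"
   using d(2) by blast
  hence nZ: "n > card Z" and n0: "n > 0" and n1: "real n >= 1" by auto
  have pw: "real n ^ kappa >= 1" using n1 by simp
  obtain z where z: "z : unity_roots n" "smallest_positive ev n : set (ev z)" "0 < smallest_positive ev n"
   using smallest_positive_in[OF nZ] by blast
  have z1: "cmod z = 1" using unity_roots_norm[OF z(1) n0] .
  from gap(2)[OF z1 z(2,3)] have "e / real n ^ kappa <= smallest_positive ev n"
  proof
   assume "gap <= smallest_positive ev n"
   moreover have "e / real n ^ kappa <= e / 1" using pw e n0 by (intro divide_left_mono) auto
   ultimately show ?thesis by (simp add: e_def)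
  next
   assume "z ~: Z & (\<exists>w\<in>Z. gap * cmod (z - w) ^ kappa <= smallest_positive ev n)"
   then obtain w where w: "w : Z" "z ~= w" "gap * cmod (z - w) ^ kappa <= smallest_positive ev n" by auto
   have "d / real n <= cmod (z - w)" using n(2) z(1) w by (auto simp: unity_roots_def)
   hence "gap * (d / real n) ^ kappa <= gap * cmod (z - w) ^ kappa"
    using gap(1) d(1) by (intro mult_left_mono power_mono) auto
   moreover have "gap * (d / real n) ^ kappa = gap * d ^ kappa / real n ^ kappa" by (simp add: power_divide)
   moreover have "e / real n ^ kappa <= gap * d ^ kappa / real n ^ kappa"
    using pw by (intro divide_right_mono) (auto simp: e_def)
   ultimately show ?thesis using w(3) by simp
  qed
  thus "\<exists>n\<ge>N0. n > card Z & e / real n ^ kappa <= smallest_positive ev n" using n nZ by auto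
 qed
qed

lemma smallest_positive_lower_kappa_0:
 assumes "kappa = 0" and n: "n > card Z"
 shows "gap <= smallest_positive ev n"
proof -
 obtain z where z: "z : unity_roots n" "smallest_positive ev n : set (ev z)" "0 < smallest_positive ev n"
  using smallest_positive_in[OF n] by blast
 show ?thesis using gap(2)[OF unity_roots_norm[OF z(1)] z(2,3)] assms by auto
qed

lemma decay_rate_antimono: "0 < x ==> x <= y ==> n >= 2 ==> decay_rate y n <= decay_rate x n"
 unfolding decay_rate_def by (intro divide_right_mono) auto

lemma decay_rate_eq:
 assumes "C > 0" "n >= 2"
 shows "decay_rate (C / real n ^ k) n = real k / 2 - ln C / (2 * ln (real n))"
proof -
 have "ln (real n) > 0" using assms by simp
 thus ?thesis using assms by (simp add: decay_rate_def ln_sqrt ln_div ln_realpow field_simps)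
qed

lemma decay_rate_ge: "0 < x ==> x <= C / real n ^ k ==> C > 0 ==> n >= 2 ==> real k / 2 - ln C / (2 * ln (real n)) <= decay_rate x n"
 using decay_rate_antimono decay_rate_eq by metis

lemma decay_rate_le: "c / real n ^ k <= x ==> c > 0 ==> n >= 2 ==> decay_rate x n <= real k / 2 - ln c / (2 * ln (real n))"
 using decay_rate_antimono[of "c / real n ^ k" x n] decay_rate_eq[of c n k] by simp

lemma correction_tendsto: "(%n. real k / 2 - C / (2 * ln (real n))) \<longlonglongrightarrow> real k / 2"
 by real_asymp

theorem liminf_decay_rate:
 "liminf (%n. ereal (decay_rate (smallest_positive ev n) n)) = ereal (real kappa / 2)"
proof (rule antisym)
 let ?r = "%n. ereal (decay_rate (smallest_positive ev n) n)"
 obtain C where C: "C > 0" "\<forall>\<^sub>F n in sequentially. smallest_positive ev n <= C / real n ^ kappa"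
  by (rule smallest_positive_upper)
 have "\<forall>\<^sub>F n in sequentially. ereal (real kappa / 2 - ln C / (2 * ln (real n))) <= ?r n"
  using C(2) eventually_gt_at_top[of "card Z"] eventually_ge_at_top[of 2]
 proof eventually_elim
  case (elim n)
  thus ?case using decay_rate_ge[OF _ elim(1) C(1) elim(3)] smallest_positive_in[OF elim(2)] by simp
 qed
 hence "liminf (%n. ereal (real kappa / 2 - ln C / (2 * ln (real n)))) <= liminf ?r"
  by (rule Liminf_mono)
 moreover have "liminf (%n. ereal (real kappa / 2 - ln C / (2 * ln (real n)))) = ereal (real kappa / 2)"
  by (rule lim_imp_Liminf) (use correction_tendsto in \<open>simp_all add: tendsto_ereal\<close>)
 ultimately show "ereal (real kappa / 2) <= liminf ?r" by simp
 obtain c where c: "c > 0" "!!N0. \<exists>n\<ge>N0. n > card Z & c / real n ^ kappa <= smallest_positive ev n"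
  using smallest_positive_lower_frequently by metis
 show "liminf ?r <= ereal (real kappa / 2)"
 proof (rule ereal_le_epsilon2)
  fix e :: real assume e: "e > 0"
  have "\<forall>\<^sub>F n in sequentially. real kappa / 2 - ln c / (2 * ln (real n)) < real kappa / 2 + e"
   using e by (intro order_tendstoD(2)[OF correction_tendsto]) simp
  then obtain N1 where N1: "!!n. n >= N1 ==> real kappa / 2 - ln c / (2 * ln (real n)) < real kappa / 2 + e"
   by (auto simp: eventually_sequentially)
  have "\<exists>n\<ge>N0. ?r n <= ereal (real kappa / 2 + e)" for N0
  proof -
   obtain n where n: "n >= max (max N0 2) N1" "c / real n ^ kappa <= smallest_positive ev n" using c(2) by blast
   hence "decay_rate (smallest_positive ev n) n <= real kappa / 2 - ln c / (2 * ln (real n))"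
    using c(1) by (intro decay_rate_le) auto
   thus ?thesis using N1[of n] n(1) by (intro exI[of _ n]) auto
  qed
  hence "\<not> (\<forall>\<^sub>F n in sequentially. ereal (real kappa / 2 + e) < ?r n)"
   unfolding eventually_sequentially by (meson not_le)
  hence "\<not> ereal (real kappa / 2 + e) < liminf ?r"
   using less_LiminfD by blast
  thus "liminf ?r <= ereal (real kappa / 2) + ereal e" by simp
 qed
qed

text \<open>For \<open>kappa = 0\<close> the lower bound \<open>gap\<close> holds for every large
  \<open>n\<close>, not just along a sequence of good ones, so the upper limit is controlled
  too.\<close>

theorem decay_rate_tendsto_0:
 assumes "kappa = 0"
 shows "(%n. decay_rate (smallest_positive ev n) n) \<longlonglongrightarrow> 0"
proof -
 obtain C where C: "C > 0" "\<forall>\<^sub>F n in sequentially. smallest_positive ev n <= C / real n ^ kappa"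
  by (rule smallest_positive_upper)
 show ?thesis
 proof (rule tendsto_sandwich)
  show "\<forall>\<^sub>F n in sequentially. real kappa / 2 - ln C / (2 * ln (real n)) <= decay_rate (smallest_positive ev n) n"
   using C(2) eventually_gt_at_top[of "card Z"] eventually_ge_at_top[of 2]
  proof eventually_elim
   case (elim n)
   thus ?case using decay_rate_ge[OF _ elim(1) C(1) elim(3)] smallest_positive_in[OF elim(2)] by simp
  qed
  show "\<forall>\<^sub>F n in sequentially. decay_rate (smallest_positive ev n) n <= real kappa / 2 - ln gap / (2 * ln (real n))"
   using eventually_gt_at_top[of "card Z"] eventually_ge_at_top[of 2]
  proof eventually_elim
   case (elim n)
   thus ?case using gap(1) smallest_positive_lower_kappa_0 assms by (intro decay_rate_le) auto
  qed
  show "(%n. real kappa / 2 - ln C / (2 * ln (real n))) \<longlonglongrightarrow> 0"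
   "(%n. real kappa / 2 - ln gap / (2 * ln (real n))) \<longlonglongrightarrow> 0"
   using correction_tendsto[of kappa] assms by auto
 qed
qed

end

section \<open>From averages over roots of unity to the Novikov-Shubin number\<close>

lemma root_average_diff:
 "root_average ev (%a. f a - g a) n = root_average ev f n - root_average ev g n"
proof -
 have "(\<Sum>a\<leftarrow>l. f a - g a) = (\<Sum>a\<leftarrow>l. f a) - (\<Sum>a\<leftarrow>l. g a)" for l :: "real list"
  by (induction l) auto
 thus ?thesis by (simp add: root_average_def sum_subtractf diff_divide_distrib)
qed

lemma root_average_mono:
 assumes "!!z a. z : unity_roots n ==> a : set (ev z) ==> f a <= g a"
 shows "root_average ev f n <= root_average ev g n"
 unfolding root_average_def
 by (intro divide_right_mono sum_mono sum_list_mono) (use assms in auto)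

text \<open>On the logarithmic scale a constant contributes ln C / ln l, which tends to 0. Division
  by the negative number ln l exchanges the two bounds.\<close>

lemma novikov_shubin_power_law:
 assumes "c > 0" "p > 0" "d > 0" and mono: "!!s t. 0 <= s ==> s <= t ==> F s <= F t"
  and lower: "!!l. 0 < l ==> l < d ==> c * l powr p <= F l - F 0"
  and upper: "!!l. 0 < l ==> l < d ==> F l - F 0 <= C * l powr p"
 shows "novikov_shubin F = NS_val (ereal p)"
proof -
 have "C > 0"
 proof -
  have "0 < c * (d/2) powr p" using assms by simp
  also have "... <= F (d/2) - F 0" using assms(3) by (intro lower) auto
  also have "... <= C * (d/2) powr p" using assms(3) by (intro upper) auto
  finally show ?thesis by (simp add: zero_less_mult_iff)
 qed
 have pos: "F l > F 0" if "l > 0" for l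
 proof -
  define m where "m = min l (d/2)"
  have m: "0 < m" "m < d" "m <= l" using that assms(3) by (auto simp: m_def)
  have "0 < c * m powr p" using assms(1) m by simp
  hence "F 0 < F m" using lower[OF m(1,2)] by linarith
  also have "... <= F l" using mono m by simp
  finally show ?thesis .
 qed
 have "((%l. ln (F l - F 0) / ln l) \<longlongrightarrow> p) (at_right 0)"
 proof (rule tendsto_sandwich)
  have *: "\<forall>\<^sub>F l in at_right 0. 0 < l & l < min d 1"
   using assms(3) by (intro eventually_at_rightI[of 0 "min d 1"]) auto
  show "\<forall>\<^sub>F l in at_right 0. p + ln C / ln l <= ln (F l - F 0) / ln l"
   using *
  proof eventually_elim
   case (elim l)
   have l: "ln l < 0" using elim by simp
   have "ln (F l - F 0) <= ln (C * l powr p)"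
    using upper[of l] pos[of l] elim by (intro ln_mono) auto
   also have "... = ln C + p * ln l" using \<open>C > 0\<close> elim by (simp add: ln_mult ln_powr)
   finally have "(ln C + p * ln l) / ln l <= ln (F l - F 0) / ln l"
    using l by (intro divide_right_mono_neg) auto
   thus ?case using l by (simp add: add_divide_distrib add.commute)
  qed
  show "\<forall>\<^sub>F l in at_right 0. ln (F l - F 0) / ln l <= p + ln c / ln l"
   using *
  proof eventually_elim
   case (elim l)
   have l: "ln l < 0" using elim by simp
   have "0 < c * l powr p" using assms(1) elim by simp
   hence "ln (c * l powr p) <= ln (F l - F 0)"
    using lower[of l] elim by (intro ln_mono) auto
   moreover have "ln (c * l powr p) = ln c + p * ln l" using \<open>c > 0\<close> elim by (simp add: ln_mult ln_powr)
   ultimately have "ln (F l - F 0) / ln l <= (ln c + p * ln l) / ln l"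
    using l by (intro divide_right_mono_neg) auto
   thus ?case using l by (simp add: add_divide_distrib add.commute)
  qed
  have "((%l. p + x / ln l) \<longlongrightarrow> p) (at_right 0)" for x :: real by real_asymp
  thus "((%l. p + ln C / ln l) \<longlongrightarrow> p) (at_right 0)" "((%l. p + ln c / ln l) \<longlongrightarrow> p) (at_right 0)"
   by blast+
 qed
 hence "((%l. ereal (ln (F l - F 0) / ln l)) \<longlongrightarrow> ereal p) (at_right 0)"
  by (rule tendsto_ereal)
 hence "Liminf (at_right 0) (%l. ereal (ln (F l - F 0) / ln l)) = ereal p"
  by (intro lim_imp_Liminf) auto
 thus ?thesis using pos by (simp add: novikov_shubin_def)
qed

text \<open>\<open>tau s k\<close> will be the trace of a ramp of the Gram operator on the infinite
  cover and \<open>F s\<close> the trace of its spectral projection. Both are accessible through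
  averages over roots of unity.\<close>

locale circle_density = circle_spectrum +
 fixes tau :: "real => nat => real" and F :: "real => real"
 assumes tau: "(%n. root_average ev (ramp s k) n) \<longlonglongrightarrow> tau s k"
  and F: "(%k. tau s k) \<longlonglongrightarrow> F s"
begin

lemma F_mono: "s <= t ==> F s <= F t"
proof -
 assume st: "s <= t"
 have "root_average ev (ramp s k) n <= root_average ev (ramp t k) n" for k n
  by (intro root_average_mono ramp_mono st order_refl)
 hence "tau s k <= tau t k" for k
  by (intro LIMSEQ_le[OF tau tau]) auto
 thus ?thesis by (intro LIMSEQ_le[OF F F]) auto
qed

text \<open>Subtracting the ramp at 0 cancels the zero eigenvalues, just as \<open>F s - F 0\<close>
  discards the kernel.\<close>

abbreviation bump :: "real => nat => real => real" where
 "bump s k a \<equiv> ramp s k a - ramp 0 k a"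

lemma tau_diff: "(%n. root_average ev (bump s k) n) \<longlonglongrightarrow> tau s k - tau 0 k"
 unfolding root_average_diff by (intro tendsto_diff tau)

lemma F_diff: "(%k. tau s k - tau 0 k) \<longlonglongrightarrow> F s - F 0"
 by (intro tendsto_diff F)

lemma bump_le: "bump s k a <= 1"
 using ramp_le_1[of s k a] ramp_nonneg[of 0 k a] by linarith

lemma bump_nonneg: "0 <= s ==> 0 <= bump s k a"
 using ramp_mono[of k k 0 s a] by simp

lemma ramp_nonpos_eq_1: "0 <= s ==> a <= 0 ==> ramp s k a = 1"
proof -
 assume "0 <= s" "a <= 0"
 hence "a <= s" by simp
 moreover have "s <= s + 1 / 2 ^ Suc k" by simp
 ultimately show ?thesis by (intro ramp_eq_1) linarith
qed

lemma sum_bump_le: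
 assumes n: "n > 0" and s: "0 <= s"
  and S: "!!z a. z : unity_roots n ==> a : set (ev z) ==> 0 < a ==> a < s + 1 / 2 ^ k ==> z : S"
  and finS: "finite S" and cardS: "real (card S) <= x"
 shows "root_average ev (bump s k) n <= real N * x / real n"
proof -
 have "(\<Sum>a\<leftarrow>ev z. bump s k a) <= (if z : S then real N else 0)" if z: "z : unity_roots n" for z
 proof (cases "z : S")
  case True
  have "(\<Sum>a\<leftarrow>ev z. bump s k a) <= (\<Sum>a\<leftarrow>ev z. 1)"
   by (intro sum_list_mono bump_le)
  also have "... = real N" using ev_len[OF unity_roots_norm[OF z n]] by (simp add: sum_list_triv)
  finally show ?thesis using True by simp
 next
  case False
  have "bump s k a = 0" if a: "a : set (ev z)" for a
  proof (cases "a = 0")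
   case True
   thus ?thesis using ramp_nonpos_eq_1[of s a k] ramp_nonpos_eq_1[of 0 a k] s by simp
  next
   case False
   hence "0 < a" using ev_nonneg[OF unity_roots_norm[OF z n] a] by simp
   hence "s + 1 / 2 ^ k <= a" using S[OF z a] \<open>z ~: S\<close> by force
   hence "ramp s k a = 0" "ramp 0 k a = 0" using s by (auto intro!: ramp_eq_0)
   thus ?thesis by simp
  qed
  hence "(\<Sum>a\<leftarrow>ev z. bump s k a) <= (\<Sum>a\<leftarrow>ev z. 0)" by (intro sum_list_mono) auto
  thus ?thesis using False by simp
 qed
 hence "(\<Sum>z\<in>unity_roots n. \<Sum>a\<leftarrow>ev z. bump s k a) <= (\<Sum>z\<in>unity_roots n. if z : S then real N else 0)"
  by (rule sum_mono)
 also have "... = (\<Sum>z\<in>unity_roots n \<inter> S. real N)"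
  by (rule sum.inter_restrict[OF finite_unity_roots[OF n], symmetric])
 also have "... <= real N * real (card S)"
  using card_mono[OF finS, of "unity_roots n \<inter> S"] by (simp add: mult.commute mult_left_mono)
 also have "... <= real N * x" using cardS by (intro mult_left_mono) auto
 finally show ?thesis unfolding root_average_def by (intro divide_right_mono) auto
qed

text \<open>The limit in \<open>n\<close> is taken before the one in \<open>k\<close>: the estimate
  is asked for all ramps narrower than \<open>d\<close>, with a bound \<open>B\<close> that is the
  same for all of them.\<close>

lemma F_diff_le:
 fixes d :: real
 assumes d: "d > 0" and B: "!!k n. (1/2) ^ k < d ==> n > 0 ==> root_average ev (bump s k) n <= B n" and x: "B \<longlonglongrightarrow> x"
 shows "F s - F 0 <= x"
proof (rule tendsto_upperbound[OF F_diff])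
 have "\<forall>\<^sub>F k in sequentially. (1/2::real) ^ k < d"
  using d by (intro order_tendstoD(2)[OF LIMSEQ_realpow_zero]) auto
 thus "\<forall>\<^sub>F k in sequentially. tau s k - tau 0 k <= x"
 proof eventually_elim
  case (elim k)
  show ?case
   by (rule tendsto_le[OF _ x tau_diff]) (auto intro!: eventually_mono[OF eventually_gt_at_top[of 0]] B[OF elim])
 qed
qed simp

lemma F_diff_ge:
 fixes d :: real
 assumes d: "d > 0" and B: "!!k n. (1/2) ^ k < d ==> n > n0 ==> x <= root_average ev (bump s k) n"
 shows "x <= F s - F 0"
proof (rule tendsto_lowerbound[OF F_diff])
 have "\<forall>\<^sub>F k in sequentially. (1/2::real) ^ k < d"
  using d by (intro order_tendstoD(2)[OF LIMSEQ_realpow_zero]) auto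
 thus "\<forall>\<^sub>F k in sequentially. x <= tau s k - tau 0 k"
 proof eventually_elim
  case (elim k)
  show ?case
   by (rule tendsto_lowerbound[OF tau_diff]) (auto intro!: eventually_mono[OF eventually_gt_at_top[of n0]] B[OF elim])
 qed
qed simp

lemma novikov_shubin_kappa_0:
 assumes "kappa = 0"
 shows "novikov_shubin (%l. F (l\<^sup>2)) = Infinity_plus"
proof -
 \<comment> \<open>No eigenvalue lies strictly between 0 and \<open>gap\<close>; half of
   \<open>gap\<close> leaves room for the width of the ramp.\<close>
 have "F (gap/2) - F 0 <= 0"
 proof (rule F_diff_le[where B = "%n. real N * 0 / real n"])
  fix k n :: nat assume k: "(1/2) ^ k < gap / 2" and n: "n > 0"
  show "root_average ev (bump (gap/2) k) n <= real N * 0 / real n"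
  proof (rule sum_bump_le[OF n, of _ _ "{}"])
   fix z a assume z: "z : unity_roots n" and a: "a : set (ev z)" "0 < a" "a < gap/2 + 1 / 2 ^ k"
   have "gap <= a" using gap(2)[OF unity_roots_norm[OF z n] a(1,2)] assms by auto
   thus "z : {}" using a(3) k by (simp add: power_one_over)
  qed (use gap(1) in auto)
 qed (use gap(1) in auto)
 moreover have "sqrt (gap/2) > 0" "(sqrt (gap/2))\<^sup>2 = gap/2" using gap(1) by simp_all
 ultimately have "\<exists>l>0. F (l\<^sup>2) <= F 0" by (intro exI[of _ "sqrt (gap/2)"]) simp
 hence "\<not> (\<forall>l>0. F (l\<^sup>2) > F (0\<^sup>2))" by (simp add: not_less)
 thus ?thesis unfolding novikov_shubin_def by (simp only: if_False)
qed

lemma F_upper_bound: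
 assumes "kappa > 0"
 obtains C d where "d > 0" "!!s. 0 < s ==> s < d ==> F s - F 0 <= C * s powr (1 / real kappa)"
proof -
 define C where "C = real N * real (card Z) * (2 / gap) powr (1 / real kappa)"
 show ?thesis
 proof (rule that[of "gap / 2" C])
  fix s :: real assume s: "0 < s" "s < gap / 2"
  \<comment> \<open>A ramp narrower than \<open>s\<close> sees only eigenvalues below 2s, and these
    force a zero of \<open>P\<close> within distance \<open>e\<close>, since gap e^kappa =
    2s.\<close>
  define e where "e = (2 / gap * s) powr (1 / real kappa)"
  have e: "e > 0" using s gap(1) by (simp add: e_def)
  have e_pow: "e ^ kappa = 2 / gap * s"
   using s gap(1) assms by (simp add: e_def powr_powr powr_realpow[symmetric])
  have "F s - F 0 <= real N * real (card Z) * (e + 0)"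
  proof (rule F_diff_le[OF s(1)])
   show "(%n. real N * real (card Z) * (e + 1 / real n)) \<longlonglongrightarrow> real N * real (card Z) * (e + 0)"
    by (intro tendsto_intros lim_1_over_n)
   fix k n :: nat assume k: "(1/2) ^ k < s" and n: "n > 0"
   define S where "S = (\<Union>w\<in>Z. {z : unity_roots n. cmod (z - w) <= e})"
   have "root_average ev (bump s k) n <= real N * (real (card Z) * (real n * e + 1)) / real n"
   proof (rule sum_bump_le[OF n, of _ _ S])
    fix z a assume z: "z : unity_roots n" and a: "a : set (ev z)" "0 < a" "a < s + 1 / 2 ^ k"
    have a2: "a < 2 * s" using a(3) k by (simp add: power_one_over)
    obtain w where w: "w : Z" "gap * cmod (z - w) ^ kappa <= a"
     using gap(2)[OF unity_roots_norm[OF z n] a(1,2)] a2 s by auto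
    have "cmod (z - w) ^ kappa <= e ^ kappa"
     using w(2) a2 gap(1) by (simp add: e_pow field_simps)
    hence "cmod (z - w) <= e" using e assms power_mono_iff[of "cmod (z - w)" e kappa] by simp
    thus "z : S" using w(1) z by (auto simp: S_def)
   next
    show "finite S" using finite_Z finite_unity_roots[OF n] by (auto simp: S_def)
    have "real (card S) <= (\<Sum>w\<in>Z. real (card {z : unity_roots n. cmod (z - w) <= e}))"
     unfolding S_def of_nat_sum[symmetric] by (intro of_nat_mono card_UN_le finite_Z)
    also have "... <= (\<Sum>w\<in>Z. real n * e + 1)"
     by (intro sum_mono card_unity_roots_near_le) (use n e in \<open>auto simp: Z_def\<close>)
    finally show "real (card S) <= real (card Z) * (real n * e + 1)" by simp
   qed (use s in auto)
   also have "... = real N * real (card Z) * (e + 1 / real n)"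
    using n by (simp add: add_divide_distrib distrib_left)
   finally show "root_average ev (bump s k) n <= real N * real (card Z) * (e + 1 / real n)" .
  qed
  thus "F s - F 0 <= C * s powr (1 / real kappa)" unfolding C_def e_def powr_mult by (simp add: mult.assoc)
 qed (use gap(1) in auto)
qed

lemma F_lower_bound:
 assumes "kappa > 0"
 obtains c d where "c > 0" "d > 0" "!!s. 0 < s ==> s < d ==> c * s powr (1 / real kappa) <= F s - F 0"
proof -
 obtain w d c C where w1: "cmod w = 1" and w: "d > 0" "c > 0" "C > 0"
  "!!z. dist z w < d ==> z ~= w ==> poly P z ~= 0"
  "!!z. dist z w < d ==> z ~= w ==> cmod z = 1 ==> c * cmod (z - w) ^ kappa <= q z"
  "!!z. dist z w < d ==> z ~= w ==> cmod z = 1 ==> q z <= C * cmod (z - w) ^ kappa"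
  using q_near_worst_point by metis
 define D where "D = real N * C"
 have D: "D > 0" using N_pos w(3) by (simp add: D_def)
 define c' where "c' = (1 / D) powr (1 / real kappa) / (8 * pi)"
 define d' where "d' = D * (min (d/2) 1) ^ kappa"
 have "c' > 0" "d' > 0" using D w(1) by (simp_all add: c'_def d'_def)
 thus ?thesis
 proof (rule that)
  fix s :: real assume s: "0 < s" "s < d'"
  \<comment> \<open>Chosen so that N C e^kappa = s: within distance \<open>e\<close> of the worst
    point some positive eigenvalue is at most \<open>s\<close>.\<close>
  define e where "e = (1 / D * s) powr (1 / real kappa)"
  have e: "e > 0" using s D by (simp add: e_def)
  have e_pow: "e ^ kappa = s / D"
   using s D assms by (simp add: e_def powr_powr powr_realpow[symmetric])
  have "e ^ kappa < (min (d/2) 1) ^ kappa"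
   using s D by (simp add: e_pow d'_def pos_divide_less_eq mult.commute)
  hence "e < min (d/2) 1" by (rule power_less_imp_less_base) (use w(1) in auto)
  hence ed: "e < d" "e <= 1" using w(1) by auto
  \<comment> \<open>On the annulus this bounds all positive eigenvalues from below, so a ramp at 0
    of width below \<open>m\<close> does not see them.\<close>
  define m where "m = c * (e / 4) ^ kappa"
  have m: "m > 0" using w(2) e by (simp add: m_def)
  obtain n0 :: nat where n0: "8 * pi / e < real n0" using reals_Archimedean2 by blast
  have "e / (8 * pi) <= F s - F 0"
  proof (rule F_diff_ge[OF m])
   fix k n assume k: "(1/2) ^ k < m" and n: "n > n0"
   have np: "n > 0" using n by simp
   define S where "S = {z : unity_roots n. e / 4 <= cmod (z - w) & cmod (z - w) <= e}"
   have "8 * pi / e <= real n" using n0 n by linarith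
   hence "8 * pi <= real n * e" using e by (simp add: pos_divide_le_eq)
   hence cS: "real n * e / (8 * pi) <= real (card S)"
    unfolding S_def by (rule card_unity_roots_annulus_ge[OF w1 e ed(2)])
   have nonneg: "0 <= bump s k a" for a using s by (intro bump_nonneg) auto
   have "(if z : S then 1 else 0) <= (\<Sum>a\<leftarrow>ev z. bump s k a)" if z: "z : unity_roots n" for z
   proof (cases "z : S")
    case True
    have z1: "cmod z = 1" using unity_roots_norm[OF z np] .
    have zr: "e / 4 <= cmod (z - w)" "cmod (z - w) <= e" using True by (auto simp: S_def)
    hence zd: "dist z w < d" "z ~= w" using ed e by (auto simp: dist_norm)
    note Pz = w(4)[OF zd]
    obtain a where a: "a : set (ev z)" "a ~= 0" "a <= real N * q z" using ev_le[OF z1 Pz] by blast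
    have "m <= c * cmod (z - w) ^ kappa"
     unfolding m_def using zr(1) e w(2) by (intro mult_left_mono power_mono) auto
    also have "... <= q z" by (rule w(5)[OF zd z1])
    also have "... <= a" by (rule ev_ge[OF z1 Pz a(1,2)])
    finally have "ramp 0 k a = 0" using k by (intro ramp_eq_0) (simp add: power_one_over)
    have "q z <= C * cmod (z - w) ^ kappa" by (rule w(6)[OF zd z1])
    also have "... <= C * e ^ kappa" using zr(2) w(3) by (intro mult_left_mono power_mono) auto
    finally have "real N * q z <= real N * (C * e ^ kappa)" by (intro mult_left_mono) auto
    also have "... = s" using D by (simp add: e_pow mult.assoc[symmetric] D_def[symmetric])
    finally have "a <= s" using a(3) by simp
    moreover have "s <= s + 1 / 2 ^ Suc k" by simp
    ultimately have "ramp s k a = 1" by (intro ramp_eq_1) linarith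
    hence "bump s k a = 1" using \<open>ramp 0 k a = 0\<close> by simp
    moreover have "bump s k a <= (\<Sum>a\<leftarrow>ev z. bump s k a)"
     using a(1) nonneg by (intro member_le_sum_list) auto
    ultimately show ?thesis using True by simp
   qed (auto intro!: sum_list_nonneg nonneg)
   hence "(\<Sum>z\<in>unity_roots n. if z : S then 1 else 0) <= (\<Sum>z\<in>unity_roots n. \<Sum>a\<leftarrow>ev z. bump s k a)"
    by (rule sum_mono)
   moreover have "(\<Sum>z\<in>unity_roots n. if z : S then 1 else 0) = real (card S)"
    using finite_unity_roots[OF np] by (simp add: sum.If_cases S_def Int_def conj_commute)
   ultimately have "real n * e / (8 * pi) / real n <= root_average ev (bump s k) n"
    unfolding root_average_def using cS by (intro divide_right_mono) auto
   thus "e / (8 * pi) <= root_average ev (bump s k) n" using np by simp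
  qed
  thus "c' * s powr (1 / real kappa) <= F s - F 0" unfolding c'_def e_def powr_mult by simp
 qed
qed

theorem novikov_shubin_kappa_pos:
 assumes "kappa > 0"
 shows "novikov_shubin (%l. F (l\<^sup>2)) = NS_val (ereal (2 / real kappa))"
proof -
 obtain c d1 where 1: "c > 0" "d1 > 0" "!!s. 0 < s ==> s < d1 ==> c * s powr (1 / real kappa) <= F s - F 0"
  using F_lower_bound[OF assms] by metis
 obtain C d2 where 2: "d2 > 0" "!!s. 0 < s ==> s < d2 ==> F s - F 0 <= C * s powr (1 / real kappa)"
  using F_upper_bound[OF assms] by metis
 define d where "d = sqrt (min d1 d2)"
 have d: "d > 0" using 1 2 by (simp add: d_def)
 have sq: "0 < l\<^sup>2" "l\<^sup>2 < d1" "l\<^sup>2 < d2" "(l\<^sup>2) powr (1 / real kappa) = l powr (2 / real kappa)" if l: "0 < l" "l < d" for l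
 proof -
  have "l\<^sup>2 < d\<^sup>2" using l by (intro power_strict_mono) auto
  also have "d\<^sup>2 = min d1 d2" using 1 2 by (simp add: d_def)
  finally show "l\<^sup>2 < d1" "l\<^sup>2 < d2" by auto
  show "0 < l\<^sup>2" using l by simp
  have "l\<^sup>2 = l powr 2" using l by simp
  thus "(l\<^sup>2) powr (1 / real kappa) = l powr (2 / real kappa)" by (simp only: powr_powr) simp
 qed
 show ?thesis
 proof (rule novikov_shubin_power_law[OF 1(1) _ d])
  show "2 / real kappa > 0" using assms by simp
  show "F (s\<^sup>2) <= F (t\<^sup>2)" if "0 <= s" "s <= t" for s t
   using that by (intro F_mono power_mono) auto
  fix l assume l: "0 < l" "l < d"
  show "c * l powr (2 / real kappa) <= F (l\<^sup>2) - F (0\<^sup>2)"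
   using 1(3)[OF sq(1,2)[OF l]] sq(4)[OF l] by simp
  show "F (l\<^sup>2) - F (0\<^sup>2) <= C * l powr (2 / real kappa)"
   using 2(2)[OF sq(1,3)[OF l]] sq(4)[OF l] by simp
 qed
qed

end

section \<open>Matrices of Laurent polynomials and their symbols\<close>

text \<open>\<open>N\<close> counts the 2-cells, \<open>M\<close> the 1-cells, and
  \<open>d j i k\<close> is the coefficient of the k-th translate of the 1-cell \<open>j\<close> in
  the boundary of the 2-cell \<open>i\<close>; \<open>L\<close> bounds the translates that
  occur.\<close>

locale convolution =
 fixes N M L :: nat and d :: "nat => nat => int => int"
begin

abbreviation S :: "int set" where "S \<equiv> {- int L..int L}"

definition symbol :: "complex => nat => nat => complex" where
 "symbol z j i = (\<Sum>k\<in>S. of_int (d j i k) * z powi (- k))"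

text \<open>\<open>inverse z\<close> replaces the conjugate of \<open>z\<close>, so the entries are
  Laurent polynomials; on the unit circle the matrix is H(z), by \<open>cnj_symbol\<close>.\<close>

definition gram_symbol :: "complex => complex mat" where
 "gram_symbol z = mat N N (%(i, i'). \<Sum>j<M. symbol (inverse z) j i * symbol z j i')"

definition dA :: "(nat => int => complex) => nat => int => complex" where
 "dA u j b = (\<Sum>i<N. \<Sum>k\<in>S. of_int (d j i k) * u i (b - k))"

text \<open>The full Gram operator, adjoint after differential, on sequences without any growth
  condition: finitely supported and periodic sequences are treated by the same formula.\<close>

definition dT :: "(nat => int => complex) => nat => int => complex" where
 "dT u i a = (\<Sum>j<M. \<Sum>k\<in>S. of_int (d j i k) * dA u j (a + k))"

lemma gram_symbol_carrier [simp]: "gram_symbol z : carrier_mat N N"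
 by (simp add: gram_symbol_def)

lemma cnj_symbol:
 assumes "cmod z = 1"
 shows "cnj (symbol z j i) = symbol (inverse z) j i"
proof -
 have "z * cnj z = 1" using assms by (simp add: complex_norm_square[symmetric])
 hence "cnj z = inverse z" by (metis inverse_unique)
 have "cnj (z powi k) = inverse z powi k" for k
  by (cases "k >= 0") (auto simp: power_int_def \<open>cnj z = inverse z\<close>)
 thus ?thesis by (simp add: symbol_def)
qed

lemma gram_symbol_mult_vec:
 assumes "v : carrier_vec N" "i < N"
 shows "(gram_symbol z *\<^sub>v v) $ i = (\<Sum>j<M. symbol (inverse z) j i * (\<Sum>i'<N. symbol z j i' * v $ i'))"
proof -
 have "(gram_symbol z *\<^sub>v v) $ i = (\<Sum>i'<N. (\<Sum>j<M. symbol (inverse z) j i * symbol z j i') * v $ i')"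
  using assms by (simp add: gram_symbol_def scalar_prod_def atLeast0LessThan)
 also have "... = (\<Sum>i'<N. \<Sum>j<M. symbol (inverse z) j i * (symbol z j i' * v $ i'))"
  by (simp add: sum_distrib_right mult.assoc)
 also have "... = (\<Sum>j<M. \<Sum>i'<N. symbol (inverse z) j i * (symbol z j i' * v $ i'))"
  by (rule sum.swap)
 finally show ?thesis by (simp add: sum_distrib_left)
qed

lemma gram_symbol_psd:
 assumes z: "cmod z = 1" and a: "eigenvalue (gram_symbol z) a"
 shows "\<exists>r\<ge>0. a = of_real r"
proof -
 obtain v where v: "v : carrier_vec N" "v ~= 0\<^sub>v N" "gram_symbol z *\<^sub>v v = a \<cdot>\<^sub>v v"
  using a gram_symbol_carrier[of z] unfolding eigenvalue_def eigenvector_def by auto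
 define w where "w j = (\<Sum>i<N. symbol z j i * v $ i)" for j
 have "a * (\<Sum>i<N. v $ i * cnj (v $ i)) = (\<Sum>i<N. (gram_symbol z *\<^sub>v v) $ i * cnj (v $ i))"
  using v by (simp add: sum_distrib_left mult.assoc)
 also have "... = (\<Sum>i<N. (\<Sum>j<M. cnj (symbol z j i) * w j) * cnj (v $ i))"
  using v(1) by (intro sum.cong refl) (simp add: gram_symbol_mult_vec cnj_symbol[OF z] w_def)
 also have "... = (\<Sum>i<N. \<Sum>j<M. w j * (cnj (symbol z j i) * cnj (v $ i)))"
  by (simp add: sum_distrib_right mult_ac sum_distrib_left)
 also have "... = (\<Sum>j<M. \<Sum>i<N. w j * (cnj (symbol z j i) * cnj (v $ i)))"
  by (rule sum.swap)
 also have "... = (\<Sum>j<M. w j * cnj (w j))"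
  by (simp add: w_def sum_distrib_left)
 also have "... = of_real (\<Sum>j<M. (cmod (w j))\<^sup>2)" by (simp only: complex_norm_square of_real_sum)
 finally have eq: "a * of_real (\<Sum>i<N. (cmod (v $ i))\<^sup>2) = of_real (\<Sum>j<M. (cmod (w j))\<^sup>2)"
  by (simp only: complex_norm_square of_real_sum)
 obtain i where i: "i < N" "v $ i ~= 0" using v(1,2) by (auto simp: vec_eq_iff)
 hence "0 < (cmod (v $ i))\<^sup>2" by simp
 also have "... <= (\<Sum>i<N. (cmod (v $ i))\<^sup>2)" using i(1) by (intro member_le_sum) auto
 finally have pos: "0 < (\<Sum>i<N. (cmod (v $ i))\<^sup>2)" .
 have "a = of_real ((\<Sum>j<M. (cmod (w j))\<^sup>2) / (\<Sum>i<N. (cmod (v $ i))\<^sup>2))"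
  unfolding of_real_divide eq[symmetric] using pos
  by (metis less_irrefl nonzero_mult_div_cancel_right of_real_eq_0_iff)
 moreover have "0 <= (\<Sum>j<M. (cmod (w j))\<^sup>2) / (\<Sum>i<N. (cmod (v $ i))\<^sup>2)"
  by (intro divide_nonneg_nonneg sum_nonneg) auto
 ultimately show ?thesis by blast
qed

lemma gram_symbol_spectrum:
 assumes z: "cmod z = 1"
 obtains es :: "real list" where "length es = N"
  "!!m. mat_trace (gram_symbol z ^\<^sub>m m) = of_real (\<Sum>a\<leftarrow>es. a ^ m)"
  "!!c. char_poly (c \<cdot>\<^sub>m gram_symbol z) = (\<Prod>a\<leftarrow>es. [:- (c * of_real a), 1:])"
  "!!x. eigenvalue (gram_symbol z) (of_real x) \<longleftrightarrow> x : set es" "!!a. a : set es ==> 0 <= a"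
proof -
 obtain cs where cs: "length cs = N"
  "!!k. mat_trace (gram_symbol z ^\<^sub>m k) = (\<Sum>a\<leftarrow>cs. a ^ k)"
  "!!c. char_poly (c \<cdot>\<^sub>m gram_symbol z) = (\<Prod>a\<leftarrow>cs. [:- (c * a), 1:])"
  "!!x. eigenvalue (gram_symbol z) x \<longleftrightarrow> x : set cs"
  using eigenvalue_list_exists[OF gram_symbol_carrier] by metis
 define es where "es = map Re cs"
 have re: "of_real (Re c) = c" "0 <= Re c" if "c : set cs" for c
 proof -
  obtain r where "r >= 0" "c = of_real r" using gram_symbol_psd[OF z, of c] cs(4) \<open>c : set cs\<close> by auto
  thus "of_real (Re c) = c" "0 <= Re c" by simp_all
 qed
 hence cs_eq: "cs = map of_real es" by (simp add: es_def o_def map_idI)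
 show ?thesis
 proof (rule that[of es])
  show "length es = N" by (simp add: es_def cs(1))
  show "mat_trace (gram_symbol z ^\<^sub>m m) = of_real (\<Sum>a\<leftarrow>es. a ^ m)" for m
  proof -
   have "(\<Sum>a\<leftarrow>map complex_of_real l. a ^ m) = of_real (\<Sum>a\<leftarrow>l. a ^ m)" for l by (induction l) auto
   thus ?thesis by (simp only: cs(2) cs_eq)
  qed
  show "char_poly (c \<cdot>\<^sub>m gram_symbol z) = (\<Prod>a\<leftarrow>es. [:- (c * of_real a), 1:])" for c
   by (simp add: cs(3) cs_eq o_def)
  show "eigenvalue (gram_symbol z) (of_real x) \<longleftrightarrow> x : set es" for x
   unfolding cs(4) cs_eq by auto
  show "0 <= a" if "a : set es" for a using that re(2) by (auto simp: es_def)
 qed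
qed

definition ev :: "complex => real list" where
 "ev z = (SOME es. length es = N &
   (\<forall>m. mat_trace (gram_symbol z ^\<^sub>m m) = of_real (\<Sum>a\<leftarrow>es. a ^ m)) &
   (\<forall>c. char_poly (c \<cdot>\<^sub>m gram_symbol z) = (\<Prod>a\<leftarrow>es. [:- (c * of_real a), 1:])) &
   (\<forall>x. eigenvalue (gram_symbol z) (of_real x) \<longleftrightarrow> x : set es) & (\<forall>a\<in>set es. 0 <= a))"

lemma ev:
 assumes "cmod z = 1"
 shows "length (ev z) = N" "mat_trace (gram_symbol z ^\<^sub>m m) = of_real (\<Sum>a\<leftarrow>ev z. a ^ m)"
  "char_poly (c \<cdot>\<^sub>m gram_symbol z) = (\<Prod>a\<leftarrow>ev z. [:- (c * of_real a), 1:])"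
  "eigenvalue (gram_symbol z) (of_real x) \<longleftrightarrow> x : set (ev z)" "a : set (ev z) ==> 0 <= a"
proof -
 obtain es :: "real list" where es: "length es = N"
  "!!m. mat_trace (gram_symbol z ^\<^sub>m m) = of_real (\<Sum>a\<leftarrow>es. a ^ m)"
  "!!c. char_poly (c \<cdot>\<^sub>m gram_symbol z) = (\<Prod>a\<leftarrow>es. [:- (c * of_real a), 1:])"
  "!!x. eigenvalue (gram_symbol z) (of_real x) \<longleftrightarrow> x : set es" "!!a. a : set es ==> 0 <= a"
  using gram_symbol_spectrum[OF assms] by metis
 let ?P = "%es. length es = N &
   (\<forall>m. mat_trace (gram_symbol z ^\<^sub>m m) = of_real (\<Sum>a\<leftarrow>es. a ^ m)) &
   (\<forall>c. char_poly (c \<cdot>\<^sub>m gram_symbol z) = (\<Prod>a\<leftarrow>es. [:- (c * of_real a), 1:])) &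
   (\<forall>x. eigenvalue (gram_symbol z) (of_real x) \<longleftrightarrow> x : set es) & (\<forall>a\<in>set es. 0 <= (a::real))"
 have "?P es" using es by blast
 hence "?P (ev z)" unfolding ev_def by (rule someI)
 thus "length (ev z) = N" "mat_trace (gram_symbol z ^\<^sub>m m) = of_real (\<Sum>a\<leftarrow>ev z. a ^ m)"
  "char_poly (c \<cdot>\<^sub>m gram_symbol z) = (\<Prod>a\<leftarrow>ev z. [:- (c * of_real a), 1:])"
  "eigenvalue (gram_symbol z) (of_real x) \<longleftrightarrow> x : set (ev z)" "a : set (ev z) ==> 0 <= a"
  by blast+
qed

text \<open>This single number bounds the entries and the support sizes of the matrices of all
  covers as well as, by its square, the eigenvalues of all symbols. The resulting constants are
  independent of \<open>n\<close>.\<close>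

definition total :: nat where
 "total = (\<Sum>j<M. \<Sum>i<N. \<Sum>k\<in>S. nat \<bar>d j i k\<bar>)"

lemma sum_cmod_symbol_le:
 assumes "cmod z = 1"
 shows "(\<Sum>j<M. \<Sum>i<N. cmod (symbol z j i)) <= real total"
proof -
 have "cmod (symbol z j i) <= (\<Sum>k\<in>S. real (nat \<bar>d j i k\<bar>))" for j i
  unfolding symbol_def
  by (rule order_trans[OF norm_sum]) (simp add: norm_mult norm_power_int assms)
 thus ?thesis unfolding total_def of_nat_sum by (intro sum_mono)
qed

text \<open>The eigenvector equation is read at a coordinate of maximal modulus, as for row-sum
  bounds.\<close>

lemma ev_le_total:
 assumes z: "cmod z = 1" and a: "a : set (ev z)"
 shows "a <= (real total)\<^sup>2"
proof -
 have "eigenvalue (gram_symbol z) (of_real a)" using a ev(4)[OF z] by simp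
 then obtain v where v: "v : carrier_vec N" "v ~= 0\<^sub>v N" "gram_symbol z *\<^sub>v v = of_real a \<cdot>\<^sub>v v"
  using gram_symbol_carrier[of z] unfolding eigenvalue_def eigenvector_def by auto
 obtain i where i: "i < N" "v $ i ~= 0" using v(1,2) by (auto simp: vec_eq_iff)
 hence "finite ((%i. cmod (v $ i)) ` {..<N})" "(%i. cmod (v $ i)) ` {..<N} ~= {}" by auto
 note Max_I = Max_in[OF this] Max_ge[OF this(1)]
 then obtain i0 where "i0 < N" "cmod (v $ i0) = Max ((%i. cmod (v $ i)) ` {..<N})" by auto
 hence i0: "i0 < N" "!!i. i < N ==> cmod (v $ i) <= cmod (v $ i0)"
  using Max_I(2) by auto
 have m: "0 < cmod (v $ i0)" using i0(2)[OF i(1)] i(2) by (meson norm_le_zero_iff not_less order_trans)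
 let ?x = "cmod (v $ i0)"
 have z': "cmod (inverse z) = 1" using z by (simp add: norm_inverse)
 have le: "(\<Sum>i<N. cmod (symbol y j i)) <= real total" if "cmod y = 1" "j < M" for y j
 proof -
  have "(\<Sum>i<N. cmod (symbol y j i)) <= (\<Sum>j<M. \<Sum>i<N. cmod (symbol y j i))"
   using that(2) by (intro member_le_sum) (auto intro: sum_nonneg)
  thus ?thesis using sum_cmod_symbol_le[OF that(1)] by simp
 qed
 have "cmod (\<Sum>i<N. symbol z j i * v $ i) <= real total * ?x" if "j < M" for j
 proof -
  have "cmod (\<Sum>i<N. symbol z j i * v $ i) <= (\<Sum>i<N. cmod (symbol z j i) * ?x)"
   using i0(2) by (intro order_trans[OF norm_sum] sum_mono) (simp add: norm_mult mult_left_mono)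
  also have "... <= real total * ?x"
   unfolding sum_distrib_right[symmetric] by (intro mult_right_mono le z that) simp
  finally show ?thesis .
 qed
 hence "cmod (symbol (inverse z) j i0 * (\<Sum>i<N. symbol z j i * v $ i)) <= cmod (symbol (inverse z) j i0) * (real total * ?x)"
  if "j < M" for j unfolding norm_mult using that by (intro mult_left_mono) auto
 hence "cmod ((gram_symbol z *\<^sub>v v) $ i0) <= (\<Sum>j<M. cmod (symbol (inverse z) j i0) * (real total * ?x))"
  unfolding gram_symbol_mult_vec[OF v(1) i0(1)] by (intro order_trans[OF norm_sum] sum_mono) auto
 also have "... = (\<Sum>j<M. cmod (symbol (inverse z) j i0)) * (real total * ?x)"
  by (simp add: sum_distrib_right)
 also have "... <= real total * (real total * ?x)"
 proof (intro mult_right_mono)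
  have "(\<Sum>j<M. cmod (symbol (inverse z) j i0)) <= (\<Sum>j<M. \<Sum>i<N. cmod (symbol (inverse z) j i))"
   using i0(1) by (intro sum_mono member_le_sum) auto
  thus "(\<Sum>j<M. cmod (symbol (inverse z) j i0)) <= real total"
   using sum_cmod_symbol_le[OF z'] by simp
 qed auto
 finally have "\<bar>a\<bar> * ?x <= (real total)\<^sup>2 * ?x"
  using v(1,3) i0(1) by (simp add: norm_mult power2_eq_square mult.assoc)
 thus ?thesis using m by (simp add: mult_le_cancel_right)
qed

text \<open>Multiplication by z^L clears the negative exponents. With the same factor in
  \<open>conjugate_poly\<close>, the matrix \<open>gram_poly\<close> evaluates to z^(2L) times the
  symbol, a factor of modulus 1 on the circle.\<close>

definition numerator_poly :: "nat => nat => complex poly" where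
 "numerator_poly j i = (\<Sum>k\<in>S. Polynomial.monom (of_int (d j i k)) (nat (int L - k)))"

definition conjugate_poly :: "nat => nat => complex poly" where
 "conjugate_poly j i = (\<Sum>k\<in>S. Polynomial.monom (of_int (d j i k)) (nat (int L + k)))"

definition gram_poly :: "complex poly mat" where
 "gram_poly = mat N N (%(i, i'). \<Sum>j<M. conjugate_poly j i * numerator_poly j i')"

lemma poly_numerator:
 assumes "z ~= 0"
 shows "poly (numerator_poly j i) z = z ^ L * symbol z j i"
proof -
 have "z ^ nat (int L - k) = z ^ L * z powi (- k)" if "k : S" for k
  using that assms power_int_add[of z "int L" "- k"] by (auto simp: power_int_def)
 thus ?thesis
  by (simp add: numerator_poly_def symbol_def poly_sum poly_monom sum_distrib_left mult_ac)
qed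

lemma poly_conjugate:
 assumes "z ~= 0"
 shows "poly (conjugate_poly j i) z = z ^ L * symbol (inverse z) j i"
proof -
 have "z ^ nat (int L + k) = z ^ L * inverse z powi (- k)" if "k : S" for k
  using that assms power_int_add[of z "int L" "k"]
  by (auto simp: power_int_inverse power_int_minus) (auto simp: power_int_def)
 thus ?thesis
  by (simp add: conjugate_poly_def symbol_def poly_sum poly_monom sum_distrib_left mult_ac)
qed

lemma comm_ring_hom_poly_eval: "comm_ring_hom (%p. poly p (z::complex))"
 by unfold_locales auto

lemma char_poly_gram_poly:
 assumes "z ~= 0"
 shows "map_poly (%p. poly p z) (char_poly gram_poly) = char_poly (z ^ (2 * L) \<cdot>\<^sub>m gram_symbol z)"
proof -
 have "map_mat (%p. poly p z) gram_poly = z ^ (2 * L) \<cdot>\<^sub>m gram_symbol z"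
  using assms
  by (intro eq_matI) (auto simp: gram_poly_def gram_symbol_def poly_sum poly_numerator poly_conjugate
    sum_distrib_left power_add mult_2 mult_ac power2_eq_square power_mult intro!: sum.cong)
 moreover have "gram_poly : carrier_mat N N" by (simp add: gram_poly_def)
 ultimately show ?thesis using comm_ring_hom.char_poly_hom[OF comm_ring_hom_poly_eval, of gram_poly N z] by simp
qed

end

section \<open>Discrete Fourier transform and moments\<close>

lemma periodic_mult:
 fixes f :: "int => 'a"
 assumes "!!a. f (a + int n) = f a"
 shows "f (a + int n * k) = f a"
proof (induction k rule: int_induct[where k = 0])
 case (step1 i)
 thus ?case using assms[of "a + int n * i"] by (simp add: distrib_left add.assoc)
next
 case (step2 i)
 thus ?case using assms[of "a + int n * (i - 1)"] by (simp add: right_diff_distrib add.assoc)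
qed simp

lemma periodic_mod:
 fixes f :: "int => 'a"
 assumes "!!a. f (a + int n) = f a"
 shows "f (a mod int n) = f a"
 using periodic_mult[of f n "a mod int n" "a div int n", OF assms] by simp

lemma sum_periodic_shift:
 fixes f :: "int => 'a::comm_monoid_add"
 assumes per: "!!a. f (a + int n) = f a" and n: "n > 0"
 shows "(\<Sum>a\<in>{0..<int n}. f (a + m)) = (\<Sum>a\<in>{0..<int n}. f a)"
proof (rule sum.reindex_bij_witness[of _ "%b. (b - m) mod int n" "%a. (a + m) mod int n"])
 fix a assume a: "a : {0..<int n}"
 thus "((a + m) mod int n - m) mod int n = a" by (simp add: mod_diff_left_eq)
 show "((a - m) mod int n + m) mod int n = a" using a by (simp add: mod_add_left_eq)
 show "(a + m) mod int n : {0..<int n}" "(a - m) mod int n : {0..<int n}" using n by auto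
 show "f ((a + m) mod int n) = f (a + m)" by (rule periodic_mod[of f, OF per])
qed

lemma unity_root_powi_period:
 assumes "z : unity_roots n" "n > 0"
 shows "z powi (a + int n) = z powi a"
proof -
 have "z ~= 0" "z ^ n = 1" using assms unity_roots_norm[OF assms] by (auto simp: unity_roots_def)
 thus ?thesis by (simp add: power_int_add)
qed

text \<open>Multiplying all roots by a primitive one permutes them and multiplies the sum by w^m,
  which differs from 1 unless \<open>n\<close> divides \<open>m\<close>.\<close>

lemma sum_unity_roots_powi:
 assumes n: "n > 0"
 shows "(\<Sum>z\<in>unity_roots n. z powi m) = (if int n dvd m then of_nat n else 0)"
proof (cases "int n dvd m")
 case True
 then obtain k where k: "m = int n * k" by auto
 have "z powi m = 1" if "z : unity_roots n" for z
  using periodic_mult[of "%a. z powi a" n 0 k, OF unity_root_powi_period[OF that n]] k by simp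
 moreover have "card (unity_roots n) = n" unfolding unity_roots_def by (rule card_roots_unity_eq[OF n])
 ultimately show ?thesis using True by simp
next
 case False
 define w where "w = cis (2 * pi / real n)"
 have w: "w : unity_roots n" using cis_unity_root[OF n, of 1] by (simp add: w_def)
 have w0: "w ~= 0" by (simp add: w_def)
 have "w powi m = cis (of_int m * (2 * pi / real n))" unfolding w_def by (rule cis_power_int)
 moreover have "cis (of_int m * (2 * pi / real n)) ~= 1"
 proof
  assume "cis (of_int m * (2 * pi / real n)) = 1"
  hence "cos (of_int m * (2 * pi / real n)) = 1" by (simp add: complex_eq_iff)
  then obtain k :: int where "of_int m * (2 * pi / real n) = of_int k * 2 * pi"
   by (auto simp: cos_one_2pi_int)
  hence "of_int m = real n * of_int k" using n by (simp add: divide_eq_eq)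
  hence "m = int n * k" by (metis of_int_eq_iff of_int_mult of_int_of_nat_eq)
  thus False using False by simp
 qed
 ultimately have w1: "w powi m ~= 1" by simp
 have "(\<Sum>z\<in>unity_roots n. z powi m) = (\<Sum>z\<in>unity_roots n. (w * z) powi m)"
  by (rule sum.reindex_bij_witness[of _ "%z. w * z" "%z. inverse w * z"])
    (use w w0 in \<open>auto simp: unity_roots_def power_mult_distrib power_inverse mult.assoc[symmetric]\<close>)
 also have "... = w powi m * (\<Sum>z\<in>unity_roots n. z powi m)"
  by (simp add: power_int_mult_distrib sum_distrib_left)
 finally show ?thesis using w1 False by simp
qed

definition fourier :: "nat => complex => (int => complex) => complex" where
 "fourier n z f = (\<Sum>a\<in>{0..<int n}. z powi (- a) * f a)"

lemma fourier_shift: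
 assumes z: "z : unity_roots n" "n > 0" and f: "!!a. f (a + int n) = f a"
 shows "fourier n z (%a. f (a + m)) = z powi m * fourier n z f"
proof -
 have z0: "z ~= 0" using unity_roots_norm[OF z] by auto
 define g where "g a = z powi (- a) * f a" for a
 have z': "inverse z : unity_roots n" using z by (simp add: unity_roots_def power_inverse)
 have g: "g (a + int n) = g a" for a
  using unity_root_powi_period[OF z' z(2), of a] f[of a]
  unfolding g_def power_int_minus power_int_inverse by simp
 have "z powi (- a) * f (a + m) = z powi m * g (a + m)" for a
  using z0 power_int_add[of z m "- (a + m)"] by (simp add: g_def mult.assoc[symmetric])
 hence "fourier n z (%a. f (a + m)) = z powi m * (\<Sum>a\<in>{0..<int n}. g (a + m))"
  by (simp add: fourier_def sum_distrib_left)
 also have "(\<Sum>a\<in>{0..<int n}. g (a + m)) = (\<Sum>a\<in>{0..<int n}. g a)" by (rule sum_periodic_shift[of g n m, OF g z(2)])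
 finally show ?thesis by (simp add: fourier_def g_def)
qed

lemma fourier_inversion:
 assumes n: "n > 0" and a: "a : {0..<int n}"
 shows "of_nat n * f a = (\<Sum>z\<in>unity_roots n. z powi a * fourier n z f)"
proof -
 have z0: "z ~= 0" if "z : unity_roots n" for z using unity_roots_norm[OF that n] by auto
 have "(\<Sum>z\<in>unity_roots n. z powi a * fourier n z f)
   = (\<Sum>z\<in>unity_roots n. \<Sum>b\<in>{0..<int n}. z powi (a - b) * f b)"
  unfolding fourier_def sum_distrib_left mult.assoc[symmetric]
  by (intro sum.cong refl) (simp add: z0 power_int_add[symmetric])
 also have "... = (\<Sum>b\<in>{0..<int n}. \<Sum>z\<in>unity_roots n. z powi (a - b) * f b)" by (rule sum.swap)
 also have "... = (\<Sum>b\<in>{0..<int n}. if b = a then of_nat n * f b else 0)"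
 proof (intro sum.cong refl)
  fix b assume b: "b : {0..<int n}"
  have "int n dvd a - b \<longleftrightarrow> b = a"
  proof
   assume "int n dvd a - b"
   moreover have "\<bar>a - b\<bar> < \<bar>int n\<bar>" using a b by auto
   ultimately show "b = a" using dvd_imp_le_int[of "a - b" "int n"] by fastforce
  qed simp
  thus "(\<Sum>z\<in>unity_roots n. z powi (a - b) * f b) = (if b = a then of_nat n * f b else 0)"
   unfolding sum_distrib_right[symmetric] sum_unity_roots_powi[OF n] by simp
 qed
 finally show ?thesis using a by simp
qed

context convolution
begin

lemma fourier_dA:
 assumes z: "z : unity_roots n" "n > 0" and u: "!!i a. u i (a + int n) = u i a"
 shows "fourier n z (dA u j) = (\<Sum>i<N. symbol z j i * fourier n z (u i))"
proof -
 have "fourier n z (dA u j) = (\<Sum>a\<in>{0..<int n}. \<Sum>i<N. \<Sum>k\<in>S. of_int (d j i k) * (z powi (- a) * u i (a + - k)))"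
  by (simp add: fourier_def dA_def sum_distrib_left mult_ac)
 also have "... = (\<Sum>i<N. \<Sum>k\<in>S. of_int (d j i k) * fourier n z (%a. u i (a + - k)))"
  unfolding fourier_def sum_distrib_left
  by (subst sum.swap, rule sum.cong[OF refl], subst sum.swap) simp
 also have "... = (\<Sum>i<N. \<Sum>k\<in>S. of_int (d j i k) * (z powi (- k) * fourier n z (u i)))"
  by (intro sum.cong refl arg_cong2[of _ _ _ _ "(*)"] fourier_shift z u)
 finally show ?thesis by (simp add: symbol_def sum_distrib_right mult.assoc)
qed

lemma dA_periodic: "(!!i a. u i (a + int n) = u i a) ==> dA u j (b + int n) = dA u j b"
 using diff_add_eq[of b _ "int n"] unfolding dA_def
 by (intro sum.cong refl) (metis (no_types, opaque_lifting) add_diff_eq diff_add_eq)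

lemma dT_periodic: "(!!i a. u i (a + int n) = u i a) ==> dT u i (b + int n) = dT u i b"
 using dA_periodic[of u n] unfolding dT_def
 by (intro sum.cong refl) (metis add.assoc add.commute)

lemma fourier_dT:
 assumes z: "z : unity_roots n" "n > 0" and u: "!!i a. u i (a + int n) = u i a" and i: "i < N"
 shows "fourier n z (dT u i) = (gram_symbol z *\<^sub>v vec N (%i. fourier n z (u i))) $ i"
proof -
 have "fourier n z (dT u i) = (\<Sum>a\<in>{0..<int n}. \<Sum>j<M. \<Sum>k\<in>S. of_int (d j i k) * (z powi (- a) * dA u j (a + k)))"
  by (simp add: fourier_def dT_def sum_distrib_left mult_ac)
 also have "... = (\<Sum>j<M. \<Sum>k\<in>S. of_int (d j i k) * fourier n z (%a. dA u j (a + k)))"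
  unfolding fourier_def sum_distrib_left
  by (subst sum.swap, rule sum.cong[OF refl], subst sum.swap) simp
 also have "... = (\<Sum>j<M. \<Sum>k\<in>S. of_int (d j i k) * (z powi k * fourier n z (dA u j)))"
  by (intro sum.cong refl arg_cong2[of _ _ _ _ "(*)"] fourier_shift z dA_periodic u)
 also have "... = (\<Sum>j<M. symbol (inverse z) j i * (\<Sum>i<N. symbol z j i * fourier n z (u i)))"
  by (simp add: symbol_def fourier_dA[of z n u, OF z u] sum_distrib_right power_int_inverse power_int_minus mult.assoc)
 finally show ?thesis using i by (simp add: gram_symbol_mult_vec)
qed

lemma dA_cong: "(!!i b. i < N ==> \<bar>b - a\<bar> <= r + int L ==> u i b = u' i b) ==> \<bar>b - a\<bar> <= r ==> dA u j b = dA u' j b"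
 unfolding dA_def by (intro sum.cong refl arg_cong2[of _ _ _ _ "(*)"]) auto

lemma dT_cong:
 assumes "!!i b. i < N ==> \<bar>b - a\<bar> <= r + 2 * int L ==> u i b = u' i b" "\<bar>b - a\<bar> <= r"
 shows "dT u i b = dT u' i b"
 unfolding dT_def
proof (intro sum.cong refl arg_cong2[of _ _ _ _ "(*)"])
 fix j k assume "k : S"
 thus "dA u j (b + k) = dA u' j (b + k)"
  using assms by (intro dA_cong[of a "r + int L"]) auto
qed

text \<open>Finite propagation: every application of \<open>dT\<close> looks at most 2L places
  further.\<close>

lemma dT_power_cong:
 assumes "!!i b. i < N ==> \<bar>b - a\<bar> <= r + 2 * int L * int m ==> u i b = u' i b" "\<bar>b - a\<bar> <= r" "i < N"
 shows "(dT ^^ m) u i b = (dT ^^ m) u' i b"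
 using assms
proof (induction m arbitrary: r b i)
 case (Suc m)
 have "dT ((dT ^^ m) u) i b = dT ((dT ^^ m) u') i b"
 proof (rule dT_cong[of a r])
  fix i b assume "i < N" "\<bar>b - a\<bar> <= r + 2 * int L"
  thus "(dT ^^ m) u i b = (dT ^^ m) u' i b"
   by (intro Suc.IH[of "r + 2 * int L"] Suc.prems(1)) (auto simp: algebra_simps)
 qed (use Suc.prems in auto)
 thus ?case by simp
qed auto

lemma dT_translate: "dT (%i a. u i (a + t)) = (%i a. dT u i (a + t))"
 unfolding dT_def dA_def by (simp add: fun_eq_iff algebra_simps)

lemma dT_power_translate: "(dT ^^ m) (%i a. u i (a + t)) = (%i a. (dT ^^ m) u i (a + t))"
 by (induction m) (auto simp: dT_translate)

definition delta :: "nat => int => nat => int => complex" where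
 "delta i0 a0 = (%i a. if i = i0 & a = a0 then 1 else 0)"

definition moment :: "nat => nat => complex" where
 "moment m i = (dT ^^ m) (delta i 0) i 0"

lemma moment_translate: "(dT ^^ m) (delta i a) i a = moment m i"
proof -
 have "delta i a = (%j b. delta i 0 j (b + - a))" by (auto simp: delta_def fun_eq_iff)
 thus ?thesis using dT_power_translate[of m "delta i 0" "- a"] by (simp add: moment_def)
qed

lemma pow_mat_commute:
 fixes A :: "'b::semiring_1 mat"
 assumes A: "A : carrier_mat n n"
 shows "A * A ^\<^sub>m m = A ^\<^sub>m m * A"
proof (induction m)
 case (Suc m)
 have "A * (A ^\<^sub>m m * A) = (A * A ^\<^sub>m m) * A"
  by (rule assoc_mult_mat[symmetric, OF A pow_carrier_mat[OF A] A])
 thus ?case using Suc.IH by simp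
qed (use A in auto)

lemma mat_mult_unit_vec_index:
 fixes A :: "'b::semiring_1 mat"
 assumes A: "A : carrier_mat n n" and "i < n" "j < n"
 shows "(A *\<^sub>v unit_vec n i) $ j = A $$ (j, i)"
 using assms by simp

text \<open>The value at 0 after m steps depends only on places at distance at most 2Lm, so for
  larger \<open>n\<close> a delta at 0 cannot be told from its n-periodic extension. The latter has
  constant Fourier transform, powers of \<open>dT\<close> become powers of the symbol, and Fourier
  inversion at 0 gives the average of the traces. The equality is exact, not asymptotic.\<close>

lemma sum_moment:
 assumes n: "n > 2 * L * m"
 shows "(\<Sum>i<N. moment m i) = of_real (root_average ev (%a. a ^ m) n)"
proof -
 have n0: "n > 0" using n by simp
 define w where "w i = (dT ^^ m) (%j a. if j = i & int n dvd a then 1 else 0)" for i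
 have init: "fourier n z (%a. if j = i & int n dvd a then 1 else 0) = (if j = i then 1 else 0)" for z j i
 proof -
  have "fourier n z (%a. if j = i & int n dvd a then 1 else 0)
   = (\<Sum>a\<in>{0..<int n}. if a = 0 then (if j = i then 1 else 0) else 0)"
   unfolding fourier_def
  proof (intro sum.cong refl)
   fix a assume a: "a : {0..<int n}"
   have "int n dvd a \<longleftrightarrow> a = 0" using a zdvd_not_zless[of a "int n"] by (cases "a = 0") auto
   thus "z powi (- a) * (if j = i & int n dvd a then 1 else 0) = (if a = 0 then (if j = i then 1 else 0) else 0)"
    by auto
  qed
  thus ?thesis using n0 by simp
 qed
 have per: "(dT ^^ m) (%j a. if j = i & int n dvd a then 1 else 0) j (a + int n)
   = (dT ^^ m) (%j a. if j = i & int n dvd a then 1 else 0) j a" for m i j a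
  by (induction m arbitrary: j a) (auto intro: dT_periodic)
 have ft: "vec N (%j. fourier n z ((dT ^^ m) (%j a. if j = i & int n dvd a then 1 else 0) j))
   = gram_symbol z ^\<^sub>m m *\<^sub>v unit_vec N i" if z: "z : unity_roots n" and "i < N" for z i m
 proof (induction m)
  case 0
  thus ?case using that by (intro eq_vecI) (auto simp: init gram_symbol_def)
 next
  case (Suc m)
  have "vec N (%j. fourier n z (dT ((dT ^^ m) (%j a. if j = i & int n dvd a then 1 else 0)) j))
    = gram_symbol z *\<^sub>v (gram_symbol z ^\<^sub>m m *\<^sub>v unit_vec N i)"
   unfolding Suc.IH[symmetric]
   by (intro eq_vecI) (use fourier_dT[OF z n0, of "(dT ^^ m) (%j a. if j = i & int n dvd a then 1 else 0)", OF per] carrier_matD[OF gram_symbol_carrier] in auto)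
  also have "... = (gram_symbol z * gram_symbol z ^\<^sub>m m) *\<^sub>v unit_vec N i"
   by (intro assoc_mult_mat_vec[symmetric, of _ N N _ N]) auto
  also have "gram_symbol z * gram_symbol z ^\<^sub>m m = gram_symbol z ^\<^sub>m Suc m"
   using pow_mat_commute[OF gram_symbol_carrier] by simp
  finally show ?case by simp
 qed
 have w_eq: "w i i 0 = (\<Sum>z\<in>unity_roots n. (gram_symbol z ^\<^sub>m m) $$ (i, i)) / of_nat n" if i: "i < N" for i
 proof -
  have "fourier n z (w i i) = (gram_symbol z ^\<^sub>m m) $$ (i, i)" if z: "z : unity_roots n" for z
  proof -
   have "fourier n z (w i i) = (gram_symbol z ^\<^sub>m m *\<^sub>v unit_vec N i) $ i"
    using arg_cong[OF ft[OF z i, of m], of "%v. vec_index v i"] i by (simp add: w_def)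
   also have "... = (gram_symbol z ^\<^sub>m m) $$ (i, i)"
    using i mat_mult_unit_vec_index[OF pow_carrier_mat[OF gram_symbol_carrier] i i] by simp
   finally show ?thesis .
  qed
  thus ?thesis using fourier_inversion[OF n0, of 0 "w i i"] n0 by (simp add: eq_divide_eq mult.commute)
 qed
 have "moment m i = w i i 0" if "i < N" for i
  unfolding moment_def w_def
 proof (rule dT_power_cong[of 0 0])
  fix j b assume "\<bar>b - 0\<bar> <= 0 + 2 * int L * int m"
  hence "\<bar>b\<bar> < int n" using n by (metis add_0 diff_zero int_ops(7) of_nat_less_iff of_nat_numeral order_le_less_trans)
  hence "int n dvd b \<longleftrightarrow> b = 0" using zdvd_not_zless[of "\<bar>b\<bar>" "int n"] by (cases "b = 0") auto
  thus "delta i 0 j b = (if j = i & int n dvd b then 1 else 0)" by (auto simp: delta_def)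
 qed (use that in auto)
 hence "(\<Sum>i<N. moment m i) = (\<Sum>z\<in>unity_roots n. mat_trace (gram_symbol z ^\<^sub>m m)) / of_nat n"
  by (simp add: w_eq mat_trace_def gram_symbol_def flip: sum_divide_distrib)
    (subst sum.swap, simp)
 also have "... = of_real (root_average ev (%a. a ^ m) n)"
  using ev(2)[OF unity_roots_norm[OF _ n0]] by (simp add: root_average_def)
 finally show ?thesis .
qed

text \<open>The Fourier coefficients of a periodic eigenvector are, where nonzero, eigenvectors of
  the symbols, and one of them is nonzero by inversion. Conversely an eigenvector \<open>v\<close>
  of the symbol at \<open>z\<close> gives the wave z^a v.\<close>

lemma periodic_eigenvalue_iff:
 assumes n: "n > 0"
 shows "(\<exists>u. (\<forall>i a. u i (a + int n) = u i a) & (\<exists>i<N. \<exists>a. u i a ~= 0) & (\<forall>i<N. \<forall>a. dT u i a = of_real x * u i a))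
  \<longleftrightarrow> (\<exists>z\<in>unity_roots n. x : set (ev z))" (is "?l \<longleftrightarrow> ?r")
proof
 assume ?l
 then obtain u where u: "!!i a. u i (a + int n) = u i a" "!!i a. i < N ==> dT u i a = of_real x * u i a"
  and ne: "\<exists>i<N. \<exists>a. u i a ~= 0" by blast
 obtain i a where ia: "i < N" "u i a ~= 0" using ne by blast
 have "a mod int n : {0..<int n}" using n by simp
 note inv = fourier_inversion[OF n this, of "u i"]
 have "u i (a mod int n) ~= 0" using periodic_mod[of "u i" n a, OF u(1)] ia(2) by simp
 hence "(\<Sum>z\<in>unity_roots n. z powi (a mod int n) * fourier n z (u i)) ~= 0" using inv n by auto
 then obtain z where z: "z : unity_roots n" "z powi (a mod int n) * fourier n z (u i) ~= 0"
  by (metis (no_types, lifting) sum.neutral)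
 define v where "v = vec N (%i. fourier n z (u i))"
 have "gram_symbol z *\<^sub>v v = of_real x \<cdot>\<^sub>v v"
 proof (intro eq_vecI)
  fix j assume "j < dim_vec (of_real x \<cdot>\<^sub>v v)"
  hence j: "j < N" by (simp add: v_def)
  have "(gram_symbol z *\<^sub>v v) $ j = fourier n z (dT u j)" unfolding v_def by (rule fourier_dT[where u = u, OF z(1) n u(1) j, symmetric])
  also have "... = of_real x * fourier n z (u j)"
   using u(2)[OF j] by (simp add: fourier_def sum_distrib_left mult_ac)
  finally show "(gram_symbol z *\<^sub>v v) $ j = (of_real x \<cdot>\<^sub>v v) $ j" using j by (simp add: v_def)
 qed (simp add: v_def gram_symbol_def)
 moreover have "v ~= 0\<^sub>v N"
 proof
  assume "v = 0\<^sub>v N"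
  hence "v $ i = 0" using ia(1) by simp
  thus False using z(2) ia(1) by (simp add: v_def)
 qed
 ultimately have "eigenvalue (gram_symbol z) (of_real x)"
  unfolding eigenvalue_def eigenvector_def by (intro exI[of _ v]) (auto simp: v_def gram_symbol_def)
 thus ?r using ev(4)[OF unity_roots_norm[OF z(1) n]] z(1) by blast
next
 assume ?r
 then obtain z where z: "z : unity_roots n" "x : set (ev z)" by blast
 have z1: "cmod z = 1" "z ~= 0" using unity_roots_norm[OF z(1) n] by auto
 obtain v where v: "v : carrier_vec N" "v ~= 0\<^sub>v N" "gram_symbol z *\<^sub>v v = of_real x \<cdot>\<^sub>v v"
  using z(2) ev(4)[OF z1(1)] gram_symbol_carrier[of z] unfolding eigenvalue_def eigenvector_def by auto
 obtain i where i: "i < N" "v $ i ~= 0" using v(1,2) by (auto simp: vec_eq_iff)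
 define u where "u i a = z powi a * v $ i" for i a
 have dA: "dA u j b = z powi b * (\<Sum>i<N. symbol z j i * v $ i)" for j b
  using z1(2) by (simp add: dA_def u_def symbol_def sum_distrib_left sum_distrib_right power_int_diff power_int_minus
    divide_inverse mult_ac)
 have "dT u i a = of_real x * u i a" if "i < N" for i a
 proof -
  have "(\<Sum>k\<in>S. of_int (d j i k) * (z powi (a + k) * x)) = z powi a * (symbol (inverse z) j i * x)" for j x
   using z1(2)
   by (simp add: symbol_def sum_distrib_left sum_distrib_right power_int_add power_int_inverse power_int_minus mult_ac)
  hence "dT u i a = z powi a * (\<Sum>j<M. symbol (inverse z) j i * (\<Sum>i<N. symbol z j i * v $ i))"
   unfolding dT_def dA by (simp only: sum_distrib_left[of "z powi a"])
  also have "... = z powi a * (of_real x \<cdot>\<^sub>v v) $ i"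
   unfolding gram_symbol_mult_vec[OF v(1) that, symmetric] v(3) ..
  finally show ?thesis using that v(1) by (simp add: u_def)
 qed
 moreover have "u i (a + int n) = u i a" for i a
  using unity_root_powi_period[OF z(1) n] by (simp add: u_def)
 moreover have "\<exists>i<N. \<exists>a. u i a ~= 0" using i z1(2) by (intro exI[of _ i] conjI exI[of _ 0]) (auto simp: u_def)
 ultimately show ?l by blast
qed

end

section \<open>Differentials of cyclic covers and their traces\<close>

lemma poly_op_inner:
 "poly_op T p u \<bullet> v = (\<Sum>m\<le>degree p. coeff p m * ((T ^^ m) u \<bullet> v))"
 by (simp add: poly_op_def inner_sum_left)

lemma root_average_poly:
 "root_average ev (poly p) n = (\<Sum>m\<le>degree p. coeff p m * root_average ev (%a. a ^ m) n)"
proof -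
 have list: "(\<Sum>a\<leftarrow>l. poly p a) = (\<Sum>m\<le>degree p. coeff p m * (\<Sum>a\<leftarrow>l. a ^ m))" for l :: "real list"
  by (induction l) (simp_all add: poly_altdef distrib_left sum.distrib)
 show ?thesis
  unfolding root_average_def list sum_distrib_left times_divide_eq_right sum_divide_distrib
  by (subst sum.swap) (simp add: sum_distrib_left sum_divide_distrib)
qed

lemma root_average_close:
 assumes n: "n > 0" and len: "!!z. z : unity_roots n ==> length (ev z) = N"
  and fg: "!!z a. z : unity_roots n ==> a : set (ev z) ==> \<bar>f a - g a\<bar> <= e"
 shows "\<bar>root_average ev f n - root_average ev g n\<bar> <= real N * e"
proof -
 have card: "card (unity_roots n) = n" unfolding unity_roots_def by (rule card_roots_unity_eq[OF n])
 have list: "\<bar>\<Sum>a\<leftarrow>l. f a - g a\<bar> <= real (length l) * e" if "!!a. a : set l ==> \<bar>f a - g a\<bar> <= e" for l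
  using that
 proof (induction l)
  case (Cons x l)
  have "\<bar>f x - g x + (\<Sum>a\<leftarrow>l. f a - g a)\<bar> <= e + real (length l) * e"
   using Cons.prems[of x] Cons.IH Cons.prems by (intro order_trans[OF abs_triangle_ineq] add_mono) auto
  thus ?case by (simp add: distrib_right)
 qed simp
 have "\<bar>\<Sum>z\<in>unity_roots n. \<Sum>a\<leftarrow>ev z. f a - g a\<bar> <= (\<Sum>z\<in>unity_roots n. real N * e)"
  by (intro order_trans[OF sum_abs] sum_mono) (use list fg len in metis)
 also have "... = real n * (real N * e)" by (simp add: card)
 finally have "\<bar>root_average ev (%a. f a - g a) n\<bar> <= real N * e"
  using n by (simp add: root_average_def pos_divide_le_eq mult_ac)
 thus ?thesis by (simp add: root_average_diff)
qed

text \<open>\<open>n = 0\<close> describes the infinite cyclic cover, since \<open>int 0\<close>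
  divides only 0; thus finite and infinite covers share one set of lemmas.
  \<open>\<beta> i a\<close> and \<open>\<gamma> j b\<close> are translates of chosen cells.\<close>

locale cyclic_matrix = convolution +
 fixes n :: nat and B :: "'c set" and C :: "'d set" and m :: "'c => 'd => int"
  and \<beta> :: "nat => int => 'c" and \<gamma> :: "nat => int => 'd"
 assumes B_eq: "B = (\<Union>i<N. range (\<beta> i))" and C_eq: "C = (\<Union>j<M. range (\<gamma> j))"
  and \<beta>_eq: "!!i i' a a'. i < N ==> i' < N ==> \<beta> i a = \<beta> i' a' \<longleftrightarrow> i = i' & int n dvd a - a'"
  and \<gamma>_eq: "!!j j' b b'. j < M ==> j' < M ==> \<gamma> j b = \<gamma> j' b' \<longleftrightarrow> j = j' & int n dvd b - b'"
  and row: "!!i a f. i < N ==> f : C ==>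
   m (\<beta> i a) f = (\<Sum>(j, k)\<in>{..<M} \<times> S. if \<gamma> j (a + k) = f then d j i k else 0)"
begin

lemma column:
 assumes x: "x : B" and j: "j < M"
 shows "m x (\<gamma> j b) = (\<Sum>(i, k)\<in>{..<N} \<times> S. if \<beta> i (b - k) = x then d j i k else 0)"
proof -
 obtain i0 a where x_eq: "x = \<beta> i0 a" and i0: "i0 < N" using x by (auto simp: B_eq)
 have "m x (\<gamma> j b) = (\<Sum>j'<M. \<Sum>k\<in>S. if \<gamma> j' (a + k) = \<gamma> j b then d j' i0 k else 0)"
  unfolding x_eq using j by (subst row[OF i0]) (auto simp: C_eq sum.cartesian_product)
 also have "... = (\<Sum>j'<M. if j' = j then \<Sum>k\<in>S. if int n dvd a + k - b then d j' i0 k else 0 else 0)"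
  using j by (intro sum.cong refl) (auto simp: \<gamma>_eq)
 also have "... = (\<Sum>k\<in>S. if int n dvd a + k - b then d j i0 k else 0)" using j by simp
 also have "... = (\<Sum>i<N. if i = i0 then \<Sum>k\<in>S. if int n dvd a + k - b then d j i k else 0 else 0)" using i0 by simp
 also have "... = (\<Sum>i<N. \<Sum>k\<in>S. if \<beta> i (b - k) = x then d j i k else 0)"
 proof (intro sum.cong refl)
  fix i assume i: "i : {..<N}"
  have "int n dvd a + k - b \<longleftrightarrow> int n dvd b - k - a" for k
   using dvd_minus_iff[of "int n" "b - k - a"] by (simp add: algebra_simps)
  thus "(if i = i0 then \<Sum>k\<in>S. if int n dvd a + k - b then d j i k else 0 else 0) = (\<Sum>k\<in>S. if \<beta> i (b - k) = x then d j i k else 0)"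
   using i i0 by (auto simp: x_eq \<beta>_eq)
 qed
 finally show ?thesis by (simp add: sum.cartesian_product)
qed

lemma row_support:
 assumes "i < N"
 shows "{f : C. m (\<beta> i a) f ~= 0} \<subseteq> (%(j, k). \<gamma> j (a + k)) ` {(j, k) : {..<M} \<times> S. d j i k ~= 0}"
proof
 fix f assume f: "f : {f : C. m (\<beta> i a) f ~= 0}"
 hence "(\<Sum>(j, k)\<in>{..<M} \<times> S. if \<gamma> j (a + k) = f then d j i k else 0) ~= 0" using row[OF assms, of f a] by auto
 then obtain p where "p : {..<M} \<times> S" "(case p of (j, k) => if \<gamma> j (a + k) = f then d j i k else 0) ~= 0"
  by (rule sum.not_neutral_contains_not_neutral)
 thus "f : (%(j, k). \<gamma> j (a + k)) ` {(j, k) : {..<M} \<times> S. d j i k ~= 0}"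
  by (auto split: if_splits)
qed

lemma column_support:
 assumes "j < M"
 shows "{x : B. m x (\<gamma> j b) ~= 0} \<subseteq> (%(i, k). \<beta> i (b - k)) ` {(i, k) : {..<N} \<times> S. d j i k ~= 0}"
proof
 fix x assume x: "x : {x : B. m x (\<gamma> j b) ~= 0}"
 hence "(\<Sum>(i, k)\<in>{..<N} \<times> S. if \<beta> i (b - k) = x then d j i k else 0) ~= 0" using column[OF _ assms, of x b] by auto
 then obtain p where "p : {..<N} \<times> S" "(case p of (i, k) => if \<beta> i (b - k) = x then d j i k else 0) ~= 0"
  by (rule sum.not_neutral_contains_not_neutral)
 thus "x : (%(i, k). \<beta> i (b - k)) ` {(i, k) : {..<N} \<times> S. d j i k ~= 0}"
  by (auto split: if_splits)
qed

lemma card_le_sum_abs: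
 fixes g :: "'k => int"
 assumes "finite A"
 shows "card {x : A. g x ~= 0} <= (\<Sum>x\<in>A. nat \<bar>g x\<bar>)"
proof -
 have "card {x : A. g x ~= 0} = (\<Sum>x\<in>{x : A. g x ~= 0}. 1)" by simp
 also have "... <= (\<Sum>x\<in>{x : A. g x ~= 0}. nat \<bar>g x\<bar>)" by (intro sum_mono) auto
 also have "... <= (\<Sum>x\<in>A. nat \<bar>g x\<bar>)" using assms by (intro sum_mono2) auto
 finally show ?thesis .
qed

lemma row_total: "i < N ==> (\<Sum>(j, k)\<in>{..<M} \<times> S. nat \<bar>d j i k\<bar>) <= total"
proof -
 assume i: "i < N"
 have "(\<Sum>j<M. \<Sum>k\<in>S. nat \<bar>d j i k\<bar>) <= total"
  unfolding total_def using i
  by (intro sum_mono member_le_sum[of i "{..<N}" "%i. \<Sum>k\<in>S. nat \<bar>d _ i k\<bar>"]) auto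
 thus ?thesis by (simp add: sum.cartesian_product)
qed

lemma column_total: "j < M ==> (\<Sum>(i, k)\<in>{..<N} \<times> S. nat \<bar>d j i k\<bar>) <= total"
 unfolding sum.cartesian_product[symmetric] total_def
 by (intro member_le_sum[of j "{..<M}" "%j. \<Sum>i<N. \<Sum>k\<in>S. nat \<bar>d j i k\<bar>"]) auto

sublocale bounded_matrix B C m total
proof
 have fin: "finite ({(j, k) : {..<M} \<times> S. d j i k ~= 0})" "finite ({(i, k) : {..<N} \<times> S. d j i k ~= 0})" for i j
  by (rule finite_subset[of _ "{..<M} \<times> S"], auto, rule finite_subset[of _ "{..<N} \<times> S"], auto)
 {
  fix x assume "x : B"
  then obtain i a where x: "x = \<beta> i a" and i: "i < N" by (auto simp: B_eq)
  show "finite {f : C. m x f ~= 0}"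
   unfolding x by (rule finite_subset[OF row_support[OF i] finite_imageI[OF fin(1)]])
  have "card {f : C. m x f ~= 0} <= card {(j, k) : {..<M} \<times> S. d j i k ~= 0}"
   unfolding x by (rule order_trans[OF card_mono[OF finite_imageI[OF fin(1)] row_support[OF i]] card_image_le[OF fin(1)]])
  also have "{(j, k) : {..<M} \<times> S. d j i k ~= 0} = {p : {..<M} \<times> S. (case p of (j, k) => d j i k) ~= 0}" by auto
  also have "card ... <= (\<Sum>p\<in>{..<M} \<times> S. nat \<bar>case p of (j, k) => d j i k\<bar>)" by (rule card_le_sum_abs) simp
  also have "... = (\<Sum>(j, k)\<in>{..<M} \<times> S. nat \<bar>d j i k\<bar>)" by (intro sum.cong) auto
  also have "... <= total" by (rule row_total[OF i])
  finally show "card {f : C. m x f ~= 0} <= total" .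
  fix f assume f: "f : C"
  have "\<bar>m x f\<bar> <= (\<Sum>(j, k)\<in>{..<M} \<times> S. \<bar>if \<gamma> j (a + k) = f then d j i k else 0\<bar>)"
   unfolding x row[OF i f] by (rule order_trans[OF sum_abs]) (auto intro!: sum_mono)
  also have "... <= (\<Sum>(j, k)\<in>{..<M} \<times> S. int (nat \<bar>d j i k\<bar>))" by (intro sum_mono) auto
  also have "... <= int total" using of_nat_mono[OF row_total[OF i], where 'a = int] by (simp only: of_nat_sum case_prod_beta')
  finally show "\<bar>m x f\<bar> <= int total" .
 }
 fix f assume "f : C"
 then obtain j b where f: "f = \<gamma> j b" and j: "j < M" by (auto simp: C_eq)
 show "finite {x : B. m x f ~= 0}"
  unfolding f by (rule finite_subset[OF column_support[OF j] finite_imageI[OF fin(2)]])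
 have "card {x : B. m x f ~= 0} <= card {(i, k) : {..<N} \<times> S. d j i k ~= 0}"
  unfolding f by (rule order_trans[OF card_mono[OF finite_imageI[OF fin(2)] column_support[OF j]] card_image_le[OF fin(2)]])
 also have "{(i, k) : {..<N} \<times> S. d j i k ~= 0} = {p : {..<N} \<times> S. (case p of (i, k) => d j i k) ~= 0}" by auto
 also have "card ... <= (\<Sum>p\<in>{..<N} \<times> S. nat \<bar>case p of (i, k) => d j i k\<bar>)" by (rule card_le_sum_abs) simp
 also have "... = (\<Sum>(i, k)\<in>{..<N} \<times> S. nat \<bar>d j i k\<bar>)" by (intro sum.cong) auto
 also have "... <= total" by (rule column_total[OF j])
 finally show "card {x : B. m x f ~= 0} <= total" .
qed

text \<open>For small \<open>n\<close> several index pairs can name the same cell, and their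
  coefficients add up or cancel; a sum over cells is therefore rewritten as a sum over index
  pairs.\<close>

lemma sum_incidence:
 fixes g :: "'x => complex" and h :: "'y => int" and v :: "'y => 'x" and mm :: "'x => int"
 assumes fin: "finite P" and mm: "!!x. x : A ==> mm x = (\<Sum>p\<in>P. if v p = x then h p else 0)"
  and v: "v ` P \<subseteq> A"
 shows "(\<Sum>x | x : A & mm x ~= 0. of_int (mm x) * g x) = (\<Sum>p\<in>P. of_int (h p) * g (v p))"
proof -
 have "{x. x : A & mm x ~= 0} \<subseteq> v ` P"
 proof
  fix x assume x: "x : {x. x : A & mm x ~= 0}"
  hence "(\<Sum>p\<in>P. if v p = x then h p else 0) ~= 0" using mm[of x] by auto
  then obtain p where "p : P" "(if v p = x then h p else 0) ~= 0" by (rule sum.not_neutral_contains_not_neutral)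
  thus "x : v ` P" by (auto split: if_splits)
 qed
 hence "(\<Sum>x | x : A & mm x ~= 0. of_int (mm x) * g x) = (\<Sum>x\<in>v ` P. of_int (mm x) * g x)"
  using fin v by (intro sum.mono_neutral_left) auto
 also have "... = (\<Sum>x\<in>v ` P. \<Sum>p\<in>P. if v p = x then of_int (h p) * g x else 0)"
 proof (rule sum.cong[OF refl])
  fix x assume "x : v ` P"
  hence "x : A" using v by blast
  hence "of_int (mm x) * g x = (\<Sum>p\<in>P. of_int (if v p = x then h p else 0) * g x)"
   by (simp only: mm of_int_sum sum_distrib_right)
  also have "... = (\<Sum>p\<in>P. if v p = x then of_int (h p) * g x else 0)"
   by (intro sum.cong refl) simp
  finally show "of_int (mm x) * g x = (\<Sum>p\<in>P. if v p = x then of_int (h p) * g x else 0)" .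
 qed
 also have "... = (\<Sum>p\<in>P. \<Sum>x\<in>v ` P. if v p = x then of_int (h p) * g x else 0)" by (rule sum.swap)
 also have "... = (\<Sum>p\<in>P. of_int (h p) * g (v p))" using fin by (intro sum.cong refl) simp
 finally show ?thesis .
qed

lemma gram_\<beta>:
 assumes i: "i < N"
 shows "gram u (\<beta> i a) = dT (%i a. u (\<beta> i a)) i a"
proof -
 have \<beta>B: "\<beta> i a : B" for a using i by (auto simp: B_eq)
 have inner: "(\<Sum>y | y : B & m y (\<gamma> j b) ~= 0. of_int (m y (\<gamma> j b)) * u y) = dA (%i a. u (\<beta> i a)) j b"
  if j: "j < M" for j b
 proof -
  have "(\<Sum>y | y : B & m y (\<gamma> j b) ~= 0. of_int (m y (\<gamma> j b)) * u y)
   = (\<Sum>p\<in>{..<N} \<times> S. of_int (case p of (i, k) => d j i k) * u (case p of (i, k) => \<beta> i (b - k)))"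
   by (rule sum_incidence) (auto simp: column[OF _ j] B_eq intro!: sum.cong)
  also have "... = (\<Sum>(i, k)\<in>{..<N} \<times> S. of_int (d j i k) * u (\<beta> i (b - k)))"
   by (intro sum.cong) auto
  finally show ?thesis by (simp add: dA_def sum.cartesian_product)
 qed
 have "gram u (\<beta> i a) = (\<Sum>f | f : C & m (\<beta> i a) f ~= 0. of_int (m (\<beta> i a) f) * (\<Sum>y | y : B & m y f ~= 0. of_int (m y f) * u y))"
  by (simp add: gram_eq[OF \<beta>B] sum_distrib_left mult.assoc)
 also have "... = (\<Sum>p\<in>{..<M} \<times> S. of_int (case p of (j, k) => d j i k) *
   (%f. \<Sum>y | y : B & m y f ~= 0. of_int (m y f) * u y) (case p of (j, k) => \<gamma> j (a + k)))"
  by (rule sum_incidence) (auto simp: row[OF i] C_eq intro!: sum.cong)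
 also have "... = (\<Sum>(j, k)\<in>{..<M} \<times> S. of_int (d j i k) * dA (%i a. u (\<beta> i a)) j (a + k))"
  by (intro sum.cong) (auto simp: inner)
 finally show ?thesis by (simp add: dT_def sum.cartesian_product)
qed

lemma finite_B: "n > 0 ==> finite B"
proof -
 assume n: "n > 0"
 have "B \<subseteq> (%(i, a). \<beta> i a) ` ({..<N} \<times> {0..<int n})"
 proof
  fix x assume "x : B"
  then obtain i a where x: "x = \<beta> i a" "i < N" by (auto simp: B_eq)
  hence "x = \<beta> i (a mod int n)" by (simp add: \<beta>_eq dvd_eq_mod_eq_0 mod_diff_right_eq)
  thus "x : (%(i, a). \<beta> i a) ` ({..<N} \<times> {0..<int n})" using x(2) n by auto
 qed
 thus ?thesis by (rule finite_subset) simp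
qed

text \<open>Functions on the finite set \<open>B\<close> are the same as n-periodic sequences
  through \<beta>, so the eigenvalue problem of the Gram operator is the one of
  \<open>periodic_eigenvalue_iff\<close>.\<close>

lemma singular_values_eq:
 assumes n: "n > 0"
 shows "singular_values B matrix_op = {s. 0 <= s & (\<exists>z\<in>unity_roots n. s\<^sup>2 : set (ev z))}"
proof -
 have "(\<exists>u\<in>ell2 B. u ~= (%x. 0) & gram u = (%x. of_real (s\<^sup>2) * u x)) \<longleftrightarrow>
  (\<exists>w. (\<forall>i a. w i (a + int n) = w i a) & (\<exists>i<N. \<exists>a. w i a ~= 0) & (\<forall>i<N. \<forall>a. dT w i a = of_real (s\<^sup>2) * w i a))"
  (is "?l \<longleftrightarrow> ?r") for s
 proof
  assume ?l
  then obtain u where u: "u : ell2 B" "u ~= (%x. 0)" "gram u = (%x. of_real (s\<^sup>2) * u x)" by blast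
  obtain x where "x : B" "u x ~= 0" using u(1,2) by (auto simp: ell2_def)
  hence ne: "\<exists>i<N. \<exists>a. u (\<beta> i a) ~= 0" by (auto simp: B_eq)
  define w where "w i a = (if i < N then u (\<beta> i a) else 0)" for i a
  have "dT w i a = of_real (s\<^sup>2) * w i a" if "i < N" for i a
  proof -
   have "dT w i a = dT (%i a. u (\<beta> i a)) i a" by (rule dT_cong[of a 0]) (auto simp: w_def)
   thus ?thesis using gram_\<beta>[OF that, of u a] u(3) that by (simp add: w_def)
  qed
  moreover have "w i (a + int n) = w i a" for i a using \<beta>_eq[of i i "a + int n" a] by (simp add: w_def)
  moreover have "\<exists>i<N. \<exists>a. w i a ~= 0" using ne by (auto simp: w_def)
  ultimately show ?r by blast
 next
  assume ?r
  then obtain w where w: "!!i a. w i (a + int n) = w i a" "!!i a. i < N ==> dT w i a = of_real (s\<^sup>2) * w i a"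
   and ne: "\<exists>i<N. \<exists>a. w i a ~= 0" by blast
  \<comment> \<open>A cell has many names; periodicity of \<open>w\<close> makes the value
    independent of the chosen one.\<close>
  define u where "u x = (if x : B then let p = SOME p. fst p < N & x = \<beta> (fst p) (snd p) in w (fst p) (snd p) else 0)" for x
  have u: "u (\<beta> i a) = w i a" if i: "i < N" for i a
  proof -
   define p where "p = (SOME p. fst p < N & \<beta> i a = \<beta> (fst p) (snd p))"
   have "fst p < N & \<beta> i a = \<beta> (fst p) (snd p)" unfolding p_def by (rule someI[of _ "(i, a)"]) (use i in auto)
   hence p: "fst p = i" "int n dvd a - snd p" using \<beta>_eq[OF i, of "fst p" a "snd p"] by auto
   obtain k where "a - snd p = int n * k" using p(2) by (elim dvdE)
   hence "a = snd p + int n * k" by simp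
   hence "w i a = w i (snd p)" using periodic_mult[of "w i" n "snd p" k, OF w(1)] by simp
   moreover have "\<beta> i a : B" using i by (auto simp: B_eq)
   ultimately show ?thesis using p(1) by (simp add: u_def p_def[symmetric] Let_def)
  qed
  have "gram u = (%x. of_real (s\<^sup>2) * u x)"
  proof
   fix x
   show "gram u x = of_real (s\<^sup>2) * u x"
   proof (cases "x : B")
    case True
    then obtain i a where x: "x = \<beta> i a" and i: "i < N" by (auto simp: B_eq)
    have "dT (%i a. u (\<beta> i a)) i a = dT w i a" by (rule dT_cong[of a 0]) (auto simp: u)
    thus ?thesis using gram_\<beta>[OF i, of u a] w(2)[OF i] u[OF i] by (simp add: x)
   qed (simp add: gram_outside u_def)
  qed
  moreover have "u ~= (%x. 0)" using ne u by (metis (no_types, lifting))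
  moreover have "u : ell2 B"
  proof -
   have "(%x. (cmod (u x))\<^sup>2) summable_on B" using finite_B[OF n] by (rule summable_on_finite)
   hence "(%x. (cmod (u x))\<^sup>2) summable_on UNIV"
    by (rule summable_on_cong_neutral[THEN iffD1, rotated -1]) (auto simp: u_def)
   thus ?thesis by (auto simp: ell2_def u_def)
  qed
  ultimately show ?l by blast
 qed
 thus ?thesis
  unfolding singular_values_def gram_def[symmetric] comp_def[symmetric] periodic_eigenvalue_iff[OF n]
  by (simp add: gram_def o_def)
qed

end

context cyclic_matrix
begin

lemma gram_power_\<beta>:
 assumes n: "n = 0" and i: "i < N" and j: "j < N"
 shows "l2_fun ((gram_l2 ^^ k) (basis_l2 (\<beta> i a) 1)) (\<beta> j b) = (dT ^^ k) (delta i a) j b"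
 using j
proof (induction k arbitrary: j b)
 case 0
 thus ?case using \<beta>_eq[OF 0 i, of b a] n by (auto simp: l2_fun_basis_l2 delta_def)
next
 case (Suc k)
 have "l2_fun ((gram_l2 ^^ Suc k) (basis_l2 (\<beta> i a) 1)) (\<beta> j b)
   = dT (%j b. l2_fun ((gram_l2 ^^ k) (basis_l2 (\<beta> i a) 1)) (\<beta> j b)) j b"
  by (simp add: l2_fun_gram_l2 gram_\<beta>[OF Suc.prems])
 also have "... = dT ((dT ^^ k) (delta i a)) j b"
  by (rule dT_cong[of b 0]) (auto simp: Suc.IH)
 finally show ?case by simp
qed

lemma gram_power_moment:
 assumes "n = 0" "i < N"
 shows "(gram_l2 ^^ k) (basis_l2 (\<beta> i a) 1) \<bullet> basis_l2 (\<beta> i a) 1 = Re (moment k i)"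
 by (simp add: inner_basis_l2 gram_power_\<beta>[OF assms assms(2)] moment_translate)

lemma trace_poly_op:
 assumes n: "n = 0" and n': "n' > 2 * L * degree p"
 shows "(\<Sum>i<N. poly_op gram_l2 p (basis_l2 (\<beta> i (a i)) 1) \<bullet> basis_l2 (\<beta> i (a i)) 1) = root_average ev (poly p) n'"
proof -
 have "(\<Sum>i<N. poly_op gram_l2 p (basis_l2 (\<beta> i (a i)) 1) \<bullet> basis_l2 (\<beta> i (a i)) 1)
   = (\<Sum>k\<le>degree p. coeff p k * Re (\<Sum>i<N. moment k i))"
  unfolding poly_op_inner
  by (subst sum.swap) (simp add: gram_power_moment[OF n] sum_distrib_left)
 also have "... = root_average ev (poly p) n'"
  unfolding root_average_poly
 proof (intro sum.cong refl)
  fix k assume "k : {..degree p}"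
  hence "2 * L * k <= 2 * L * degree p" by (intro mult_left_mono) auto
  hence "2 * L * k < n'" using n' by (rule order_le_less_trans)
  thus "coeff p k * Re (\<Sum>i<N. moment k i) = coeff p k * root_average ev (%a. a ^ k) n'"
   by (simp only: sum_moment Re_complex_of_real)
 qed
 finally show ?thesis .
qed

lemma ev_bounds:
 assumes "cmod z = 1" "a : set (ev z)"
 shows "0 <= a" "a <= gram_bound"
proof -
 show "0 <= a" using ev(5)[OF assms] .
 define x where "x = (real total)\<^sup>2"
 have "0 <= x\<^sup>2 - 2 * x + 1" using zero_le_power2[of "x - 1"] by (simp add: power2_diff)
 moreover have "0 <= x" by (simp add: x_def)
 ultimately have "x <= x\<^sup>2 + 1" by linarith
 hence "x <= gram_bound" by (simp add: gram_bound_def x_def flip: power_mult)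
 thus "a <= gram_bound" using ev_le_total[OF assms] by (simp add: x_def)
qed

text \<open>Polynomials have exact traces by \<open>trace_poly_op\<close>. A uniform approximation
  on [0, gram_bound], which contains the spectrum of the Gram operator and all eigenvalues of the
  symbols, changes trace and average by at most N e each.\<close>

lemma trace_fc:
 assumes n: "n = 0" and f: "continuous_on {0..gram_bound} f"
 shows "(%n. root_average ev f n) \<longlonglongrightarrow>
  (\<Sum>i<N. gram.fc f (basis_l2 (\<beta> i (a i)) 1) \<bullet> basis_l2 (\<beta> i (a i)) 1)"
proof (rule LIMSEQ_I)
 fix r :: real assume r: "r > 0"
 define e where "e = r / (3 * (real N + 1))"
 have e: "e > 0" using r by (simp add: e_def)
 have Ne: "2 * (real N * e) < r"
 proof -
  have "3 * (real N + 1) * e = r" by (simp add: e_def)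
  hence "3 * (real N * e) + 3 * e = r" by (simp add: distrib_left distrib_right)
  moreover have "0 <= real N * e" using e by simp
  ultimately show ?thesis using e by linarith
 qed
 obtain q where q: "uniform_limit {0..gram_bound} (%n. poly (q n)) f sequentially"
  using uniform_limit_polynomials_exist[OF f] by meson
 obtain k where "\<forall>x\<in>{0..gram_bound}. dist (poly (q k) x) (f x) < e"
  using uniform_limitD[OF q e] by (auto simp: eventually_sequentially)
 hence close: "\<bar>f x - poly (q k) x\<bar> <= e" if "0 <= x" "x <= gram_bound" for x
  using that by (force simp: dist_real_def)
 define e' where "e' i = basis_l2 (\<beta> i (a i)) 1" for i
 have norm_e': "norm (e' i) = 1" for i
 proof -
  have "e' i \<bullet> e' i = 1" unfolding e'_def inner_basis_l2 by (simp add: l2_fun_basis_l2)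
  thus ?thesis by (simp add: norm_eq_sqrt_inner)
 qed
 have 1: "\<bar>(\<Sum>i<N. gram.fc f (e' i) \<bullet> e' i) - (\<Sum>i<N. poly_op gram_l2 (q k) (e' i) \<bullet> e' i)\<bar> <= real N * e"
 proof -
  have "\<bar>gram.fc f (e' i) \<bullet> e' i - poly_op gram_l2 (q k) (e' i) \<bullet> e' i\<bar> <= e" for i
  proof -
   have "gram.fc f (e' i) \<bullet> e' i - poly_op gram_l2 (q k) (e' i) \<bullet> e' i = gram.fc (%x. f x - poly (q k) x) (e' i) \<bullet> e' i"
    by (subst gram.fc_diff[OF f]) (auto simp: inner_diff_left intro!: continuous_intros)
   also have "\<bar>...\<bar> <= norm (gram.fc (%x. f x - poly (q k) x) (e' i)) * norm (e' i)" by (rule Cauchy_Schwarz_ineq2)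
   also have "... <= e * norm (e' i) * norm (e' i)"
    by (intro mult_right_mono gram.fc_norm_le_UNIV close) (auto intro!: continuous_intros f)
   finally show ?thesis by (simp add: norm_e')
  qed
  hence "(\<Sum>i<N. \<bar>gram.fc f (e' i) \<bullet> e' i - poly_op gram_l2 (q k) (e' i) \<bullet> e' i\<bar>) <= (\<Sum>i<N. e)"
   by (intro sum_mono)
  thus ?thesis unfolding sum_subtractf[symmetric] by (intro order_trans[OF sum_abs]) simp
 qed
 have "norm (root_average ev f n' - (\<Sum>i<N. gram.fc f (e' i) \<bullet> e' i)) < r" if n': "n' > 2 * L * degree (q k)" for n'
 proof -
  have n0: "n' > 0" using n' by simp
  have "\<bar>root_average ev f n' - root_average ev (poly (q k)) n'\<bar> <= real N * e"
   by (rule root_average_close[OF n0])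
     (use ev(1) unity_roots_norm[OF _ n0] close ev_bounds in blast)+
  moreover have "(\<Sum>i<N. poly_op gram_l2 (q k) (e' i) \<bullet> e' i) = root_average ev (poly (q k)) n'"
   unfolding e'_def by (rule trace_poly_op[OF n n'])
  ultimately show ?thesis using 1 Ne unfolding real_norm_def by linarith
 qed
 thus "\<exists>no. \<forall>n\<ge>no. norm (root_average ev f n - (\<Sum>i<N. gram.fc f (basis_l2 (\<beta> i (a i)) 1) \<bullet> basis_l2 (\<beta> i (a i)) 1)) < r"
  unfolding e'_def by (intro exI[of _ "Suc (2 * L * degree (q k))"]) simp
qed

lemma spectral_density_limits:
 assumes n: "n = 0"
 obtains tau F where "!!s k. (%n. root_average ev (ramp s k) n) \<longlonglongrightarrow> tau s k"
  "!!s. (%k. tau s k) \<longlonglongrightarrow> F s"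
  "spectral_density ((%i. range (\<beta> i)) ` {..<N}) B matrix_op = (%l. F (l\<^sup>2))"
proof -
 have "\<exists>a. (SOME b. b : range (\<beta> i)) = \<beta> i a" for i
  using someI[of "%b. b : range (\<beta> i)" "\<beta> i 0"] by blast
 \<comment> \<open>The von Neumann trace picks an unspecified cell in each orbit. It is some
   translate \<open>\<beta> i (a i)\<close>, and \<open>trace_fc\<close> holds for every choice of
   \<open>a\<close>.\<close>
 then obtain a where a: "!!i. (SOME b. b : range (\<beta> i)) = \<beta> i (a i)" by metis
 define tau where "tau s k = (\<Sum>i<N. gram.fc (ramp s k) (basis_l2 (\<beta> i (a i)) 1) \<bullet> basis_l2 (\<beta> i (a i)) 1)" for s k
 define F where "F s = (\<Sum>i<N. gram.specproj s (basis_l2 (\<beta> i (a i)) 1) \<bullet> basis_l2 (\<beta> i (a i)) 1)" for s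
 show ?thesis
 proof (rule that[of tau F])
  show "(%n. root_average ev (ramp s k) n) \<longlonglongrightarrow> tau s k" for s k
   unfolding tau_def by (rule trace_fc[OF n ramp_continuous])
  show "(%k. tau s k) \<longlonglongrightarrow> F s" for s
   unfolding tau_def F_def by (intro tendsto_sum tendsto_inner gram.specproj_limit tendsto_const)
  have inj: "inj_on (%i. range (\<beta> i)) {..<N}"
  proof (rule inj_onI)
   fix i j assume ij: "i : {..<N}" "j : {..<N}" and eq: "range (\<beta> i) = range (\<beta> j)"
   then obtain b where "\<beta> i 0 = \<beta> j b" by blast
   thus "i = j" using \<beta>_eq[of i j 0 b] ij by simp
  qed
  show "spectral_density ((%i. range (\<beta> i)) ` {..<N}) B matrix_op = (%l. F (l\<^sup>2))"
  proof
   fix l :: real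
   have "Re (ell2_inner (spectral_projection B gram (l\<^sup>2) (basis_vector (\<beta> i (a i)))) (basis_vector (\<beta> i (a i))))
     = gram.specproj (l\<^sup>2) (basis_l2 (\<beta> i (a i)) 1) \<bullet> basis_l2 (\<beta> i (a i)) 1" if "i < N" for i
    by (rule spectral_projection_diagonal) (use that in \<open>auto simp: B_eq\<close>)
   thus "spectral_density ((%i. range (\<beta> i)) ` {..<N}) B matrix_op l = F (l\<^sup>2)"
    unfolding spectral_density_def von_Neumann_trace_def gram_def[symmetric] sum.reindex[OF inj]
    by (simp add: a Let_def F_def)
  qed
 qed
qed

end

section \<open>Comparison of shrinkage rates and spectral density\<close>

context convolution
begin

definition char_coeff :: "nat => complex poly" where
 "char_coeff j = coeff (char_poly gram_poly) j"

lemma coeff_char_poly_gram_symbol: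
 assumes "z ~= 0"
 shows "coeff (char_poly (z ^ (2 * L) \<cdot>\<^sub>m gram_symbol z)) j = poly (char_coeff j) z"
 unfolding char_poly_gram_poly[OF assms, symmetric] char_coeff_def by (simp add: coeff_map_poly)

text \<open>The characteristic polynomial of the rescaled symbol is then the pure power x^N.\<close>

lemma ev_eq_0:
 assumes "!!j. j < N ==> char_coeff j = 0" and z: "cmod z = 1" and a: "a : set (ev z)"
 shows "a = 0"
proof -
 have z0: "z ~= 0" using z by auto
 define p where "p = char_poly (z ^ (2 * L) \<cdot>\<^sub>m gram_symbol z)"
 have carrier: "z ^ (2 * L) \<cdot>\<^sub>m gram_symbol z : carrier_mat N N" by simp
 have "p = Polynomial.monom 1 N"
 proof (rule poly_eqI)
  fix j
  consider "j < N" | "j = N" | "j > N" by linarith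
  thus "coeff p j = coeff (Polynomial.monom 1 N) j"
   using degree_monic_char_poly[OF carrier] assms(1)[of j] coeff_char_poly_gram_symbol[OF z0, of j]
   by cases (auto simp: p_def coeff_eq_0)
 qed
 moreover have "poly p (z ^ (2 * L) * of_real a) = 0"
  using a by (induction "ev z") (auto simp: p_def ev(3)[OF z] poly_prod_list prod_list_zero_iff)
 ultimately show "a = 0" using z0 by (simp add: poly_monom)
qed

theorem shrinkage_rates:
 fixes tau :: "real => nat => real" and F :: "real => real" and \<sigma> :: "nat => real"
 assumes tau: "!!s k. (%n. root_average ev (ramp s k) n) \<longlonglongrightarrow> tau s k"
  and F: "!!s. (%k. tau s k) \<longlonglongrightarrow> F s"
  and \<sigma>: "!!n. n > 0 ==> \<sigma> n = Min {s. 0 < s & (\<exists>z\<in>unity_roots n. s\<^sup>2 : set (ev z))}"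
 defines "lo \<equiv> liminf (%n. ereal (- ln (\<sigma> n) / ln (real n)))"
  and "hi \<equiv> limsup (%n. ereal (- ln (\<sigma> n) / ln (real n)))"
  and "alpha \<equiv> novikov_shubin (%l. F (l\<^sup>2))"
 shows "lo = hi & hi = 0 \<longleftrightarrow> alpha = Infinity_plus"
  "lo = hi & hi > 0 \<or> lo < hi ==> alpha = NS_val (inverse lo)"
proof -
 \<comment> \<open>Both claims follow from this dichotomy: a positive \<open>lo\<close> excludes
   type I, and lo = hi = 0 excludes types II and III.\<close>
 have "(lo = hi & hi = 0 & alpha = Infinity_plus) \<or> (0 < lo & alpha = NS_val (inverse lo))"
 proof (cases "\<forall>j<N. char_coeff j = 0")
  case True
  have ev0: "a = 0" if "n > 0" "z : unity_roots n" "a : set (ev z)" for n z a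
   using ev_eq_0[of z a] True unity_roots_norm[OF that(2,1)] that(3) by blast
  have \<sigma>': "\<sigma> n = Min {}" if "n > 0" for n
  proof -
   have "{s. 0 < s & (\<exists>z\<in>unity_roots n. s\<^sup>2 : set (ev z))} = {}"
    using ev0[OF that] by fastforce
   thus ?thesis using \<sigma>[OF that] by (simp only:)
  qed
  \<comment> \<open>Without positive singular values \<open>\<sigma> n\<close> is the unspecified
    but fixed number \<open>Min {}\<close>, and the quotient still tends to 0.\<close>
  have "(%n. - ln (Min {}) / ln (real n)) \<longlonglongrightarrow> 0" by real_asymp
  hence "(%n. ereal (- ln (\<sigma> n) / ln (real n))) \<longlonglongrightarrow> 0"
   unfolding zero_ereal_def
   by (intro tendsto_ereal) (rule tendsto_cong[THEN iffD1, rotated], assumption,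
     use \<sigma>' in \<open>auto intro!: eventually_mono[OF eventually_gt_at_top[of 0]]\<close>)
  hence "lo = 0" "hi = 0"
   unfolding lo_def hi_def
   by (rule lim_imp_Liminf[OF trivial_limit_sequentially], rule lim_imp_Limsup[OF trivial_limit_sequentially])
  moreover have "alpha = Infinity_plus"
  proof -
   have "root_average ev (ramp 1 k) n = root_average ev (ramp 0 k) n" if "n > 0" for n k
   proof -
    have eq: "ramp 1 k a = ramp 0 k a" if "a : set (ev z)" "z : unity_roots n" for z a
     using ev0[OF \<open>n > 0\<close> that(2,1)] by (simp add: ramp_eq_1)
    show ?thesis unfolding root_average_def
     by (intro arg_cong2[of _ _ _ _ "(/)"] sum.cong refl arg_cong[of _ _ sum_list] map_cong eq)
   qed
   hence "\<forall>\<^sub>F n in sequentially. root_average ev (ramp 1 k) n = root_average ev (ramp 0 k) n" for k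
    by (rule eventually_mono[OF eventually_gt_at_top[of 0]])
   hence "(%n. root_average ev (ramp 1 k) n) \<longlonglongrightarrow> tau 0 k" for k
    using tau[of 0 k] by (subst tendsto_cong)
   hence "tau 1 k = tau 0 k" for k using tau[of 1 k] LIMSEQ_unique by blast
   hence "F 1 = F 0" using F[of 1] F[of 0] LIMSEQ_unique by simp
   hence "\<not> (\<forall>l>0. F (l\<^sup>2) > F (0\<^sup>2))" by (metis less_irrefl one_power2 power_zero_numeral zero_less_one_class.zero_less_one)
   thus ?thesis unfolding alpha_def novikov_shubin_def by (simp only: if_False)
  qed
  ultimately show ?thesis by simp
 next
  case False
  \<comment> \<open>\<open>j\<close> is the generic dimension of the kernel of H: all lower
    coefficients vanish identically. \<open>j < N\<close> leaves room for the next coefficient,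
    possibly the leading 1.\<close>
  define j where "j = (LEAST j. char_coeff j ~= 0)"
  obtain j' where j': "j' < N" "char_coeff j' ~= 0" using False by blast
  have j: "char_coeff j ~= 0" "j < N" "!!i. i < j ==> char_coeff i = 0"
  proof -
   show "char_coeff j ~= 0" unfolding j_def by (rule LeastI, rule j'(2))
   have "j <= j'" unfolding j_def by (rule Least_le, rule j'(2))
   thus "j < N" using j'(1) by simp
   show "char_coeff i = 0" if "i < j" for i using not_less_Least[OF that[unfolded j_def]] by simp
  qed
  have roots: "poly (char_coeff (Suc j)) z ~= 0"
   "!!a. a : set (ev z) ==> a ~= 0 ==> cmod (poly (char_coeff j) z) / cmod (poly (char_coeff (Suc j)) z) <= a"
   "\<exists>a\<in>set (ev z). a ~= 0 & a <= real N * (cmod (poly (char_coeff j) z) / cmod (poly (char_coeff (Suc j)) z))"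
   if z: "cmod z = 1" and nz: "poly (char_coeff j) z ~= 0" for z
  proof -
   have z0: "z ~= 0" using z by auto
   note * = smallest_root_vs_coefficients[OF ev(5)[OF z] _ ev(3)[OF z, of "z ^ (2 * L)"], of j,
     unfolded coeff_char_poly_gram_symbol[OF z0] ev(1)[OF z]]
   have 1: "cmod (z ^ (2 * L)) = 1" using z by (simp add: norm_power)
   have 2: "poly (char_coeff i) z = 0" if "i < j" for i using j(3)[OF that] by simp
   show "poly (char_coeff (Suc j)) z ~= 0"
    "!!a. a : set (ev z) ==> a ~= 0 ==> cmod (poly (char_coeff j) z) / cmod (poly (char_coeff (Suc j)) z) <= a"
    "\<exists>a\<in>set (ev z). a ~= 0 & a <= real N * (cmod (poly (char_coeff j) z) / cmod (poly (char_coeff (Suc j)) z))"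
    using *[OF _ 1 2 nz j(2)] by auto
  qed
  interpret circle_quotient "char_coeff j" "char_coeff (Suc j)" "(real total)\<^sup>2"
  proof
   show "char_coeff j ~= 0" by (rule j(1))
   fix z :: complex assume z: "cmod z = 1" and nz: "poly (char_coeff j) z ~= 0"
   show "poly (char_coeff (Suc j)) z ~= 0" by (rule roots(1)[OF z nz])
   obtain a where a: "a : set (ev z)" "a ~= 0" using roots(3)[OF z nz] by blast
   show "cmod (poly (char_coeff j) z) / cmod (poly (char_coeff (Suc j)) z) <= (real total)\<^sup>2"
    using roots(2)[OF z nz a] ev_le_total[OF z a(1)] by simp
  qed
  interpret circle_density "char_coeff j" "char_coeff (Suc j)" "(real total)\<^sup>2" N ev tau F
   by unfold_locales (use ev(1,5) tau F roots in \<open>auto simp: q_def\<close>)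
  have eq: "- ln (\<sigma> n) / ln (real n) = decay_rate (smallest_positive ev n) n" if n: "n > card Z" for n
  proof -
   have n0: "n > 0" using n by simp
   let ?A = "{a. 0 < a & (\<exists>z\<in>unity_roots n. a : set (ev z))}"
   have "{s. 0 < s & (\<exists>z\<in>unity_roots n. s\<^sup>2 : set (ev z))} = sqrt ` ?A"
   proof (intro equalityI subsetI)
    fix s assume s: "s : {s. 0 < s & (\<exists>z\<in>unity_roots n. s\<^sup>2 : set (ev z))}"
    hence "s = sqrt (s\<^sup>2)" "s\<^sup>2 : ?A" by auto
    thus "s : sqrt ` ?A" by blast
   qed auto
   hence "\<sigma> n = sqrt (smallest_positive ev n)"
    using \<sigma>[OF n0] mono_Min_commute[of sqrt ?A] finite_pos_spec[OF n0] pos_spec_nonempty[OF n]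
    by (simp add: smallest_positive_def mono_def)
   thus ?thesis by (simp add: decay_rate_def)
  qed
  hence ev_eq: "\<forall>\<^sub>F n in sequentially. ereal (- ln (\<sigma> n) / ln (real n)) = ereal (decay_rate (smallest_positive ev n) n)"
   using eventually_mono[OF eventually_gt_at_top[of "card Z"]] by simp
  have lo: "lo = ereal (real kappa / 2)"
   unfolding lo_def Liminf_eq[OF ev_eq] by (rule liminf_decay_rate)
  show ?thesis
  proof (cases "kappa = 0")
   case True
   have "(%n. ereal (decay_rate (smallest_positive ev n) n)) \<longlonglongrightarrow> 0"
    unfolding zero_ereal_def by (intro tendsto_ereal decay_rate_tendsto_0 True)
   hence "hi = 0"
    unfolding hi_def Limsup_eq[OF ev_eq] by (rule lim_imp_Limsup[OF trivial_limit_sequentially])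
   thus ?thesis using lo True novikov_shubin_kappa_0[OF True] by (simp add: alpha_def zero_ereal_def)
  next
   case False
   hence "alpha = NS_val (ereal (2 / real kappa))" unfolding alpha_def by (intro novikov_shubin_kappa_pos) simp
   thus ?thesis using lo False by simp
  qed
 qed
 thus "lo = hi & hi = 0 \<longleftrightarrow> alpha = Infinity_plus"
  "lo = hi & hi > 0 \<or> lo < hi ==> alpha = NS_val (inverse lo)"
  by auto
qed

end

section \<open>Lifting in covering spaces\<close>

lemma continuous_on_locally:
 assumes "!!x. x : U ==> \<exists>V. openin (top_of_set U) V & x : V & continuous_on V f"
 shows "continuous_on U f"
 unfolding continuous_on_def
proof
 fix x assume "x : U"
 then obtain V where V: "openin (top_of_set U) V" "x : V" "continuous_on V f" using assms by blast
 obtain W where W: "open W" "V = U \<inter> W" using V(1) by (auto simp: openin_open)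
 have "(f \<longlongrightarrow> f x) (at x within V)" using V by (simp add: continuous_on_def)
 moreover have "at x within V = at x within U"
  using W V(2) by (intro at_within_nhd[of x W]) auto
 ultimately show "(f \<longlongrightarrow> f x) (at x within U)" by simp
qed

lemma openin_vimage:
 assumes "continuous_on V f" "f ` V \<subseteq> E" "openin (top_of_set E) u"
 shows "openin (top_of_set V) (V \<inter> f -` u)"
 using continuous_openin_preimage[OF assms(1) _ assms(3)] assms(2) by blast

locale covering =
 fixes E :: "'e::topological_space set" and p :: "'e => 's::topological_space" and S :: "'s set"
 assumes cov: "covering_space E p S"
begin

lemma p_continuous: "continuous_on E p" and p_surj: "p ` E = S"
 using cov by (simp_all add: covering_space_def)

lemma p_in: "e : E ==> p e : S"
 using p_surj by blast

text \<open>Around each point both lifts stay in fixed sheets, and distinct sheets are disjoint, so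
  agreement is locally constant. The argument works for covers that are mere topological
  spaces.\<close>

lemma lift_unique:
 fixes g1 g2 :: "'a::topological_space => 'e"
 assumes T: "connected T" and a: "a : T" "g1 a = g2 a"
  and g1: "continuous_on T g1" "g1 ` T \<subseteq> E" and g2: "continuous_on T g2" "g2 ` T \<subseteq> E"
  and eq: "!!x. x : T ==> p (g1 x) = p (g2 x)" and x: "x : T"
 shows "g1 x = g2 x"
proof -
 have "\<exists>V. openin (top_of_set T) V & x : V & (\<forall>y\<in>V. g1 y = g2 y \<longleftrightarrow> g1 x = g2 x)" if x: "x : T" for x
 proof -
  have "p (g1 x) : S" using x g1(2) p_in by blast
  then obtain W v where W: "p (g1 x) : W" "\<Union>v = E \<inter> p -` W" "!!u. u : v ==> openin (top_of_set E) u"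
   "pairwise disjnt v" "!!u. u : v ==> \<exists>q. homeomorphism u W p q"
   using cov unfolding covering_space_def by metis
  have "g1 x : \<Union>v" "g2 x : \<Union>v" using W(1,2) x g1(2) g2(2) eq[OF x] by auto
  then obtain u1 u2 where u: "u1 : v" "g1 x : u1" "u2 : v" "g2 x : u2" by blast
  define V where "V = (T \<inter> g1 -` u1) \<inter> (T \<inter> g2 -` u2)"
  have "openin (top_of_set T) V"
   unfolding V_def by (intro openin_Int openin_vimage[OF g1 W(3)] openin_vimage[OF g2 W(3)] u)
  moreover have "g1 y = g2 y \<longleftrightarrow> u1 = u2" if y: "y : V" for y
  proof
   assume "g1 y = g2 y"
   thus "u1 = u2" using y u(1,3) W(4) by (auto simp: V_def pairwise_def disjnt_def)
  next
   assume "u1 = u2"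
   obtain q where q: "homeomorphism u1 W p q" using W(5) u(1) by blast
   have "g1 y : u1" "g2 y : u1" "p (g1 y) = p (g2 y)" using y eq by (auto simp: V_def \<open>u1 = u2\<close>)
   thus "g1 y = g2 y" using q unfolding homeomorphism_def by metis
  qed
  moreover have "x : V" using x u by (simp add: V_def)
  ultimately show ?thesis by blast
 qed
 then obtain V where V: "!!x. x : T ==> openin (top_of_set T) (V x)" "!!x. x : T ==> x : V x"
  "!!x y. x : T ==> y : V x ==> g1 y = g2 y \<longleftrightarrow> g1 x = g2 x" by metis
 define A where "A = (\<Union>x\<in>{x\<in>T. g1 x = g2 x}. V x)"
 define B where "B = (\<Union>x\<in>{x\<in>T. g1 x ~= g2 x}. V x)"
 have "openin (top_of_set T) A" "openin (top_of_set T) B" unfolding A_def B_def using V(1) by (auto intro!: openin_Union)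
 moreover have "T \<subseteq> A \<union> B" using V(2) by (auto simp: A_def B_def)
 moreover have "A \<inter> B = {}" using V(3) by (auto simp: A_def B_def)
 moreover have "A ~= {}" using a V(2) by (auto simp: A_def)
 ultimately have "B = {}" using T by (metis connected_openin)
 thus ?thesis using x V(2) by (auto simp: B_def)
qed

definition lifts :: "(real \<times> 'u => 's) => real => real => 'u::topological_space set => ('u => 'e) => (real \<times> 'u => 'e) => bool" where
 "lifts h a b V f k \<longleftrightarrow> continuous_on ({a..b} \<times> V) k & k ` ({a..b} \<times> V) \<subseteq> E & (\<forall>y\<in>V. k (a, y) = f y)
   & (\<forall>t\<in>{a..b}. \<forall>y\<in>V. p (k (t, y)) = h (t, y))"

text \<open>Bisection of time (\<open>Bolzano\<close>) plays the role of a Lebesgue number: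
  \<open>P a b\<close> passes to adjacent intervals and holds on short ones. It quantifies over all
  initial lifts on all neighbourhoods because the neighbourhood shrinks at each concatenation.
  \<open>h\<close> is given for all times because the short intervals may leave [0, 1].\<close>

lemma lift_homotopy_local:
 fixes h :: "real \<times> 'u::topological_space => 's" and f :: "'u => 'e"
 assumes h: "continuous_on (UNIV \<times> U) h" "h ` (UNIV \<times> U) \<subseteq> S" and y0: "y0 : U"
  and f: "continuous_on U f" "f ` U \<subseteq> E" "!!y. y : U ==> p (f y) = h (0, y)"
 obtains V k where "openin (top_of_set U) V" "y0 : V" "lifts h 0 1 V f k"
proof -
 define P where "P a b \<longleftrightarrow> (\<forall>W f. openin (top_of_set U) W & y0 : W & continuous_on W f & f ` W \<subseteq> E & (\<forall>y\<in>W. p (f y) = h (a, y))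
  --> (\<exists>V k. openin (top_of_set U) V & y0 : V & V \<subseteq> W & lifts h a b V f k))" for a b
 have "P 0 1"
 proof (rule Bolzano)
  fix a b c assume trans: "P a b" "P b c" "a <= b" "b <= c"
  show "P a c" unfolding P_def
  proof (intro allI impI, elim conjE)
   fix W f assume W: "openin (top_of_set U) W" "y0 : W" "continuous_on W f" "f ` W \<subseteq> E" "\<forall>y\<in>W. p (f y) = h (a, y)"
   then obtain V k where V: "openin (top_of_set U) V" "y0 : V" "V \<subseteq> W" "continuous_on ({a..b} \<times> V) k" "k ` ({a..b} \<times> V) \<subseteq> E"
     "\<forall>y\<in>V. k (a, y) = f y" "\<forall>t\<in>{a..b}. \<forall>y\<in>V. p (k (t, y)) = h (t, y)"
    using trans(1)[unfolded P_def lifts_def, rule_format, of W f] by blast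
   have "continuous_on V (%y. k (b, y))"
    by (rule continuous_on_compose2[OF V(4)]) (use trans(3) in \<open>auto intro!: continuous_intros\<close>)
   moreover have "(%y. k (b, y)) ` V \<subseteq> E" "\<forall>y\<in>V. p (k (b, y)) = h (b, y)" using V(5,7) trans(3) by auto
   ultimately obtain V' k' where V': "openin (top_of_set U) V'" "y0 : V'" "V' \<subseteq> V" "continuous_on ({b..c} \<times> V') k'"
     "k' ` ({b..c} \<times> V') \<subseteq> E" "\<forall>y\<in>V'. k' (b, y) = k (b, y)" "\<forall>t\<in>{b..c}. \<forall>y\<in>V'. p (k' (t, y)) = h (t, y)"
    using trans(2)[unfolded P_def lifts_def, rule_format, of V "%y. k (b, y)"] V(1,2) by blast
   have un: "{a..c} \<times> V' = {a..b} \<times> V' \<union> {b..c} \<times> V'" using trans(3,4) by auto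
   let ?k = "%x. if fst x <= b then k x else k' x"
   have "continuous_on ({a..c} \<times> V') ?k"
    unfolding un
   proof (rule continuous_on_cases_local)
    have "{a..b} \<times> V' = ({a..b} \<times> V' \<union> {b..c} \<times> V') \<inter> ({..b} \<times> UNIV)" using trans(3,4) by auto
    thus "closedin (top_of_set ({a..b} \<times> V' \<union> {b..c} \<times> V')) ({a..b} \<times> V')"
     by (metis closedin_closed_Int closed_Times closed_atMost closed_UNIV)
    have "{b..c} \<times> V' = ({a..b} \<times> V' \<union> {b..c} \<times> V') \<inter> ({b..} \<times> UNIV)" using trans(3,4) by auto
    thus "closedin (top_of_set ({a..b} \<times> V' \<union> {b..c} \<times> V')) ({b..c} \<times> V')"
     by (metis closedin_closed_Int closed_Times closed_atLeast closed_UNIV)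
    show "continuous_on ({a..b} \<times> V') k" by (rule continuous_on_subset[OF V(4)]) (use V'(3) in auto)
    show "continuous_on ({b..c} \<times> V') k'" by (rule V'(4))
    fix x assume "x : {a..b} \<times> V' & \<not> fst x <= b \<or> x : {b..c} \<times> V' & fst x <= b"
    hence "x : {b} \<times> V'" by auto
    thus "k x = k' x" using V'(6) by auto
   qed
   moreover have "?k ` ({a..c} \<times> V') \<subseteq> E" 
   proof (rule image_subsetI)
    fix x assume "x : {a..c} \<times> V'"
    hence "(fst x <= b --> x : {a..b} \<times> V) & (\<not> fst x <= b --> x : {b..c} \<times> V')"
     using V'(3) by auto
    thus "?k x : E" using V(5) V'(5) by (cases "fst x <= b") (simp_all only: if_True if_False, blast+)
   qed
   moreover have "\<forall>y\<in>V'. ?k (a, y) = f y" using V(6) V'(3) trans(3) by auto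
   moreover have "\<forall>t\<in>{a..c}. \<forall>y\<in>V'. p (?k (t, y)) = h (t, y)" using V(7) V'(3,7) by auto
   moreover have "V' \<subseteq> W" using V(3) V'(3) by blast
   ultimately show "\<exists>V k. openin (top_of_set U) V & y0 : V & V \<subseteq> W & lifts h a c V f k"
    unfolding lifts_def using V'(1,2) by blast
  qed
 next
  fix t0
  have "h (t0, y0) : S" using h(2) y0 by auto
  then obtain Q v where Q: "h (t0, y0) : Q" "openin (top_of_set S) Q" "\<Union>v = E \<inter> p -` Q"
   "!!u. u : v ==> openin (top_of_set E) u" "!!u. u : v ==> \<exists>q. homeomorphism u Q p q"
   using cov unfolding covering_space_def by metis
  have "openin (top_of_set (UNIV \<times> U)) ((UNIV \<times> U) \<inter> h -` Q)" by (rule openin_vimage[OF h Q(2)])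
  then obtain Z where Z: "open Z" "(UNIV \<times> U) \<inter> h -` Q = (UNIV \<times> U) \<inter> Z" by (auto simp: openin_open)
  hence "(t0, y0) : Z" using y0 Q(1) by blast
  then obtain A B where AB: "open A" "open B" "t0 : A" "y0 : B" "A \<times> B \<subseteq> Z" using Z(1) by (metis SigmaE2 open_prod_elim)
  obtain d where d: "d > 0" "ball t0 d \<subseteq> A" using AB(1,3) open_contains_ball by blast
  have "P a b" if ab: "a <= t0" "t0 <= b" "b - a < d" for a b
   unfolding P_def
  proof (intro allI impI, elim conjE)
   fix W f assume W: "openin (top_of_set U) W" "y0 : W" "continuous_on W f" "f ` W \<subseteq> E" "\<forall>y\<in>W. p (f y) = h (a, y)"
   have sub: "{a..b} \<subseteq> A" using ab d(2) by (auto simp: subset_eq dist_real_def)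
   have hQ: "h (t, y) : Q" if "t : {a..b}" "y : U \<inter> B" for t y using that sub AB(5) Z(2) by blast
   have "p (f y0) : Q" using hQ[of a y0] W(2,5) y0 AB(4) ab by auto
   hence "f y0 : \<Union>v" using W(2,4) Q(3) by auto
   then obtain u where u: "u : v" "f y0 : u" by blast
   obtain q where q: "homeomorphism u Q p q" using Q(5) u(1) by blast
   define V where "V = (W \<inter> f -` u) \<inter> B"
   have "openin (top_of_set U) (W \<inter> f -` u)"
    by (rule openin_trans[OF openin_vimage[OF W(3,4) Q(4)[OF u(1)]] W(1)])
   hence "openin (top_of_set U) V" unfolding V_def by (rule openin_Int_open[OF _ AB(2)])
   moreover have VU: "V \<subseteq> U \<inter> B" using openin_imp_subset[OF W(1)] by (auto simp: V_def)
   have hV: "h x : Q" if "x : {a..b} \<times> V" for x using that by (cases x) (use hQ VU in blast)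
   have "continuous_on ({a..b} \<times> V) (%x. q (h x))"
    by (rule continuous_on_compose2[OF homeomorphism_cont2[OF q] continuous_on_subset[OF h(1)]])
      (use VU hV in auto)
   moreover have "(%x. q (h x)) ` ({a..b} \<times> V) \<subseteq> E"
   proof safe
    fix t y assume "t : {a..b}" "y : V"
    hence "q (h (t, y)) : q ` Q" using hV by blast
    thus "q (h (t, y)) : E"
     using homeomorphism_image2[OF q] openin_imp_subset[OF Q(4)[OF u(1)]] by blast
   qed
   moreover have "\<forall>y\<in>V. q (h (a, y)) = f y"
   proof
    fix y assume "y : V"
    hence "f y : u" "h (a, y) = p (f y)" using W(5) by (auto simp: V_def)
    thus "q (h (a, y)) = f y" using q by (simp add: homeomorphism_def)
   qed
   moreover have "\<forall>t\<in>{a..b}. \<forall>y\<in>V. p (q (h (t, y))) = h (t, y)"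
    using homeomorphism_apply2[OF q] hV by simp
   moreover have "y0 : V" "V \<subseteq> W" using W(2) u(2) AB(4) by (auto simp: V_def)
   ultimately show "\<exists>V k. openin (top_of_set U) V & y0 : V & V \<subseteq> W & lifts h a b V f k"
    unfolding lifts_def by blast
  qed
  thus "\<exists>d>0. \<forall>a b. a <= t0 & t0 <= b & b - a < d --> P a b" using d(1) by blast
 qed simp
 from this[unfolded P_def, rule_format, of U f] f y0 show ?thesis using that by auto
qed

theorem lift_homotopy:
 fixes h :: "real \<times> 'u::topological_space => 's" and f :: "'u => 'e"
 assumes h: "continuous_on ({0..1} \<times> U) h" "h ` ({0..1} \<times> U) \<subseteq> S"
  and f: "continuous_on U f" "f ` U \<subseteq> E" "!!y. y : U ==> p (f y) = h (0, y)"
 obtains k where "continuous_on ({0..1} \<times> U) k" "k ` ({0..1} \<times> U) \<subseteq> E"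
  "!!y. y : U ==> k (0, y) = f y" "!!t y. t : {0..1} ==> y : U ==> p (k (t, y)) = h (t, y)"
proof -
 \<comment> \<open>Time is clamped to [0, 1] to obtain a homotopy for all real times.\<close>
 define h' where "h' = (%(t, y). h (max 0 (min 1 t), y))"
 have h': "continuous_on (UNIV \<times> U) h'" "h' ` (UNIV \<times> U) \<subseteq> S"
 proof -
  show "continuous_on (UNIV \<times> U) h'" unfolding h'_def case_prod_beta
   by (rule continuous_on_compose2[OF h(1)]) (auto intro!: continuous_intros)
  show "h' ` (UNIV \<times> U) \<subseteq> S" using h(2) by (auto simp: h'_def image_subset_iff)
 qed
 have f': "p (f y) = h' (0, y)" if "y : U" for y using f(3)[OF that] by (simp add: h'_def)
 have "\<forall>y0. \<exists>V k. y0 : U --> openin (top_of_set U) V & y0 : V & lifts h' 0 1 V f k"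
  using lift_homotopy_local[OF h' _ f(1,2) f'] by metis
 then obtain V k where Vk: "\<forall>y0. y0 : U --> openin (top_of_set U) (V y0) & y0 : V y0 & lifts h' 0 1 (V y0) f (k y0)"
  by metis
 have hh: "h' (t, y) = h (t, y)" if "t : {0..1}" for t y using that by (simp add: h'_def)
  have V: "!!y. y : U ==> openin (top_of_set U) (V y)" "!!y. y : U ==> y : V y"
  and L: "!!y. y : U ==> lifts h' 0 1 (V y) f (k y)" using Vk by simp_all
 have k: "!!y. y : U ==> continuous_on ({0..1} \<times> V y) (k y)" "!!y. y : U ==> k y ` ({0..1} \<times> V y) \<subseteq> E"
   "!!y0 y. y0 : U ==> y : V y0 ==> k y0 (0, y) = f y"
   "!!y0 t y. y0 : U ==> t : {0..1} ==> y : V y0 ==> p (k y0 (t, y)) = h (t, y)"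
  using L[unfolded lifts_def] hh by simp_all
 have VU: "V y \<subseteq> U" if "y : U" for y using openin_imp_subset[OF V(1)[OF that]] .
 \<comment> \<open>Over a fixed point two local lifts are lifts of one path with one starting point,
   so they coincide and can be glued.\<close>
 have agree: "k y (t, y) = k y0 (t, y)" if y0: "y0 : U" and y: "y : V y0" and t: "t : {0..1}" for y0 y t
 proof (rule lift_unique[of "{0..1}" 0 "%t. k y (t, y)" "%t. k y0 (t, y)"])
  have yU: "y : U" using y VU[OF y0] by blast
  show "continuous_on {0..1} (%t. k y (t, y))" "continuous_on {0..1} (%t. k y0 (t, y))"
   by (rule continuous_on_compose2[OF k(1)[OF yU]]; use V(2)[OF yU] in \<open>auto intro!: continuous_intros\<close>)
     (rule continuous_on_compose2[OF k(1)[OF y0]]; use y in \<open>auto intro!: continuous_intros\<close>)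
  show "(%t. k y (t, y)) ` {0..1} \<subseteq> E" "(%t. k y0 (t, y)) ` {0..1} \<subseteq> E"
   using k(2)[OF yU] k(2)[OF y0] V(2)[OF yU] y by auto
  show "k y (0, y) = k y0 (0, y)" using k(3)[OF yU V(2)[OF yU]] k(3)[OF y0 y] by simp
  show "p (k y (t, y)) = p (k y0 (t, y))" if "t : {0..1}" for t
   using k(4)[OF yU that V(2)[OF yU]] k(4)[OF y0 that y] by simp
 qed (use t in auto)
 show ?thesis
 proof (rule that[of "%(t, y). k y (t, y)"])
  show "continuous_on ({0..1} \<times> U) (%(t, y). k y (t, y))"
  proof (rule continuous_on_locally)
   fix x :: "real \<times> 'u" assume x: "x : {0..1} \<times> U"
   hence y: "snd x : U" by auto
   have "continuous_on ({0..1} \<times> V (snd x)) (%(t, y). k y (t, y))"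
    by (rule continuous_on_eq[OF k(1)[OF y]]) (use agree[OF y] in auto)
   moreover have "openin (top_of_set ({0..1} \<times> U)) ({0..1} \<times> V (snd x))"
    by (intro openin_Times V(1) y) auto
   ultimately show "\<exists>V. openin (top_of_set ({0..1} \<times> U)) V & x : V & continuous_on V (%(t, y). k y (t, y))"
    using x V(2)[OF y] by (intro exI[of _ "{0..1} \<times> V (snd x)"]) auto
  qed
  show "(%(t, y). k y (t, y)) ` ({0..1} \<times> U) \<subseteq> E" using k(2) V(2) by (fastforce simp: image_subset_iff)
 qed (use k(3,4) V(2) in auto)
qed

end

abbreviation sing :: "nat => 'a::topological_space set => ((nat => real) => 'a) => bool" where
 "sing n E \<equiv> singular_simplex n (top_of_set E)"

lemma sing_iff:
 "sing n E f \<longleftrightarrow> f : extensional (standard_simplex n) & continuous_on (standard_simplex n) f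
   & f ` standard_simplex n \<subseteq> E"
 unfolding singular_simplex_def
 by (auto simp: euclidean_product_topology continuous_map_iff_continuous continuous_map_in_subtopology image_subset_iff_funcset)

lemma connected_standard_simplex: "connected (standard_simplex n)"
 using connectedin_standard_simplex[of n] by (simp add: euclidean_product_topology)

lemma compact_standard_simplex: "compact (standard_simplex n)"
 using compactin_standard_simplex[of n] by (simp add: euclidean_product_topology)

lemma sing_imp:
 assumes "sing n E f"
 shows "continuous_on (standard_simplex n) f" "f : extensional (standard_simplex n)"
  "x : standard_simplex n ==> f x : E"
 using assms by (auto simp: sing_iff)

lemma sing_mono: "sing n A f ==> A \<subseteq> B ==> sing n B f"
 by (auto simp: sing_iff)

lemma sing_simplex_map:
 assumes "sing n E f" "continuous_on E g" "g ` E \<subseteq> T"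
 shows "sing n T (simplex_map n g f)"
 using assms by (intro singular_simplex_simplex_map) (auto simp: continuous_map_in_subtopology)

lemma simplex_map_apply: "x : standard_simplex n ==> simplex_map n g f x = g (f x)"
 by (simp add: simplex_map_def)

lemma simplex_map_comp: "simplex_map n g (simplex_map n h f) = simplex_map n (%x. g (h x)) f"
 by (auto simp: simplex_map_def)

lemma sing_eqI:
 assumes "sing n E f" "sing n E' g" "!!x. x : standard_simplex n ==> f x = g x"
 shows "f = g"
 using assms by (intro extensionalityI[of f "standard_simplex n" g]) (auto simp: sing_iff)

context covering
begin

lemma simplex_lift_unique:
 assumes f: "sing n E f" and g: "sing n E g" and eq: "simplex_map n p f = simplex_map n p g"
  and v: "v : standard_simplex n" "f v = g v"
 shows "f = g"
proof (rule sing_eqI[OF f g])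
 fix x assume x: "x : standard_simplex n"
 have "p (f y) = p (g y)" if "y : standard_simplex n" for y
  using fun_cong[OF eq, of y] that by (simp add: simplex_map_apply)
 thus "f x = g x"
  using f g x lift_unique[of "standard_simplex n" v f g x] connected_standard_simplex v by (auto simp: sing_iff)
qed

text \<open>The simplex is contracted linearly to \<open>v\<close>; the resulting homotopy is lifted
  from the constant map \<open>e\<close>, and its end is the lift. At \<open>v\<close> the homotopy
  stands still, so the value there remains \<open>e\<close>.\<close>

lemma simplex_lift_exists:
 assumes f: "sing n S f" and v: "v : standard_simplex n" and e: "e : E" "p e = f v"
 obtains g where "sing n E g" "simplex_map n p g = f" "g v = e"
proof -
 define c where "c = (%(t, x). %i. (1 - t) * v i + t * x i :: real)"
 have c_in: "c x : standard_simplex n" if "x : {0..1} \<times> standard_simplex n" for x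
  using that convex_standard_simplex[OF v] by (auto simp: c_def)
 have "continuous_on A c" for A
  unfolding c_def case_prod_beta by (intro continuous_intros continuous_on_coordinatewise_then_product
    continuous_on_product_coordinates continuous_on_compose2[OF continuous_on_product_coordinates continuous_on_snd]) auto
 hence "continuous_on ({0..1} \<times> standard_simplex n) (%x. f (c x))"
  by (intro continuous_on_compose2[OF sing_imp(1)[OF f]]) (use c_in in auto)
 moreover have "(%x. f (c x)) ` ({0..1} \<times> standard_simplex n) \<subseteq> S"
  using c_in sing_imp(3)[OF f] by blast
 ultimately obtain k where k: "continuous_on ({0..1} \<times> standard_simplex n) k" "k ` ({0..1} \<times> standard_simplex n) \<subseteq> E"
  "!!y. y : standard_simplex n ==> k (0, y) = e"
  "!!t y. t : {0..1} ==> y : standard_simplex n ==> p (k (t, y)) = f (c (t, y))"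
  using lift_homotopy[of "standard_simplex n" "%x. f (c x)" "%_. e"] e by (auto simp: c_def)
 define g where "g = restrict (%x. k (1, x)) (standard_simplex n)"
 have "continuous_on (standard_simplex n) (%x. k (1, x))"
  by (rule continuous_on_compose2[OF k(1)]) (auto intro!: continuous_intros)
 hence "sing n E g" using k(2) by (auto simp: sing_iff g_def)
 moreover have "simplex_map n p g = f"
 proof (rule extensionalityI[of _ "standard_simplex n"])
  show "simplex_map n p g x = f x" if "x : standard_simplex n" for x
   using k(4)[of 1 x] that by (simp add: simplex_map_apply g_def c_def)
 qed (use f in \<open>auto simp: sing_iff simplex_map_def\<close>)
 moreover have "g v = e"
 proof -
  have vv: "c (t, v) = v" for t by (simp add: c_def fun_eq_iff algebra_simps)
  have "k (1, v) = e"
  proof (rule lift_unique[of "{0..1}" 0 "%t. k (t, v)" "%_. e"])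
   show "continuous_on {0..1} (%t. k (t, v))"
    by (rule continuous_on_compose2[OF k(1)]) (use v in \<open>auto intro!: continuous_intros\<close>)
   show "(%t. k (t, v)) ` {0..1} \<subseteq> E" using k(2) v by blast
   show "p (k (t, v)) = p e" if "t : {0..1}" for t using k(4)[OF that v] e(2) by (simp add: vv)
  qed (use k(3)[OF v] e in auto)
  thus ?thesis using v by (simp add: g_def)
 qed
 ultimately show ?thesis by (rule that)
qed

end

section \<open>Holonomy and comparison of cyclic covers\<close>

declare One_nat_def [simp del]

text \<open>Evaluation of a cochain on chains; the values are integers for holonomies and complex
  numbers for winding numbers.\<close>

definition lin :: "('k => 'r::comm_ring_1) => ('k \<Rightarrow>\<^sub>0 int) => 'r" where
 "lin c z = (\<Sum>x\<in>Poly_Mapping.keys z. of_int (Poly_Mapping.lookup z x) * c x)"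

lemma lin_eq_sum:
 assumes "finite A" "Poly_Mapping.keys z \<subseteq> A"
 shows "lin c z = (\<Sum>x\<in>A. of_int (Poly_Mapping.lookup z x) * c x)"
 unfolding lin_def using assms by (intro sum.mono_neutral_left) (auto simp: in_keys_iff)

lemma lin_of [simp]: "lin c (frag_of x) = c x" and lin_0 [simp]: "lin c 0 = 0"
 by (simp_all add: lin_def)

lemma lin_add [simp]: "lin c (a + b) = lin c a + lin c b"
proof -
 let ?A = "Poly_Mapping.keys a \<union> Poly_Mapping.keys b"
 have "Poly_Mapping.keys (a + b) \<subseteq> ?A" by (rule Poly_Mapping.keys_add)
 thus ?thesis
  by (simp add: lin_eq_sum[of ?A] lookup_add distrib_right sum.distrib)
qed

lemma lin_cmul [simp]: "lin c (frag_cmul k a) = of_int k * lin c a"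
 using keys_cmul[of k a]
 by (simp add: lin_eq_sum[of "Poly_Mapping.keys a"] sum_distrib_left mult.assoc)

lemma lin_minus [simp]: "lin c (- a) = - lin c a"
 using lin_cmul[of c "-1" a] by simp

lemma lin_diff [simp]: "lin c (a - b) = lin c a - lin c b"
 using lin_add[of c a "- b"] by simp

lemma sum_atMost_1: "(\<Sum>i\<le>1. f i) = f 0 + (f (1::nat) :: 'a::comm_monoid_add)"
 and sum_atMost_2: "(\<Sum>i\<le>2. f i) = f 0 + f 1 + (f (2::nat) :: 'a)"
 by (simp_all add: numeral_2_eq_2 One_nat_def)

definition pt :: "real => nat => real" where
 "pt t = (%i. if i = 0 then 1 - t else if i = 1 then t else 0)"

definition vtx :: "nat => nat => real" where
 "vtx i = (%j. if j = i then 1 else 0)"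

lemma vtx_in [simp]: "vtx i : standard_simplex n \<longleftrightarrow> i <= n"
 unfolding vtx_def by simp

lemma pt_0 [simp]: "pt 0 = vtx 0" and pt_1 [simp]: "pt 1 = vtx 1"
 by (auto simp: pt_def vtx_def fun_eq_iff)

lemma standard_simplex_1: "standard_simplex 1 = pt ` {0..1}"
proof (intro equalityI subsetI)
 fix x assume x: "x : standard_simplex 1"
 hence x': "!!i. 0 <= x i & x i <= 1" "!!i. i > 1 ==> x i = 0" "x 0 + x 1 = 1"
  by (auto simp: standard_simplex_def sum_atMost_1)
 have "x = pt (x 1)"
 proof
  fix i :: nat
  consider "i = 0" | "i = 1" | "i > 1" by linarith
  thus "x i = pt (x 1) i" using x'(2)[of i] x'(3) by cases (auto simp: pt_def)
 qed
 thus "x : pt ` {0..1}" using x'(1)[of 1] by auto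
qed (auto simp: standard_simplex_def pt_def sum_atMost_1)

lemma pt_in: "t : {0..1} ==> pt t : standard_simplex 1"
 by (simp add: standard_simplex_1)

lemma pt_inject [simp]: "pt s = pt t \<longleftrightarrow> s = t"
 by (metis pt_def zero_neq_one)

lemma standard_simplex_0': "standard_simplex 0 = {vtx 0}"
 by (simp add: standard_simplex_0 vtx_def)

definition point_simplex :: "nat => 'a => (nat => real) => 'a" where
 "point_simplex n a = restrict (%_. a) (standard_simplex n)"

lemma sing_point: "a : E ==> sing n E (point_simplex n a)"
 by (auto simp: sing_iff point_simplex_def)

lemma boundary_1: "chain_boundary 1 (frag_of f) = frag_of (point_simplex 0 (f (vtx 1))) - frag_of (point_simplex 0 (f (vtx 0)))"
proof -
 have "singular_face 1 0 f = point_simplex 0 (f (vtx 1))" "singular_face 1 1 f = point_simplex 0 (f (vtx 0))"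
  by (auto simp: singular_face_def point_simplex_def standard_simplex_0' fun_eq_iff simplical_face_def vtx_def
    intro!: arg_cong[of _ _ f])
 thus ?thesis by (simp add: chain_boundary_of sum_atMost_1)
qed

lemma boundary_2: "chain_boundary 2 (frag_of f) =
  frag_of (singular_face 2 0 f) - frag_of (singular_face 2 1 f) + frag_of (singular_face 2 2 f)"
 by (simp add: chain_boundary_of sum_atMost_2)

lemma face_2:
 "singular_face 2 0 f (vtx 0) = f (vtx 1)" "singular_face 2 0 f (vtx 1) = f (vtx 2)"
 "singular_face 2 1 f (vtx 0) = f (vtx 0)" "singular_face 2 1 f (vtx 1) = f (vtx 2)"
 "singular_face 2 2 f (vtx 0) = f (vtx 0)" "singular_face 2 2 f (vtx 1) = f (vtx 1)"
 by (auto simp: singular_face_def simplical_face_def vtx_def fun_eq_iff intro!: arg_cong[of _ _ f])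

lemma sing_face: "sing 2 E f ==> k <= 2 ==> sing 1 E (singular_face 2 k f)"
 using singular_simplex_singular_face[of 2 "top_of_set E" f k] by simp

lemma face_map: "k <= 2 ==> simplex_map 1 g (singular_face 2 k f) = singular_face 2 k (simplex_map 2 g f)"
 using simplical_face_in_standard_simplex[of 2 k] by (auto simp: simplex_map_def singular_face_def)

text \<open>\<open>P\<close> is membership in a subgroup, the multiples of \<open>n\<close> or just
  0, so that cocycles modulo \<open>n\<close> and genuine cocycles are treated together.\<close>

lemma lin_boundary_2:
 assumes c: "!!f. sing 2 E f ==> P (c (singular_face 2 0 f) - c (singular_face 2 1 f) + c (singular_face 2 2 f))"
  and P: "P 0" "!!a b. P a ==> P b ==> P (a - b)" and w: "singular_chain 2 (top_of_set E) w"
 shows "P (lin c (chain_boundary 2 w))"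
 using w unfolding singular_chain_def
 by (induction w rule: frag_induction) (auto simp: P(1) boundary_2 c chain_boundary_diff P(2))

text \<open>The deck group is replaced by an action of the integers whose stabilisers are the
  multiples of \<open>n\<close>; \<open>n = 0\<close> is the infinite cyclic case.\<close>

locale cyclic_cover = covering E p S
 for E :: "'e::topological_space set" and p :: "'e => 's::topological_space" and S +
 fixes n :: nat and act :: "int => 'e => 'e"
 assumes act_in: "e : E ==> act k e : E" and act_p: "e : E ==> p (act k e) = p e"
  and act_add: "e : E ==> act a (act b e) = act (a + b) e"
  and act_continuous: "continuous_on E (act k)"
  and act_transitive: "e : E ==> e' : E ==> p e = p e' ==> \<exists>k. act k e = e'"
  and act_fix: "e : E ==> act k e = e \<longleftrightarrow> int n dvd k"
begin

lemma act_eq_iff: "e : E ==> act k e = act l e \<longleftrightarrow> int n dvd k - l"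
proof -
 assume e: "e : E"
 have "act k e = act l e \<longleftrightarrow> act (k - l) e = e"
  using act_add[OF e, of "- l" k] act_add[OF e, of "- l" l] act_add[OF e, of l "k - l"] act_fix[OF e, of 0] by auto
 thus ?thesis using act_fix[OF e] by simp
qed

lemma sing_act: "sing m E g ==> sing m E (simplex_map m (act k) g)"
 by (rule sing_simplex_map[OF _ act_continuous]) (auto intro: act_in)

lemma simplex_map_act: "sing m E g ==> simplex_map m p (simplex_map m (act k) g) = simplex_map m p g"
 unfolding simplex_map_def by (rule restrict_ext) (use sing_imp(3) act_p in fastforce)

definition base :: "'s => 'e" where "base x = (SOME e. e : E & p e = x)"

lemma base: "x : S ==> base x : E" "x : S ==> p (base x) = x"
 using someI_ex[of "%e. e : E & p e = x"] p_surj by (auto simp: base_def)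

text \<open>The position of a point in its fibre relative to the chosen \<open>base\<close> point,
  meaningful only modulo \<open>n\<close>. \<open>base\<close> is a section of sets, with no
  continuity.\<close>

definition idx :: "'e => int" where "idx e = (SOME k. act k (base (p e)) = e)"

lemma idx: "e : E ==> act (idx e) (base (p e)) = e"
 unfolding idx_def by (rule someI_ex) (simp add: act_transitive base p_in)

lemma idx_act: "e : E ==> int n dvd idx (act k e) - (k + idx e)"
proof -
 assume e: "e : E"
 have "act (idx (act k e)) (base (p e)) = act k e" using idx[OF act_in[OF e]] act_p[OF e] by simp
 also have "... = act (k + idx e) (base (p e))" using act_add[OF base(1)[OF p_in[OF e]]] idx[OF e] by metis
 finally show ?thesis by (simp add: act_eq_iff base(1) p_in e)
qed

lemma idx_cong: "e : E ==> e = act k (base (p e)) ==> int n dvd idx e - k"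
 using idx[of e] act_eq_iff[OF base(1)[OF p_in], of e "idx e" k] by metis

text \<open>An integer representing the change of \<open>idx\<close> along lifts of
  \<open>s\<close>. Modulo \<open>n\<close> it is a cocycle, whose class in first cohomology
  classifies the cover.\<close>

definition hol :: "((nat => real) => 's) => int" where
 "hol s = idx ((SOME g. sing 1 E g & simplex_map 1 p g = s & g (vtx 0) = base (s (vtx 0))) (vtx 1))"

text \<open>Every lift is a translate of the chosen one by uniqueness of lifts, and a translation
  shifts all values of \<open>idx\<close> by the same amount modulo \<open>n\<close>.\<close>

lemma hol:
 assumes g: "sing 1 E g"
 shows "int n dvd idx (g (vtx 1)) - idx (g (vtx 0)) - hol (simplex_map 1 p g)"
proof -
 let ?s = "simplex_map 1 p g"
 have s: "sing 1 S ?s" by (rule sing_simplex_map[OF g p_continuous]) (use p_surj in auto)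
 have s0: "?s (vtx 0) = p (g (vtx 0))" by (simp add: simplex_map_apply)
 have g0: "g (vtx 0) : E" using sing_imp(3)[OF g] by simp
 define l where "l = (SOME g. sing 1 E g & simplex_map 1 p g = ?s & g (vtx 0) = base (?s (vtx 0)))"
 have "\<exists>g. sing 1 E g & simplex_map 1 p g = ?s & g (vtx 0) = base (?s (vtx 0))"
  using simplex_lift_exists[OF s, of "vtx 0" "base (?s (vtx 0))"] base[of "?s (vtx 0)"] sing_imp(3)[OF s] by (metis vtx_in zero_le)
 hence l: "sing 1 E l" "simplex_map 1 p l = ?s" "l (vtx 0) = base (p (g (vtx 0)))"
  unfolding l_def s0[symmetric] by (metis (mono_tags, lifting) someI_ex)+
 let ?k = "idx (g (vtx 0))"
 have "simplex_map 1 (act ?k) l = g"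
  by (rule simplex_lift_unique[OF sing_act[OF l(1)] g, of _ "vtx 0"])
    (simp_all add: simplex_map_act l simplex_map_apply idx[OF g0])
 hence "g (vtx 1) = act ?k (l (vtx 1))" by (metis simplex_map_apply vtx_in order_refl)
 hence "int n dvd idx (g (vtx 1)) - (?k + idx (l (vtx 1)))"
  using idx_act sing_imp(3)[OF l(1)] by simp
 thus ?thesis by (simp add: hol_def l_def diff_diff_eq)
qed

text \<open>A 2-simplex lifts, and around the boundary of the lift the increments of
  \<open>idx\<close> cancel.\<close>

lemma hol_boundary:
 assumes w: "singular_chain 2 (top_of_set S) w"
 shows "int n dvd lin hol (chain_boundary 2 w)"
 using _ _ _ w
proof (rule lin_boundary_2)
 fix f assume f: "sing 2 S f"
 obtain g where g: "sing 2 E g" "simplex_map 2 p g = f"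
  using simplex_lift_exists[OF f, of "vtx 0" "base (f (vtx 0))"] base[of "f (vtx 0)"] sing_imp(3)[OF f] by (metis vtx_in zero_le)
 have "int n dvd idx (singular_face 2 k g (vtx 1)) - idx (singular_face 2 k g (vtx 0)) - hol (singular_face 2 k f)" if "k <= 2" for k
  using hol[OF sing_face[OF g(1) that]] face_map[OF that, of p g] g(2) by simp
 from dvd_diff[OF this[of 1] dvd_add[OF this[of 0] this[of 2]]]
 show "int n dvd hol (singular_face 2 0 f) - hol (singular_face 2 1 f) + hol (singular_face 2 2 f)"
  unfolding face_2 by (simp add: algebra_simps)
qed auto

lemma hol_homologous: "homologous_rel 1 (top_of_set S) {} a b ==> int n dvd lin hol a - lin hol b"
proof -
 assume "homologous_rel 1 (top_of_set S) {} a b"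
 then obtain w where "singular_chain 2 (top_of_set S) w" "chain_boundary 2 w = a - b"
  unfolding homologous_rel_def singular_boundary by (auto simp: One_nat_def numeral_2_eq_2)
 thus ?thesis using hol_boundary[of w] by simp
qed

end

definition simplex_connected :: "'e::topological_space set => bool" where
 "simplex_connected E \<longleftrightarrow> (\<forall>x\<in>E. \<forall>y\<in>E. \<exists>s. sing 1 E s & s (vtx 0) = x & s (vtx 1) = y)"

text \<open>The part of continuity that singular chains can see. It suffices for chain maps and can
  be checked from holonomies.\<close>

definition simplexwise :: "'a::topological_space set => 'b::topological_space set => ('a => 'b) => bool" where
 "simplexwise A B q \<longleftrightarrow> (\<forall>m s. sing m A s --> sing m B (simplex_map m q s))"

text \<open>A path from \<open>e\<close> to \<open>act 1 e\<close> projects to a loop of holonomy 1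
  modulo \<open>n\<close>. As the loop is homologous to a multiple of \<open>z0\<close>, the
  holonomy of \<open>z0\<close> is a unit modulo \<open>n\<close>.\<close>

lemma (in cyclic_cover) hol_generator:
 assumes "simplex_connected E" "S ~= {}"
  and z0: "!!z. singular_relcycle 1 (top_of_set S) {} z ==> \<exists>m. homologous_rel 1 (top_of_set S) {} z (frag_cmul m z0)"
 obtains m where "int n dvd 1 - m * lin hol z0"
proof -
 obtain e where e: "e : E" using assms(2) p_surj by blast
 obtain g where g: "sing 1 E g" "g (vtx 0) = e" "g (vtx 1) = act 1 e"
  using assms(1) e act_in[OF e] unfolding simplex_connected_def by blast
 let ?s = "simplex_map 1 p g"
 have "sing 1 S ?s" by (rule sing_simplex_map[OF g(1) p_continuous]) (use p_surj in auto)
 hence "singular_relcycle 1 (top_of_set S) {} (frag_of ?s)"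
  unfolding singular_cycle boundary_1 by (simp add: singular_chain_of simplex_map_apply g act_p[OF e])
 then obtain m where "homologous_rel 1 (top_of_set S) {} (frag_of ?s) (frag_cmul m z0)" using z0 by blast
 hence 1: "int n dvd hol ?s - m * lin hol z0" using hol_homologous by fastforce
 have 2: "int n dvd idx (act 1 e) - idx e - hol ?s" using hol[OF g(1)] g by simp
 show ?thesis using dvd_diff[OF dvd_add[OF 1 2] idx_act[OF e, of 1]] by (intro that[of m]) (simp add: algebra_simps)
qed

text \<open>The image of the simplex is compared with the lift that starts at the image of vertex 0.
  Both agree at \<open>x\<close> because the segment from vertex 0 to \<open>x\<close> is a
  1-simplex, where the hypothesis on paths applies.\<close>

lemma simplexwiseI:
 assumes cov: "covering A pA S" "covering B pB S"
  and q: "!!e. e : A ==> q e : B & pB (q e) = pA e"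
  and paths: "!!g. sing 1 A g ==> \<exists>h. sing 1 B h & simplex_map 1 pB h = simplex_map 1 pA g
   & h (vtx 0) = q (g (vtx 0)) & h (vtx 1) = q (g (vtx 1))"
 shows "simplexwise A B q"
 unfolding simplexwise_def
proof (intro allI impI)
 fix m s assume s: "sing m A s"
 interpret A: covering A pA S by fact
 interpret B: covering B pB S by fact
 have ps: "sing m S (simplex_map m pA s)" by (rule sing_simplex_map[OF s A.p_continuous]) (use A.p_surj in auto)
 have v: "vtx 0 : standard_simplex m" by simp
 hence "q (s (vtx 0)) : B" "pB (q (s (vtx 0))) = simplex_map m pA s (vtx 0)"
  using q[OF sing_imp(3)[OF s v]] by (simp_all add: simplex_map_apply)
 then obtain t where t: "sing m B t" "simplex_map m pB t = simplex_map m pA s" "t (vtx 0) = q (s (vtx 0))"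
  using B.simplex_lift_exists[OF ps v] by metis
 have "t x = q (s x)" if x: "x : standard_simplex m" for x
 proof -
  define c where "c = (%(y :: nat => real) i. (1 - y 1) * vtx 0 i + y 1 * x i :: real)"
  have c_in: "c y : standard_simplex m" if "y : standard_simplex 1" for y
   unfolding c_def using that by (intro convex_standard_simplex v x) (auto simp: standard_simplex_1 pt_def)
  have "continuous_on (standard_simplex 1) c"
   unfolding c_def by (intro continuous_intros continuous_on_coordinatewise_then_product
     continuous_on_subset[OF continuous_on_product_coordinates subset_UNIV])
  hence sing_c: "sing 1 D (restrict (%y. f (c y)) (standard_simplex 1))" if "sing m D f" for D :: "'x::topological_space set" and f
   using sing_imp(1,3)[OF that] c_in
   by (auto simp: sing_iff intro!: continuous_on_compose2[of "standard_simplex m" f])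
  define g where "g = restrict (%y. s (c y)) (standard_simplex 1)"
  have c01: "c (vtx 0) = vtx 0" "c (vtx 1) = x" by (auto simp: c_def vtx_def fun_eq_iff)
  obtain h where h: "sing 1 B h" "simplex_map 1 pB h = simplex_map 1 pA g" "h (vtx 0) = q (g (vtx 0))" "h (vtx 1) = q (g (vtx 1))"
   using paths[of g] sing_c[OF s] by (auto simp: g_def)
  have "restrict (%y. t (c y)) (standard_simplex 1) = h"
  proof (rule B.simplex_lift_unique[OF sing_c[OF t(1)] h(1), where v = "vtx 0"])
   have "pB (t (c y)) = pA (s (c y))" if "y : standard_simplex 1" for y
    using fun_cong[OF t(2), of "c y"] c_in[OF that] by (simp add: simplex_map_apply)
   thus "simplex_map 1 pB (restrict (%y. t (c y)) (standard_simplex 1)) = simplex_map 1 pB h"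
    unfolding h(2) by (auto simp: simplex_map_def g_def)
   show "restrict (%y. t (c y)) (standard_simplex 1) (vtx 0) = h (vtx 0)"
    using h(3) t(3) by (simp add: g_def c01)
  qed simp
  hence "t x = h (vtx 1)" by (auto simp: c01)
  thus ?thesis using h(4) by (simp add: g_def c01)
 qed
 hence "simplex_map m q s = t" by (intro extensionalityI[of _ "standard_simplex m"])
   (use sing_imp(2)[OF t(1)] in \<open>auto simp: simplex_map_def\<close>)
 thus "sing m B (simplex_map m q s)" using t(1) by simp
qed

text \<open>The integers act through the inverse of the isomorphism. Freeness comes from uniqueness
  of lifts, as deck transformations are lifts of the projection; transitivity is part of
  regularity.\<close>

lemma regular_covering_imp_cyclic_cover:
 fixes E :: "'e::topological_space set" and p :: "'e => 's::topological_space"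
 assumes reg: "regular_connected_covering E p S" and iso: "deck_group E p \<cong> integer_mod_group n"
 obtains act where "cyclic_cover E p S n act" "carrier (deck_group E p) = range (%k. restrict (act k) E)"
proof -
 let ?G = "deck_group E p"
 have cov: "covering_space E p S" and conn: "connected E"
  and trans: "!!x y. x : E ==> y : E ==> p x = p y ==> \<exists>h\<in>carrier ?G. h x = y"
  using reg by (auto simp: regular_connected_covering_def)
 interpret covering E p S by standard (rule cov)
 obtain \<psi> where \<psi>: "\<psi> : iso ?G (integer_mod_group n)" using iso by (auto simp: is_iso_def)
 define \<phi> where "\<phi> = inv_into (carrier ?G) \<psi>"
 have bij: "bij_betw \<psi> (carrier ?G) (carrier (integer_mod_group n))" using \<psi> by (simp add: iso_def)
 have \<psi>_mult: "\<psi> (compose E g h) = (\<psi> g + \<psi> h) mod int n" if "g : carrier ?G" "h : carrier ?G" for g h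
  using \<psi> that by (simp add: iso_def hom_def deck_group_def)
 have carrier_n: "k mod int n : carrier (integer_mod_group n)" for k by (simp add: carrier_integer_mod_group)
 have \<phi>: "\<phi> (k mod int n) : carrier ?G" "\<psi> (\<phi> (k mod int n)) = k mod int n" for k
  using carrier_n[of k] bij_betw_imp_surj_on[OF bij] unfolding \<phi>_def by (metis inv_into_into, metis f_inv_into_f)
 have deck: "h ` E \<subseteq> E" "continuous_on E h" "h : extensional E" "!!x. x : E ==> p (h x) = p x"
  if "h : carrier ?G" for h
  using that by (auto simp: deck_group_def homeomorphism_def)
 have closed: "compose E g h : carrier ?G" if g: "g : carrier ?G" and h: "h : carrier ?G" for g h
 proof -
  obtain g' h' where "homeomorphism E E g g'" "homeomorphism E E h h'" using g h by (auto simp: deck_group_def)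
  hence "homeomorphism E E (g \<circ> h) (h' \<circ> g')" by (rule homeomorphism_compose[rotated])
  hence "homeomorphism E E (compose E g h) (h' \<circ> g')"
   by (rule homeomorphism_cong) (auto simp: compose_def)
  moreover have "p (compose E g h x) = p x" if "x : E" for x
   using that deck[OF g] deck[OF h] by (auto simp: compose_eq)
  ultimately show ?thesis by (auto simp: deck_group_def)
 qed
 have free: "g = h" if "g : carrier ?G" "h : carrier ?G" "x : E" "g x = h x" for g h x
 proof (rule extensionalityI[of g E h])
  fix y assume "y : E"
  thus "g y = h y" using lift_unique[of E x g h y] conn that(3,4) deck[OF that(1)] deck[OF that(2)] by simp
 qed (use deck that in auto)
 define act where "act k = \<phi> (k mod int n)" for k
 have act: "act k : carrier ?G" "\<psi> (act k) = k mod int n" for k using \<phi> by (simp_all add: act_def)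
 have \<psi>_inj: "g = h" if "g : carrier ?G" "h : carrier ?G" "\<psi> g = \<psi> h" for g h
  using bij that by (auto simp: bij_betw_def dest: inj_onD)
 have act_compose: "compose E (act a) (act b) = act (a + b)" for a b
  by (rule \<psi>_inj[OF closed[OF act(1) act(1)] act(1)]) (simp add: \<psi>_mult act mod_add_eq)
 have surj: "\<exists>k. g = act k" if "g : carrier ?G" for g
 proof -
  have "\<psi> g : carrier (integer_mod_group n)" using bij that by (auto simp: bij_betw_def)
  hence "\<psi> g mod int n = \<psi> g" by (auto simp: carrier_integer_mod_group split: if_splits)
  thus ?thesis using \<psi>_inj[OF that act(1)[of "\<psi> g"]] act(2)[of "\<psi> g"] by auto
 qed
 have idn: "restrict id E : carrier ?G"
  by (auto simp: deck_group_def intro!: exI[of _ "%a. a"] homeomorphism_cong[OF homeomorphism_ident])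
 have act_0: "act k = restrict id E \<longleftrightarrow> int n dvd k" for k
 proof -
  \<comment> \<open>The identity is idempotent, which forces its index to be 0 modulo
    \<open>n\<close>.\<close>
  have "compose E (restrict id E) (restrict id E) = restrict id E" by (auto simp: compose_def)
  hence "\<psi> (restrict id E) = (\<psi> (restrict id E) + \<psi> (restrict id E)) mod int n" using \<psi>_mult[OF idn idn] by simp
  moreover obtain l where l: "restrict id E = act l" using surj[OF idn] by blast
  ultimately have "(l + l) mod int n = l mod int n" using act(2)[of l] by (metis mod_add_eq)
  hence "l mod int n = 0" by (simp add: mod_eq_dvd_iff dvd_eq_mod_eq_0)
  hence "\<psi> (restrict id E) = 0" using l act(2)[of l] by simp
  thus ?thesis using \<psi>_inj[OF act(1)[of k] idn] act(2)[of k] by (auto simp: dvd_eq_mod_eq_0)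
 qed
 have "cyclic_cover E p S n act"
 proof unfold_locales
  fix e k assume e: "e : E"
  show "act k e : E" "p (act k e) = p e" using deck[OF act(1)] e by auto
  show "act a (act b e) = act (a + b) e" for a b using fun_cong[OF act_compose[of a b], of e] e by (simp add: compose_eq)
  show "act k e = e \<longleftrightarrow> int n dvd k"
   using free[OF act(1) idn e, of k] act_0[of k] e by auto
  show "\<exists>k. act k e = e'" if "e' : E" "p e = p e'" for e' using trans[OF e that] surj by metis
 qed (use deck[OF act(1)] in auto)
 moreover have "restrict (act k) E = act k" for k using deck(3)[OF act(1)[of k]] by (simp add: extensional_restrict)
 hence "carrier ?G = range (%k. restrict (act k) E)" using surj act(1) by (auto simp: image_iff)
 ultimately show ?thesis by (rule that)
qed

text \<open>First homology is generated by \<open>z0\<close>, so a holonomy is known on cycles from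
  its value on \<open>z0\<close>: \<open>h1\<close> is 1 or -1, and \<open>h2\<close> is a unit
  modulo \<open>n\<close>. With u = h2 h1, the difference \<open>D\<close> of the second holonomy
  and \<open>u\<close> times the first vanishes modulo \<open>n\<close> on cycles, hence is the
  coboundary of a function \<open>f\<close> modulo \<open>n\<close>. Correcting fibre positions by
  \<open>f\<close> makes \<open>q\<close> compatible with the lifting of paths.\<close>

lemma cyclic_cover_comparison:
 fixes E1 :: "'e::topological_space set" and E2 :: "'f::topological_space set" and S :: "'s::topological_space set"
 assumes c1: "cyclic_cover E1 p1 S 0 act1" and c2: "cyclic_cover E2 p2 S n act2"
  and conn: "simplex_connected E1" "simplex_connected E2"
  and z0: "!!z. singular_relcycle 1 (top_of_set S) {} z ==> \<exists>m. homologous_rel 1 (top_of_set S) {} z (frag_cmul m z0)"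
  and ne: "S ~= {}"
 obtains q act where "cyclic_cover E2 p2 S n act" "simplexwise E1 E2 q" "!!e. e : E1 ==> q e : E2 & p2 (q e) = p1 e"
  "!!k e. e : E1 ==> q (act1 k e) = act k (q e)"
proof -
 interpret c1: cyclic_cover E1 p1 S 0 act1 by fact
 interpret c2: cyclic_cover E2 p2 S n act2 by fact
 obtain x0 where x0: "x0 : S" using ne by blast
 obtain m1 where m1: "int 0 dvd 1 - m1 * lin c1.hol z0" using c1.hol_generator[OF conn(1) ne z0] by metis
 obtain m2 where m2: "int n dvd 1 - m2 * lin c2.hol z0" using c2.hol_generator[OF conn(2) ne z0] by metis
 define h1 where "h1 = lin c1.hol z0"
 define h2 where "h2 = lin c2.hol z0"
 have "m1 * h1 = 1" using m1 by (simp add: h1_def)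
 hence "h1 = 1 \<or> h1 = -1" by (metis zmult_eq_1_iff)
 hence h1: "h1 * h1 = 1" by auto
 define u where "u = h2 * h1"
 define D where "D s = c2.hol s - u * c1.hol s" for s
 have lin_D: "lin D z = lin c2.hol z - u * lin c1.hol z" for z
  by (simp add: lin_def D_def sum_subtractf sum_distrib_left right_diff_distrib mult_ac)
 have D_cycle: "int n dvd lin D z" if z: "singular_relcycle 1 (top_of_set S) {} z" for z
 proof -
  obtain m where m: "homologous_rel 1 (top_of_set S) {} z (frag_cmul m z0)" using z0[OF z] by blast
  have "lin c1.hol z = m * h1" using c1.hol_homologous[OF m] by (simp add: h1_def)
  hence "lin D z = lin c2.hol z - m * h2" using h1 by (simp add: lin_D u_def mult_ac)
  thus ?thesis using c2.hol_homologous[OF m] by (simp add: h2_def)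
 qed
 have "\<exists>s. sing 1 S s & s (vtx 0) = x0 & s (vtx 1) = x" if x: "x : S" for x
 proof -
  obtain s where "sing 1 E1 s" "s (vtx 0) = c1.base x0" "s (vtx 1) = c1.base x"
   using conn(1) c1.base(1)[OF x0] c1.base(1)[OF x] unfolding simplex_connected_def by blast
  thus ?thesis
   using sing_simplex_map[of 1 E1 s p1 S] c1.p_continuous c1.p_surj c1.base(2) x0 x
   by (intro exI[of _ "simplex_map 1 p1 s"]) (auto simp: simplex_map_apply)
 qed
 then obtain w where w: "!!x. x : S ==> sing 1 S (w x)" "!!x. x : S ==> w x (vtx 0) = x0" "!!x. x : S ==> w x (vtx 1) = x"
  by metis
 \<comment> \<open>\<open>D\<close> is integrated along chosen paths from \<open>x0\<close>.\<close>
 define f where "f x = D (w x)" for x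
 have D: "int n dvd f (s (vtx 0)) + D s - f (s (vtx 1))" if s: "sing 1 S s" for s
 proof -
  have xy: "s (vtx 0) : S" "s (vtx 1) : S" using sing_imp(3)[OF s] by simp_all
  have "singular_relcycle 1 (top_of_set S) {} (frag_of (w (s (vtx 0))) + frag_of s - frag_of (w (s (vtx 1))))"
   unfolding singular_cycle chain_boundary_diff chain_boundary_add boundary_1
   using xy s by (simp add: singular_chain_of singular_chain_add singular_chain_diff w)
  from D_cycle[OF this] show ?thesis by (simp add: f_def)
 qed
 define q where "q e = act2 (u * c1.idx e + f (p1 e)) (c2.base (p1 e))" for e
 \<comment> \<open>\<open>q\<close> carries translation by 1 in the first cover to translation by
   \<open>u\<close> in the second, so the second action is reparametrised by the unit
   \<open>u\<close>; its inverse modulo \<open>n\<close> is \<open>h1 * m2\<close>.\<close>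
 define act where "act k = act2 (u * k)" for k
 have q_in: "q e : E2" "p2 (q e) = p1 e" if "e : E1" for e
  using c2.act_in c2.act_p c2.base c1.p_in[OF that] by (auto simp: q_def)
 have unit: "int n dvd u * (h1 * m2 * k) - k" for k
 proof -
  have "u * (h1 * m2 * k) - k = - ((1 - m2 * h2) * k)" using h1
   by (simp add: u_def algebra_simps)
  thus ?thesis using m2 by (simp add: h2_def)
 qed
 have "cyclic_cover E2 p2 S n act"
 proof unfold_locales
  fix e k assume e: "e : E2"
  show "act k e = e \<longleftrightarrow> int n dvd k"
  proof -
   have "int n dvd k" if "int n dvd u * k"
    using dvd_diff[OF dvd_mult[OF that, of "h1 * m2"] unit[of k]] by (simp add: mult_ac)
   hence "int n dvd u * k \<longleftrightarrow> int n dvd k" using dvd_mult by blast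
   thus ?thesis unfolding act_def c2.act_fix[OF e] .
  qed
  fix e' assume e': "e' : E2" "p2 e = p2 e'"
  then obtain k where "act2 k e = e'" using c2.act_transitive[OF e] by blast
  hence "act (h1 * m2 * k) e = e'"
   using c2.act_eq_iff[OF e] unit[of k] by (auto simp: act_def)
  thus "\<exists>k. act k e = e'" by blast
 qed (auto simp: act_def c2.act_in c2.act_p c2.act_add distrib_left c2.act_continuous)
 moreover have "q (act1 k e) = act k (q e)" if e: "e : E1" for k e
 proof -
  have "c1.idx (act1 k e) = k + c1.idx e" using c1.idx_act[OF e, of k] by simp
  thus ?thesis
   using c1.act_p[OF e] c2.act_add c2.base(1)[OF c1.p_in[OF e]] by (simp add: q_def act_def distrib_left add.assoc)
 qed
 moreover have "simplexwise E1 E2 q"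
 proof (rule simplexwiseI[OF c1.covering_axioms c2.covering_axioms])
  show "q e : E2 & p2 (q e) = p1 e" if "e : E1" for e using q_in[OF that] by simp
  fix g assume g: "sing 1 E1 g"
  let ?s = "simplex_map 1 p1 g" and ?a = "g (vtx 0)" and ?b = "g (vtx 1)"
  have ab: "?a : E1" "?b : E1" using sing_imp(3)[OF g] by simp_all
  have s: "sing 1 S ?s" by (rule sing_simplex_map[OF g c1.p_continuous]) (use c1.p_surj in auto)
  have s01: "?s (vtx 0) = p1 ?a" "?s (vtx 1) = p1 ?b" by (simp_all add: simplex_map_apply)
  have "p2 (q ?a) = ?s (vtx 0)" using q_in(2)[OF ab(1)] s01 by simp
  then obtain h where h: "sing 1 E2 h" "simplex_map 1 p2 h = ?s" "h (vtx 0) = q ?a"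
   using c2.simplex_lift_exists[OF s _ q_in(1)[OF ab(1)]] by (metis vtx_in zero_le)
  have h1': "h (vtx 1) : E2" "p2 (h (vtx 1)) = p1 ?b"
   using sing_imp(3)[OF h(1)] fun_cong[OF h(2), of "vtx 1"] s01 by (simp_all add: simplex_map_apply)
  have "int n dvd c2.idx (q ?a) - (u * c1.idx ?a + f (p1 ?a))"
   by (rule c2.idx_cong[OF q_in(1)[OF ab(1)]]) (simp add: q_in(2)[OF ab(1)], simp add: q_def)
  note 1 = this
  have 2: "int n dvd c2.idx (h (vtx 1)) - c2.idx (q ?a) - c2.hol ?s" using c2.hol[OF h(1)] h by simp
  have 3: "c1.idx ?b = c1.idx ?a + c1.hol ?s" using c1.hol[OF g] by simp
  have 4: "int n dvd f (p1 ?a) + D ?s - f (p1 ?b)" using D[OF s] s01 by simp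
  have "int n dvd c2.idx (h (vtx 1)) - (u * c1.idx ?b + f (p1 ?b))"
   using dvd_add[OF dvd_add[OF 1 2] 4] 3 by (simp add: D_def algebra_simps)
  hence "h (vtx 1) = q ?b"
   using c2.idx[OF h1'(1)] c2.act_eq_iff[OF c2.base(1)[OF c1.p_in[OF ab(2)]]] unfolding q_def h1'(2) by metis
  thus "\<exists>h. sing 1 E2 h & simplex_map 1 p2 h = ?s & h (vtx 0) = q ?a & h (vtx 1) = q ?b"
   using h by blast
 qed
 ultimately show ?thesis using that q_in by blast
qed

section \<open>The 1-skeleton, its lifts and their deformation\<close>

text \<open>Compact images in a Hausdorff space are closed, so preimages of closed sets are finite
  unions of closed sets.\<close>

lemma continuous_on_finite_compact_cover:
 fixes F :: "'i => 'k::topological_space => 'a::t2_space" and g :: "'a => 'b::topological_space"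
 assumes fin: "finite I" and K: "!!i. i : I ==> compact (K i)" and F: "!!i. i : I ==> continuous_on (K i) (F i)"
  and g: "!!i. i : I ==> continuous_on (K i) (%x. g (F i x))"
 shows "continuous_on (\<Union>i\<in>I. F i ` K i) g"
 unfolding continuous_on_closed_invariant
proof (intro allI impI)
 fix C :: "'b set" assume C: "closed C"
 let ?A = "\<Union>i\<in>I. F i ` (K i \<inter> (%x. g (F i x)) -` C)"
 have "compact (F i ` (K i \<inter> (%x. g (F i x)) -` C))" if i: "i : I" for i
 proof -
  have "closedin (top_of_set (K i)) (K i \<inter> (%x. g (F i x)) -` C)"
   by (rule continuous_closedin_preimage[OF g[OF i] C])
  hence "compact (K i \<inter> (%x. g (F i x)) -` C)" by (rule closedin_compact[OF K[OF i]])
  thus ?thesis by (intro compact_continuous_image continuous_on_subset[OF F[OF i]]) auto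
 qed
 hence "closed ?A" using fin by (intro closed_UN ballI compact_imp_closed) auto
 moreover have "?A \<inter> (\<Union>i\<in>I. F i ` K i) = g -` C \<inter> (\<Union>i\<in>I. F i ` K i)" by blast
 ultimately show "\<exists>A. closed A & A \<inter> (\<Union>i\<in>I. F i ` K i) = g -` C \<inter> (\<Union>i\<in>I. F i ` K i)" by blast
qed

text \<open>The middle half [1/4, 3/4] is expanded to the whole interval, and the outer quarters are
  pushed to the ends.\<close>

definition stretch :: "real => real" where
 "stretch t = max 0 (min 1 (2 * t - 1 / 2))"

definition deform :: "real => real => real" where
 "deform u t = (1 - u) * t + u * stretch t"

lemma stretch_01: "0 <= stretch t" "stretch t <= 1" "stretch 0 = 0" "stretch 1 = 1"
 by (auto simp: stretch_def)

lemma deform_simps [simp]: "deform u 0 = 0" "deform u 1 = 1" "deform 0 t = t" "deform 1 t = stretch t"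
 by (auto simp: deform_def stretch_01)

lemma deform_in: "u : {0..1} ==> t : {0..1} ==> deform u t : {0..1}"
proof -
 assume u: "u : {0..1}" and t: "t : {0..1}"
 have "(1 - u) * t + u * stretch t <= (1 - u) * 1 + u * 1"
  using u t stretch_01(2)[of t] by (intro add_mono mult_left_mono) auto
 thus ?thesis using u t stretch_01(1)[of t] by (simp add: deform_def)
qed

lemma deform_continuous: "continuous_on A (%x. deform (f x) (g x))" if "continuous_on A f" "continuous_on A g"
 unfolding deform_def stretch_def by (intro continuous_intros that)

lemma pt_continuous [continuous_intros]: "continuous_on A f ==> continuous_on A (%x. pt (f x))"
proof (unfold pt_def, intro continuous_on_coordinatewise_then_product)
 fix i :: nat assume "continuous_on A f"
 thus "continuous_on A (%x. if i = 0 then 1 - f x else if i = 1 then f x else 0)"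
  by (cases "i = 0"; cases "i = 1") (auto intro!: continuous_intros)
qed

lemma pt_coord [simp]: "pt t 1 = t" "pt t 0 = 1 - t"
 by (simp_all add: pt_def)

lemma coordinate_continuous: "continuous_on A (%x :: nat => real. x i)"
 by (rule continuous_on_subset[OF continuous_on_product_coordinates subset_UNIV])

lemma open_simplex_1: "open_simplex 1 = pt ` {0<..<1}"
proof (intro equalityI subsetI)
 fix x assume "x : open_simplex 1"
 then obtain t where t: "x = pt t" "t : {0..1}" "\<forall>i\<le>1. 0 < x i" by (auto simp: open_simplex_def standard_simplex_1)
 from t(1) t(3)[rule_format, of 0] t(3)[rule_format, of 1] have "t : {0<..<1}" by (auto simp: pt_def)
 thus "x : pt ` {0<..<1}" using t(1) by blast
next
 fix x assume "x : pt ` {0<..<1}"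
 then obtain t where t: "x = pt t" "t : {0<..<1}" by blast
 moreover have "0 < pt t i" if "i <= 1" for i using that t(2) by (cases i) (auto simp: pt_def One_nat_def)
 ultimately show "x : open_simplex 1" using pt_in[of t] by (auto simp: open_simplex_def)
qed

lemma open_simplex_0: "open_simplex 0 = {vtx 0}"
 by (auto simp: open_simplex_def standard_simplex_0' vtx_def)

lemma skeleton_0: "skeleton \<Phi> 0 = (\<Union>f\<in>\<Phi> 0. f ` standard_simplex 0)"
 by (simp add: skeleton_def)

lemma skeleton_Suc: "skeleton \<Phi> (int (Suc n)) = skeleton \<Phi> (int n) \<union> (\<Union>f\<in>\<Phi> (Suc n). f ` standard_simplex (Suc n))"
proof -
 have "{p. int p <= int (Suc n)} = insert (Suc n) {p. int p <= int n}" by auto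
 thus ?thesis by (auto simp: skeleton_def)
qed

lemma skeleton_1: "skeleton \<Phi> 1 = skeleton \<Phi> 0 \<union> (\<Union>f\<in>\<Phi> 1. f ` standard_simplex 1)"
 using skeleton_Suc[of \<Phi> 0] by (simp add: One_nat_def)

locale cw_complex =
 fixes X :: "'a::t2_space set" and \<Phi> :: "'a cell_structure"
 assumes cw: "finite_CW_structure X \<Phi>"
begin

abbreviation "X0 \<equiv> skeleton \<Phi> 0"
abbreviation "X1 \<equiv> skeleton \<Phi> 1"

lemma finite_cells: "finite (\<Phi> q)"
proof -
 have "finite (SIGMA p:UNIV. \<Phi> p)" using cw unfolding finite_CW_structure_def by simp
 hence "finite (Pair q ` \<Phi> q)" by (rule rev_finite_subset) auto
 thus ?thesis by (rule finite_imageD) (auto intro: inj_onI)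
qed

lemma cell: "f : \<Phi> q ==> sing q X f"
 using cw unfolding finite_CW_structure_def by blast

lemma cell_boundary: "f : \<Phi> q ==> x : standard_simplex q ==> x ~: open_simplex q ==>
  \<exists>r<q. \<exists>g\<in>\<Phi> r. f x : g ` open_simplex r"
 using cw unfolding finite_CW_structure_def by blast

lemma cell_disjoint: "f : \<Phi> q ==> g : \<Phi> r ==> x : open_simplex q ==> y : open_simplex r ==> f x = g y
  ==> q = r & f = g"
 using cw unfolding finite_CW_structure_def by blast

lemma cell_inj: "f : \<Phi> q ==> inj_on f (open_simplex q)"
 using cw unfolding finite_CW_structure_def by blast

lemma vertex_in: "f : \<Phi> 0 ==> f (vtx 0) : X0"
 by (auto simp: skeleton_0 standard_simplex_0')

lemma X0_vertex: "y : X0 ==> \<exists>f\<in>\<Phi> 0. y = f (vtx 0)"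
 by (auto simp: skeleton_0 standard_simplex_0')

lemma edge_in: "f : \<Phi> 1 ==> t : {0..1} ==> f (pt t) : X1"
 unfolding skeleton_1 using pt_in[of t] by blast

lemma edge_ends: "f : \<Phi> 1 ==> t : {0, 1} ==> f (pt t) : X0"
proof -
 assume f: "f : \<Phi> 1" and t: "t : {0, 1}"
 have "pt t : standard_simplex 1" "pt t ~: open_simplex 1" using t by (auto simp: open_simplex_1 standard_simplex_1 image_iff simp del: pt_0 pt_1)
 then obtain r g where "r < 1" "g : \<Phi> r" "f (pt t) : g ` open_simplex r" using cell_boundary[OF f] by blast
 thus ?thesis using vertex_in by (auto simp: open_simplex_0)
qed

lemma edge_not_vertex: "f : \<Phi> 1 ==> t : {0<..<1} ==> f (pt t) ~: X0"
 using X0_vertex[of "f (pt t)"] cell_disjoint[of f 1 _ 0 "pt t" "vtx 0"]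
 by (auto simp: open_simplex_1 open_simplex_0)

lemma edge_unique:
 assumes "f : \<Phi> 1" "g : \<Phi> 1" "s : {0<..<1}" "t : {0<..<1}" "f (pt s) = g (pt t)"
 shows "f = g & s = t"
proof -
 have o: "pt s : open_simplex 1" "pt t : open_simplex 1" using assms by (auto simp: open_simplex_1)
 hence "f = g" using cell_disjoint[OF assms(1,2)] assms(5) by blast
 thus ?thesis using inj_onD[OF cell_inj[OF assms(1)], of "pt s" "pt t"] o assms(5) by simp
qed

lemma X1_cases:
 assumes "y : X1"
 obtains "y : X0" | f t where "f : \<Phi> 1" "t : {0<..<1}" "y = f (pt t)"
proof (cases "y : X0")
 case False
 then obtain f t where ft: "f : \<Phi> 1" "t : {0..1}" "y = f (pt t)" using assms by (auto simp: skeleton_1 standard_simplex_1)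
 hence "t ~= 0" "t ~= 1" using edge_ends[OF ft(1), of t] False by auto
 thus ?thesis using that(2)[OF ft(1) _ ft(3)] ft(2) by auto
qed (use that in blast)

lemma X1_subset: "X1 \<subseteq> X"
 using cell[THEN sing_imp(3)] by (auto simp: skeleton_1 skeleton_0)

lemma compact_edge: "f : \<Phi> 1 ==> compact T ==> T \<subseteq> {0..1} ==> compact ((%t. f (pt t)) ` T)"
 by (intro compact_continuous_image continuous_on_compose2[OF sing_imp(1)[OF cell]])
   (auto intro!: continuous_intros pt_in)

lemma finite_X0: "finite X0"
 using finite_cells by (simp add: skeleton_0 standard_simplex_0')

text \<open>The complement in the 1-skeleton is cut out by a finite union of compact sets: the
  vertices, the other closed edges and the rest of this edge.\<close>

lemma open_edge:
 assumes f: "f : \<Phi> 1" and J: "open J" "J \<subseteq> {0<..<1}"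
 shows "openin (top_of_set X1) ((%t. f (pt t)) ` J)"
proof -
 let ?C = "X0 \<union> (\<Union>g\<in>\<Phi> 1 - {f}. (%t. g (pt t)) ` {0..1}) \<union> (%t. f (pt t)) ` ({0..1} - J)"
 have "compact ({0..1} - J)" by (rule compact_diff[OF compact_Icc J(1)])
 hence "closed ((%t. f (pt t)) ` ({0..1} - J))" by (intro compact_imp_closed compact_edge f) auto
 moreover have "closed ((%t. g (pt t)) ` {0..1})" if "g : \<Phi> 1" for g
  using that by (intro compact_imp_closed compact_edge) auto
 moreover have "closed X0" by (rule compact_imp_closed[OF finite_imp_compact[OF finite_X0]])
 ultimately have "closed ?C" using finite_cells by (intro closed_Un closed_UN ballI) auto
 moreover have "(%t. f (pt t)) ` J = X1 - ?C"
 proof (intro equalityI subsetI)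
  fix y assume "y : (%t. f (pt t)) ` J"
  then obtain t where t: "t : J" "y = f (pt t)" by blast
  hence t01: "t : {0<..<1}" using J by blast
  hence y: "y ~: X0" using edge_not_vertex[OF f] t(2) by blast
  have *: "g = f & s = t" if "g : \<Phi> 1" "s : {0..1}" "y = g (pt s)" for g s
  proof -
   have "s ~= 0" "s ~= 1" using edge_ends[OF that(1), of s] y that(3) by auto
   hence "s : {0<..<1}" using that(2) by auto
   thus ?thesis using edge_unique[OF that(1) f _ t01] that(3) t(2) by blast
  qed
  have "y ~: ?C" using y *[OF f] * t(1) by blast
  moreover have "y : X1" unfolding t(2) using t01 by (intro edge_in f) auto
  ultimately show "y : X1 - ?C" by blast
 next
  fix y assume y: "y : X1 - ?C"
  hence "y : X1" "y ~: X0" by auto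
  then obtain g t where g: "g : \<Phi> 1" "t : {0<..<1}" "y = g (pt t)" by (elim X1_cases) auto
  hence "t : {0..1}" by auto
  hence "g = f" using y g by blast
  thus "y : (%t. f (pt t)) ` J" using y g \<open>t : {0..1}\<close> by blast
 qed
 ultimately show ?thesis using openin_open_Int[of "- ?C" X1] by (simp only: Diff_eq open_Compl)
qed

definition edge_param :: "'a => 'a cell \<times> real" where
 "edge_param y = (SOME (f, t). f : \<Phi> 1 & t : {0<..<1} & y = f (pt t))"

lemma edge_param: "f : \<Phi> 1 ==> t : {0<..<1} ==> edge_param (f (pt t)) = (f, t)"
 unfolding edge_param_def by (rule some_equality) (use edge_unique in auto)

lemma edge_coord_continuous:
 assumes f: "f : \<Phi> 1"
 shows "continuous_on ((%t. f (pt t)) ` {0<..<1}) (%y. snd (edge_param y))"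
proof -
 let ?O = "%J. (%t. f (pt t)) ` J"
 have "openin (top_of_set (?O {0<..<1})) (?O {0<..<1} \<inter> (%y. snd (edge_param y)) -` J)" if J: "open J" for J
 proof -
  have "openin (top_of_set X1) (?O (J \<inter> {0<..<1}))" by (rule open_edge[OF f]) (use J in auto)
  hence "openin (top_of_set (?O {0<..<1})) (?O (J \<inter> {0<..<1}))"
   by (rule openin_subset_trans) (use edge_in[OF f] in auto)
  moreover have "?O (J \<inter> {0<..<1}) = ?O {0<..<1} \<inter> (%y. snd (edge_param y)) -` J"
   using edge_param[OF f] by (auto simp: image_iff)
  ultimately show ?thesis by simp
 qed
 thus ?thesis by (simp add: continuous_on_open_gen[of _ _ UNIV])
qed

definition deformation :: "real \<times> 'a => 'a" where
 "deformation = (%(u, y). if y : X0 then y else fst (edge_param y) (pt (deform u (snd (edge_param y)))))"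

lemma deformation_edge: "f : \<Phi> 1 ==> t : {0..1} ==> deformation (u, f (pt t)) = f (pt (deform u t))"
 using edge_ends[of f t] edge_not_vertex[of f t] edge_param[of f t]
 by (cases "t = 0 \<or> t = 1") (auto simp: deformation_def)

lemma deformation_vertex: "y : X0 ==> deformation (u, y) = y"
 by (simp add: deformation_def)

lemma deformation_in: "u : {0..1} ==> y : X1 ==> deformation (u, y) : X1"
proof (elim X1_cases)
 fix f t assume u: "u : {0..1}" and f: "f : \<Phi> 1" "t : {0<..<1}" "y = f (pt t)"
 thus "deformation (u, y) : X1" using edge_in[OF f(1) deform_in[OF u, of t]] by (simp add: deformation_edge)
qed (simp add: deformation_vertex skeleton_1)

lemma deformation_0: "y : X1 ==> deformation (0, y) = y"
 by (elim X1_cases) (auto simp: deformation_vertex deformation_edge)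

lemma deformation_continuous: "continuous_on ({0..1} \<times> X1) deformation"
proof -
 let ?I = "Pair 0 ` \<Phi> 0 \<union> Pair 1 ` \<Phi> 1"
 let ?F = "%(q :: nat, f) (u, x). (u, f x)" and ?K = "%i :: nat \<times> 'a cell. {0..1::real} \<times> standard_simplex (fst i)"
 have cover: "{0..1} \<times> X1 = (\<Union>i\<in>?I. ?F i ` ?K i)"
  by (auto simp: skeleton_1 skeleton_0 image_iff)
 show ?thesis
  unfolding cover
 proof (rule continuous_on_finite_compact_cover)
  show "finite ?I" using finite_cells by simp
  fix i :: "nat \<times> 'a cell" assume i: "i : ?I"
  show "compact (?K i)" by (intro compact_Times compact_standard_simplex compact_Icc)
  obtain q f where qf: "i = (q, f)" "f : \<Phi> q" using i by auto
  note c = sing_imp(1)[OF cell[OF qf(2)]]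
  show F: "continuous_on (?K i) (?F i)"
   unfolding qf(1) case_prod_beta fst_conv snd_conv by (intro continuous_intros continuous_on_compose2[OF c]) auto
  show "continuous_on (?K i) (%x. deformation (?F i x))"
  proof (cases "q = 0")
   case True
   show ?thesis
    by (rule continuous_on_eq[OF continuous_on_snd[OF F]])
      (use qf True vertex_in in \<open>auto simp: standard_simplex_0' deformation_vertex\<close>)
  next
   case False
   hence q: "q = 1" using i qf(1) by auto
   have "continuous_on ({0..1} \<times> standard_simplex 1) (%x. f (pt (deform (fst x) (snd x 1))))"
   proof (rule continuous_on_compose2[OF c[unfolded q]])
    show "continuous_on ({0..1} \<times> standard_simplex 1) (%x. pt (deform (fst x) (snd x 1)))"
     by (intro pt_continuous deform_continuous continuous_intros
       continuous_on_compose2[OF coordinate_continuous[of UNIV]]) auto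
    show "(%x. pt (deform (fst x) (snd x 1))) ` ({0..1} \<times> standard_simplex 1) \<subseteq> standard_simplex 1"
     using deform_in by (auto simp: standard_simplex_1 pt_coord)
   qed
   moreover have "f (pt (deform (fst x) (snd x 1))) = deformation (?F i x)" if "x : {0..1} \<times> standard_simplex 1" for x
    using that qf q by (auto simp: standard_simplex_1 pt_coord deformation_edge)
   ultimately show ?thesis unfolding qf(1) q fst_conv by (rule continuous_on_eq) (simp add: qf(1) q)
  qed
 qed
qed

end

lemma homologous_rel_0: "homologous_rel n X S c 0 \<longleftrightarrow> singular_relboundary n X S c"
 by (simp add: homologous_rel_def)

lemma sing_chain_of [simp]: "singular_chain n (top_of_set A) (frag_of f) \<longleftrightarrow> sing n A f"
 by (simp add: singular_chain_of)

lemma singular_chain_relboundary: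
 "singular_chain n (top_of_set B) c ==> B \<subseteq> A ==> singular_relboundary n (top_of_set A) B c"
 by (rule singular_chain_imp_relboundary) (simp add: subtopology_subtopology Int_absorb1)

lemma homotopy_homologous:
 fixes h :: "real \<times> 'a::topological_space => 'b::topological_space"
 assumes h: "continuous_on ({0..1} \<times> A) h" "h ` ({0..1} \<times> A) \<subseteq> B" "!!t x. t : {0..1} ==> x : S ==> h (t, x) : T"
  and c: "singular_relcycle n (top_of_set A) S c"
 shows "homologous_rel n (top_of_set B) T (chain_map n (%x. h (0, x)) c) (chain_map n (%x. h (1, x)) c)"
proof (rule homotopic_imp_homologous_rel_chain_maps[OF _ c])
 show "homotopic_with (%h. h : S \<rightarrow> T) (top_of_set A) (top_of_set B) (%x. h (0, x)) (%x. h (1, x))"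
  unfolding homotopic_with_def
  by (intro exI[of _ h]) (use h in \<open>auto simp: continuous_map_in_subtopology prod_topology_subtopology_eu image_subset_iff_funcset\<close>)
qed

lemma simplex_acyclic:
 assumes c: "singular_relcycle 1 (top_of_set (standard_simplex n)) {} c"
 shows "singular_relboundary 1 (top_of_set (standard_simplex n)) {} c"
proof -
 let ?D = "standard_simplex n" and ?h = "%(t, x). %i. (1 - t) * vtx 0 i + t * x i :: real"
 have "continuous_on A ?h" for A
  unfolding case_prod_beta by (intro continuous_intros continuous_on_coordinatewise_then_product
    continuous_on_compose2[OF coordinate_continuous[of UNIV] continuous_on_snd]) auto
 moreover have "?h ` ({0..1} \<times> ?D) \<subseteq> ?D" using convex_standard_simplex[of "vtx 0" n] by auto
 ultimately have "homologous_rel 1 (top_of_set ?D) {} (chain_map 1 (%x. ?h (0, x)) c) (chain_map 1 (%x. ?h (1, x)) c)"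
  using c by (intro homotopy_homologous) auto
 moreover have "chain_map 1 (%x. ?h (1, x)) c = c"
  using c by (intro chain_map_id_gen[of _ "top_of_set ?D"]) (auto simp: singular_cycle)
 moreover have "chain_map 1 (%x. ?h (0, x)) c = chain_map 1 (%x. vtx 0) c" by simp
 moreover have "singular_relboundary 1 (top_of_set ?D) {} (chain_map 1 (%x. vtx 0) c)"
 proof -
  have "singular_relcycle 1 (top_of_set {vtx 0}) {} (chain_map 1 (%x. vtx 0) c)"
   by (rule singular_relcycle_chain_map[OF c]) auto
  hence "singular_relboundary 1 (top_of_set {vtx 0}) {} (chain_map 1 (%x. vtx 0) c)"
   by (subst singular_boundary_eq_cycle_singleton[of _ "vtx 0"]) auto
  thus ?thesis by (rule singular_boundary_mono[rotated]) auto
 qed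
 ultimately have "homologous_rel 1 (top_of_set ?D) {} c 0"
  by (metis homologous_rel_0 homologous_rel_sym homologous_rel_trans)
 thus ?thesis by (simp add: homologous_rel_0)
qed

locale cw_cover = covering E p X + cw_complex X \<Phi>
 for E :: "'e::topological_space set" and p :: "'e => 'a::t2_space" and X \<Phi>
begin

abbreviation "\<Psi> \<equiv> lifted_cells E p \<Phi>"
abbreviation "Y0 \<equiv> skeleton \<Psi> 0"
abbreviation "Y1 \<equiv> skeleton \<Psi> 1"

lemma lcell: "g : \<Psi> q ==> sing q E g" "g : \<Psi> q ==> simplex_map q p g : \<Phi> q"
 by (auto simp: lifted_cells_def)

lemma p_lcell: "x : standard_simplex q ==> p (g x) = simplex_map q p g x"
 by (simp add: simplex_map_apply)

lemma lift_cell: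
 assumes "f : \<Phi> q" "x : standard_simplex q" "e : E" "p e = f x"
 obtains g where "g : \<Psi> q" "simplex_map q p g = f" "g x = e"
 using simplex_lift_exists[OF cell[OF assms(1)] assms(2-4)] assms(1) by (auto simp: lifted_cells_def)

lemma skeleton_lift: "y : skeleton \<Psi> m \<longleftrightarrow> y : E & p y : skeleton \<Phi> m"
proof
 assume "y : skeleton \<Psi> m"
 then obtain q g x where "int q <= m" "g : \<Psi> q" "x : standard_simplex q" "y = g x" by (auto simp: skeleton_def)
 thus "y : E & p y : skeleton \<Phi> m"
  using lcell[of g q] sing_imp(3)[of q E g x] p_lcell[of x q g] by (auto simp: skeleton_def)
next
 assume y: "y : E & p y : skeleton \<Phi> m"
 then obtain q f x where f: "int q <= m" "f : \<Phi> q" "x : standard_simplex q" "p y = f x" by (auto simp: skeleton_def)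
 obtain g where "g : \<Psi> q" "g x = y" using lift_cell[OF f(2,3) _ f(4)] y by metis
 thus "y : skeleton \<Psi> m" using f by (auto simp: skeleton_def)
qed

lemma Y_subset: "Y0 \<subseteq> Y1" "Y1 \<subseteq> E"
 by (auto simp: skeleton_lift) (auto simp: skeleton_1)

lemma ledge:
 assumes "g : \<Psi> 1"
 shows "t : {0..1} ==> g (pt t) : Y1" "g (vtx 0) : Y0" "g (vtx 1) : Y0" "t : {0<..<1} ==> g (pt t) ~: Y0"
  "t : {0..1} ==> p (g (pt t)) = simplex_map 1 p g (pt t)" "sing 1 Y1 g"
proof -
 note l = lcell[OF assms]
 have E: "g (pt t) : E" "p (g (pt t)) = simplex_map 1 p g (pt t)" if "t : {0..1}" for t
  using sing_imp(3)[OF l(1) pt_in[OF that]] p_lcell[OF pt_in[OF that]] by simp_all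
 show "t : {0..1} ==> p (g (pt t)) = simplex_map 1 p g (pt t)" by (rule E)
 show Y1: "g (pt t) : Y1" if "t : {0..1}" for t using E[OF that] edge_in[OF l(2) that] by (simp add: skeleton_lift)
 show "g (vtx 0) : Y0" "g (vtx 1) : Y0"
  using E[of 0] E[of 1] edge_ends[OF l(2), of 0] edge_ends[OF l(2), of 1] by (simp_all add: skeleton_lift)
 show "t : {0<..<1} ==> g (pt t) ~: Y0" using E[of t] edge_not_vertex[OF l(2), of t] by (simp add: skeleton_lift)
 show "sing 1 Y1 g" using l(1) Y1 by (auto simp: sing_iff standard_simplex_1)
qed

lemma ledge_cases:
 assumes y: "y : E" "f : \<Phi> 1" "t : {0..1}" "p y = f (pt t)"
 obtains g where "g : \<Psi> 1" "simplex_map 1 p g = f" "y = g (pt t)"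
 using lift_cell[OF y(2) pt_in[OF y(3)] y(1,4)] by metis

lemma Y1_cases:
 assumes "y : Y1"
 obtains "y : Y0" | g t where "g : \<Psi> 1" "t : {0<..<1}" "y = g (pt t)"
proof -
 have y: "y : E" "p y : X1" using assms by (auto simp: skeleton_lift)
 from y(2) show thesis
 proof (cases rule: X1_cases)
  case (2 f t)
  thus thesis using ledge_cases[OF y(1) 2(1) _ 2(3)] that(2)[of _ t] by (metis atLeastAtMost_iff greaterThanLessThan_iff less_imp_le)
 qed (use y(1) that(1) in \<open>auto simp: skeleton_lift\<close>)
qed

lemma ledge_unique:
 assumes g: "g : \<Psi> 1" "g' : \<Psi> 1" and st: "s : {0<..<1}" "t : {0<..<1}" and eq: "g (pt s) = g' (pt t)"
 shows "g = g' & s = t"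
proof -
 have st': "s : {0..1}" "t : {0..1}" using st by auto
 have "simplex_map 1 p g (pt s) = simplex_map 1 p g' (pt t)"
  using ledge(5)[OF g(1) st'(1)] ledge(5)[OF g(2) st'(2)] eq by simp
 hence *: "simplex_map 1 p g = simplex_map 1 p g'" "s = t"
  using edge_unique[OF lcell(2)[OF g(1)] lcell(2)[OF g(2)] st] by auto
 thus ?thesis
  using simplex_lift_unique[OF lcell(1)[OF g(1)] lcell(1)[OF g(2)] *(1) pt_in[OF st'(1)]] eq by simp
qed

lemma p_Y1: "continuous_on Y1 p" "p ` Y1 \<subseteq> X1"
 using continuous_on_subset[OF p_continuous Y_subset(2)] by (auto simp: skeleton_lift)

text \<open>A neighbourhood of the vertices that the deformation pushes into the vertices, and that
  covers the 1-skeleton together with the open edges.\<close>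

definition off_middle :: "'e set" where
 "off_middle = Y1 \<inter> p -` (X1 - (\<Union>f\<in>\<Phi> 1. (%t. f (pt t)) ` {1/4..3/4}))"

lemma off_middle_open: "openin (top_of_set Y1) off_middle"
proof -
 have "closed (\<Union>f\<in>\<Phi> 1. (%t. f (pt t)) ` {1/4..3/4})"
  using finite_cells by (intro closed_UN ballI compact_imp_closed compact_edge) auto
 hence "openin (top_of_set X1) (X1 - (\<Union>f\<in>\<Phi> 1. (%t. f (pt t)) ` {1/4..3/4}))"
  by (simp only: Diff_eq openin_open_Int open_Compl)
 thus ?thesis unfolding off_middle_def by (rule openin_vimage[OF p_Y1])
qed

lemma off_middle_stretch:
 assumes "g (pt t) : off_middle" and g: "g : \<Psi> 1" and t: "t : {0<..<1}"
 shows "stretch t = 0 \<or> stretch t = 1"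
proof -
 have "p (g (pt t)) = simplex_map 1 p g (pt t)" using ledge(5)[OF g, of t] t by simp
 hence "t ~: {1/4..3/4}" using assms(1) lcell(2)[OF g] by (auto simp: off_middle_def)
 thus ?thesis by (auto simp: stretch_def)
qed

lemma off_middle_vertices: "Y0 \<subseteq> off_middle"
proof -
 have "f (pt t) ~: X0" if "f : \<Phi> 1" "t : {1/4..3/4}" for f and t :: real
  using edge_not_vertex[OF that(1), of t] that(2) by auto
 thus ?thesis by (auto simp: off_middle_def skeleton_lift) (auto simp: skeleton_1)
qed

text \<open>The cover can have infinitely many edges, so the deformation is not pasted there but
  lifted from below. Uniqueness of lifts identifies it on vertices and edges. Outside
  \<open>Y1\<close> it is set to the identity, which makes \<open>K (0, y) = y\<close>
  unconditional.\<close>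

lemma deformation_lift:
 obtains K :: "real \<times> 'e => 'e" where "continuous_on ({0..1} \<times> Y1) K" "K ` ({0..1} \<times> Y1) \<subseteq> Y1" "!!y. K (0, y) = y"
  "!!u y. u : {0..1} ==> y : Y0 ==> K (u, y) = y"
  "!!g t. g : \<Psi> 1 ==> t : {0..1} ==> K (1, g (pt t)) = g (pt (stretch t))"
proof -
 have h: "continuous_on ({0..1} \<times> Y1) (%x. deformation (fst x, p (snd x)))"
  by (rule continuous_on_compose2[OF deformation_continuous])
    (auto simp: skeleton_lift intro!: continuous_intros continuous_on_compose2[OF p_continuous])
 have "(%x. deformation (fst x, p (snd x))) ` ({0..1} \<times> Y1) \<subseteq> X" "!!y. y : Y1 ==> p y = deformation (0, p y)"
  using deformation_in deformation_0 X1_subset by (auto simp: skeleton_lift)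
 from lift_homotopy[of Y1 "%x. deformation (fst x, p (snd x))" "%y. y", OF h this(1)] Y_subset(2) this(2)
 obtain k where k: "continuous_on ({0..1} \<times> Y1) k" "k ` ({0..1} \<times> Y1) \<subseteq> E" "!!y. y : Y1 ==> k (0, y) = y"
  "!!u y. u : {0..1} ==> y : Y1 ==> p (k (u, y)) = deformation (u, p y)"
  by (auto simp: image_subset_iff)
 have track: "k (u, y) = l u" if y: "y : Y1" and l: "continuous_on {0..1} l" "l ` {0..1} \<subseteq> E" "l 0 = y"
  "!!u. u : {0..1} ==> p (l u) = deformation (u, p y)" and u: "u : {0..1}" for u :: real and l y
 proof (rule lift_unique[of "{0..1}" 0 "%u. k (u, y)" l])
  show "continuous_on {0..1} (%u. k (u, y))"
   by (rule continuous_on_compose2[OF k(1)]) (use y in \<open>auto intro!: continuous_intros\<close>)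
 qed (use k y l u in auto)
 define K where "K = (%(u :: real, y). if y : Y1 then k (u, y) else y)"
 show ?thesis
 proof (rule that[of K])
  show "continuous_on ({0..1} \<times> Y1) K" by (rule continuous_on_eq[OF k(1)]) (auto simp: K_def)
  show "K ` ({0..1} \<times> Y1) \<subseteq> Y1"
  proof (rule image_subsetI)
   fix x :: "real \<times> 'e" assume "x : {0..1} \<times> Y1"
   then obtain u y where x: "x = (u, y)" "u : {0..1}" "y : Y1" by auto
   hence "k (u, y) : E" "p (k (u, y)) : X1" using k(2,4) deformation_in[of u "p y"] by (auto simp: skeleton_lift)
   thus "K x : Y1" using x by (simp add: K_def skeleton_lift)
  qed
  show "K (0, y) = y" for y using k(3) by (simp add: K_def)
  show "K (u, y) = y" if "u : {0..1}" "y : Y0" for u y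
   using track[of y "%_. y" u] that Y_subset by (auto simp: K_def skeleton_lift deformation_vertex)
  show "K (1, g (pt t)) = g (pt (stretch t))" if g: "g : \<Psi> 1" and t: "t : {0..1}" for g t
  proof -
   have "k (1, g (pt t)) = g (pt (deform 1 t))"
   proof (rule track[of _ "%u. g (pt (deform u t))"])
    show "continuous_on {0..1} (%u. g (pt (deform u t)))"
     by (rule continuous_on_compose2[OF sing_imp(1)[OF lcell(1)[OF g]]])
       (use pt_in[OF deform_in[OF _ t]] in \<open>auto intro!: continuous_intros deform_continuous\<close>)
    show "(%u. g (pt (deform u t))) ` {0..1} \<subseteq> E"
     using sing_imp(3)[OF lcell(1)[OF g] pt_in[OF deform_in[OF _ t]]] by auto
    show "p (g (pt (deform u t))) = deformation (u, p (g (pt t)))" if "u : {0..1}" for u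
     using ledge(5)[OF g deform_in[OF that t]] ledge(5)[OF g t] deformation_edge[OF lcell(2)[OF g] t] by simp
   qed (use ledge(1)[OF g t] in auto)
   thus ?thesis using ledge(1)[OF g t] by (simp add: K_def)
  qed
 qed
qed

end

section \<open>Edges generate the relative first homology of the 1-skeleton\<close>

definition seg :: "real => (nat => real) => nat => real" where
 "seg t = restrict (%x. pt (t * x 1)) (standard_simplex 1)"

lemma sing_pt:
 assumes "continuous_on (standard_simplex 1) u" "!!x. x : standard_simplex 1 ==> u x : {0..1}"
 shows "sing 1 (standard_simplex 1) (restrict (%x. pt (u x)) (standard_simplex 1))"
 using assms pt_in by (auto simp: sing_iff intro!: continuous_intros)

lemma sing_seg: "t : {0..1} ==> sing 1 (standard_simplex 1) (seg t)"
 unfolding seg_def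
 by (intro sing_pt continuous_intros coordinate_continuous) (auto simp: standard_simplex_1 mult_le_one)

lemma seg_ends [simp]: "seg t (vtx 0) = vtx 0" "seg t (vtx 1) = pt t"
 by (simp_all add: seg_def) (simp_all add: vtx_def)

lemma simplex_map_seg_1: "sing 1 A g ==> simplex_map 1 g (seg 1) = g"
 by (rule extensionalityI[of _ "standard_simplex 1"])
   (auto simp: simplex_map_def seg_def sing_iff standard_simplex_1 image_iff)

lemma simplex_map_seg_0: "simplex_map 1 g (seg 0) = point_simplex 1 (g (vtx 0))"
 by (auto simp: simplex_map_def seg_def point_simplex_def)

context cw_cover
begin

abbreviation "hom1 \<equiv> homologous_rel 1 (top_of_set Y1) Y0"
abbreviation "bd1 \<equiv> singular_relboundary 1 (top_of_set Y1) Y0"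

definition spanned :: "'e chain => bool" where
 "spanned c \<longleftrightarrow> (\<exists>a. Poly_Mapping.keys a \<subseteq> \<Psi> 1 & hom1 c a)"

lemma spanned_bd: "bd1 c ==> spanned c"
 unfolding spanned_def by (intro exI[of _ 0]) (simp add: homologous_rel_0)

lemma spanned_cell: "g : \<Psi> 1 ==> spanned (frag_of g)"
 unfolding spanned_def by (intro exI[of _ "frag_of g"]) simp

lemma spanned_diff: "spanned a ==> spanned b ==> spanned (a - b)"
 unfolding spanned_def by (meson homologous_rel_diff keys_diff le_supI order_trans)

lemma spanned_add: "spanned a ==> spanned b ==> spanned (a + b)"
 using spanned_diff[OF _ spanned_diff[OF spanned_bd[of 0]], of a b] by simp

lemma spanned_hom: "hom1 c c' ==> spanned c' ==> spanned c"
 unfolding spanned_def by (meson homologous_rel_trans)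

lemma spanned_Y0: "singular_chain 1 (top_of_set Y0) c ==> spanned c"
 by (intro spanned_bd singular_chain_relboundary Y_subset)

text \<open>The path from the initial vertex of the edge containing \<open>y\<close> to \<open>y\<close>; it is constant at vertices.\<close>

definition tail :: "'e => (nat => real) => 'e" where
 "tail y = (if y : Y0 then point_simplex 1 y
   else SOME s. \<exists>g t. g : \<Psi> 1 & t : {0<..<1} & y = g (pt t) & s = simplex_map 1 g (seg t))"

lemma tail_edge: "g : \<Psi> 1 ==> t : {0<..<1} ==> tail (g (pt t)) = simplex_map 1 g (seg t)"
 using ledge(4)[of g t] unfolding tail_def
 by (simp del: greaterThanLessThan_iff) (rule some_equality, blast, metis ledge_unique)

text \<open>At the far end of an edge \<open>tail\<close> jumps to a constant path while the segment
  is the full edge; the difference is then a chain in \<open>Y0\<close> minus the edge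
  itself.\<close>

lemma spanned_tail_diff:
 assumes g: "g : \<Psi> 1" and t: "t : {0..1}"
 shows "spanned (frag_of (tail (g (pt t))) - frag_of (simplex_map 1 g (seg t)))"
proof -
 consider "t = 0" | "t = 1" | "t : {0<..<1}" using t by fastforce
 thus ?thesis
 proof cases
  case 1
  thus ?thesis using ledge(2)[OF g] spanned_bd[of 0] by (simp add: tail_def simplex_map_seg_0)
 next
  case 2
  thus ?thesis using g ledge(3,6)[OF g] simplex_map_seg_1[of Y1 g]
   by (auto simp: tail_def intro!: spanned_diff[OF spanned_Y0 spanned_cell] sing_point)
 next
  case 3
  thus ?thesis using spanned_bd[of 0] by (simp add: tail_edge[OF g])
 qed
qed

definition tails :: "'e chain => 'e chain" where
 "tails = frag_extend (%x. frag_of (tail (x (vtx 0))))"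

lemma tails_simps: "tails 0 = 0" "tails (a - b) = tails a - tails b" "tails (frag_of x) = frag_of (tail (x (vtx 0)))"
 by (simp_all add: tails_def frag_extend_diff)

text \<open>The simplex runs inside one lifted edge, so it factors through the standard 1-simplex.
  There the path together with the two segments from vertex 0 forms a cycle, which bounds by
  \<open>simplex_acyclic\<close>.\<close>

lemma spanned_small_edge:
 assumes f: "f : \<Phi> 1" and s: "sing 1 Y1 s" and small: "!!x. x : standard_simplex 1 ==> p (s x) : (%t. f (pt t)) ` {0<..<1}"
  and r: "!!g t. g : \<Psi> 1 ==> t : {0..1} ==> r (g (pt t)) = g (pt (stretch t))"
 shows "spanned (frag_of (simplex_map 1 r s) + frag_of (tail (r (s (vtx 0)))) - frag_of (tail (r (s (vtx 1)))))"
proof -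
 let ?D = "standard_simplex 1"
 define u where "u x = snd (edge_param (p (s x)))" for x
 have u: "u x : {0<..<1}" "p (s x) = f (pt (u x))" if x: "x : ?D" for x
  using small[OF x] edge_param[OF f] by (auto simp: u_def)
 have sE: "s x : E" "s x : Y1" if "x : ?D" for x using sing_imp(3)[OF s that] Y_subset by auto
 have cont_ps: "continuous_on ?D (%x. p (s x))" "(%x. p (s x)) ` ?D \<subseteq> X1"
  using sE by (auto simp: skeleton_lift intro!: continuous_on_compose2[OF p_continuous sing_imp(1)[OF s]])
 have "continuous_on ?D u" unfolding u_def
  by (rule continuous_on_compose2[OF edge_coord_continuous[OF f] cont_ps(1)]) (use small in blast)
 note cont_u = this
 have v: "vtx 0 : ?D" "vtx 1 : ?D" by simp_all
 have u01: "u x : {0..1}" if "x : ?D" for x using u(1)[OF that] by simp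
 obtain g where g: "g : \<Psi> 1" "simplex_map 1 p g = f" "s (vtx 0) = g (pt (u (vtx 0)))"
  using ledge_cases[OF sE(1)[OF v(1)] f u01[OF v(1)] u(2)[OF v(1)]] .
 have gE: "sing 1 E g" using lcell[OF g(1)] by simp
 have s_eq: "s x = g (pt (u x))" if x: "x : ?D" for x
 proof (rule lift_unique[of ?D "vtx 0" s "%x. g (pt (u x))"])
  show "continuous_on ?D (%x. g (pt (u x)))"
   by (rule continuous_on_compose2[OF sing_imp(1)[OF gE]]) (use pt_in u01 in \<open>auto intro!: continuous_intros cont_u\<close>)
  show "(%x. g (pt (u x))) ` ?D \<subseteq> E" using sing_imp(3)[OF gE] pt_in u01 by blast
  show "p (s y) = p (g (pt (u y)))" if "y : ?D" for y
   using u(2)[OF that] ledge(5)[OF g(1) u01[OF that]] g(2) by simp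
 qed (use connected_standard_simplex v g(3) sing_imp(1)[OF s] sE x in auto)
 define W where "W = restrict (%x. pt (stretch (u x))) ?D"
 have str: "stretch t : {0..1}" for t using stretch_01(1,2)[of t] by simp
 have W: "sing 1 ?D W"
  unfolding W_def stretch_def by (rule sing_pt) (auto intro!: continuous_intros cont_u)
 have rs: "simplex_map 1 r s = simplex_map 1 g W"
  using s_eq r[OF g(1) u01] by (auto simp: simplex_map_def W_def)
 define a where "a = stretch (u (vtx 0))"
 define b where "b = stretch (u (vtx 1))"
 have ends: "r (s (vtx 0)) = g (pt a)" "r (s (vtx 1)) = g (pt b)"
  using s_eq r[OF g(1) u01] v by (simp_all add: a_def b_def)
 have "singular_relcycle 1 (top_of_set ?D) {} (frag_of W + frag_of (seg a) - frag_of (seg b))"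
  unfolding singular_cycle chain_boundary_diff chain_boundary_add boundary_1
  using W sing_seg[OF str] by (auto simp: singular_chain_add singular_chain_diff a_def b_def W_def)
 hence "singular_relboundary 1 (top_of_set ?D) {} (frag_of W + frag_of (seg a) - frag_of (seg b))"
  by (rule simplex_acyclic)
 hence "bd1 (chain_map 1 g (frag_of W + frag_of (seg a) - frag_of (seg b)))"
  by (rule singular_relboundary_chain_map) (use ledge(6)[OF g(1)] in \<open>auto simp: sing_iff continuous_map_in_subtopology\<close>)
 hence "spanned (frag_of (simplex_map 1 r s) + frag_of (simplex_map 1 g (seg a)) - frag_of (simplex_map 1 g (seg b)))"
  unfolding rs by (intro spanned_bd) (simp add: chain_map_add chain_map_diff)
 moreover have "spanned (frag_of (tail (g (pt a))) - frag_of (simplex_map 1 g (seg a)))"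
  "spanned (frag_of (tail (g (pt b))) - frag_of (simplex_map 1 g (seg b)))"
  by (rule spanned_tail_diff[OF g(1)]; simp add: a_def b_def stretch_01)+
 ultimately have "spanned ((frag_of (simplex_map 1 r s) + frag_of (simplex_map 1 g (seg a)) - frag_of (simplex_map 1 g (seg b)))
   + (frag_of (tail (g (pt a))) - frag_of (simplex_map 1 g (seg a))) - (frag_of (tail (g (pt b))) - frag_of (simplex_map 1 g (seg b))))"
  by (rule spanned_diff[OF spanned_add])
 thus ?thesis by (simp add: ends algebra_simps)
qed

text \<open>Subdivision makes all simplices small: over one open edge, or inside
  \<open>off_middle\<close>, which the deformation moves into \<open>Y0\<close>. Each deformed
  simplex minus the \<open>tails\<close> of its boundary is spanned by edges, and these corrections
  sum to the \<open>tails\<close> of the boundary of a relative cycle, a chain in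
  \<open>Y0\<close>.\<close>

theorem spanning:
 assumes c: "singular_relcycle 1 (top_of_set Y1) Y0 c"
 shows "spanned c"
proof -
 obtain K :: "real \<times> 'e => 'e" where K: "continuous_on ({0..1} \<times> Y1) K" "K ` ({0..1} \<times> Y1) \<subseteq> Y1" "!!y. K (0, y) = y"
  "!!u y. u : {0..1} ==> y : Y0 ==> K (u, y) = y"
  "!!g t. g : \<Psi> 1 ==> t : {0..1} ==> K (1, g (pt t)) = g (pt (stretch t))"
  using deformation_lift by metis
 define r where "r y = K (1, y)" for y
 have r_cont: "continuous_on Y1 r" "r ` Y1 \<subseteq> Y1" "r ` Y0 \<subseteq> Y0"
  unfolding r_def using K(2,4) by (auto intro!: continuous_intros continuous_on_compose2[OF K(1)])
 let ?O = "%f. (%t. f (pt t)) ` {0<..<1}"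
 define C where "C = insert off_middle ((%f. Y1 \<inter> p -` ?O f) ` \<Phi> 1)"
 have "openin (top_of_set Y1) V" if "V : C" for V
  using that off_middle_open openin_vimage[OF p_Y1 open_edge[of _ "{0<..<1}"]] by (auto simp: C_def)
 moreover have "topspace (top_of_set Y1) \<subseteq> \<Union>C"
 proof
  fix y assume "y : topspace (top_of_set Y1)"
  hence "y : Y1" by simp
  thus "y : \<Union>C"
  proof (cases rule: Y1_cases)
   case (2 g t)
   hence "p y : ?O (simplex_map 1 p g)" using ledge(5)[OF 2(1), of t] by auto
   thus ?thesis using lcell(2)[OF 2(1)] \<open>y : Y1\<close> by (auto simp: C_def)
  qed (use off_middle_vertices in \<open>auto simp: C_def\<close>)
 qed
 ultimately obtain c' where c': "singular_relcycle 1 (top_of_set Y1) Y0 c'" "hom1 c c'"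
  "!!f. f : Poly_Mapping.keys c' ==> \<exists>V \<in> C. f : standard_simplex 1 \<rightarrow> V"
  using small_homologous_rel_relcycle_exists[OF _ _ c, of C] by metis
 have rU: "r y : Y0" if y: "y : off_middle" for y
 proof -
  have "y : Y1" using y by (simp add: off_middle_def)
  thus ?thesis
  proof (cases rule: Y1_cases)
   case 1
   thus ?thesis using K(4)[of 1 y] by (simp add: r_def)
  next
   case (2 g t)
   hence "stretch t = 0 \<or> stretch t = 1" using off_middle_stretch y by blast
   thus ?thesis using K(5)[OF 2(1), of t] 2(2,3) ledge(2,3)[OF 2(1)] by (auto simp: r_def)
  qed
 qed
 have small: "spanned (frag_of (simplex_map 1 r s) + frag_of (tail (r (s (vtx 0)))) - frag_of (tail (r (s (vtx 1)))))"
  if s: "sing 1 Y1 s" "V : C" "s : standard_simplex 1 \<rightarrow> V" for s V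
 proof (cases "V = off_middle")
  case True
  hence *: "r (s x) : Y0" if "x : standard_simplex 1" for x using rU s(3) that by blast
  moreover have "sing 1 Y1 (simplex_map 1 r s)" by (rule sing_simplex_map[OF s(1) r_cont(1,2)])
  ultimately have "sing 1 Y0 (simplex_map 1 r s)" by (auto simp: sing_iff simplex_map_apply)
  thus ?thesis using *[of "vtx 0"] *[of "vtx 1"]
   by (intro spanned_Y0 singular_chain_diff singular_chain_add) (auto simp: tail_def intro!: sing_point)
 next
  case False
  then obtain f where "f : \<Phi> 1" "V = Y1 \<inter> p -` ?O f" using s(2) by (auto simp: C_def)
  thus ?thesis using s(1,3) K(5) by (intro spanned_small_edge) (auto simp: r_def)
 qed
 have "spanned (chain_map 1 r c' - tails (chain_boundary 1 (chain_map 1 r c')))"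
 proof -
  have "Poly_Mapping.keys c' \<subseteq> {s. sing 1 Y1 s & (\<exists>V\<in>C. s : standard_simplex 1 \<rightarrow> V)}"
   using c'(1,3) by (auto simp: singular_relcycle singular_chain_def)
  thus ?thesis
  proof (induction c' rule: frag_induction)
   case zero
   thus ?case using spanned_bd[of 0] by (simp add: tails_simps)
  next
   case (one s)
   thus ?case using small[of s]
    by (auto simp: boundary_1 tails_simps simplex_map_apply point_simplex_def algebra_simps)
  next
   case (diff a b)
   thus ?case using spanned_diff[OF diff] by (simp add: chain_map_diff chain_boundary_diff tails_simps algebra_simps)
  qed
 qed
 moreover have "spanned (tails (chain_boundary 1 (chain_map 1 r c')))"
 proof -
  have "singular_relcycle 1 (top_of_set Y1) Y0 (chain_map 1 r c')"
   by (rule singular_relcycle_chain_map[OF c'(1)]) (use r_cont in \<open>auto simp: continuous_map_in_subtopology\<close>)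
  hence "Poly_Mapping.keys (chain_boundary 1 (chain_map 1 r c')) \<subseteq> {x. sing 0 Y0 x}"
   using Y_subset(1) by (auto simp: singular_relcycle singular_chain_def subtopology_subtopology Int_absorb1)
  thus ?thesis
  proof (induction rule: frag_induction)
   case (one x)
   hence "x (vtx 0) : Y0" using sing_imp(3)[of 0 Y0 x "vtx 0"] by simp
   thus ?case by (auto simp: tails_simps tail_def intro!: spanned_Y0 sing_point)
  qed (auto simp: tails_simps spanned_diff spanned_bd)
 qed
 ultimately have "spanned (chain_map 1 r c')" using spanned_add by fastforce
 moreover have "hom1 c' (chain_map 1 r c')"
 proof -
  have "hom1 (chain_map 1 (%x. K (0, x)) c') (chain_map 1 (%x. K (1, x)) c')"
   by (rule homotopy_homologous[OF K(1,2) _ c'(1)]) (simp add: K(4))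
  moreover have "chain_map 1 (%x. K (0, x)) c' = c'"
   using c'(1) K(3) by (intro chain_map_id_gen[of _ "top_of_set Y1"]) (auto simp: singular_relcycle)
  ultimately show ?thesis by (simp add: r_def[abs_def])
 qed
 ultimately show ?thesis using spanned_hom c'(2) by blast
qed

end

section \<open>Independence of the edges by winding numbers\<close>

lemma sing_euclidean: "singular_simplex n euclidean f \<longleftrightarrow> f : extensional (standard_simplex n) & continuous_on (standard_simplex n) f"
 using sing_iff[of n UNIV f] by simp

lemma stretch_continuous: "continuous_on A f ==> continuous_on A (%x. stretch (f x))"
 unfolding stretch_def by (intro continuous_intros)

context cw_cover
begin

abbreviation ledge_interior :: "'e cell => 'e set" where
 "ledge_interior g \<equiv> (%t. g (pt t)) ` {0<..<1}"

text \<open>There may be infinitely many lifted edges, so instead of the complement argument of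
  \<open>open_edge\<close> a sheet of the cover is used: within the sheet, points over a small piece
  of the edge below lie on this lift.\<close>

lemma open_ledge:
 assumes g: "g : \<Psi> 1"
 shows "openin (top_of_set Y1) (ledge_interior g)"
proof (subst openin_subopen, intro ballI)
 fix y assume "y : ledge_interior g"
 then obtain t0 where t0: "t0 : {0<..<1}" "y = g (pt t0)" by blast
 let ?f = "simplex_map 1 p g"
 have gE: "g (pt t) : E" "p (g (pt t)) = ?f (pt t)" "g (pt t) : Y1" if "t : {0<..<1}" for t
  using ledge(1,5)[OF g, of t] that Y_subset by auto
 obtain u W q where u: "y : u" "openin (top_of_set E) u" "homeomorphism u W p q"
  using covering_space_local_homeomorphism[OF cov] gE(1)[OF t0(1)] t0(2) by metis
 define J where "J = {0<..<1} \<inter> (%t. g (pt t)) -` u"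
 have "continuous_on {0<..<1} (%t. g (pt t))"
  by (rule continuous_on_compose2[OF sing_imp(1)[OF lcell(1)[OF g]]]) (auto intro!: continuous_intros pt_in)
 hence "openin (top_of_set {0<..<1}) J" unfolding J_def by (rule openin_vimage) (use gE u(2) in auto)
 hence J: "open J" "J \<subseteq> {0<..<1}" by (auto simp: openin_open_eq J_def)
 define T where "T = (Y1 \<inter> u) \<inter> (Y1 \<inter> p -` ((%t. ?f (pt t)) ` J))"
 have "openin (top_of_set Y1) (Y1 \<inter> u)"
  using u(2) Y_subset(2) by (auto simp: openin_open)
 moreover have "openin (top_of_set Y1) (Y1 \<inter> p -` ((%t. ?f (pt t)) ` J))"
  by (rule openin_vimage[OF p_Y1 open_edge[OF lcell(2)[OF g] J]])
 ultimately have "openin (top_of_set Y1) T" unfolding T_def by (rule openin_Int)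
 moreover have "t0 : J" using t0 u(1) by (simp add: J_def)
 hence "y : T" using gE[OF t0(1)] t0(2) u(1) by (auto simp: T_def)
 moreover have "T \<subseteq> ledge_interior g"
 proof
  fix z assume "z : T"
  then obtain t where z: "z : u" "t : J" "p z = ?f (pt t)" by (auto simp: T_def)
  hence "t : {0<..<1}" "g (pt t) : u" by (auto simp: J_def)
  hence "z = g (pt t)" using homeomorphism_apply1[OF u(3)] z(1,3) gE(2) by metis
  thus "z : ledge_interior g" using \<open>t : {0<..<1}\<close> by blast
 qed
 ultimately show "\<exists>T. openin (top_of_set Y1) T & y : T & T \<subseteq> ledge_interior g" by blast
qed

text \<open>Collapses everything but the middle of the edge \<open>g\<close> to 1 and wraps this middle around the circle.\<close>

definition collapse :: "'e cell => 'e => complex" where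
 "collapse g y = (if y : ledge_interior g then exp (2 * pi * \<i> * stretch (snd (edge_param (p y)))) else 1)"

lemma collapse_edge:
 assumes "g : \<Psi> 1" "t : {0<..<1}"
 shows "collapse g (g (pt t)) = exp (2 * pi * \<i> * stretch t)"
 using assms ledge(5)[OF assms(1), of t] edge_param[OF lcell(2)[OF assms(1)] assms(2)] by (auto simp: collapse_def)

lemma collapse_other:
 assumes g: "g : \<Psi> 1" "g' : \<Psi> 1" "g' ~= g" and t: "t : {0..1}"
 shows "collapse g (g' (pt t)) = 1"
proof -
 have "g' (pt t) ~: ledge_interior g"
 proof
  assume *: "g' (pt t) : ledge_interior g"
  then obtain t' where t': "t' : {0<..<1}" "g' (pt t) = g (pt t')" by blast
  hence "g' (pt t) ~: Y0" using ledge(4)[OF g(1)] by simp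
  hence "t ~= 0" "t ~= 1" using ledge(2,3)[OF g(2)] by auto
  hence "t : {0<..<1}" using t by auto
  thus False using ledge_unique[OF g(2,1) _ t'(1)] t'(2) g(3) by blast
 qed
 thus ?thesis by (simp add: collapse_def)
qed

lemma collapse_vertex: "g : \<Psi> 1 ==> y : Y0 ==> collapse g y = 1"
 using ledge(4) by (auto simp: collapse_def)

lemma collapse_continuous:
 assumes g: "g : \<Psi> 1"
 shows "continuous_on Y1 (collapse g)"
proof (rule continuous_on_locally)
 fix y assume "y : Y1"
 thus "\<exists>V. openin (top_of_set Y1) V & y : V & continuous_on V (collapse g)"
 proof (cases rule: Y1_cases)
  case 1
  have "collapse g z = 1" if z: "z : off_middle" for z
  proof (cases "z : ledge_interior g")
   case True
   then obtain t where t: "t : {0<..<1}" "z = g (pt t)" by blast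
   hence "stretch t = 0 \<or> stretch t = 1" using off_middle_stretch[OF _ g] z by blast
   thus ?thesis using collapse_edge[OF g t(1)] t(2) exp_two_pi_i by (auto simp: mult_ac)
  qed (simp add: collapse_def)
  hence "continuous_on off_middle (collapse g)" by (simp cong: continuous_on_cong)
  thus ?thesis using off_middle_open off_middle_vertices 1 by blast
 next
  case (2 g' t)
  have "continuous_on (ledge_interior g') (collapse g)"
  proof (cases "g' = g")
   case True
   have p_int: "p ` ledge_interior g \<subseteq> (%t. simplex_map 1 p g (pt t)) ` {0<..<1}"
   proof (rule image_subsetI)
    fix z assume "z : ledge_interior g"
    then obtain t where t: "t : {0<..<1}" "z = g (pt t)" by blast
    hence "p z = simplex_map 1 p g (pt t)" using ledge(5)[OF g, of t] by simp
    thus "p z : (%t. simplex_map 1 p g (pt t)) ` {0<..<1}" using t(1) by blast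
   qed
   have "ledge_interior g \<subseteq> E" using ledge(1)[OF g] Y_subset(2) by (auto simp: image_subset_iff)
   hence "continuous_on (ledge_interior g) (%z. snd (edge_param (p z)))"
    by (intro continuous_on_compose2[OF edge_coord_continuous[OF lcell(2)[OF g]] _ p_int] continuous_on_subset[OF p_continuous])
   hence "continuous_on (ledge_interior g) (%z. exp (2 * pi * \<i> * stretch (snd (edge_param (p z)))))"
    by (intro continuous_on_exp continuous_on_mult continuous_on_const continuous_on_of_real stretch_continuous)
   thus ?thesis unfolding True by (rule continuous_on_eq) (simp add: collapse_def)
  next
   case False
   hence "collapse g z = 1" if "z : ledge_interior g'" for z using collapse_other[OF g 2(1) False] that by auto
   thus ?thesis by (simp cong: continuous_on_cong)
  qed
  thus ?thesis using open_ledge[OF 2(1)] 2(2,3) by blast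
 qed
qed

lemma collapse_nonzero: "collapse g y ~= 0"
 by (simp add: collapse_def)

interpretation exp: covering UNIV exp "- {0::complex}"
 by standard (rule covering_space_exp_punctured_plane)

definition winding :: "'e cell => ((nat => real) => 'e) => complex" where
 "winding g s = (let l = SOME l. sing 1 UNIV l & simplex_map 1 exp l = simplex_map 1 (collapse g) s in l (vtx 1) - l (vtx 0))"

lemma winding_eq:
 assumes l: "sing 1 UNIV l" "simplex_map 1 exp l = simplex_map 1 (collapse g) s"
 shows "winding g s = l (vtx 1) - l (vtx 0)"
proof -
 define l' where "l' = (SOME l. sing 1 UNIV l & simplex_map 1 exp l = simplex_map 1 (collapse g) s)"
 have l': "sing 1 UNIV l'" "simplex_map 1 exp l' = simplex_map 1 (collapse g) s"
  unfolding l'_def by (rule someI2[of _ l]; use l in blast)+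
 have exp_eq: "exp (l' x) = exp (l x)" if "x : standard_simplex 1" for x
  using fun_cong[OF trans[OF l'(2) l(2)[symmetric]], of x] that by (simp add: simplex_map_apply)
 define c where "c = l' (vtx 0) - l (vtx 0)"
 have "exp c = 1" using exp_eq[of "vtx 0"] by (simp add: c_def exp_diff)
 have "restrict (%x. l x + c) (standard_simplex 1) = l'"
 proof (rule exp.simplex_lift_unique[of 1 _ _ "vtx 0"])
  show "sing 1 UNIV (restrict (%x. l x + c) (standard_simplex 1))"
   using l(1) by (auto simp: sing_euclidean intro!: continuous_intros)
  show "simplex_map 1 exp (restrict (%x. l x + c) (standard_simplex 1)) = simplex_map 1 exp l'"
   using exp_eq \<open>exp c = 1\<close> by (auto simp: simplex_map_def exp_add)
 qed (use l' in \<open>auto simp: c_def\<close>)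
 hence "l' (vtx 1) = l (vtx 1) + c" by (metis restrict_apply' vtx_in order_refl)
 thus ?thesis unfolding winding_def l'_def[symmetric] Let_def by (simp add: c_def)
qed

lemma winding_const:
 assumes "!!x. x : standard_simplex 1 ==> collapse g (s x) = 1"
 shows "winding g s = 0"
 using assms
 by (subst winding_eq[of "point_simplex 1 0"]) (auto simp: sing_euclidean simplex_map_def point_simplex_def)

lemma winding_self:
 assumes g: "g : \<Psi> 1"
 shows "winding g g = 2 * pi * \<i>"
proof (subst winding_eq[of "restrict (%x. 2 * pi * \<i> * stretch (x 1)) (standard_simplex 1)"])
 show "sing 1 UNIV (restrict (%x. 2 * pi * \<i> * complex_of_real (stretch (x 1))) (standard_simplex 1))"
  by (auto simp: sing_euclidean intro!: continuous_intros stretch_continuous coordinate_continuous)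
 have "exp (2 * pi * \<i> * stretch t) = collapse g (g (pt t))" if "t : {0..1}" for t
  using that collapse_edge[OF g, of t] collapse_vertex[OF g] ledge(2,3)[OF g] exp_two_pi_i
  by (cases "t = 0 \<or> t = 1") (auto simp: stretch_01 mult_ac)
 thus "simplex_map 1 exp (restrict (%x. 2 * pi * \<i> * complex_of_real (stretch (x 1))) (standard_simplex 1)) = simplex_map 1 (collapse g) g"
  unfolding simplex_map_def by (intro restrict_ext) (auto simp: standard_simplex_1)
qed (auto simp: stretch_01 vtx_def)

text \<open>A logarithm exists on the whole 2-simplex, and its increments along the three faces
  cancel.\<close>

lemma winding_boundary:
 assumes g: "g : \<Psi> 1" and s: "singular_chain 2 (top_of_set Y1) d"
 shows "lin (winding g) (chain_boundary 2 d) = 0"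
 using _ _ _ s
proof (rule lin_boundary_2[where P = "%x. x = 0"])
 fix f assume f: "sing 2 Y1 f"
 have cf: "sing 2 (- {0}) (simplex_map 2 (collapse g) f)"
  by (rule sing_simplex_map[OF f collapse_continuous[OF g]]) (auto simp: collapse_nonzero)
 obtain z where "exp z = simplex_map 2 (collapse g) f (vtx 0)"
  using sing_imp(3)[OF cf, of "vtx 0"] exp.p_surj by (metis imageE vtx_in zero_le)
 then obtain l where l: "sing 2 UNIV l" "simplex_map 2 exp l = simplex_map 2 (collapse g) f"
  using exp.simplex_lift_exists[OF cf, of "vtx 0" z] by auto
 have "winding g (singular_face 2 k f) = singular_face 2 k l (vtx 1) - singular_face 2 k l (vtx 0)" if "k <= 2" for k
  by (rule winding_eq[OF sing_face[OF l(1) that]]) (simp only: face_map[OF that] l(2))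
 thus "winding g (singular_face 2 0 f) - winding g (singular_face 2 1 f) + winding g (singular_face 2 2 f) = 0"
  by (simp add: face_2)
qed auto

text \<open>\<open>winding g\<close> is dual to the edge \<open>g\<close>: it is 2 pi i on
  \<open>g\<close>, and 0 on the other edges, on simplices in \<open>Y0\<close> and on boundaries.
  Applied to a relative boundary it isolates the coefficient of \<open>g\<close>.\<close>

theorem independence:
 assumes a: "Poly_Mapping.keys a \<subseteq> \<Psi> 1" and bd: "bd1 a"
 shows "a = 0"
proof (rule poly_mapping_eqI)
 fix g
 show "Poly_Mapping.lookup a g = Poly_Mapping.lookup 0 g"
 proof (cases "g : \<Psi> 1")
  case True
  obtain d e where d: "singular_chain 2 (top_of_set Y1) d" and e: "singular_chain 1 (top_of_set Y0) e"
   and a_eq: "chain_boundary 2 d + e = a"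
   using bd Y_subset(1) unfolding singular_relboundary
   by (auto simp: One_nat_def numeral_2_eq_2 subtopology_subtopology Int_absorb1)
  have "lin (winding g) e = 0"
  proof -
   have "winding g s = 0" if "s : Poly_Mapping.keys e" for s
    using e that collapse_vertex[OF True] by (intro winding_const) (auto simp: singular_chain_def dest: sing_imp(3))
   thus ?thesis by (simp add: lin_def)
  qed
  hence "lin (winding g) a = 0" using winding_boundary[OF True d] a_eq by (auto simp flip: a_eq)
  moreover have "lin (winding g) a = (\<Sum>g'\<in>Poly_Mapping.keys a. if g' = g then of_int (Poly_Mapping.lookup a g) * (2 * pi * \<i>) else 0)"
   unfolding lin_def
  proof (intro sum.cong refl)
   fix g' assume g': "g' : Poly_Mapping.keys a"
   have "winding g g' = 0" if "g' ~= g"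
    using a g' that collapse_other[OF True] by (intro winding_const) (auto simp: standard_simplex_1)
   thus "of_int (Poly_Mapping.lookup a g') * winding g g' = (if g' = g then of_int (Poly_Mapping.lookup a g) * (2 * pi * \<i>) else 0)"
    using winding_self[OF True] by simp
  qed
  ultimately have "g : Poly_Mapping.keys a ==> Poly_Mapping.lookup a g = 0" by (simp add: sum.delta')
  thus ?thesis by (auto simp: in_keys_iff)
 qed (use a in \<open>auto simp: in_keys_iff\<close>)
qed

end

section \<open>Incidence numbers and maps between covers\<close>

lemma relative_homology_class_hom:
 fixes a b :: "'a chain" and n :: nat
 assumes "singular_relcycle n X S a" "singular_relcycle n X S b"
 shows "homologous_rel_set n X S a \<otimes>\<^bsub>relative_homology_group (int n) X S\<^esub> homologous_rel_set n X S b
  = homologous_rel_set n X S (a + b)"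
proof -
 have "(%a. {b. homologous_rel n X S a b}) : hom (relcycle_group n X S) (relcycle_group n X S Mod singular_relboundary_set n X S)"
  using normal.r_coset_hom_Mod[OF normal_subgroup_singular_relboundary_relcycle, of n X S]
  by (simp only: right_coset_singular_relboundary)
 thus ?thesis using assms by (simp add: hom_def nontrivial_relative_homology_group)
qed

lemma relative_homology_class_nat_pow:
 fixes a :: "'a chain" and k :: nat
 assumes "singular_relcycle n X S a"
 shows "homologous_rel_set n X S a [^]\<^bsub>relative_homology_group (int n) X S\<^esub> k = homologous_rel_set n X S (frag_cmul (int k) a)"
proof (induction k)
 case 0
 thus ?case using homologous_rel_set_eq_relboundary[of n X S 0] by simp
next
 case (Suc k)
 have "frag_cmul (int (Suc k)) a = frag_cmul (int k) a + a"
  by (rule poly_mapping_eqI) (simp add: lookup_add distrib_right)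
 thus ?case
  using Suc relative_homology_class_hom[OF singular_relcycle_cmul[OF assms] assms, of "int k"] by simp
qed

lemma relative_homology_class_int_pow:
 fixes a :: "'a chain" and k :: int
 assumes a: "singular_relcycle n X S a"
 shows "homologous_rel_set n X S a [^]\<^bsub>relative_homology_group (int n) X S\<^esub> k = homologous_rel_set n X S (frag_cmul k a)"
proof (cases "k >= 0")
 case True
 then obtain m where "k = int m" using nonneg_int_cases by blast
 thus ?thesis using relative_homology_class_nat_pow[OF a, of m] by (simp add: int_pow_int)
next
 case False
 then obtain m where k: "k = - int m" by (metis int_cases2 le_minus_iff neg_le_0_iff_le of_nat_0_le_iff)
 let ?G = "relative_homology_group (int n) X S"
 have c: "homologous_rel_set n X S b : carrier ?G" if "singular_relcycle n X S b" for b
  using that by (auto simp: carrier_relative_homology_group)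
 have "inv\<^bsub>?G\<^esub> homologous_rel_set n X S (frag_cmul (int m) a) = homologous_rel_set n X S (frag_cmul k a)"
 proof (rule group.inv_equality)
  have "homologous_rel_set n X S (frag_cmul k a) \<otimes>\<^bsub>?G\<^esub> homologous_rel_set n X S (frag_cmul (int m) a)
   = homologous_rel_set n X S (frag_cmul k a + frag_cmul (int m) a)"
   by (rule relative_homology_class_hom; rule singular_relcycle_cmul[OF a])
  moreover have "frag_cmul k a + frag_cmul (int m) a = 0" by (rule poly_mapping_eqI) (simp add: k lookup_add)
  ultimately show "homologous_rel_set n X S (frag_cmul k a) \<otimes>\<^bsub>?G\<^esub> homologous_rel_set n X S (frag_cmul (int m) a) = \<one>\<^bsub>?G\<^esub>"
   using homologous_rel_set_eq_relboundary[of n X S 0] by simp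
 qed (use c singular_relcycle_cmul[OF a] in auto)
 thus ?thesis
  using relative_homology_class_nat_pow[OF a, of m] group.int_pow_neg[OF group_relative_homology_group c[OF a], of "int m"]
  by (simp add: k int_pow_int)
qed

lemma relative_homology_class_finprod:
 assumes "finite A" "!!f. f : A ==> singular_relcycle n X S (b f)"
 shows "finprod (relative_homology_group (int n) X S) (%f. homologous_rel_set n X S (b f)) A
  = homologous_rel_set n X S (\<Sum>f\<in>A. b f)"
 using assms
proof (induction A rule: finite_induct)
 case empty
 interpret comm_group "relative_homology_group (int n) X S" by simp
 show ?case using homologous_rel_set_eq_relboundary[of n X S 0] by simp
next
 case (insert x A)
 interpret comm_group "relative_homology_group (int n) X S" by simp
 have "finprod (relative_homology_group (int n) X S) (%f. homologous_rel_set n X S (b f)) (insert x A)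
   = homologous_rel_set n X S (b x) \<otimes>\<^bsub>relative_homology_group (int n) X S\<^esub> homologous_rel_set n X S (\<Sum>f\<in>A. b f)"
  using insert by (subst finprod_insert) (auto simp: carrier_relative_homology_group)
 also have "... = homologous_rel_set n X S (b x + (\<Sum>f\<in>A. b f))"
  by (rule relative_homology_class_hom) (use insert.prems in \<open>auto intro: singular_relcycle_sum\<close>)
 finally show ?case using insert.hyps by simp
qed

context cw_cover
begin

lemma ledge_relcycle: "g : \<Psi> 1 ==> singular_relcycle 1 (top_of_set Y1) Y0 (frag_of g)"
proof -
 assume g: "g : \<Psi> 1"
 have "singular_chain 0 (top_of_set Y0) (chain_boundary 1 (frag_of g))"
  unfolding boundary_1 by (intro singular_chain_diff) (use ledge(2,3)[OF g] in \<open>auto intro: sing_point\<close>)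
 thus ?thesis using ledge(6)[OF g] Y_subset(1) by (simp add: singular_relcycle subtopology_subtopology Int_absorb1)
qed

lemma face_relcycle: "g : \<Psi> 2 ==> sing 2 (skeleton \<Psi> 2) g & singular_chain 1 (top_of_set Y1) (chain_boundary 2 (frag_of g))"
proof
 assume g: "g : \<Psi> 2"
 have gE: "sing 2 E g" using lcell(1)[OF g] .
 have "g x : skeleton \<Psi> 2" if "x : standard_simplex 2" for x using g that by (auto simp: skeleton_def)
 thus "sing 2 (skeleton \<Psi> 2) g" using gE by (auto simp: sing_iff)
 have "sing 1 Y1 (singular_face 2 k g)" if k: "k <= 2" for k
 proof -
  have "g (simplical_face k x) : Y1" if x: "x : standard_simplex 1" for x
  proof -
   have s: "simplical_face k x : standard_simplex 2"
    using simplical_face_in_standard_simplex[of 2 k x] k x by (simp add: One_nat_def)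
   moreover have "simplical_face k x ~: open_simplex 2"
    using k by (auto simp: open_simplex_def simplical_face_def intro!: exI[of _ k])
   ultimately obtain r h where "r < 2" "h : \<Phi> r" "simplex_map 2 p g (simplical_face k x) : h ` open_simplex r"
    using cell_boundary[OF lcell(2)[OF g]] by blast
   then obtain y where y: "p (g (simplical_face k x)) = h y" "y : standard_simplex r"
    using p_lcell[OF s, of g] by (auto simp: open_simplex_def)
   have "p (g (simplical_face k x)) : X1"
    unfolding skeleton_def y(1) by (rule UN_I[of r], use \<open>r < 2\<close> in simp, rule UN_I[OF \<open>h : \<Phi> r\<close> imageI[OF y(2)]])
   thus ?thesis using sing_imp(3)[OF gE s] by (simp add: skeleton_lift)
  qed
  thus ?thesis using sing_face[OF gE k] by (auto simp: sing_iff singular_face_def One_nat_def[symmetric])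
 qed
 thus "singular_chain 1 (top_of_set Y1) (chain_boundary 2 (frag_of g))"
  unfolding boundary_2 by (intro singular_chain_add singular_chain_diff) auto
qed

lemma boundary_relcycle:
 assumes "g : \<Psi> 2"
 shows "singular_relcycle 1 (top_of_set Y1) Y0 (chain_boundary 2 (frag_of g))"
proof -
 have "chain_boundary 1 (chain_boundary 2 (frag_of g)) = 0"
  using chain_boundary_boundary[of 2 "top_of_set (skeleton \<Psi> 2)" "frag_of g"] face_relcycle[OF assms] by (simp add: One_nat_def)
 thus ?thesis using face_relcycle[OF assms] by (simp add: singular_relcycle)
qed

text \<open>The boundary map of the triple passes through the absolute homology of
  \<open>Y1\<close>; on representatives it is \<open>chain_boundary\<close> followed by the
  identity.\<close>

lemma cellular_boundary_cell:
 assumes "g : \<Psi> 2"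
 shows "cellular_boundary \<Psi> 2 (cell_class \<Psi> 2 g) = homologous_rel_set 1 (top_of_set Y1) Y0 (chain_boundary 2 (frag_of g))"
proof -
 note f = face_relcycle[OF assms]
 have sub: "Y1 \<subseteq> skeleton \<Psi> 2" unfolding skeleton_def by (rule UN_mono) auto
 have st: "subtopology (top_of_set (skeleton \<Psi> 2)) Y1 = top_of_set Y1" using sub by (simp add: subtopology_subtopology Int_absorb1)
 have rel: "singular_relcycle 2 (top_of_set (skeleton \<Psi> 2)) Y1 (frag_of g)"
  using f by (simp add: singular_relcycle st One_nat_def)
 have "chain_map 1 id (chain_boundary 2 (frag_of g)) = chain_boundary 2 (frag_of g)"
  using f by (intro chain_map_ident[of _ "top_of_set Y1"]) auto
 moreover have "singular_relcycle 1 (top_of_set Y1) {} (chain_boundary 2 (frag_of g))"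
  using f chain_boundary_boundary[of 2 "top_of_set (skeleton \<Psi> 2)" "frag_of g"] by (simp add: singular_cycle One_nat_def)
 ultimately show ?thesis
  using hom_boundary_chain_boundary[OF rel] hom_induced_chain_map[of "top_of_set Y1" "top_of_set Y1" id "{}" Y0 1]
  by (simp add: cellular_boundary_def cell_class_def hom_relboundary_def st One_nat_def)
qed

lemma sum_frag_keys: "(\<Sum>f\<in>Poly_Mapping.keys a. frag_cmul (Poly_Mapping.lookup a f) (frag_of f)) = a"
 by (metis frag_expansion frag_extend_def)

lemma lookup_sum_frag:
 "finite A ==> Poly_Mapping.lookup (\<Sum>f\<in>A. frag_cmul (c f) (frag_of f)) x = (if x : A then c x else 0)"
 by (induction A rule: finite_induct) (auto simp: lookup_add)

lemma cellular_chain_group_1: "cellular_chain_group \<Psi> 1 = relative_homology_group (int 1) (top_of_set Y1) Y0"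
 by (simp add: cellular_chain_group_def)

lemma cell_class_1: "cell_class \<Psi> 1 f = homologous_rel_set 1 (top_of_set Y1) Y0 (frag_of f)"
 by (simp add: cell_class_def)

text \<open>Two solutions of the description in \<open>incidence\<close> differ by a chain of edges
  that is a relative boundary, hence by 0 according to \<open>independence\<close>. This makes the
  definite description denote the coefficients of \<open>a\<close>.\<close>

theorem incidence_eqI:
 assumes g: "g : \<Psi> 2" and a: "Poly_Mapping.keys a \<subseteq> \<Psi> 1" and hom: "hom1 (chain_boundary 2 (frag_of g)) a"
 shows "incidence \<Psi> 1 g = Poly_Mapping.lookup a"
proof -
 let ?A = "%c :: 'e cell => int. \<Sum>f | c f ~= 0. frag_cmul (c f) (frag_of f)"
 let ?P = "%c :: 'e cell => int. finite {f. c f ~= 0} & {f. c f ~= 0} \<subseteq> \<Psi> 1 &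
    cellular_boundary \<Psi> (Suc 1) (cell_class \<Psi> (Suc 1) g) =
    finprod (cellular_chain_group \<Psi> 1)
     (%f. cell_class \<Psi> 1 f [^]\<^bsub>cellular_chain_group \<Psi> 1\<^esub> c f) {f. c f ~= 0}"
 have P: "?P c \<longleftrightarrow> finite {f. c f ~= 0} & {f. c f ~= 0} \<subseteq> \<Psi> 1 & hom1 (chain_boundary 2 (frag_of g)) (?A c)" for c :: "'e cell => int"
 proof -
  have "finprod (cellular_chain_group \<Psi> 1) (%f. cell_class \<Psi> 1 f [^]\<^bsub>cellular_chain_group \<Psi> 1\<^esub> c f) {f. c f ~= 0}
    = homologous_rel_set 1 (top_of_set Y1) Y0 (?A c)" if fin: "finite {f. c f ~= 0}" and sub: "{f. c f ~= 0} \<subseteq> \<Psi> 1"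
  proof -
   let ?G = "relative_homology_group (int 1) (top_of_set Y1) Y0"
   let ?b = "%f. frag_cmul (c f) (frag_of f)"
   interpret comm_group ?G by simp
   have rel: "singular_relcycle 1 (top_of_set Y1) Y0 (frag_of f)" if "f : {f. c f ~= 0}" for f
    using sub that ledge_relcycle by blast
   have "finprod ?G (%f. cell_class \<Psi> 1 f [^]\<^bsub>?G\<^esub> c f) {f. c f ~= 0}
    = finprod ?G (%f. homologous_rel_set 1 (top_of_set Y1) Y0 (?b f)) {f. c f ~= 0}"
   proof (rule finprod_cong'[OF refl])
    show "(%f. homologous_rel_set 1 (top_of_set Y1) Y0 (?b f)) : {f. c f ~= 0} \<rightarrow> carrier ?G"
     unfolding carrier_relative_homology_group by (intro Pi_I imageI CollectI singular_relcycle_cmul rel) simp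
    show "cell_class \<Psi> 1 f [^]\<^bsub>?G\<^esub> c f = homologous_rel_set 1 (top_of_set Y1) Y0 (?b f)" if "f : {f. c f ~= 0}" for f
     unfolding cell_class_1 by (rule relative_homology_class_int_pow[OF rel[OF that]])
   qed
   also have "... = homologous_rel_set 1 (top_of_set Y1) Y0 (?A c)"
    by (rule relative_homology_class_finprod[OF fin]) (rule singular_relcycle_cmul[OF rel])
   finally show ?thesis unfolding cellular_chain_group_1 .
  qed
  moreover have "Suc 1 = 2" by simp
  ultimately show ?thesis
   unfolding \<open>Suc 1 = 2\<close> cellular_boundary_cell[OF g] by (metis (no_types, lifting) homologous_rel_set_eq)
 qed
 have la: "{f. Poly_Mapping.lookup a f ~= 0} = Poly_Mapping.keys a" by (auto simp: in_keys_iff)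
 show ?thesis
  unfolding incidence_def
 proof (rule the_equality)
  show "?P (Poly_Mapping.lookup a)" using a hom by (intro P[THEN iffD2]) (simp add: la sum_frag_keys)
  fix c assume "?P c"
  hence c: "finite {f. c f ~= 0}" "{f. c f ~= 0} \<subseteq> \<Psi> 1" "hom1 (chain_boundary 2 (frag_of g)) (?A c)" unfolding P by auto
  have look: "Poly_Mapping.lookup (?A c) f = c f" for f using lookup_sum_frag[OF c(1), of c f] by auto
  hence "Poly_Mapping.keys (?A c) \<subseteq> \<Psi> 1" using c(2) by (auto simp: in_keys_iff)
  hence "Poly_Mapping.keys (?A c - a) \<subseteq> \<Psi> 1" using a keys_diff[of "?A c" a] by blast
  moreover have "bd1 (?A c - a)"
   using homologous_rel_trans[OF hom c(3)[THEN homologous_rel_sym[THEN iffD1]]] by (simp add: homologous_rel_def)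
  ultimately have "?A c - a = 0" by (rule independence)
  thus "c = Poly_Mapping.lookup a" using look by auto
 qed
qed

lemma incidence_exists:
 assumes "g : \<Psi> 2"
 obtains a where "Poly_Mapping.keys a \<subseteq> \<Psi> 1" "hom1 (chain_boundary 2 (frag_of g)) a"
 using spanning[OF boundary_relcycle[OF assms]] by (auto simp: spanned_def)

end

lemma lookup_chain_map:
 "Poly_Mapping.lookup (chain_map n q a) x = (\<Sum>f\<in>Poly_Mapping.keys a. if simplex_map n q f = x then Poly_Mapping.lookup a f else 0)"
 unfolding chain_map_def frag_extend_def
 by (auto simp: lookup_sum intro!: sum.cong)

locale cw_cover_map = A: cw_cover E1 p1 X \<Phi> + B: cw_cover E2 p2 X \<Phi>
 for E1 :: "'e::topological_space set" and p1 :: "'e => 'a::t2_space" and E2 :: "'f::topological_space set" and p2 X \<Phi> +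
 fixes q :: "'e => 'f"
 assumes q_in: "e : E1 ==> q e : E2" and p_q: "e : E1 ==> p2 (q e) = p1 e" and simplexwise: "simplexwise E1 E2 q"
begin

lemma map_cell: "g : A.\<Psi> m ==> simplex_map m q g : B.\<Psi> m"
proof -
 assume g: "g : A.\<Psi> m"
 have "simplex_map m p2 (simplex_map m q g) = simplex_map m p1 g"
  unfolding simplex_map_def by (rule restrict_ext) (use sing_imp(3)[OF A.lcell(1)[OF g]] p_q in simp)
 thus ?thesis using A.lcell[OF g] simplexwise by (simp add: lifted_cells_def simplexwise_def)
qed

lemma map_skeleton_chain:
 assumes "singular_chain m (top_of_set (skeleton A.\<Psi> k)) c"
 shows "singular_chain m (top_of_set (skeleton B.\<Psi> k)) (chain_map m q c)"
 unfolding chain_map_def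
proof (rule singular_chain_extend)
 fix s assume "s : Poly_Mapping.keys c"
 hence s: "sing m (skeleton A.\<Psi> k) s" using assms by (auto simp: singular_chain_def)
 hence "sing m E1 s" by (rule sing_mono) (auto simp: A.skeleton_lift)
 hence "sing m E2 (simplex_map m q s)" using simplexwise by (simp add: simplexwise_def)
 moreover have "q (s x) : skeleton B.\<Psi> k" if "x : standard_simplex m" for x
  using sing_imp(3)[OF s that] q_in p_q by (auto simp: A.skeleton_lift B.skeleton_lift)
 ultimately show "singular_chain m (top_of_set (skeleton B.\<Psi> k)) ((frag_of \<circ> simplex_map m q) s)"
  by (auto simp: sing_iff simplex_map_apply)
qed

text \<open>The relative homology between the cell boundary and \<open>a\<close> is pushed forward
  by \<open>chain_map\<close>. Edges may be identified by \<open>q\<close>, so coefficients are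
  added over preimages.\<close>

theorem incidence_map:
 assumes g: "g : A.\<Psi> 2" and a: "Poly_Mapping.keys a \<subseteq> A.\<Psi> 1" and hom: "A.hom1 (chain_boundary 2 (frag_of g)) a"
 shows "incidence B.\<Psi> 1 (simplex_map 2 q g) f' = (\<Sum>f\<in>Poly_Mapping.keys a. if simplex_map 1 q f = f' then Poly_Mapping.lookup a f else 0)"
proof -
 have gc: "singular_chain 2 (top_of_set (skeleton A.\<Psi> 2)) (frag_of g)" using A.face_relcycle[OF g] by simp
 have "Poly_Mapping.keys (chain_map 1 q a) \<subseteq> B.\<Psi> 1"
 proof
  fix x assume "x : Poly_Mapping.keys (chain_map 1 q a)"
  hence "x : (%f. simplex_map 1 q f) ` Poly_Mapping.keys a"
   using keys_frag_extend[of "frag_of \<circ> simplex_map 1 q" a] by (auto simp: chain_map_def)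
  thus "x : B.\<Psi> 1" using a map_cell by blast
 qed
 moreover have "B.hom1 (chain_boundary 2 (frag_of (simplex_map 2 q g))) (chain_map 1 q a)"
 proof -
  obtain d e where d: "singular_chain 2 (top_of_set A.Y1) d" and e: "singular_chain 1 (top_of_set A.Y0) e"
   and eq: "chain_boundary 2 d + e = chain_boundary 2 (frag_of g) - a"
   using hom A.Y_subset(1) unfolding homologous_rel_def singular_relboundary
   by (auto simp: One_nat_def numeral_2_eq_2 subtopology_subtopology Int_absorb1)
  have "chain_boundary 2 (chain_map 2 q d) + chain_map 1 q e = chain_map 1 q (chain_boundary 2 d + e)"
   using chain_boundary_chain_map[OF d, of q] by (simp add: chain_map_add One_nat_def)
  also have "... = chain_boundary 2 (frag_of (simplex_map 2 q g)) - chain_map 1 q a"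
   unfolding eq chain_map_diff using chain_boundary_chain_map[OF gc, of q] by (simp add: One_nat_def)
  finally have *: "chain_boundary 2 (chain_map 2 q d) + chain_map 1 q e = ..." .
  show ?thesis
   unfolding homologous_rel_def singular_relboundary
   using * map_skeleton_chain[OF d] map_skeleton_chain[OF e] B.Y_subset(1)
   by (intro exI[of _ "chain_map 2 q d"] exI[of _ "chain_map 1 q e"])
     (simp add: One_nat_def numeral_2_eq_2 subtopology_subtopology Int_absorb1)
 qed
 ultimately show ?thesis using B.incidence_eqI[OF map_cell[OF g]] lookup_chain_map[of 1 q a f'] by simp
qed

end

section \<open>Topology of the knot complement\<close>

text \<open>Sheets carry local path connectedness from \<open>S\<close> to \<open>E\<close>, where
  path components are then open.\<close>

lemma covering_simplex_connected:
 fixes E :: "'e::topological_space set" and p :: "'e => 's::topological_space"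
 assumes cov: "covering_space E p S" and conn: "connected E" and lpc: "locally path_connected S"
 shows "simplex_connected E"
proof -
 interpret covering E p S by standard (rule cov)
 have nbhd: "\<exists>V. openin (top_of_set E) V & x : V & path_connected V" if x: "x : E" for x
 proof -
  obtain W v where W: "openin (top_of_set S) W" "p x : W" "\<Union>v = E \<inter> p -` W" "!!u. u : v ==> openin (top_of_set E) u"
   "!!u. u : v ==> \<exists>q. homeomorphism u W p q"
   using cov p_in[OF x] unfolding covering_space_def by metis
  obtain u where u: "u : v" "x : u" using W(2,3) x by blast
  then obtain q where q: "homeomorphism u W p q" using W(5) by blast
  obtain V where V: "openin (top_of_set S) V" "path_connected V" "p x : V" "V \<subseteq> W"
   using lpc W(1,2) unfolding locally_path_connected by metis
  have "openin (top_of_set E) (q ` V)"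
  proof -
   have "openin (top_of_set W) V" by (rule openin_subset_trans[OF V(1,4) openin_imp_subset[OF W(1)]])
   hence "openin (top_of_set u) (q ` V)" by (rule homeomorphism_imp_open_map[OF homeomorphism_symD[OF q]])
   thus ?thesis using W(4)[OF u(1)] openin_trans by blast
  qed
  moreover have "x : q ` V" using q u(2) V(3) by (metis homeomorphism_apply1 imageI)
  moreover have "path_connected (q ` V)"
   using V(2,4) q by (intro path_connected_continuous_image) (auto simp: homeomorphism_def intro: continuous_on_subset)
  ultimately show ?thesis by blast
 qed
 have "path_component E x y" if x: "x : E" and y: "y : E" for x y
 proof -
  have "\<exists>V. openin (top_of_set E) V & a : V & (\<forall>b\<in>V. path_component E a b)" if a: "a : E" for a
  proof -
   obtain V where "openin (top_of_set E) V" "a : V" "path_connected V" using nbhd[OF a] by blast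
   thus ?thesis by (metis openin_imp_subset path_component_of_subset path_connected_component)
  qed
  note loc = this
  have op: "openin (top_of_set E) {b : E. Q b}" if Q: "!!a b. path_component E a b ==> Q a ==> Q b" for Q
  proof (subst openin_subopen, intro ballI)
   fix a assume a: "a : {b : E. Q b}"
   then obtain V where V: "openin (top_of_set E) V" "a : V" "\<forall>b\<in>V. path_component E a b" using loc by blast
   thus "\<exists>T. openin (top_of_set E) T & a : T & T \<subseteq> {b : E. Q b}"
    using a Q openin_imp_subset[OF V(1)] by (intro exI[of _ V]) auto
  qed
  have "openin (top_of_set E) {b : E. path_component E x b}"
   by (rule op) (blast intro: path_component_trans)
  moreover have "openin (top_of_set E) {b : E. \<not> path_component E x b}"
   by (rule op) (meson path_component_sym path_component_trans)
  moreover have "{b : E. path_component E x b} \<inter> {b : E. \<not> path_component E x b} = {}"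
   "E \<subseteq> {b : E. path_component E x b} \<union> {b : E. \<not> path_component E x b}"
   "x : {b : E. path_component E x b}" using x path_component_refl by auto
  ultimately show ?thesis using conn y unfolding connected_openin by blast
 qed
 note pc = this
 have "\<exists>s. sing 1 E s & s (vtx 0) = x & s (vtx 1) = y" if xy: "x : E" "y : E" for x y
 proof -
  obtain g where g: "path g" "path_image g \<subseteq> E" "pathstart g = x" "pathfinish g = y"
   using pc[OF xy] unfolding path_component_def by blast
  let ?s = "restrict (%v. g (v 1)) (standard_simplex 1)"
  have sub: "v 1 : {0..1}" if "v : standard_simplex 1" for v :: "nat => real" using that by (simp add: standard_simplex_def)
  have "continuous_on (standard_simplex 1) (%v. g (v 1))"
   by (rule continuous_on_compose2[OF g(1)[unfolded path_def] continuous_on_subset[OF continuous_on_product_coordinates subset_UNIV]])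
    (use sub in blast)
  moreover have "g (v 1) : E" if "v : standard_simplex 1" for v
   using sub[OF that] g(2) unfolding path_image_def by blast
  ultimately have "sing 1 E ?s" by (auto simp: sing_iff)
  thus ?thesis using g(3,4) vtx_in[of 0 1] vtx_in[of 1 1]
   by (intro exI[of _ ?s]) (simp add: pathstart_def pathfinish_def vtx_def)
 qed
 thus ?thesis by (simp add: simplex_connected_def)
qed

lemma contractible_punctured_sphere:
 fixes a :: "'a::euclidean_space"
 assumes "0 < r" "b : sphere a r"
 shows "contractible (sphere a r - {b})"
proof -
 obtain c :: 'a where c: "c ~= 0" using nonzero_Basis SOME_Basis by blast
 show ?thesis
  using homeomorphic_contractible_eq[OF homeomorphic_punctured_sphere_hyperplane[OF assms c, of 0]]
   convex_imp_contractible[OF convex_hyperplane[of c 0]] by simp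
qed

lemma nsphere_1: "nsphere 1 = top_of_set {x. (\<Sum>i\<le>1. (x i)\<^sup>2) = 1 & (\<forall>i>1. x i = 0)}"
 unfolding nsphere euclidean_product_topology ..

lemma contractible_times_punctured_plane:
 fixes A :: "'a::real_normed_vector set"
 assumes A: "contractible A" "A ~= {}"
 shows "top_of_set (A \<times> (UNIV - {0::complex})) homotopy_equivalent_space nsphere 1"
proof -
 let ?Y = "A \<times> (UNIV - {0::complex})" and ?N = "{x :: nat => real. (\<Sum>i\<le>1. (x i)\<^sup>2) = 1 & (\<forall>i>1. x i = 0)}"
 obtain a where a: "homotopic_with_canon (%x. True) A A id (%x. a)" using A(1) by (auto simp: contractible_def)
 hence aA: "a : A" using homotopic_with_imp_subset2[OF a] A(2) by auto
 obtain c where c: "continuous_on ({0..1::real} \<times> A) c" "c ` ({0..1} \<times> A) \<subseteq> A" "!!x. c (0, x) = x" "!!x. c (1, x) = a"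
  using a by (auto simp: homotopic_with_def)
 define f :: "'a \<times> complex => nat => real" where
  "f y = (%i. if i = 0 then Re (sgn (snd y)) else if i = 1 then Im (sgn (snd y)) else 0)" for y
 define g :: "(nat => real) => 'a \<times> complex" where "g x = (a, Complex (x 0) (x 1))" for x
 have sum1: "(\<Sum>i\<le>1. (x i)\<^sup>2) = (x 0)\<^sup>2 + (x 1)\<^sup>2" for x :: "nat => real" by (simp add: One_nat_def)
 have norm1: "(Re z)\<^sup>2 + (Im z)\<^sup>2 = 1 \<longleftrightarrow> cmod z = 1" for z by (simp add: cmod_def)
 have cf: "continuous_on ?Y f"
  unfolding f_def sgn_div_norm
 proof (rule continuous_on_coordinatewise_then_product)
  fix i :: nat
  consider "i = 0" | "i = 1" | "i ~= 0" "i ~= 1" by blast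
  thus "continuous_on ?Y (%y. if i = 0 then Re (snd y /\<^sub>R cmod (snd y)) else if i = 1 then Im (snd y /\<^sub>R cmod (snd y)) else 0)"
   by cases (auto intro!: continuous_intros)
 qed
 have fN: "f y : ?N" if "y : ?Y" for y
 proof -
  have "(Re (sgn (snd y)))\<^sup>2 + (Im (sgn (snd y)))\<^sup>2 = 1" unfolding norm1 using that by (auto simp: norm_sgn)
  thus ?thesis by (simp add: sum1 f_def)
 qed
 have cg: "continuous_on ?N g"
  unfolding g_def Complex_eq by (intro continuous_intros continuous_on_subset[OF continuous_on_product_coordinates subset_UNIV])
 have gN: "g x : ?Y" "f (g x) = x" if x: "x : ?N" for x
 proof -
  have n: "cmod (Complex (x 0) (x 1)) = 1" using x norm1[of "Complex (x 0) (x 1)"] unfolding mem_Collect_eq sum1 by simp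
  hence "Complex (x 0) (x 1) ~= 0" by (metis norm_zero zero_neq_one)
  thus "g x : ?Y" using aA by (simp add: g_def)
  have "f (g x) i = x i" for i
   using x n by (auto simp: f_def g_def sgn_div_norm)
  thus "f (g x) = x" by blast
 qed
 \<comment> \<open>The first factor is contracted while the second is scaled to the circle; the
   factor (1 - t) + t / |w| stays positive, so 0 is avoided.\<close>
 define H where "H = (%(t, y). (c (t, fst y), ((1 - t) + t / cmod (snd y)) *\<^sub>R snd y))"
 have "homotopic_with_canon (%x. True) ?Y ?Y id (g \<circ> f)"
  unfolding homotopic_with_def
 proof (intro exI[of _ H] conjI allI ballI TrueI)
  have "continuous_on ({0..1} \<times> ?Y) (%(t, y). c (t, fst y))"
   unfolding case_prod_unfold by (rule continuous_on_compose2[OF c(1)]) (auto intro!: continuous_intros)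
  hence "continuous_on ({0..1} \<times> ?Y) H"
   unfolding H_def case_prod_unfold by (auto intro!: continuous_intros)
  moreover have "H x : ?Y" if x: "x : {0..1} \<times> ?Y" for x
  proof -
   obtain t b w where tb: "x = (t, (b, w))" "0 <= t" "t <= 1" "b : A" "w ~= 0" using x by (cases x) auto
   have "(1 - t) + t / cmod w > 0"
   proof (cases "t = 0")
    case False
    thus ?thesis using tb by (intro add_nonneg_pos divide_pos_pos) auto
   qed simp
   moreover have "c (t, b) : A" using c(2) tb by auto
   ultimately show ?thesis using tb by (simp add: H_def)
  qed
  ultimately show "continuous_map (prod_topology (top_of_set {0..1}) (top_of_set ?Y)) (top_of_set ?Y) H"
   by (auto simp: continuous_map_in_subtopology image_subset_iff_funcset)
  show "H (0, x) = id x" for x by (simp add: H_def c(3))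
  show "H (1, x) = (g \<circ> f) x" for x
   by (simp add: H_def c(4) f_def g_def sgn_div_norm complex_eq_iff One_nat_def divide_inverse)
 qed
 hence "homotopic_with (%x. True) (top_of_set ?Y) (top_of_set ?Y) (g \<circ> f) id" by (rule homotopic_with_symD)
 moreover have "homotopic_with (%x. True) (top_of_set ?N) (top_of_set ?N) (f \<circ> g) id"
  using gN continuous_on_compose2[OF cf cg] fN by (intro homotopic_with_equal) (auto simp: o_def image_subset_iff)
 ultimately show ?thesis
  unfolding nsphere_1 homotopy_equivalent_space_def using cf fN cg gN(1)
  by (intro exI[of _ f] exI[of _ g]) (auto simp: continuous_map_in_subtopology)
qed

text \<open>Alexander duality by hand. Removing a point \<open>p0\<close> of the knot from the
  sphere leaves the contractible \<open>Y\<close>, and the tube \<open>T0\<close> over the circle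
  without a point is contractible too. Then H_1(S3 - K) is H_2(Y, S3 - K) by contractibility,
  H_2(T0, T0 - K) by excision, and H_1(T0 - K) by contractibility, where T0 - K is an open arc times
  a punctured plane. A retraction onto S3 - N carries cyclicity and local path connectedness
  over.\<close>

lemma knot_complement:
 assumes tub: "open_tubular_neighbourhood K N"
 shows "S3 - N ~= {}" "locally path_connected (S3 - N)" "cyclic_group (homology_group 1 (top_of_set (S3 - N)))"
proof -
 let ?C = "sphere (0::complex) 1" and ?p = "2::int"
 obtain h :: "complex \<times> complex => real^4" and k T where T: "openin (top_of_set S3) T" and hom: "homeomorphism (?C \<times> UNIV) T h k"
  and K: "h ` (?C \<times> {0}) = K" and N: "h ` (?C \<times> ball 0 1) = N"
  using tub unfolding open_tubular_neighbourhood_def by blast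
 have TS: "T \<subseteq> S3" by (rule openin_imp_subset[OF T])
 have h_in: "h (s, w) : T" and kh: "k (h (s, w)) = (s, w)" if "s : ?C" for s w
  using hom that by (auto simp: homeomorphism_def)
 have hk: "h (k x) = x" and k_in: "fst (k x) : ?C" if "x : T" for x
  using hom that by (auto simp: homeomorphism_def image_subset_iff mem_Times_iff)
 have h_mem: "h (s, w) : h ` (?C \<times> W) \<longleftrightarrow> w : W" if "s : ?C" for s w W
 proof
  assume "h (s, w) : h ` (?C \<times> W)"
  then obtain s' w' where "s' : ?C" "w' : W" "h (s, w) = h (s', w')" by blast
  hence "(s, w) = (s', w')" using kh[OF that, of w] kh[of s' w'] by metis
  thus "w : W" using \<open>w' : W\<close> by blast
 qed (use that in blast)
 have closed: "closed (h ` (?C \<times> W))" if "compact W" for W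
  using hom that by (intro compact_imp_closed compact_continuous_image compact_Times)
   (auto simp: homeomorphism_def intro: continuous_on_subset)
 have open_h: "openin (top_of_set S3) (h ` V)" if "openin (top_of_set (?C \<times> UNIV)) V" for V
  using homeomorphism_imp_open_map[OF hom that] T openin_trans by blast
 define p0 where "p0 = h (1, 0)"
 have p0: "p0 : K" "p0 : S3" using K h_in[of 1 0] TS by (auto simp: p0_def)
 have cK: "closed K" using closed[of "{0}"] K by simp
 hence oK: "openin (top_of_set S3) (S3 - K)" by (metis Diff_eq open_Compl openin_open_Int)
 show ne: "S3 - N ~= {}"
  using h_in[of 1 1] TS h_mem[of 1 1 "ball 0 1"] N by auto
 \<comment> \<open>Points of the tube inside the unit disc bundle, off the core, are pushed radially
   to the boundary of that bundle.\<close>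
 define r where "r x = (if x : T then h (fst (k x), (max 1 (cmod (snd (k x))) / cmod (snd (k x))) *\<^sub>R snd (k x)) else x)" for x
 have snd_k: "snd (k x) ~= 0" if "x : T" "x ~: K" for x
  using that hk[of x] k_in[of x] K by (metis SigmaI imageI prod.collapse singletonI)
 have r_id: "r x = x" if "x ~: N" for x
 proof (cases "x : T")
  case True
  hence "cmod (snd (k x)) >= 1" using that N hk[of x] k_in[of x]
   by (metis SigmaI imageI linorder_not_le mem_ball_0 prod.collapse)
  thus ?thesis using True hk[of x] by (cases "snd (k x) = 0") (simp_all add: r_def max_def)
 qed (simp add: r_def)
 have cT: "continuous_on (T - K) r"
 proof -
  have k: "continuous_on (T - K) k" using hom by (auto simp: homeomorphism_def intro: continuous_on_subset)
  have "continuous_on (T - K) (%x. (fst (k x), (max 1 (cmod (snd (k x))) / cmod (snd (k x))) *\<^sub>R snd (k x)))"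
   using snd_k by (auto intro!: continuous_intros k)
  hence "continuous_on (T - K) (%x. h (fst (k x), (max 1 (cmod (snd (k x))) / cmod (snd (k x))) *\<^sub>R snd (k x)))"
   by (rule continuous_on_compose2[OF homeomorphism_cont1[OF hom]]) (use k_in in auto)
  thus ?thesis by (rule continuous_on_eq) (simp add: r_def)
 qed
 have r_cont: "continuous_on (S3 - K) r"
 proof (rule continuous_on_locally)
  fix x assume x: "x : S3 - K"
  have sub: "openin (top_of_set (S3 - K)) V" if "openin (top_of_set S3) V" "V \<subseteq> S3 - K" for V
   using that by (meson Diff_subset openin_subset_trans)
  show "\<exists>V. openin (top_of_set (S3 - K)) V & x : V & continuous_on V r"
  proof (cases "x : T")
   case True
   have "openin (top_of_set S3) (T - K)" using openin_Int[OF T oK] TS by (metis Diff_Int2 Int_Diff inf.orderE)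
   thus ?thesis using True x TS cT by (intro exI[of _ "T - K"] conjI sub) auto
  next
   case False
   let ?B = "h ` (?C \<times> cball 0 1)"
   have KB: "K \<subseteq> ?B" "N \<subseteq> ?B" "?B \<subseteq> T" using K N h_in by auto
   have "openin (top_of_set S3) (S3 - ?B)" using closed[of "cball 0 1"] by (metis Diff_eq compact_cball open_Compl openin_open_Int)
   moreover have "continuous_on (S3 - ?B) r" by (rule continuous_on_eq[OF continuous_on_id]) (metis DiffD2 KB(2) r_id subsetD)
   ultimately show ?thesis using False x KB by (intro exI[of _ "S3 - ?B"] conjI sub) auto
  qed
 qed
 have KN: "K \<subseteq> N" using K N by auto
 have r_in: "r x : S3 - N" if x: "x : S3 - K" for x
 proof (cases "x : T")
  case True
  let ?w = "(max 1 (cmod (snd (k x))) / cmod (snd (k x))) *\<^sub>R snd (k x)"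
  have "cmod ?w = max 1 (cmod (snd (k x)))" using snd_k[of x] True x by simp
  hence "?w ~: ball 0 1" by simp
  thus ?thesis 
   using True subsetD[OF TS h_in[OF k_in[OF True], of ?w]] h_mem[OF k_in[OF True], of ?w "ball 0 1"] N
   by (simp add: r_def del: mem_ball_0 mem_sphere_0)
 next
  case False
  thus ?thesis using x N h_in by (auto simp: r_def)
 qed
 have retr: "retraction (S3 - K) (S3 - N) r"
  using r_cont r_in r_id KN by (auto simp: retraction_def)
 show "locally path_connected (S3 - N)"
  using retract_of_locally_path_connected[OF locally_open_subset[OF locally_path_connected_sphere oK]] retr
  by (auto simp: retract_of_def)
 define A where "A = ?C - {1}"
 define T0 where "T0 = h ` (A \<times> UNIV)"
 define Y where "Y = S3 - {p0}"
 have AC: "A \<subseteq> ?C" "contractible A" "-1 : A" using contractible_punctured_sphere[of 1 "1::complex" 0] by (auto simp: A_def)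
 have oT0: "openin (top_of_set S3) T0"
  unfolding T0_def A_def
  by (intro open_h openin_Times openin_delete openin_subtopology_self)
 have T0Y: "T0 \<subseteq> Y" 
 proof
  fix x assume "x : T0"
  then obtain s w where sw: "s : ?C" "s ~= 1" "x = h (s, w)" unfolding T0_def A_def by blast
  have "x ~= p0"
  proof
   assume "x = p0"
   hence "(s, w) = (1, 0)" using kh[OF sw(1), of w] kh[of 1 0] sw(3) by (simp add: p0_def)
   thus False using sw(2) by simp
  qed
  thus "x : Y" using TS h_in[OF sw(1), of w] sw(3) by (auto simp: Y_def)
 qed
 have T0K: "T0 - K = h ` (A \<times> (UNIV - {0}))"
 proof (intro equalityI subsetI)
  fix x assume x: "x : T0 - K"
  then obtain s w where sw: "s : A" "x = h (s, w)" by (auto simp: T0_def)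
  hence "w ~= 0" using x K AC(1) by blast
  thus "x : h ` (A \<times> (UNIV - {0}))" using sw by blast
 next
  fix x assume "x : h ` (A \<times> (UNIV - {0}))"
  then obtain s w where sw: "s : A" "w ~= 0" "x = h (s, w)" by blast
  thus "x : T0 - K" using h_mem[of s w "{0}"] K AC(1) by (auto simp: T0_def)
 qed
 have ne0: "T0 \<inter> (T0 - K) ~= {}"
 proof -
  have "h (-1, 1) : T0 - K" unfolding T0K using AC(3) by auto
  thus ?thesis by blast
 qed
 have KT0: "K - {p0} \<subseteq> T0" using K by (auto simp: T0_def A_def p0_def)
 have homs: "(h ` (A \<times> W)) homeomorphic (A \<times> W)" for W
 proof -
  have "homeomorphism (A \<times> W) (h ` (A \<times> W)) h k"
   by (rule homeomorphism_of_subsets[OF hom _ order_refl]) (use AC(1) in auto)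
  thus ?thesis using homeomorphic_def homeomorphic_sym by blast
 qed
 have cT0: "contractible_space (top_of_set T0)"
  using homeomorphic_contractible_eq[OF homs[of UNIV]] contractible_Times[OF AC(2) contractible_UNIV]
  unfolding T0_def contractible_space_top_of_set by blast
 have iso1: "reduced_homology_group 1 (top_of_set (T0 - K)) \<cong> reduced_homology_group 1 (nsphere 1)"
  unfolding T0K using AC
  by (intro homotopy_equivalent_space_imp_isomorphic_reduced_homology_groups homotopy_eqv_trans[OF
     homeomorphic_imp_homotopy_eqv[OF homs] contractible_times_punctured_plane]) auto
 have iso2: "relative_homology_group ?p (top_of_set T0) (T0 - K) \<cong> reduced_homology_group 1 (top_of_set (T0 - K))"
  using isomorphic_group_relative_homology_of_contractible[OF cT0, of "T0 - K" ?p] ne0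
  by (simp add: subtopology_subtopology Int_absorb1)
 \<comment> \<open>The excised set Y - T0 is closed in \<open>Y\<close> and lies in the open set S3
   - K, because \<open>T0\<close> contains all of the knot except \<open>p0\<close>.\<close>
 have iso3: "relative_homology_group ?p (top_of_set T0) (T0 - K) \<cong> relative_homology_group ?p (top_of_set Y) (S3 - K)"
 proof -
  let ?U = "Y - T0"
  have "closedin (top_of_set Y) ?U"
   using openin_subset_trans[OF oT0 T0Y] by (auto simp: Y_def closedin_diff)
  moreover have "openin (top_of_set Y) (S3 - K)"
   using openin_subset_trans[OF oK, of Y] p0 by (auto simp: Y_def)
  ultimately have "top_of_set Y closure_of ?U \<subseteq> top_of_set Y interior_of (S3 - K)"
   using KT0 by (auto simp: closure_of_closedin interior_of_openin Y_def)
  moreover have "S3 - K \<subseteq> Y" "S3 - K - ?U = T0 - K" "Y - ?U = T0" using p0 T0Y by (auto simp: Y_def)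
  ultimately show ?thesis
   using is_isoI[OF homology_excision_axiom[of "top_of_set Y" ?U "S3 - K" Y ?p]] T0Y
   by (simp add: subtopology_subtopology Int_absorb1)
 qed
 have iso4: "relative_homology_group ?p (top_of_set Y) (S3 - K) \<cong> reduced_homology_group 1 (top_of_set (S3 - K))"
 proof -
  have "S3 - K \<subseteq> Y" "S3 - K ~= {}" using p0 ne KN by (auto simp: Y_def)
  moreover have "contractible Y" unfolding Y_def using p0 by (intro contractible_punctured_sphere) auto
  ultimately show ?thesis
   using isomorphic_group_relative_homology_of_contractible[of "top_of_set Y" "S3 - K" ?p]
   by (simp add: subtopology_subtopology Int_absorb1)
 qed
 have "cyclic_group (homology_group 1 (top_of_set (S3 - K)))"
  using cyclic_reduced_homology_group_nsphere[of 1 1] isomorphic_group_cyclicity[OF iso1]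
   isomorphic_group_cyclicity[OF iso2] isomorphic_group_cyclicity[OF iso3] isomorphic_group_cyclicity[OF iso4]
  by (simp add: un_reduced_homology_group)
 \<comment> \<open>A retraction is surjective on homology, and cyclicity passes to
   quotients.\<close>
 moreover have "hom_induced 1 (top_of_set (S3 - K)) {} (top_of_set (S3 - N)) {} r
   : epi (homology_group 1 (top_of_set (S3 - K))) (homology_group 1 (top_of_set (S3 - N)))"
 proof -
  have "retraction_map (top_of_set (S3 - K)) (top_of_set (S3 - N)) r"
   unfolding retraction_map_def retraction_maps_def using r_cont r_in r_id KN
   by (intro exI[of _ id]) (auto simp: continuous_map_in_subtopology)
  from surj_hom_induced_retraction_map[OF this, of 1] show ?thesis
   by (simp add: epi_def hom_induced_empty_hom)
 qed
 ultimately show "cyclic_group (homology_group 1 (top_of_set (S3 - N)))"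
  using group.cyclic_group_epimorphic_image by (metis group_relative_homology_group)
qed

lemma cyclic_homology_generator:
 assumes "cyclic_group (homology_group 1 (top_of_set X))"
 obtains z0 where "!!z. singular_relcycle 1 (top_of_set X) {} z ==> \<exists>m. homologous_rel 1 (top_of_set X) {} z (frag_cmul m z0)"
proof -
 let ?G = "homology_group 1 (top_of_set X)"
 interpret group ?G by simp
 obtain x where x: "x : carrier ?G" "carrier ?G = range (%m::int. x [^]\<^bsub>?G\<^esub> m)" using assms cyclic_group by blast
 have car: "carrier ?G = homologous_rel_set 1 (top_of_set X) {} ` singular_relcycle_set 1 (top_of_set X) {}"
  using carrier_relative_homology_group[of 1 "top_of_set X" "{}"] by simp
 obtain z0 where z0: "singular_relcycle 1 (top_of_set X) {} z0" "x = homologous_rel_set 1 (top_of_set X) {} z0"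
  using x(1) unfolding car by blast
 show thesis
 proof (rule that)
  fix z assume z: "singular_relcycle 1 (top_of_set X) {} z"
  hence "homologous_rel_set 1 (top_of_set X) {} z : carrier ?G" unfolding car by blast
  then obtain m :: int where "homologous_rel_set 1 (top_of_set X) {} z = x [^]\<^bsub>?G\<^esub> m" using x(2) by blast
  also have "... = homologous_rel_set 1 (top_of_set X) {} (frag_cmul m z0)"
   using relative_homology_class_int_pow[OF z0(1)] unfolding z0(2) by simp
  finally show "\<exists>m. homologous_rel 1 (top_of_set X) {} z (frag_cmul m z0)"
   by (metis homologous_rel_set_eq)
 qed
qed

section \<open>Cells of cyclic covers and conclusion\<close>

locale cyclic_cw_cover = cyclic_cover E p X n act + cw_cover E p X \<Phi>
 for E :: "'e::topological_space set" and p :: "'e => 'a::t2_space" and X n act \<Phi>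
begin

lemma act_cell: "g : \<Psi> m ==> simplex_map m (act a) g : \<Psi> m"
proof -
 assume g: "g : \<Psi> m"
 show ?thesis using sing_act[OF lcell(1)[OF g], of a] lcell(2)[OF g] simplex_map_act[OF lcell(1)[OF g], of a]
  unfolding lifted_cells_def mem_Collect_eq by metis
qed

lemma act_cells_eq_iff:
 assumes g: "g : \<Psi> m" "g' : \<Psi> m" and eq: "simplex_map m p g = simplex_map m p g' ==> g = g'"
 shows "simplex_map m (act a) g = simplex_map m (act a') g' \<longleftrightarrow> g = g' & int n dvd a - a'"
proof
 have v: "vtx 0 : standard_simplex m" by simp
 have gE: "g (vtx 0) : E" by (rule sing_imp(3)[OF lcell(1)[OF g(1)] v])
 note ap = simplex_map_apply[OF v]
 {
  assume a: "simplex_map m (act a) g = simplex_map m (act a') g'"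
  hence gg: "g = g'" using eq simplex_map_act[OF lcell(1)] g by metis
  hence "act a (g (vtx 0)) = act a' (g (vtx 0))" using fun_cong[OF a, of "vtx 0"] unfolding ap by simp
  thus "g = g' & int n dvd a - a'" using gg act_eq_iff[OF gE] by simp
 next
  assume a: "g = g' & int n dvd a - a'"
  show "simplex_map m (act a) g = simplex_map m (act a') g'"
  proof (rule simplex_lift_unique[OF sing_act sing_act _ v])
   show "sing m E g" "sing m E g'" using lcell(1) g by auto
   show "simplex_map m p (simplex_map m (act a) g) = simplex_map m p (simplex_map m (act a') g')"
    using simplex_map_act[OF lcell(1)] g a by metis
   show "simplex_map m (act a) g (vtx 0) = simplex_map m (act a') g' (vtx 0)"
    unfolding ap using a act_eq_iff[OF gE] by simp
  qed
 }
qed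

lemma cell_translate:
 assumes g: "g : \<Psi> m" "g' : \<Psi> m" and eq: "simplex_map m p g = simplex_map m p g'"
 obtains a where "simplex_map m (act a) g' = g"
proof -
 have v: "vtx 0 : standard_simplex m" by simp
 have "p (g' (vtx 0)) = p (g (vtx 0))" using p_lcell[OF v, of g] p_lcell[OF v, of g'] eq by simp
 then obtain a where a: "act a (g' (vtx 0)) = g (vtx 0)"
  using act_transitive sing_imp(3)[OF lcell(1)[OF g(1)] v] sing_imp(3)[OF lcell(1)[OF g(2)] v] by blast
 have "simplex_map m (act a) g' = g"
 proof (rule simplex_lift_unique[OF sing_act _ _ v])
  show "sing m E g'" "sing m E g" using lcell(1) g by auto
  show "simplex_map m p (simplex_map m (act a) g') = simplex_map m p g" using simplex_map_act[OF lcell(1)[OF g(2)]] eq by simp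
  show "simplex_map m (act a) g' (vtx 0) = g (vtx 0)" using a by (simp add: simplex_map_apply[OF v])
 qed
 thus thesis by (rule that)
qed

lemma cells_enumeration:
 assumes s: "!!i. i < N ==> s i : \<Psi> m" and bij: "bij_betw (%i. simplex_map m p (s i)) {..<N} (\<Phi> m)"
 shows "\<Psi> m = (\<Union>i<N. range (%a. simplex_map m (act a) (s i)))"
  and "i < N ==> i' < N ==> simplex_map m (act a) (s i) = simplex_map m (act a') (s i') \<longleftrightarrow> i = i' & int n dvd a - a'"
proof -
 show "\<Psi> m = (\<Union>i<N. range (%a. simplex_map m (act a) (s i)))"
 proof (intro equalityI subsetI)
  fix g assume g: "g : \<Psi> m"
  then obtain i where i: "i < N" "simplex_map m p g = simplex_map m p (s i)"
   using lcell(2)[OF g] bij by (auto simp: bij_betw_def image_iff)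
  thus "g : (\<Union>i<N. range (%a. simplex_map m (act a) (s i)))"
   using cell_translate[OF g s[OF i(1)] i(2)] by (metis UN_iff lessThan_iff rangeI)
 qed (use s act_cell in auto)
 assume i: "i < N" "i' < N"
 have inj: "simplex_map m p (s i) = simplex_map m p (s i') \<longleftrightarrow> i = i'"
  using bij i by (auto simp: bij_betw_def inj_on_def)
 hence "s i = s i' \<longleftrightarrow> i = i'" by metis
 thus "simplex_map m (act a) (s i) = simplex_map m (act a') (s i') \<longleftrightarrow> i = i' & int n dvd a - a'"
  using act_cells_eq_iff[OF s[OF i(1)] s[OF i(2)]] inj by simp
qed

end

text \<open>The coefficients are read off once, in the infinite cover, and serve every cover:
  \<open>q\<close> followed by the translation by \<open>a\<close> is again a simplexwise map over
  X, and \<open>incidence_map\<close> transports the chain \<open>A i\<close> along it.\<close>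

lemma cyclic_matrix_incidence:
 fixes E1 :: "'e::topological_space set" and E2 :: "'f::topological_space set" and X :: "'a::t2_space set"
 assumes c1: "cyclic_cover E1 p1 X 0 act1" and c2: "cyclic_cover E2 p2 X n act2" and cw: "finite_CW_structure X \<Phi>"
  and q: "!!e. e : E1 ==> q e : E2 & p2 (q e) = p1 e" and sw: "simplexwise E1 E2 q"
  and q_act: "!!k e. e : E1 ==> q (act1 k e) = act2 k (q e)"
  and s: "!!i. i < N ==> s i : lifted_cells E1 p1 \<Phi> 2" "bij_betw (%i. simplex_map 2 p1 (s i)) {..<N} (\<Phi> 2)"
  and t: "!!j. j < M ==> t j : lifted_cells E1 p1 \<Phi> 1" "bij_betw (%j. simplex_map 1 p1 (t j)) {..<M} (\<Phi> 1)"
  and A: "!!i. i < N ==> Poly_Mapping.keys (A i) \<subseteq> lifted_cells E1 p1 \<Phi> 1"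
   "!!i. i < N ==> homologous_rel 1 (top_of_set (skeleton (lifted_cells E1 p1 \<Phi>) 1)) (skeleton (lifted_cells E1 p1 \<Phi>) 0)
     (chain_boundary 2 (frag_of (s i))) (A i)"
  and L: "!!i j k. i < N ==> j < M ==> Poly_Mapping.lookup (A i) (simplex_map 1 (act1 k) (t j)) ~= 0 ==> \<bar>k\<bar> <= int L"
 shows "cyclic_matrix N M L (%j i k. Poly_Mapping.lookup (A i) (simplex_map 1 (act1 k) (t j))) n
  (lifted_cells E2 p2 \<Phi> 2) (lifted_cells E2 p2 \<Phi> 1) (incidence (lifted_cells E2 p2 \<Phi>) 1)
  (%i a. simplex_map 2 (act2 a) (simplex_map 2 q (s i))) (%j b. simplex_map 1 (act2 b) (simplex_map 1 q (t j)))"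
proof -
 interpret c1: cyclic_cover E1 p1 X 0 act1 by fact
 interpret c2: cyclic_cover E2 p2 X n act2 by fact
 interpret cw_complex X \<Phi> by standard (rule cw)
 interpret A: cyclic_cw_cover E1 p1 X 0 act1 \<Phi> ..
 interpret B: cyclic_cw_cover E2 p2 X n act2 \<Phi> ..
 interpret map: cw_cover_map E1 p1 E2 p2 X \<Phi> q
  by standard (use q sw in auto)
 have pq: "simplex_map m p2 (simplex_map m q g) = simplex_map m p1 g" if "g : A.\<Psi> m" for m g
  unfolding simplex_map_def by (rule restrict_ext) (use sing_imp(3)[OF A.lcell(1)[OF that]] q in simp)
 have s2: "simplex_map 2 q (s i) : B.\<Psi> 2" if "i < N" for i using map.map_cell[OF s(1)[OF that]] .
 have t2: "simplex_map 1 q (t j) : B.\<Psi> 1" if "j < M" for j using map.map_cell[OF t(1)[OF that]] .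
 have sb: "bij_betw (%i. simplex_map 2 p2 (simplex_map 2 q (s i))) {..<N} (\<Phi> 2)"
  using s(2) pq[OF s(1)] by (subst bij_betw_cong[of _ _ "%i. simplex_map 2 p1 (s i)"]) auto
 have tb: "bij_betw (%j. simplex_map 1 p2 (simplex_map 1 q (t j))) {..<M} (\<Phi> 1)"
  using t(2) pq[OF t(1)] by (subst bij_betw_cong[of _ _ "%j. simplex_map 1 p1 (t j)"]) auto
 show ?thesis
 proof (unfold_locales, goal_cases)
  case 1 show ?case by (rule B.cells_enumeration(1)[OF s2 sb])
 next
  case 2 show ?case by (rule B.cells_enumeration(1)[OF t2 tb])
 next
  case (3 i i' a a') thus ?case by (intro B.cells_enumeration(2)[OF s2 sb])
 next
  case (4 j j' b b') thus ?case by (intro B.cells_enumeration(2)[OF t2 tb])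
 next
  case (5 i a f)
  note i = 5(1)
  let ?Q = "%e. act2 a (q e)" and ?S = "{- int L..int L}"
  interpret Q: cw_cover_map E1 p1 E2 p2 X \<Phi> ?Q
  proof
   show "?Q e : E2" "p2 (?Q e) = p1 e" if "e : E1" for e using q[OF that] c2.act_in c2.act_p by auto
   show "simplexwise E1 E2 ?Q"
    unfolding simplexwise_def using sw[unfolded simplexwise_def] c2.sing_act by (metis simplex_map_comp)
  qed
  let ?e = "%(j, k). simplex_map 1 (act1 k) (t j)"
  let ?h = "%g. if simplex_map 1 ?Q g = f then Poly_Mapping.lookup (A i) g else 0"
  have "incidence B.\<Psi> 1 (simplex_map 2 (act2 a) (simplex_map 2 q (s i))) f = (\<Sum>g\<in>Poly_Mapping.keys (A i). ?h g)"
   unfolding simplex_map_comp by (rule Q.incidence_map[OF s(1)[OF i] A(1)[OF i] A(2)[OF i]])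
  also have "... = (\<Sum>g\<in>?e ` ({..<M} \<times> ?S). ?h g)"
  proof (rule sum.mono_neutral_left)
   show "Poly_Mapping.keys (A i) \<subseteq> ?e ` ({..<M} \<times> ?S)"
   proof
    fix g assume g: "g : Poly_Mapping.keys (A i)"
    then obtain j k where jk: "j < M" "g = simplex_map 1 (act1 k) (t j)"
     using A(1)[OF i] A.cells_enumeration(1)[OF t] by auto
    hence "\<bar>k\<bar> <= int L" using L[OF i jk(1), of k] g by (auto simp: in_keys_iff)
    hence "(j, k) : {..<M} \<times> ?S" using jk(1) by auto
    thus "g : ?e ` ({..<M} \<times> ?S)" using jk(2) by (metis (no_types, lifting) case_prod_conv image_eqI)
   qed
  qed (auto simp: in_keys_iff)
  also have "... = (\<Sum>x\<in>{..<M} \<times> ?S. ?h (?e x))"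
  proof (rule sum.reindex_cong)
   show "inj_on ?e ({..<M} \<times> ?S)"
    using A.cells_enumeration(2)[OF t] by (auto simp: inj_on_def)
  qed auto
  also have "... = (\<Sum>(j, k)\<in>{..<M} \<times> ?S. if simplex_map 1 (act2 (a + k)) (simplex_map 1 q (t j)) = f
    then Poly_Mapping.lookup (A i) (simplex_map 1 (act1 k) (t j)) else 0)"
  proof (rule sum.cong[OF refl])
   fix x assume "x : {..<M} \<times> ?S"
   then obtain j k where x: "x = (j, k)" "j < M" by auto
   have "simplex_map 1 ?Q (simplex_map 1 (act1 k) (t j)) = simplex_map 1 (act2 (a + k)) (simplex_map 1 q (t j))"
    unfolding simplex_map_comp simplex_map_def
    by (rule restrict_ext) (use sing_imp(3)[OF A.lcell(1)[OF t(1)[OF x(2)]]] q q_act c2.act_add in simp)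
   thus "?h (?e x) = (case x of (j, k) => if simplex_map 1 (act2 (a + k)) (simplex_map 1 q (t j)) = f
    then Poly_Mapping.lookup (A i) (simplex_map 1 (act1 k) (t j)) else 0)" by (simp add: x(1))
  qed
  finally show ?case .
 qed
qed

lemma (in cw_cover) cells_lift:
 obtains N :: nat and s where "!!i. i < N ==> s i : \<Psi> m" "bij_betw (%i. simplex_map m p (s i)) {..<N} (\<Phi> m)"
proof -
 define N where "N = card (\<Phi> m)"
 obtain h where h: "bij_betw h {0..<N} (\<Phi> m)" using ex_bij_betw_nat_finite[OF finite_cells[of m]] unfolding N_def by blast
 have "\<exists>g\<in>\<Psi> m. simplex_map m p g = h i" if i: "i < N" for i
 proof -
  have f: "h i : \<Phi> m" using h i by (auto dest: bij_betwE)
  have v: "vtx 0 : standard_simplex m" by simp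
  have "h i (vtx 0) : X" using sing_imp(3)[OF cell[OF f] v] .
  then obtain e where "e : E" "p e = h i (vtx 0)" using p_surj by (metis imageE)
  thus ?thesis using lift_cell[OF f v] by metis
 qed
 then obtain s where s: "!!i. i < N ==> s i : \<Psi> m & simplex_map m p (s i) = h i" by metis
 hence "bij_betw (%i. simplex_map m p (s i)) {..<N} (\<Phi> m)"
  using h by (subst bij_betw_cong[of _ _ h]) (auto simp: atLeast0LessThan)
 thus thesis using s by (intro that[of N s]) simp_all
qed

lemma (in cyclic_cw_cover) deck_orbits_eq:
 assumes car: "carrier (deck_group E p) = range (%k. restrict (act k) E)"
  and s: "!!i. i < N ==> s i : \<Psi> m" "bij_betw (%i. simplex_map m p (s i)) {..<N} (\<Phi> m)"
 shows "deck_orbits E p \<Phi> m = (%i. range (%a. simplex_map m (act a) (s i))) ` {..<N}"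
proof -
 have orbit: "(%h. simplex_map m h g) ` carrier (deck_group E p) = range (%a. simplex_map m (act a) g)" if g: "g : \<Psi> m" for g
 proof -
  have "simplex_map m (restrict (act k) E) g = simplex_map m (act k) g" for k
   unfolding simplex_map_def by (rule restrict_ext) (use sing_imp(3)[OF lcell(1)[OF g]] in simp)
  thus ?thesis unfolding car image_image by simp
 qed
 have shift: "range (%a. simplex_map m (act a) (simplex_map m (act b) g)) = range (%a. simplex_map m (act a) g)" if g: "g : \<Psi> m" for g b
 proof -
  have eq: "simplex_map m (act a) (simplex_map m (act b) g) = simplex_map m (act (a + b)) g" for a
   unfolding simplex_map_comp unfolding simplex_map_def
   by (rule restrict_ext) (use sing_imp(3)[OF lcell(1)[OF g]] act_add in simp)
  have "range (%a. simplex_map m (act (a + b)) g) = (%a. simplex_map m (act a) g) ` range (%a. a + b)"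
   unfolding image_image ..
  thus ?thesis unfolding eq by simp
 qed
 show ?thesis
 proof (intro equalityI subsetI)
  fix Q assume "Q : deck_orbits E p \<Phi> m"
  then obtain g where g: "g : \<Psi> m" "Q = range (%a. simplex_map m (act a) g)" using orbit by (auto simp: deck_orbits_def)
  then obtain i b where i: "i < N" "g = simplex_map m (act b) (s i)" using cells_enumeration(1)[OF s] by auto
  thus "Q : (%i. range (%a. simplex_map m (act a) (s i))) ` {..<N}"
   unfolding g(2) i(2) shift[OF s(1)[OF i(1)]] using i(1) by blast
 next
  fix Q assume "Q : (%i. range (%a. simplex_map m (act a) (s i))) ` {..<N}"
  then obtain i where i: "i < N" "Q = range (%a. simplex_map m (act a) (s i))" by auto
  thus "Q : deck_orbits E p \<Phi> m" unfolding deck_orbits_def i(2) orbit[OF s(1)[OF i(1)], symmetric] using s(1)[OF i(1)] by blast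
 qed
qed

text \<open>A chain has finitely many cells, and for \<open>n = 0\<close> distinct integers give
  distinct translates of a cell.\<close>

lemma (in cyclic_cw_cover) lookup_translates_bounded:
 fixes N M :: nat
 assumes n: "n = 0" and t: "!!j. j < M ==> t j : \<Psi> 1"
 obtains L where "!!i j k. i < N ==> j < M ==> Poly_Mapping.lookup (A i) (simplex_map 1 (act k) (t j)) ~= 0 ==> \<bar>k\<bar> <= int L"
proof -
 define K where "K i j = {k. simplex_map 1 (act k) (t j) : Poly_Mapping.keys (A i)}" for i j
 have "finite (K i j)" if j: "j < M" for i j
 proof -
  have "inj (%k. simplex_map 1 (act k) (t j))"
   using act_cells_eq_iff[OF t[OF j] t[OF j]] n by (auto simp: inj_def)
  thus ?thesis using finite_vimageI[OF finite_keys, of _ "A i"] unfolding K_def vimage_def by blast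
 qed
 hence fin: "finite (\<Union>i<N. \<Union>j<M. K i j)" by auto
 define L where "L = nat (Max (insert 0 (abs ` (\<Union>i<N. \<Union>j<M. K i j))))"
 show thesis
 proof (rule that)
  fix i j k assume "i < N" "j < M" "Poly_Mapping.lookup (A i) (simplex_map 1 (act k) (t j)) ~= 0"
  hence "k : (\<Union>i<N. \<Union>j<M. K i j)" by (auto simp: K_def in_keys_iff)
  hence "\<bar>k\<bar> <= Max (insert 0 (abs ` (\<Union>i<N. \<Union>j<M. K i j)))" using fin by (intro Max_ge) auto
  moreover have "0 <= Max (insert 0 (abs ` (\<Union>i<N. \<Union>j<M. K i j)))" using fin by (intro Max_ge) auto
  ultimately show "\<bar>k\<bar> <= int L" unfolding L_def by linarith
 qed
qed

lemma ell2_differential_matrix: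
 assumes "cyclic_matrix N M L d n (\<Psi> 2) (\<Psi> 1) (incidence \<Psi> 1) \<beta> \<gamma>"
 shows "ell2_differential \<Psi> 1 = bounded_matrix.matrix_op (\<Psi> 2) (\<Psi> 1) (incidence \<Psi> 1)"
proof -
 interpret cyclic_matrix N M L d n "\<Psi> 2" "\<Psi> 1" "incidence \<Psi> 1" \<beta> \<gamma> by fact
 have "Suc 1 = 2" by simp
 thus ?thesis unfolding ell2_differential_def matrix_op_eq_infsum by (simp only:)
qed

theorem theorem23:
  fixes K N X :: "(real^4) set"
    and \<Phi> :: "(real^4) cell_structure"
    and E :: "nat \<Rightarrow> 'e::topological_space set" and \<pi> :: "nat \<Rightarrow> 'e \<Rightarrow> real^4"
    and Einf :: "'f::topological_space set" and \<pi>inf :: "'f \<Rightarrow> real^4"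
  assumes "knot K"
    and "open_tubular_neighbourhood K N"
    and "X = S3 - N"
    and "finite_CW_structure X \<Phi>"
    and "\<And>n. n \<ge> 1 \<Longrightarrow> cyclic_covering n (E n) (\<pi> n) X"
    and "infinite_cyclic_covering Einf \<pi>inf X"
  shows "(shrinkage_type_I E \<pi> \<Phi> \<longleftrightarrow> second_novikov_shubin Einf \<pi>inf \<Phi> = Infinity_plus) \<and>
         (shrinkage_type_II E \<pi> \<Phi> \<or> shrinkage_type_III E \<pi> \<Phi> \<longrightarrow>
            second_novikov_shubin Einf \<pi>inf \<Phi> = NS_val (inverse (lower_shrinkage_rate E \<pi> \<Phi>)))"
proof -
 note X = knot_complement[OF assms(2), folded assms(3)]
 obtain z0 where z0: "!!z. singular_relcycle 1 (top_of_set X) {} z ==> \<exists>m. homologous_rel 1 (top_of_set X) {} z (frag_cmul m z0)"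
  using cyclic_homology_generator[OF X(3)] by metis
 \<comment> \<open>\<open>integer_mod_group 0\<close> is the group of integers, so the infinite
   cover is the case n = 0.\<close>
 have reg: "regular_connected_covering Einf \<pi>inf X" and iso: "deck_group Einf \<pi>inf \<cong> integer_mod_group 0"
  using assms(6) by (auto simp: infinite_cyclic_covering_def integer_mod_group_def)
 obtain act1 where c1: "cyclic_cover Einf \<pi>inf X 0 act1"
  and car: "carrier (deck_group Einf \<pi>inf) = range (%k. restrict (act1 k) Einf)"
  using regular_covering_imp_cyclic_cover[OF reg iso] by metis
 have conn: "simplex_connected Einf"
  using reg by (auto simp: regular_connected_covering_def intro: covering_simplex_connected[OF _ _ X(2)])
 interpret c1: cyclic_cover Einf \<pi>inf X 0 act1 by fact
 interpret cw_complex X \<Phi> by standard (rule assms(4))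
 interpret c1: cyclic_cw_cover Einf \<pi>inf X 0 act1 \<Phi> ..
 obtain N2 :: nat and s where s: "!!i. i < N2 ==> s i : c1.\<Psi> 2" "bij_betw (%i. simplex_map 2 \<pi>inf (s i)) {..<N2} (\<Phi> 2)"
  using c1.cells_lift by metis
 obtain N1 :: nat and t where t: "!!i. i < N1 ==> t i : c1.\<Psi> 1" "bij_betw (%i. simplex_map 1 \<pi>inf (t i)) {..<N1} (\<Phi> 1)"
  using c1.cells_lift by metis
 have "\<exists>a. Poly_Mapping.keys a \<subseteq> c1.\<Psi> 1 & c1.hom1 (chain_boundary 2 (frag_of (s i))) a" if "i < N2" for i
  using c1.incidence_exists[OF s(1)[OF that]] by metis
 then obtain A where A: "!!i. i < N2 ==> Poly_Mapping.keys (A i) \<subseteq> c1.\<Psi> 1"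
  "!!i. i < N2 ==> c1.hom1 (chain_boundary 2 (frag_of (s i))) (A i)" by metis
 obtain L where L: "!!i j k. i < N2 ==> j < N1 ==> Poly_Mapping.lookup (A i) (simplex_map 1 (act1 k) (t j)) ~= 0 ==> \<bar>k\<bar> <= int L"
 proof (rule c1.lookup_translates_bounded[OF refl t(1), where M = N1 and N = N2 and A = A])
  fix L assume a: "!!i j k. i < N2 ==> j < N1 ==> Poly_Mapping.lookup (A i) (simplex_map 1 (act1 k) (t j)) ~= 0 ==> \<bar>k\<bar> <= int L"
  show thesis by (rule that) (rule a)
 qed
 define d where "d = (%j i k. Poly_Mapping.lookup (A i) (simplex_map 1 (act1 k) (t j)))"
 note matrix = cyclic_matrix_incidence[OF c1 _ assms(4) _ _ _ s t A L, folded d_def]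
 \<comment> \<open>The infinite cover is compared with itself by the identity, which makes it an
   instance of the same lemma as the finite covers.\<close>
 have sw: "simplexwise Einf Einf (%x. x)"
  unfolding simplexwise_def simplex_map_def o_def
  using extensional_restrict[OF sing_imp(2)] by metis
 interpret inf: cyclic_matrix N2 N1 L d 0 "c1.\<Psi> 2" "c1.\<Psi> 1" "incidence c1.\<Psi> 1"
  "%i a. simplex_map 2 (act1 a) (s i)" "%j b. simplex_map 1 (act1 b) (t j)"
  by (rule matrix[OF c1 _ sw, unfolded simplex_map_comp]) simp_all
 obtain tau F where tau: "!!s k. (%n. root_average inf.ev (ramp s k) n) \<longlonglongrightarrow> tau s k" "!!s. (%k. tau s k) \<longlonglongrightarrow> F s"
  and F: "spectral_density ((%i. range (%a. simplex_map 2 (act1 a) (s i))) ` {..<N2}) (c1.\<Psi> 2) inf.matrix_op = (%l. F (l\<^sup>2))"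
 proof (rule inf.spectral_density_limits[OF refl])
  fix tau F assume a: "!!s k. (%n. root_average inf.ev (ramp s k) n) \<longlonglongrightarrow> tau s k" "!!s. (%k. tau s k) \<longlonglongrightarrow> F s"
   "spectral_density ((%i. range (%a. simplex_map 2 (act1 a) (s i))) ` {..<N2}) (c1.\<Psi> 2) inf.matrix_op = (%l. F (l\<^sup>2))"
  show thesis by (rule that) (rule a)+
 qed
 have orbits: "deck_orbits Einf \<pi>inf \<Phi> 2 = (%i. range (%a. simplex_map 2 (act1 a) (s i))) ` {..<N2}"
  by (rule c1.deck_orbits_eq[OF car s])
 have alpha: "second_novikov_shubin Einf \<pi>inf \<Phi> = novikov_shubin (%l. F (l\<^sup>2))"
  unfolding second_novikov_shubin_def Let_def F[symmetric] orbits
   ell2_differential_matrix[OF inf.cyclic_matrix_axioms] ..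
 have sigma: "shrinkage_sigma E \<pi> \<Phi> n = Min {s. 0 < s & (\<exists>z\<in>unity_roots n. s\<^sup>2 : set (inf.ev z))}" if n: "n > 0" for n
 proof -
  have reg: "regular_connected_covering (E n) (\<pi> n) X" and iso: "deck_group (E n) (\<pi> n) \<cong> integer_mod_group n"
   using assms(5)[of n] n by (auto simp: cyclic_covering_def)
  obtain act0 where c0: "cyclic_cover (E n) (\<pi> n) X n act0"
   using regular_covering_imp_cyclic_cover[OF reg iso] by metis
  have conn2: "simplex_connected (E n)"
   using reg by (auto simp: regular_connected_covering_def intro: covering_simplex_connected[OF _ _ X(2)])
  \<comment> \<open>The action obtained from the deck group is replaced by a reparametrised one, for
    which \<open>q\<close> is equivariant.\<close>
  obtain q act2 where c2: "cyclic_cover (E n) (\<pi> n) X n act2" and sw: "simplexwise Einf (E n) q"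
   and q: "!!e. e : Einf ==> q e : E n & \<pi> n (q e) = \<pi>inf e" "!!k e. e : Einf ==> q (act1 k e) = act2 k (q e)"
   using cyclic_cover_comparison[OF c1 c0 conn conn2 z0 X(1)] by metis
  interpret fin: cyclic_matrix N2 N1 L d n "lifted_cells (E n) (\<pi> n) \<Phi> 2" "lifted_cells (E n) (\<pi> n) \<Phi> 1"
   "incidence (lifted_cells (E n) (\<pi> n) \<Phi>) 1"
   "%i a. simplex_map 2 (act2 a) (simplex_map 2 q (s i))" "%j b. simplex_map 1 (act2 b) (simplex_map 1 q (t j))"
   by (rule matrix[OF c2 q(1) sw q(2)])
  have "{s : singular_values (lifted_cells (E n) (\<pi> n) \<Phi> 2) (ell2_differential (lifted_cells (E n) (\<pi> n) \<Phi>) 1). 0 < s}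
    = {s. 0 < s & (\<exists>z\<in>unity_roots n. s\<^sup>2 : set (inf.ev z))}"
   unfolding ell2_differential_matrix[OF fin.cyclic_matrix_axioms] fin.singular_values_eq[OF n] by auto
  thus ?thesis by (simp add: shrinkage_sigma_def smallest_positive_singular_value_def Let_def)
 qed
 show ?thesis
  using inf.shrinkage_rates[OF tau sigma]
  unfolding alpha shrinkage_type_I_def shrinkage_type_II_def shrinkage_type_III_def lower_shrinkage_rate_def upper_shrinkage_rate_def
  by blast
qed

end
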